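(* Let $\mathcal C$ be a join restriction category with local glueings. Restricting the adjunction $\Psi\dashv\Phi_g\colon\mathrm{pGpd}_c(\mathcal C)\to\mathrm{iCat}/\!/\mathcal C$ to its fixpoints yields an equivalence $$\Phi_g\colon\mathrm{peGpd}_c(\mathcal C)\;\simeq\;\mathrm{jiCat}/\!/_h\,\mathcal C\;\colon\Psi$$ between the category of étale partite internal groupoids in $\mathcal C$ (with partite cofunctors) and the category of join inverse categories hyperconnected over $\mathcal C$.
   Context: RESTRICTION CATEGORIES. A restriction category is a category with an operation assigning to each $f\colon A\to B$ a map $\bar f\colon A\to A$ such that $f\bar f=f$; $\bar f\bar g=\bar g\bar f$ and $\overline{g\bar f}=\bar g\bar f$ for $f\colon A\to B$, $g\colon A\to C$; and $\bar g f=f\,\overline{gf}$ for $f\colon A\to B$, $g\colon B\to C$. $\mathcal O(A)$ is the set of restriction idempotents on $A$ (maps $e\colon A\to A$ with $\bar e=e$). A map $f$ is total if $\bar f=1$. For parallel maps, $f\leqslant g$ iff $f=g\bar f$, and $f\smile g$ (compatible) iff $f\bar g=g\bar f$. A restriction functor satisfies $F\bar f=\overline{Ff}$; it is hyperconnected if each induced $\mathcal O(A)\to\mathcal O(FA)$ is an isomorphism. A join restriction category is a restriction category in which every pairwise-compatible family of parallel maps has a join for $\leqslant$, and these joins are preserved by precomposition. A partial isomorphism is a map $s\colon A\to B$ with a (necessarily unique) partial inverse $s^*\colon B\to A$: $s^*s=\bar s$, $ss^*=\overline{s^*}$. A local homeomorphism is a total map which is a join of partial isomorphisms. A local atlas on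 $X$ is a set $I$ and a family $\varphi_{ij}\in\mathcal O(X)$ ($i,j\in I$) with $\varphi_{ij}=\varphi_{ji}$ and $\varphi_{jk}\varphi_{ij}\leqslant\varphi_{ik}$. A glueing of $\varphi$ is a local homeomorphism $p=\bigvee_i p_i\colon A\to X$, with each $p_i$ a partial isomorphism with partial inverse $s_i$, such that $\varphi_{ij}=p_js_i$. $\mathcal C$ has local glueings if every local atlas on every object has a glueing. A partial section of a total map $p\colon A\to X$ is a map $s\colon X\to A$ with $ps=\bar s$. INVERSE CATEGORIES. An inverse category is a category in which every $s\colon A\to B$ has a unique $s^*\colon B\to A$ with $ss^*s=s$, $s^*ss^*=s^*$; it is a restriction category with $\bar s=s^*s$. Parallel maps are bicompatible if $s\smile t$ and $s^*\smile t^*$. A join inverse category is an inverse category in which every pairwise-bicompatible family of parallel maps has a join for $\leqslant$, and these joins are preserved by precomposition. PARTITE INTERNAL CATEGORIES. For a set $I$, an $I$-partite internal category $\mathbb A$ in $\mathcal C$ comprises objects $A_i$; objects $A_{ij}$ with total maps $\sigma_{ij}\colon A_{ij}\to A_i$, $\tau_{ij}\colon A_{ij}\to A_j$, where $\sigma_{ij}$ admits pullbacks along all total maps; maps $\eta_i\colon A_i\to A_{ii}$ with $\sigma_{ii}\eta_i=1=\tau_{ii}\eta_i$; and maps $\mu_{ijk}\colon A_{jk}\times_{A_j}A_{ij}\to A_{ik}$ (domain the pullback of $\sigma_{jk}$ along $\tau_{ij}$) with $\sigma_{ik}\mu_{ijk}=\sigma_{ij}\pi_2$, $\tau_{ik}\mu_{ijk}=\tau_{jk}\pi_1$,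 satisfying $\mu_{iij}(1,\eta_i\sigma_{ij})=1=\mu_{ijj}(\eta_j\tau_{ij},1)$ and $\mu_{ik\ell}(1\times\mu_{ijk})=\mu_{ij\ell}(\mu_{jk\ell}\times 1)$. It is an internal partite groupoid if there are (necessarily unique) total maps $\iota_{ij}\colon A_{ij}\to A_{ji}$ with $\iota_{ij}\iota_{ji}=1$, $\sigma_{ji}\iota_{ij}=\tau_{ij}$ and $\mu_{iji}(\iota_{ij},1)=\eta_i\sigma_{ij}$; it is étale if every $\sigma_{ij}$ is a local homeomorphism. A partite cofunctor $F\colon\mathbb A\rightsquigarrow\mathbb B$ from an $I$-partite to a $J$-partite internal category comprises a function $I\to J$, $i\mapsto Fi$; total maps $F_i\colon B_{Fi}\to A_i$; and total maps $F_{ij}\colon A_{ij}\times_{A_i}B_{Fi}\to B_{Fi,Fj}$ (domain the pullback of $\sigma_{ij}$ along $F_i$) with $\sigma_{Fi,Fj}F_{ij}=\pi_2$, $F_j\tau_{Fi,Fj}F_{ij}=\tau_{ij}\pi_1$, $F_{ii}(\eta_iF_i,1)=\eta_{Fi}$, and $F_{ik}(\mu_{ijk}\times1)=\mu_{Fi,Fj,Fk}(F_{jk}\times1)(1\times F_{ij})$ on $A_{jk}\times_{A_j}A_{ij}\times_{A_i}B_{Fi}$ (using $A_{jk}\times_{A_j}B_{Fi,Fj}\cong(A_{jk}\times_{A_j}B_{Fj})\times_{B_{Fj}}B_{Fi,Fj}$). Composition: $(GF)i=G(Fi)$, $(GF)_i=F_iG_{Fi}$, $(GF)_{ij}=G_{Fi,Fj}(F_{ij}\times1)$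 up to the canonical isomorphism of pullbacks. $\mathrm{pGpd}_c(\mathcal C)$ is the category of partite internal groupoids and partite cofunctors; $\mathrm{peGpd}_c(\mathcal C)$ its full subcategory of étale ones. CATEGORIES OVER $\mathcal C$. $\mathrm{iCat}/\!/\mathcal C$ has as objects pairs $(\mathcal A,P)$ of an inverse category and a restriction functor $P\colon\mathcal A\to\mathcal C$; a map $(F,\alpha)\colon(\mathcal A,P)\to(\mathcal B,Q)$ is a functor $F\colon\mathcal A\to\mathcal B$ and a natural transformation $\alpha\colon QF\Rightarrow P$ with total components; $(G,\beta)(F,\alpha)=(GF,\alpha\circ\beta F)$. $\mathrm{jiCat}/\!/_h\,\mathcal C$ is the full subcategory of those $(\mathcal A,P)$ with $\mathcal A$ a join inverse category and $P$ hyperconnected. THE FUNCTOR $\Phi_g$. For a partite internal groupoid $\mathbb A$, $\Phi_g(\mathbb A)=(\Phi_g\mathbb A,\pi_{\mathbb A})$: $\Phi_g\mathbb A$ has object-set $I$; maps $i\to j$ are the partial bisections of $\sigma_{ij}$, i.e. partial sections $s$ of $\sigma_{ij}$ with $\tau_{ij}s$ a partial isomorphism; identities are $\eta_i$; the composite of $s\colon i\to j$ and $t\colon j\to k$ is $\mu_{ijk}\circ\tau_{ij}^*(t)\circ s$ where $\tau_{ij}^*(t)=(t\tau_{ij},\overline{t\tau_{ij}})\colon A_{ij}\to A_{jk}\times_{A_j}A_{ij}$; the restriction of $s$ is $\eta_i\bar s$; $\pi_{\mathbb A}(i)=A_i$, $\pi_{\mathbb A}(s)=\tau_{ij}s$.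 A cofunctor $F$ is sent to the functor $i\mapsto Fi$, $s\mapsto F_{ij}\circ(sF_i,\overline{sF_i})$, together with the transformation with components $F_i$. THE FUNCTOR $\Psi$. Given $(\mathcal A,P)$ and $f,g\in\mathcal A(i,j)$ put $[\![f=_Pg]\!]=\bigvee\{Pe: e\in\mathcal O(i),\ e\leqslant\bar f\bar g,\ fe=ge\}\in\mathcal O(Pi)$. $\Psi P$ is the $\mathrm{ob}(\mathcal A)$-partite internal category (a groupoid when $\mathcal A$ is an inverse category) with objects $Pi$; $\sigma_{ij}\colon\Psi P_{ij}\to Pi$ a glueing of the local atlas $([\![f=_Pg]\!])_{f,g\in\mathcal A(i,j)}$, with associated partial sections $s_f$; $\tau_{ij}$ the unique map with $\tau_{ij}s_f=Pf$ for all $f$; $\eta_i=s_{1_i}$; $\mu_{ijk}$ the unique map with $\mu_{ijk}\tau_{ij}^*(s_g)s_f=s_{gf}$ for all $f,g$. $\Psi$ is left adjoint to $\Phi_g$ with unit at $(\mathcal A,P)$ the functor $\mathcal A\to\Phi_g\Psi P$, identity on objects and $f\mapsto s_f$ on maps, with identity 2-cell. A left (resp. right) fixpoint of an adjunction is an object at which the counit (resp. unit) is invertible. *)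

theory Defs
  imports "HOL-Library.Equipollence" "HOL-Library.FuncSet"
begin

section \<open>Categories\<close>

text \<open>
  An arrow carries its source, its target and a label.  The label identifies it only within its
  hom-set.  The label type \<open>'u\<close> also serves as the universe of small elements: a set is small if
  it has strictly fewer elements than \<open>'u\<close> has, written \<open>S \<prec> (UNIV :: 'u set)\<close>.  The inequality
  must be strict: if atlases indexed by sets as large as \<open>'u\<close> had glueings, then \<open>'u\<close>-fold copowers
  would exist, and only trivial categories with hom-sets in \<open>'u\<close> have those.
  The object type \<open>'o\<close> is unrelated to \<open>'u\<close>, so that a category may be large but locally small.

  The same record serves for categories whose objects are themselves structures; there the
  labels are the data of the morphisms.
\<close>

datatype ('o, 'u) arr = Arr (src: 'o) (lab: 'u) (tgt: 'o)

record ('o, 'u) cat =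
  Ob :: "'o set"
  Ar :: "('o, 'u) arr set"
  Idn :: "'o \<Rightarrow> ('o, 'u) arr"
  Cmp :: "('o, 'u) arr \<Rightarrow> ('o, 'u) arr \<Rightarrow> ('o, 'u) arr"  (infixr "\<odot>\<index>" 70)

definition hom :: "('o, 'u, 'z) cat_scheme \<Rightarrow> 'o \<Rightarrow> 'o \<Rightarrow> ('o, 'u) arr set" where
  "hom C a b = {f \<in> Ar C. src f = a \<and> tgt f = b}"

locale category =
  fixes C :: "('o, 'u, 'z) cat_scheme" (structure)
  assumes src_tgt_Ob: "f \<in> Ar C \<Longrightarrow> src f \<in> Ob C \<and> tgt f \<in> Ob C"
    and Idn_hom: "a \<in> Ob C \<Longrightarrow> Idn C a \<in> hom C a a"
    and Cmp_hom: "\<lbrakk>f \<in> Ar C; g \<in> Ar C; tgt f = src g\<rbrakk> \<Longrightarrow> g \<odot> f \<in> hom C (src f) (tgt g)"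
    and Cmp_Idn: "f \<in> Ar C \<Longrightarrow> f \<odot> Idn C (src f) = f"
    and Idn_Cmp: "f \<in> Ar C \<Longrightarrow> Idn C (tgt f) \<odot> f = f"
    and Cmp_assoc: "\<lbrakk>f \<in> Ar C; g \<in> Ar C; h \<in> Ar C; tgt f = src g; tgt g = src h\<rbrakk>
      \<Longrightarrow> (h \<odot> g) \<odot> f = h \<odot> (g \<odot> f)"

definition is_iso :: "('o, 'u, 'z) cat_scheme \<Rightarrow> ('o, 'u) arr \<Rightarrow> bool" where
  "is_iso C f \<longleftrightarrow> f \<in> Ar C \<and>
    (\<exists>g \<in> hom C (tgt f) (src f). g \<odot>\<^bsub>C\<^esub> f = Idn C (src f) \<and> f \<odot>\<^bsub>C\<^esub> g = Idn C (tgt f))"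

definition full_subcat :: "('o, 'u) cat \<Rightarrow> ('o \<Rightarrow> bool) \<Rightarrow> ('o, 'u) cat" where
  "full_subcat C p = C\<lparr> Ob := {a \<in> Ob C. p a}, Ar := {f \<in> Ar C. p (src f) \<and> p (tgt f)} \<rparr>"

definition small_hom_sets :: "('o, 'u, 'z) cat_scheme \<Rightarrow> bool" where
  "small_hom_sets C \<longleftrightarrow> (\<forall>a \<in> Ob C. \<forall>b \<in> Ob C. hom C a b \<prec> (UNIV :: 'u set))"

subsection \<open>Functors, natural transformations, adjunctions, equivalences\<close>

record ('o, 'u, 'p, 'v) fctr =
  FO :: "'o \<Rightarrow> 'p"
  FA :: "('o, 'u) arr \<Rightarrow> ('p, 'v) arr"

definition is_functor ::
  "('o, 'u, 'y) cat_scheme \<Rightarrow> ('p, 'v, 'z) cat_scheme \<Rightarrow> ('o, 'u, 'p, 'v) fctr \<Rightarrow> bool" where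
  "is_functor C D F \<longleftrightarrow> category C \<and> category D \<and>
    (\<forall>a \<in> Ob C. FO F a \<in> Ob D) \<and>
    (\<forall>f \<in> Ar C. FA F f \<in> hom D (FO F (src f)) (FO F (tgt f))) \<and>
    (\<forall>a \<in> Ob C. FA F (Idn C a) = Idn D (FO F a)) \<and>
    (\<forall>f \<in> Ar C. \<forall>g \<in> Ar C. tgt f = src g \<longrightarrow> FA F (g \<odot>\<^bsub>C\<^esub> f) = FA F g \<odot>\<^bsub>D\<^esub> FA F f)"

definition id_fctr :: "('o, 'u, 'o, 'u) fctr" where
  "id_fctr = \<lparr> FO = (\<lambda>a. a), FA = (\<lambda>f. f) \<rparr>"

definition comp_fctr ::
  "('p, 'v, 'q, 'w) fctr \<Rightarrow> ('o, 'u, 'p, 'v) fctr \<Rightarrow> ('o, 'u, 'q, 'w) fctr" where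
  "comp_fctr G F = \<lparr> FO = FO G \<circ> FO F, FA = FA G \<circ> FA F \<rparr>"

definition is_nat_trans ::
  "('o, 'u, 'y) cat_scheme \<Rightarrow> ('p, 'v, 'z) cat_scheme \<Rightarrow> ('o, 'u, 'p, 'v) fctr \<Rightarrow>
   ('o, 'u, 'p, 'v) fctr \<Rightarrow> ('o \<Rightarrow> ('p, 'v) arr) \<Rightarrow> bool" where
  "is_nat_trans C D F G \<alpha> \<longleftrightarrow> is_functor C D F \<and> is_functor C D G \<and>
    (\<forall>a \<in> Ob C. \<alpha> a \<in> hom D (FO F a) (FO G a)) \<and>
    (\<forall>f \<in> Ar C. FA G f \<odot>\<^bsub>D\<^esub> \<alpha> (src f) = \<alpha> (tgt f) \<odot>\<^bsub>D\<^esub> FA F f)"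

definition is_nat_iso ::
  "('o, 'u, 'y) cat_scheme \<Rightarrow> ('p, 'v, 'z) cat_scheme \<Rightarrow> ('o, 'u, 'p, 'v) fctr \<Rightarrow>
   ('o, 'u, 'p, 'v) fctr \<Rightarrow> ('o \<Rightarrow> ('p, 'v) arr) \<Rightarrow> bool" where
  "is_nat_iso C D F G \<alpha> \<longleftrightarrow> is_nat_trans C D F G \<alpha> \<and> (\<forall>a \<in> Ob C. is_iso D (\<alpha> a))"

text \<open>\<open>is_adjunction C D L R \<eta> \<epsilon>\<close>: the functor \<open>L: C \<rightarrow> D\<close> is left adjoint to \<open>R: D \<rightarrow> C\<close>.\<close>

definition is_adjunction ::
  "('o, 'u, 'y) cat_scheme \<Rightarrow> ('p, 'v, 'z) cat_scheme \<Rightarrow> ('o, 'u, 'p, 'v) fctr \<Rightarrow>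
   ('p, 'v, 'o, 'u) fctr \<Rightarrow> ('o \<Rightarrow> ('o, 'u) arr) \<Rightarrow> ('p \<Rightarrow> ('p, 'v) arr) \<Rightarrow> bool" where
  "is_adjunction C D L R \<eta> \<epsilon> \<longleftrightarrow>
    is_functor C D L \<and> is_functor D C R \<and>
    is_nat_trans C C id_fctr (comp_fctr R L) \<eta> \<and>
    is_nat_trans D D (comp_fctr L R) id_fctr \<epsilon> \<and>
    (\<forall>a \<in> Ob C. \<epsilon> (FO L a) \<odot>\<^bsub>D\<^esub> FA L (\<eta> a) = Idn D (FO L a)) \<and>
    (\<forall>b \<in> Ob D. FA R (\<epsilon> b) \<odot>\<^bsub>C\<^esub> \<eta> (FO R b) = Idn C (FO R b))"

definition left_fixpoints ::
  "('p, 'v, 'z) cat_scheme \<Rightarrow> ('p \<Rightarrow> ('p, 'v) arr) \<Rightarrow> 'p set" where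
  "left_fixpoints D \<epsilon> = {b \<in> Ob D. is_iso D (\<epsilon> b)}"

definition right_fixpoints ::
  "('o, 'u, 'y) cat_scheme \<Rightarrow> ('o \<Rightarrow> ('o, 'u) arr) \<Rightarrow> 'o set" where
  "right_fixpoints C \<eta> = {a \<in> Ob C. is_iso C (\<eta> a)}"

definition is_equivalence ::
  "('o, 'u, 'y) cat_scheme \<Rightarrow> ('p, 'v, 'z) cat_scheme \<Rightarrow> ('o, 'u, 'p, 'v) fctr \<Rightarrow>
   ('p, 'v, 'o, 'u) fctr \<Rightarrow> ('o \<Rightarrow> ('o, 'u) arr) \<Rightarrow> ('p \<Rightarrow> ('p, 'v) arr) \<Rightarrow> bool" where
  "is_equivalence C D L R \<eta> \<epsilon> \<longleftrightarrow>
    is_functor C D L \<and> is_functor D C R \<and>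
    is_nat_iso C C id_fctr (comp_fctr R L) \<eta> \<and>
    is_nat_iso D D (comp_fctr L R) id_fctr \<epsilon>"

subsection \<open>Pullbacks\<close>

definition is_pullback ::
  "('o, 'u, 'z) cat_scheme \<Rightarrow> ('o, 'u) arr \<Rightarrow> ('o, 'u) arr \<Rightarrow>
   ('o, 'u) arr \<Rightarrow> ('o, 'u) arr \<Rightarrow> bool" where
  "is_pullback C f g p q \<longleftrightarrow>
    f \<in> Ar C \<and> g \<in> Ar C \<and> tgt f = tgt g \<and>
    p \<in> Ar C \<and> q \<in> Ar C \<and> src p = src q \<and> tgt p = src f \<and> tgt q = src g \<and>
    f \<odot>\<^bsub>C\<^esub> p = g \<odot>\<^bsub>C\<^esub> q \<and>
    (\<forall>z \<in> Ob C. \<forall>u \<in> hom C z (src f). \<forall>v \<in> hom C z (src g).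
      f \<odot>\<^bsub>C\<^esub> u = g \<odot>\<^bsub>C\<^esub> v \<longrightarrow>
      (\<exists>!w. w \<in> hom C z (src p) \<and> p \<odot>\<^bsub>C\<^esub> w = u \<and> q \<odot>\<^bsub>C\<^esub> w = v))"

text \<open>
  A fixed choice of pullbacks, used wherever a pullback occurs as a domain.  For
  \<open>f: a \<rightarrow> c\<close> and \<open>g: b \<rightarrow> c\<close>, \<open>pbo C f g\<close> is the apex \<open>a \<times>\<^sub>c b\<close> of the pullback of \<open>f\<close> along \<open>g\<close>,
  and \<open>pair C f g u v\<close> is the induced map \<open>(u, v)\<close> into it.
\<close>

definition pb :: "('o, 'u, 'z) cat_scheme \<Rightarrow> ('o, 'u) arr \<Rightarrow> ('o, 'u) arr \<Rightarrow>
    ('o, 'u) arr \<times> ('o, 'u) arr" where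
  "pb C f g = (SOME (p, q). is_pullback C f g p q)"

definition pb1 :: "('o, 'u, 'z) cat_scheme \<Rightarrow> ('o, 'u) arr \<Rightarrow> ('o, 'u) arr \<Rightarrow> ('o, 'u) arr" where
  "pb1 C f g = fst (pb C f g)"

definition pb2 :: "('o, 'u, 'z) cat_scheme \<Rightarrow> ('o, 'u) arr \<Rightarrow> ('o, 'u) arr \<Rightarrow> ('o, 'u) arr" where
  "pb2 C f g = snd (pb C f g)"

definition pbo :: "('o, 'u, 'z) cat_scheme \<Rightarrow> ('o, 'u) arr \<Rightarrow> ('o, 'u) arr \<Rightarrow> 'o" where
  "pbo C f g = src (pb1 C f g)"

definition pair :: "('o, 'u, 'z) cat_scheme \<Rightarrow> ('o, 'u) arr \<Rightarrow> ('o, 'u) arr \<Rightarrow>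
    ('o, 'u) arr \<Rightarrow> ('o, 'u) arr \<Rightarrow> ('o, 'u) arr" where
  "pair C f g u v = (THE w. w \<in> hom C (src u) (pbo C f g) \<and>
    pb1 C f g \<odot>\<^bsub>C\<^esub> w = u \<and> pb2 C f g \<odot>\<^bsub>C\<^esub> w = v)"

section \<open>Restriction categories\<close>

record ('o, 'u) rcat = "('o, 'u) cat" +
  rst :: "('o, 'u) arr \<Rightarrow> ('o, 'u) arr"

locale restriction_category = category C
  for C :: "('o, 'u, 'z) rcat_scheme" (structure) +
  assumes rst_hom: "f \<in> Ar C \<Longrightarrow> rst C f \<in> hom C (src f) (src f)"
    and Cmp_rst: "f \<in> Ar C \<Longrightarrow> f \<odot> rst C f = f"
    and rst_commute: "\<lbrakk>f \<in> Ar C; g \<in> Ar C; src f = src g\<rbrakk>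
      \<Longrightarrow> rst C f \<odot> rst C g = rst C g \<odot> rst C f"
    and rst_Cmp_rst: "\<lbrakk>f \<in> Ar C; g \<in> Ar C; src f = src g\<rbrakk>
      \<Longrightarrow> rst C (g \<odot> rst C f) = rst C g \<odot> rst C f"
    and rst_Cmp: "\<lbrakk>f \<in> Ar C; g \<in> Ar C; tgt f = src g\<rbrakk>
      \<Longrightarrow> rst C g \<odot> f = f \<odot> rst C (g \<odot> f)"

definition idems :: "('o, 'u, 'z) rcat_scheme \<Rightarrow> 'o \<Rightarrow> ('o, 'u) arr set" where
  "idems C a = {e \<in> hom C a a. rst C e = e}"

definition total_map :: "('o, 'u, 'z) rcat_scheme \<Rightarrow> ('o, 'u) arr \<Rightarrow> bool" where
  "total_map C f \<longleftrightarrow> f \<in> Ar C \<and> rst C f = Idn C (src f)"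

definition restr_le :: "('o, 'u, 'z) rcat_scheme \<Rightarrow> ('o, 'u) arr \<Rightarrow> ('o, 'u) arr \<Rightarrow> bool" where
  "restr_le C f g \<longleftrightarrow> src f = src g \<and> tgt f = tgt g \<and> f = g \<odot>\<^bsub>C\<^esub> rst C f"

definition compat :: "('o, 'u, 'z) rcat_scheme \<Rightarrow> ('o, 'u) arr \<Rightarrow> ('o, 'u) arr \<Rightarrow> bool" where
  "compat C f g \<longleftrightarrow> src f = src g \<and> tgt f = tgt g \<and> f \<odot>\<^bsub>C\<^esub> rst C g = g \<odot>\<^bsub>C\<^esub> rst C f"

definition is_join ::
  "('o, 'u, 'z) rcat_scheme \<Rightarrow> 'o \<Rightarrow> 'o \<Rightarrow> ('o, 'u) arr set \<Rightarrow> ('o, 'u) arr \<Rightarrow> bool" where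
  "is_join C a b S p \<longleftrightarrow> p \<in> hom C a b \<and> (\<forall>s \<in> S. restr_le C s p) \<and>
    (\<forall>q \<in> hom C a b. (\<forall>s \<in> S. restr_le C s q) \<longrightarrow> restr_le C p q)"

definition join :: "('o, 'u, 'z) rcat_scheme \<Rightarrow> 'o \<Rightarrow> 'o \<Rightarrow> ('o, 'u) arr set \<Rightarrow> ('o, 'u) arr" where
  "join C a b S = (THE p. is_join C a b S p)"

locale join_restriction_category = restriction_category C
  for C :: "('o, 'u, 'z) rcat_scheme" (structure) +
  assumes join_exists:
      "\<lbrakk>a \<in> Ob C; b \<in> Ob C; S \<subseteq> hom C a b; \<And>f g. \<lbrakk>f \<in> S; g \<in> S\<rbrakk> \<Longrightarrow> compat C f g\<rbrakk>
       \<Longrightarrow> \<exists>p. is_join C a b S p"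
    and join_precomp:
      "\<lbrakk>a \<in> Ob C; b \<in> Ob C; S \<subseteq> hom C a b; \<And>f g. \<lbrakk>f \<in> S; g \<in> S\<rbrakk> \<Longrightarrow> compat C f g;
        is_join C a b S p; h \<in> Ar C; tgt h = a\<rbrakk>
       \<Longrightarrow> is_join C (src h) b ((\<lambda>s. s \<odot> h) ` S) (p \<odot> h)"

definition partial_inverse :: "('o, 'u, 'z) rcat_scheme \<Rightarrow> ('o, 'u) arr \<Rightarrow> ('o, 'u) arr \<Rightarrow> bool" where
  "partial_inverse C s t \<longleftrightarrow> s \<in> Ar C \<and> t \<in> hom C (tgt s) (src s) \<and>
    t \<odot>\<^bsub>C\<^esub> s = rst C s \<and> s \<odot>\<^bsub>C\<^esub> t = rst C t"

definition partial_iso :: "('o, 'u, 'z) rcat_scheme \<Rightarrow> ('o, 'u) arr \<Rightarrow> bool" where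
  "partial_iso C s \<longleftrightarrow> (\<exists>t. partial_inverse C s t)"

definition local_homeo :: "('o, 'u, 'z) rcat_scheme \<Rightarrow> ('o, 'u) arr \<Rightarrow> bool" where
  "local_homeo C p \<longleftrightarrow> total_map C p \<and>
    (\<exists>S \<subseteq> hom C (src p) (tgt p). (\<forall>s \<in> S. partial_iso C s) \<and> is_join C (src p) (tgt p) S p)"

definition partial_section :: "('o, 'u, 'z) rcat_scheme \<Rightarrow> ('o, 'u) arr \<Rightarrow> ('o, 'u) arr \<Rightarrow> bool" where
  "partial_section C p s \<longleftrightarrow> s \<in> hom C (tgt p) (src p) \<and> p \<odot>\<^bsub>C\<^esub> s = rst C s"

definition is_restriction_functor ::
  "('o, 'u, 'y) rcat_scheme \<Rightarrow> ('p, 'v, 'z) rcat_scheme \<Rightarrow> ('o, 'u, 'p, 'v) fctr \<Rightarrow> bool" where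
  "is_restriction_functor C D F \<longleftrightarrow>
    restriction_category C \<and> restriction_category D \<and> is_functor C D F \<and>
    (\<forall>f \<in> Ar C. FA F (rst C f) = rst D (FA F f))"

text \<open>Restriction functors preserve composition of restriction idempotents, so a bijection on them
  is an isomorphism of semilattices.\<close>

definition hyperconnected ::
  "('o, 'u, 'y) rcat_scheme \<Rightarrow> ('p, 'v, 'z) rcat_scheme \<Rightarrow> ('o, 'u, 'p, 'v) fctr \<Rightarrow> bool" where
  "hyperconnected C D F \<longleftrightarrow> is_restriction_functor C D F \<and>
    (\<forall>a \<in> Ob C. bij_betw (FA F) (idems C a) (idems D (FO F a)))"

subsection \<open>Local atlases and glueings\<close>

definition local_atlas ::
  "('o, 'u, 'z) rcat_scheme \<Rightarrow> 'o \<Rightarrow> 'i set \<Rightarrow> ('i \<Rightarrow> 'i \<Rightarrow> ('o, 'u) arr) \<Rightarrow> bool" where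
  "local_atlas C x I \<phi> \<longleftrightarrow>
    (\<forall>i \<in> I. \<forall>j \<in> I. \<phi> i j \<in> idems C x \<and> \<phi> i j = \<phi> j i) \<and>
    (\<forall>i \<in> I. \<forall>j \<in> I. \<forall>k \<in> I. restr_le C (\<phi> j k \<odot>\<^bsub>C\<^esub> \<phi> i j) (\<phi> i k))"

definition is_glueing ::
  "('o, 'u, 'z) rcat_scheme \<Rightarrow> 'o \<Rightarrow> 'i set \<Rightarrow> ('i \<Rightarrow> 'i \<Rightarrow> ('o, 'u) arr) \<Rightarrow>
   ('o, 'u) arr \<Rightarrow> ('i \<Rightarrow> ('o, 'u) arr) \<Rightarrow> ('i \<Rightarrow> ('o, 'u) arr) \<Rightarrow> bool" where
  "is_glueing C x I \<phi> p q s \<longleftrightarrow>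
    local_homeo C p \<and> tgt p = x \<and>
    (\<forall>i \<in> I. q i \<in> hom C (src p) x \<and> partial_inverse C (q i) (s i)) \<and>
    is_join C (src p) x (q ` I) p \<and>
    (\<forall>i \<in> I. \<forall>j \<in> I. \<phi> i j = q j \<odot>\<^bsub>C\<^esub> s i)"

definition has_local_glueings :: "('o, 'u, 'z) rcat_scheme \<Rightarrow> bool" where
  "has_local_glueings C \<longleftrightarrow> (\<forall>x \<in> Ob C. \<forall>(I :: 'u set) \<phi>. I \<prec> (UNIV :: 'u set) \<longrightarrow>
    local_atlas C x I \<phi> \<longrightarrow> (\<exists>p q s. is_glueing C x I \<phi> p q s))"

section \<open>Inverse categories\<close>

definition is_star :: "('o, 'u, 'z) cat_scheme \<Rightarrow> ('o, 'u) arr \<Rightarrow> ('o, 'u) arr \<Rightarrow> bool" where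
  "is_star C s t \<longleftrightarrow> t \<in> hom C (tgt s) (src s) \<and>
    s \<odot>\<^bsub>C\<^esub> t \<odot>\<^bsub>C\<^esub> s = s \<and> t \<odot>\<^bsub>C\<^esub> s \<odot>\<^bsub>C\<^esub> t = t"

definition star :: "('o, 'u, 'z) cat_scheme \<Rightarrow> ('o, 'u) arr \<Rightarrow> ('o, 'u) arr" where
  "star C s = (THE t. is_star C s t)"

text \<open>The restriction field of an inverse category is forced to be the canonical one.\<close>

locale inverse_category = category C
  for C :: "('o, 'u, 'z) rcat_scheme" (structure) +
  assumes star_ex1: "s \<in> Ar C \<Longrightarrow> \<exists>!t. is_star C s t"
    and rst_star: "s \<in> Ar C \<Longrightarrow> rst C s = star C s \<odot> s"

definition bicompat :: "('o, 'u, 'z) rcat_scheme \<Rightarrow> ('o, 'u) arr \<Rightarrow> ('o, 'u) arr \<Rightarrow> bool" where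
  "bicompat C s t \<longleftrightarrow> compat C s t \<and> compat C (star C s) (star C t)"

locale join_inverse_category = inverse_category C
  for C :: "('o, 'u, 'z) rcat_scheme" (structure) +
  assumes join_exists:
      "\<lbrakk>a \<in> Ob C; b \<in> Ob C; S \<subseteq> hom C a b; \<And>f g. \<lbrakk>f \<in> S; g \<in> S\<rbrakk> \<Longrightarrow> bicompat C f g\<rbrakk>
       \<Longrightarrow> \<exists>p. is_join C a b S p"
    and join_precomp:
      "\<lbrakk>a \<in> Ob C; b \<in> Ob C; S \<subseteq> hom C a b; \<And>f g. \<lbrakk>f \<in> S; g \<in> S\<rbrakk> \<Longrightarrow> bicompat C f g;
        is_join C a b S p; h \<in> Ar C; tgt h = a\<rbrakk>
       \<Longrightarrow> is_join C (src h) b ((\<lambda>s. s \<odot> h) ` S) (p \<odot> h)"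

section \<open>Partite internal categories, groupoids and cofunctors\<close>

record ('o, 'u) pcat =
  Ix :: "'u set"
  P0 :: "'u \<Rightarrow> 'o"
  P1 :: "'u \<Rightarrow> 'u \<Rightarrow> 'o"
  sgm :: "'u \<Rightarrow> 'u \<Rightarrow> ('o, 'u) arr"
  tau :: "'u \<Rightarrow> 'u \<Rightarrow> ('o, 'u) arr"
  eta :: "'u \<Rightarrow> ('o, 'u) arr"
  mu :: "'u \<Rightarrow> 'u \<Rightarrow> 'u \<Rightarrow> ('o, 'u) arr"

text \<open>In \<open>mu_assoc\<close> the triple pullback is
  \<open>P1 k l \<times>\<^bsub>P0 k\<^esub> (P1 j k \<times>\<^bsub>P0 j\<^esub> P1 i j)\<close>, with projections \<open>a\<close>, \<open>b\<close>, \<open>c\<close> to the three factors and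
  \<open>d\<close> to the inner pullback.\<close>

locale partite_category = restriction_category C
  for C :: "('o, 'u) rcat" (structure) and A :: "('o, 'u) pcat" +
  assumes Ix_small: "Ix A \<prec> (UNIV :: 'u set)"
    and P0_Ob: "i \<in> Ix A \<Longrightarrow> P0 A i \<in> Ob C"
    and P1_Ob: "\<lbrakk>i \<in> Ix A; j \<in> Ix A\<rbrakk> \<Longrightarrow> P1 A i j \<in> Ob C"
    and sgm_hom: "\<lbrakk>i \<in> Ix A; j \<in> Ix A\<rbrakk> \<Longrightarrow> sgm A i j \<in> hom C (P1 A i j) (P0 A i)"
    and sgm_total: "\<lbrakk>i \<in> Ix A; j \<in> Ix A\<rbrakk> \<Longrightarrow> total_map C (sgm A i j)"
    and tau_hom: "\<lbrakk>i \<in> Ix A; j \<in> Ix A\<rbrakk> \<Longrightarrow> tau A i j \<in> hom C (P1 A i j) (P0 A j)"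
    and tau_total: "\<lbrakk>i \<in> Ix A; j \<in> Ix A\<rbrakk> \<Longrightarrow> total_map C (tau A i j)"
    and sgm_pullbacks: "\<lbrakk>i \<in> Ix A; j \<in> Ix A; total_map C f; tgt f = P0 A i\<rbrakk>
      \<Longrightarrow> \<exists>p q. is_pullback C (sgm A i j) f p q"
    and eta_hom: "i \<in> Ix A \<Longrightarrow> eta A i \<in> hom C (P0 A i) (P1 A i i)"
    and sgm_eta: "i \<in> Ix A \<Longrightarrow> sgm A i i \<odot> eta A i = Idn C (P0 A i)"
    and tau_eta: "i \<in> Ix A \<Longrightarrow> tau A i i \<odot> eta A i = Idn C (P0 A i)"
    and mu_hom: "\<lbrakk>i \<in> Ix A; j \<in> Ix A; k \<in> Ix A\<rbrakk>
      \<Longrightarrow> mu A i j k \<in> hom C (pbo C (sgm A j k) (tau A i j)) (P1 A i k)"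
    and sgm_mu: "\<lbrakk>i \<in> Ix A; j \<in> Ix A; k \<in> Ix A\<rbrakk>
      \<Longrightarrow> sgm A i k \<odot> mu A i j k = sgm A i j \<odot> pb2 C (sgm A j k) (tau A i j)"
    and tau_mu: "\<lbrakk>i \<in> Ix A; j \<in> Ix A; k \<in> Ix A\<rbrakk>
      \<Longrightarrow> tau A i k \<odot> mu A i j k = tau A j k \<odot> pb1 C (sgm A j k) (tau A i j)"
    and mu_eta_right: "\<lbrakk>i \<in> Ix A; j \<in> Ix A\<rbrakk>
      \<Longrightarrow> mu A i i j \<odot> pair C (sgm A i j) (tau A i i) (Idn C (P1 A i j)) (eta A i \<odot> sgm A i j)
          = Idn C (P1 A i j)"
    and mu_eta_left: "\<lbrakk>i \<in> Ix A; j \<in> Ix A\<rbrakk>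
      \<Longrightarrow> mu A i j j \<odot> pair C (sgm A j j) (tau A i j) (eta A j \<odot> tau A i j) (Idn C (P1 A i j))
          = Idn C (P1 A i j)"
    and mu_assoc: "\<lbrakk>i \<in> Ix A; j \<in> Ix A; k \<in> Ix A; l \<in> Ix A\<rbrakk> \<Longrightarrow>
      (let f = tau A j k \<odot> pb1 C (sgm A j k) (tau A i j);
           a = pb1 C (sgm A k l) f;
           d = pb2 C (sgm A k l) f;
           b = pb1 C (sgm A j k) (tau A i j) \<odot> d;
           c = pb2 C (sgm A j k) (tau A i j) \<odot> d
       in mu A i k l \<odot> pair C (sgm A k l) (tau A i k) a (mu A i j k \<odot> d)
          = mu A i j l \<odot> pair C (sgm A j l) (tau A i j)
              (mu A j k l \<odot> pair C (sgm A k l) (tau A j k) a b) c)"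

locale partite_groupoid = partite_category C A
  for C :: "('o, 'u) rcat" (structure) and A :: "('o, 'u) pcat" +
  assumes inversion: "\<exists>\<iota>. \<forall>i \<in> Ix A. \<forall>j \<in> Ix A.
      \<iota> i j \<in> hom C (P1 A i j) (P1 A j i) \<and> total_map C (\<iota> i j) \<and>
      \<iota> i j \<odot> \<iota> j i = Idn C (P1 A j i) \<and>
      sgm A j i \<odot> \<iota> i j = tau A i j \<and>
      mu A i j i \<odot> pair C (sgm A j i) (tau A i j) (\<iota> i j) (Idn C (P1 A i j))
        = eta A i \<odot> sgm A i j"

definition etale :: "('o, 'u) rcat \<Rightarrow> ('o, 'u) pcat \<Rightarrow> bool" where
  "etale C A \<longleftrightarrow> (\<forall>i \<in> Ix A. \<forall>j \<in> Ix A. local_homeo C (sgm A i j))"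

record ('o, 'u) cofun =
  cfI :: "'u \<Rightarrow> 'u"
  cf0 :: "'u \<Rightarrow> ('o, 'u) arr"
  cf1 :: "'u \<Rightarrow> 'u \<Rightarrow> ('o, 'u) arr"

text \<open>The components are required to be undefined outside the index set, so that equality of
  cofunctors is equality of records.  In the last clause the triple pullback is
  \<open>P1 A j k \<times>\<^bsub>P0 A j\<^esub> (P1 A i j \<times>\<^bsub>P0 A i\<^esub> P0 B (F i))\<close>, with projections \<open>a\<close>, \<open>b\<close>, \<open>c\<close> to the
  three factors and \<open>d\<close> to the inner pullback.\<close>

definition is_cofunctor ::
  "('o, 'u) rcat \<Rightarrow> ('o, 'u) pcat \<Rightarrow> ('o, 'u) pcat \<Rightarrow> ('o, 'u) cofun \<Rightarrow> bool" where
  "is_cofunctor C A B F \<longleftrightarrow>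
    cfI F \<in> Ix A \<rightarrow>\<^sub>E Ix B \<and>
    cf0 F \<in> extensional (Ix A) \<and>
    cf1 F \<in> extensional (Ix A) \<and> (\<forall>i \<in> Ix A. cf1 F i \<in> extensional (Ix A)) \<and>
    (\<forall>i \<in> Ix A. cf0 F i \<in> hom C (P0 B (cfI F i)) (P0 A i) \<and> total_map C (cf0 F i)) \<and>
    (\<forall>i \<in> Ix A. \<forall>j \<in> Ix A.
      cf1 F i j \<in> hom C (pbo C (sgm A i j) (cf0 F i)) (P1 B (cfI F i) (cfI F j)) \<and>
      total_map C (cf1 F i j) \<and>
      sgm B (cfI F i) (cfI F j) \<odot>\<^bsub>C\<^esub> cf1 F i j = pb2 C (sgm A i j) (cf0 F i) \<and>
      cf0 F j \<odot>\<^bsub>C\<^esub> tau B (cfI F i) (cfI F j) \<odot>\<^bsub>C\<^esub> cf1 F i j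
        = tau A i j \<odot>\<^bsub>C\<^esub> pb1 C (sgm A i j) (cf0 F i)) \<and>
    (\<forall>i \<in> Ix A.
      cf1 F i i \<odot>\<^bsub>C\<^esub> pair C (sgm A i i) (cf0 F i) (eta A i \<odot>\<^bsub>C\<^esub> cf0 F i) (Idn C (P0 B (cfI F i)))
        = eta B (cfI F i)) \<and>
    (\<forall>i \<in> Ix A. \<forall>j \<in> Ix A. \<forall>k \<in> Ix A.
      let f = tau A i j \<odot>\<^bsub>C\<^esub> pb1 C (sgm A i j) (cf0 F i);
          a = pb1 C (sgm A j k) f;
          d = pb2 C (sgm A j k) f;
          b = pb1 C (sgm A i j) (cf0 F i) \<odot>\<^bsub>C\<^esub> d;
          c = pb2 C (sgm A i j) (cf0 F i) \<odot>\<^bsub>C\<^esub> d;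
          w = cf1 F i j \<odot>\<^bsub>C\<^esub> d
      in cf1 F i k \<odot>\<^bsub>C\<^esub> pair C (sgm A i k) (cf0 F i)
           (mu A i j k \<odot>\<^bsub>C\<^esub> pair C (sgm A j k) (tau A i j) a b) c
         = mu B (cfI F i) (cfI F j) (cfI F k) \<odot>\<^bsub>C\<^esub>
           pair C (sgm B (cfI F j) (cfI F k)) (tau B (cfI F i) (cfI F j))
             (cf1 F j k \<odot>\<^bsub>C\<^esub>
               pair C (sgm A j k) (cf0 F j) a (tau B (cfI F i) (cfI F j) \<odot>\<^bsub>C\<^esub> w))
             w)"

definition id_cofun :: "('o, 'u) rcat \<Rightarrow> ('o, 'u) pcat \<Rightarrow> ('o, 'u) cofun" where
  "id_cofun C A = \<lparr>
    cfI = (\<lambda>i \<in> Ix A. i),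
    cf0 = (\<lambda>i \<in> Ix A. Idn C (P0 A i)),
    cf1 = (\<lambda>i \<in> Ix A. \<lambda>j \<in> Ix A. pb1 C (sgm A i j) (Idn C (P0 A i))) \<rparr>"

definition comp_cofun ::
  "('o, 'u) rcat \<Rightarrow> ('o, 'u) pcat \<Rightarrow> ('o, 'u) pcat \<Rightarrow>
   ('o, 'u) cofun \<Rightarrow> ('o, 'u) cofun \<Rightarrow> ('o, 'u) cofun" where
  "comp_cofun C A B G F = \<lparr>
    cfI = (\<lambda>i \<in> Ix A. cfI G (cfI F i)),
    cf0 = (\<lambda>i \<in> Ix A. cf0 F i \<odot>\<^bsub>C\<^esub> cf0 G (cfI F i)),
    cf1 = (\<lambda>i \<in> Ix A. \<lambda>j \<in> Ix A.
      let f = cf0 F i \<odot>\<^bsub>C\<^esub> cf0 G (cfI F i);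
          a = pb1 C (sgm A i j) f;
          c = pb2 C (sgm A i j) f
      in cf1 G (cfI F i) (cfI F j) \<odot>\<^bsub>C\<^esub>
         pair C (sgm B (cfI F i) (cfI F j)) (cf0 G (cfI F i))
           (cf1 F i j \<odot>\<^bsub>C\<^esub> pair C (sgm A i j) (cf0 F i) a (cf0 G (cfI F i) \<odot>\<^bsub>C\<^esub> c)) c) \<rparr>"

definition pGpd :: "('o, 'u) rcat \<Rightarrow> (('o, 'u) pcat, ('o, 'u) cofun) cat" where
  "pGpd C = \<lparr>
    Ob = {A. partite_groupoid C A},
    Ar = {H. partite_groupoid C (src H) \<and> partite_groupoid C (tgt H) \<and>
             is_cofunctor C (src H) (tgt H) (lab H)},
    Idn = (\<lambda>A. Arr A (id_cofun C A) A),
    Cmp = (\<lambda>G F. Arr (src F) (comp_cofun C (src F) (tgt F) (lab G) (lab F)) (tgt G)) \<rparr>"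

definition peGpd :: "('o, 'u) rcat \<Rightarrow> (('o, 'u) pcat, ('o, 'u) cofun) cat" where
  "peGpd C = full_subcat (pGpd C) (etale C)"

section \<open>Inverse categories over a restriction category\<close>

type_synonym ('o, 'u) over_obj = "('u, 'u) rcat \<times> ('u, 'u, 'o, 'u) fctr"
type_synonym ('o, 'u) over_map = "('u, 'u, 'u, 'u) fctr \<times> ('u \<Rightarrow> ('o, 'u) arr)"

definition is_over_obj :: "('o, 'u) rcat \<Rightarrow> ('o, 'u) over_obj \<Rightarrow> bool" where
  "is_over_obj C = (\<lambda>(D, P). inverse_category D \<and> Ob D \<prec> (UNIV :: 'u set) \<and> small_hom_sets D \<and>
    is_restriction_functor D C P)"

text \<open>As for cofunctors, the components are undefined outside their domains.\<close>

definition is_over_map ::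
  "('o, 'u) rcat \<Rightarrow> ('o, 'u) over_obj \<Rightarrow> ('o, 'u) over_obj \<Rightarrow> ('o, 'u) over_map \<Rightarrow> bool" where
  "is_over_map C = (\<lambda>(D, P) (E, Q) (F, \<alpha>).
    FO F \<in> extensional (Ob D) \<and> FA F \<in> extensional (Ar D) \<and> \<alpha> \<in> extensional (Ob D) \<and>
    is_functor D E F \<and> is_nat_trans D C (comp_fctr Q F) P \<alpha> \<and>
    (\<forall>i \<in> Ob D. total_map C (\<alpha> i)))"

definition id_over :: "('o, 'u) rcat \<Rightarrow> ('o, 'u) over_obj \<Rightarrow> ('o, 'u) over_map" where
  "id_over C = (\<lambda>(D, P).
    (\<lparr> FO = (\<lambda>i \<in> Ob D. i), FA = (\<lambda>f \<in> Ar D. f) \<rparr>, \<lambda>i \<in> Ob D. Idn C (FO P i)))"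

definition comp_over ::
  "('o, 'u) rcat \<Rightarrow> ('o, 'u) over_obj \<Rightarrow>
   ('o, 'u) over_map \<Rightarrow> ('o, 'u) over_map \<Rightarrow> ('o, 'u) over_map" where
  "comp_over C = (\<lambda>(D, P) (G, \<beta>) (F, \<alpha>).
    (\<lparr> FO = (\<lambda>i \<in> Ob D. FO G (FO F i)), FA = (\<lambda>f \<in> Ar D. FA G (FA F f)) \<rparr>,
     \<lambda>i \<in> Ob D. \<alpha> i \<odot>\<^bsub>C\<^esub> \<beta> (FO F i)))"

definition iCat_over :: "('o, 'u) rcat \<Rightarrow> (('o, 'u) over_obj, ('o, 'u) over_map) cat" where
  "iCat_over C = \<lparr>
    Ob = {X. is_over_obj C X},
    Ar = {H. is_over_obj C (src H) \<and> is_over_obj C (tgt H) \<and>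
             is_over_map C (src H) (tgt H) (lab H)},
    Idn = (\<lambda>X. Arr X (id_over C X) X),
    Cmp = (\<lambda>G F. Arr (src F) (comp_over C (src F) (lab G) (lab F)) (tgt G)) \<rparr>"

definition jiCat_over_h :: "('o, 'u) rcat \<Rightarrow> (('o, 'u) over_obj, ('o, 'u) over_map) cat" where
  "jiCat_over_h C = full_subcat (iCat_over C)
    (\<lambda>(D, P). join_inverse_category D \<and> hyperconnected D C P)"

section \<open>The functor of partial bisections\<close>

definition tau_star ::
  "('o, 'u) rcat \<Rightarrow> ('o, 'u) pcat \<Rightarrow> 'u \<Rightarrow> 'u \<Rightarrow> 'u \<Rightarrow> ('o, 'u) arr \<Rightarrow> ('o, 'u) arr" where
  "tau_star C A i j k t =
    pair C (sgm A j k) (tau A i j) (t \<odot>\<^bsub>C\<^esub> tau A i j) (rst C (t \<odot>\<^bsub>C\<^esub> tau A i j))"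

definition bisection ::
  "('o, 'u) rcat \<Rightarrow> ('o, 'u) pcat \<Rightarrow> 'u \<Rightarrow> 'u \<Rightarrow> ('o, 'u) arr \<Rightarrow> bool" where
  "bisection C A i j s \<longleftrightarrow> partial_section C (sgm A i j) s \<and> partial_iso C (tau A i j \<odot>\<^bsub>C\<^esub> s)"

text \<open>The arrow of \<open>Phi_cat C A\<close> given by a partial bisection \<open>s\<close> from \<open>i\<close> to \<open>j\<close> is
  \<open>Arr i (lab s) j\<close>; conversely \<open>under A\<close> recovers \<open>s\<close> from it.\<close>

definition under :: "('o, 'u) pcat \<Rightarrow> ('u, 'u) arr \<Rightarrow> ('o, 'u) arr" where
  "under A f = Arr (P0 A (src f)) (lab f) (P1 A (src f) (tgt f))"

definition Phi_cat :: "('o, 'u) rcat \<Rightarrow> ('o, 'u) pcat \<Rightarrow> ('u, 'u) rcat" where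
  "Phi_cat C A = \<lparr>
    Ob = Ix A,
    Ar = {f. src f \<in> Ix A \<and> tgt f \<in> Ix A \<and> bisection C A (src f) (tgt f) (under A f)},
    Idn = (\<lambda>i. Arr i (lab (eta A i)) i),
    Cmp = (\<lambda>t s. Arr (src s)
      (lab (mu A (src s) (tgt s) (tgt t) \<odot>\<^bsub>C\<^esub>
            tau_star C A (src s) (tgt s) (tgt t) (under A t) \<odot>\<^bsub>C\<^esub> under A s))
      (tgt t)),
    rst = (\<lambda>s. Arr (src s) (lab (eta A (src s) \<odot>\<^bsub>C\<^esub> rst C (under A s))) (src s)) \<rparr>"

definition Phi_proj :: "('o, 'u) rcat \<Rightarrow> ('o, 'u) pcat \<Rightarrow> ('u, 'u, 'o, 'u) fctr" where
  "Phi_proj C A = \<lparr>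
    FO = P0 A,
    FA = (\<lambda>s. tau A (src s) (tgt s) \<odot>\<^bsub>C\<^esub> under A s) \<rparr>"

definition Phi_obj :: "('o, 'u) rcat \<Rightarrow> ('o, 'u) pcat \<Rightarrow> ('o, 'u) over_obj" where
  "Phi_obj C A = (Phi_cat C A, Phi_proj C A)"

definition Phi_map :: "('o, 'u) rcat \<Rightarrow> ('o, 'u) pcat \<Rightarrow> ('o, 'u) cofun \<Rightarrow> ('o, 'u) over_map" where
  "Phi_map C A F =
    (\<lparr> FO = cfI F,
       FA = (\<lambda>s \<in> Ar (Phi_cat C A).
         let i = src s; j = tgt s; t = under A s \<odot>\<^bsub>C\<^esub> cf0 F i
         in Arr (cfI F i)
              (lab (cf1 F i j \<odot>\<^bsub>C\<^esub> pair C (sgm A i j) (cf0 F i) t (rst C t)))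
              (cfI F j)) \<rparr>,
     cf0 F)"

definition Phi_g ::
  "('o, 'u) rcat \<Rightarrow>
   (('o, 'u) pcat, ('o, 'u) cofun, ('o, 'u) over_obj, ('o, 'u) over_map) fctr" where
  "Phi_g C = \<lparr>
    FO = Phi_obj C,
    FA = (\<lambda>H. Arr (Phi_obj C (src H)) (Phi_map C (src H) (lab H)) (Phi_obj C (tgt H))) \<rparr>"

section \<open>Its left adjoint\<close>

definition agree ::
  "('o, 'u) rcat \<Rightarrow> ('o, 'u) over_obj \<Rightarrow> ('u, 'u) arr \<Rightarrow> ('u, 'u) arr \<Rightarrow> ('o, 'u) arr" where
  "agree C = (\<lambda>(D, P) f g. join C (FO P (src f)) (FO P (src f))
    (FA P ` {e \<in> idems D (src f). restr_le D e (rst D f \<odot>\<^bsub>D\<^esub> rst D g) \<and>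
                                 f \<odot>\<^bsub>D\<^esub> e = g \<odot>\<^bsub>D\<^esub> e}))"

text \<open>The chosen glueing for the hom-set from \<open>i\<close> to \<open>j\<close>: the local homeomorphism, the partial
  isomorphisms of which it is the join, and their partial inverses.\<close>

definition Psi_glueing ::
  "('o, 'u) rcat \<Rightarrow> ('o, 'u) over_obj \<Rightarrow> 'u \<Rightarrow> 'u \<Rightarrow>
   ('o, 'u) arr \<times> (('u, 'u) arr \<Rightarrow> ('o, 'u) arr) \<times> (('u, 'u) arr \<Rightarrow> ('o, 'u) arr)" where
  "Psi_glueing C X i j = (SOME (p, q, s).
    is_glueing C (FO (snd X) i) (hom (fst X) i j) (agree C X) p q s)"

definition Psi_sgm :: "('o, 'u) rcat \<Rightarrow> ('o, 'u) over_obj \<Rightarrow> 'u \<Rightarrow> 'u \<Rightarrow> ('o, 'u) arr" where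
  "Psi_sgm C X i j = (case Psi_glueing C X i j of (p, q, s) \<Rightarrow> p)"

definition Psi_sec :: "('o, 'u) rcat \<Rightarrow> ('o, 'u) over_obj \<Rightarrow> ('u, 'u) arr \<Rightarrow> ('o, 'u) arr" where
  "Psi_sec C X f = (case Psi_glueing C X (src f) (tgt f) of (p, q, s) \<Rightarrow> s f)"

definition Psi_tau :: "('o, 'u) rcat \<Rightarrow> ('o, 'u) over_obj \<Rightarrow> 'u \<Rightarrow> 'u \<Rightarrow> ('o, 'u) arr" where
  "Psi_tau C X i j = (THE t. t \<in> hom C (src (Psi_sgm C X i j)) (FO (snd X) j) \<and>
    (\<forall>f \<in> hom (fst X) i j. t \<odot>\<^bsub>C\<^esub> Psi_sec C X f = FA (snd X) f))"

definition Psi_mu :: "('o, 'u) rcat \<Rightarrow> ('o, 'u) over_obj \<Rightarrow> 'u \<Rightarrow> 'u \<Rightarrow> 'u \<Rightarrow> ('o, 'u) arr" where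
  "Psi_mu C X i j k =
    (let \<tau> = Psi_tau C X i j; \<sigma> = Psi_sgm C X j k
     in THE m. m \<in> hom C (pbo C \<sigma> \<tau>) (src (Psi_sgm C X i k)) \<and>
       (\<forall>f \<in> hom (fst X) i j. \<forall>g \<in> hom (fst X) j k.
         let t = Psi_sec C X g \<odot>\<^bsub>C\<^esub> \<tau>
         in m \<odot>\<^bsub>C\<^esub> pair C \<sigma> \<tau> t (rst C t) \<odot>\<^bsub>C\<^esub> Psi_sec C X f
            = Psi_sec C X (g \<odot>\<^bsub>fst X\<^esub> f)))"

definition Psi_obj :: "('o, 'u) rcat \<Rightarrow> ('o, 'u) over_obj \<Rightarrow> ('o, 'u) pcat" where
  "Psi_obj C X = \<lparr>
    Ix = Ob (fst X),
    P0 = FO (snd X),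
    P1 = (\<lambda>i j. src (Psi_sgm C X i j)),
    sgm = Psi_sgm C X,
    tau = Psi_tau C X,
    eta = (\<lambda>i. Psi_sec C X (Idn (fst X) i)),
    mu = Psi_mu C X \<rparr>"

definition unit_g ::
  "('o, 'u) rcat \<Rightarrow> ('o, 'u) over_obj \<Rightarrow> (('o, 'u) over_obj, ('o, 'u) over_map) arr" where
  "unit_g C X = Arr X
    (\<lparr> FO = (\<lambda>i \<in> Ob (fst X). i),
       FA = (\<lambda>f \<in> Ar (fst X). Arr (src f) (lab (Psi_sec C X f)) (tgt f)) \<rparr>,
     \<lambda>i \<in> Ob (fst X). Idn C (FO (snd X) i))
    (Phi_obj C (Psi_obj C X))"

text \<open>The action of \<open>Psi\<close> on maps and the counit are determined by the unit, through its universal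
  property: \<open>Psi H\<close> is the unique \<open>K\<close> with \<open>Phi_g K \<circ> unit = unit \<circ> H\<close>, and the counit at \<open>A\<close> is
  the unique \<open>E\<close> with \<open>Phi_g E \<circ> unit = id\<close>.\<close>

definition Psi ::
  "('o, 'u) rcat \<Rightarrow>
   (('o, 'u) over_obj, ('o, 'u) over_map, ('o, 'u) pcat, ('o, 'u) cofun) fctr" where
  "Psi C = \<lparr>
    FO = Psi_obj C,
    FA = (\<lambda>H. THE K. K \<in> hom (pGpd C) (Psi_obj C (src H)) (Psi_obj C (tgt H)) \<and>
      FA (Phi_g C) K \<odot>\<^bsub>iCat_over C\<^esub> unit_g C (src H) = unit_g C (tgt H) \<odot>\<^bsub>iCat_over C\<^esub> H) \<rparr>"

definition counit_g ::
  "('o, 'u) rcat \<Rightarrow> ('o, 'u) pcat \<Rightarrow> (('o, 'u) pcat, ('o, 'u) cofun) arr" where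
  "counit_g C A = (THE E. E \<in> hom (pGpd C) (Psi_obj C (Phi_obj C A)) A \<and>
    FA (Phi_g C) E \<odot>\<^bsub>iCat_over C\<^esub> unit_g C (Phi_obj C A) = Idn (iCat_over C) (Phi_obj C A))"

end

theory Submission
  imports Defs
begin

text \<open>
  The argument rests on one universal property.  Suppose that every source map of a groupoid \<open>A\<close> is a
  glueing of partial isomorphisms whose partial inverses are sections \<open>sec f\<close> indexed by maps \<open>f\<close> of an
  inverse category \<open>D\<close> over \<open>C\<close>, functorially in \<open>f\<close>, and that two of these sections agree only where
  \<open>f\<close> and \<open>g\<close> are forced to agree.  Then every map over \<open>C\<close> from \<open>D\<close> to the bisections of a groupoid
  \<open>B\<close> extends uniquely to a cofunctor from \<open>A\<close> to \<open>B\<close>: glueings are stable under pullback along total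
  maps, and maps out of a glued object can be prescribed, and equations between them checked, on the
  pieces \<open>sec f\<close>.

  The groupoid \<open>\<Psi> P\<close> has this property by construction, which gives the adjunction.  An etale groupoid
  has it with respect to its own bisections, because restricting to a common refinement of the pieces
  of its source and target maps yields enough of them; so the counit is invertible there.  Conversely
  \<open>\<Psi> P\<close> is always etale, and being etale is invariant under isomorphism.

  If \<open>D\<close> has joins and is hyperconnected over \<open>C\<close>, a bisection of \<open>\<Psi> P\<close> restricts on each piece to
  a section \<open>s g\<close>; the maps \<open>g\<close> so obtained are pairwise bicompatible, and the bisection is \<open>s h\<close> for
  their join \<open>h\<close>.  Hence the unit is invertible.  Conversely the bisections of a groupoid always form
  a join inverse category hyperconnected over \<open>C\<close>, and both properties transfer along an invertible unit.
\<close>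

section \<open>Adjunctions from universal arrows\<close>

text \<open>Most laws are stated for generalised elements: an equation between maps out of an
  iterated pullback becomes one between maps out of an arbitrary object. There it can be tested on
  restriction idempotents that cover the domain, and the test can be nested, once for each arrow of
  a composable string, until every arrow has become a section \<open>sec f\<close> and a law of
  \<open>D\<close> decides.

  The obstacle is that pullbacks are not given. A glued source map has them along total maps because
  the pulled back atlas is again an atlas, has a glueing by hypothesis, and any such glueing proves
  to be a pullback. Smallness of the hom-sets makes these atlases admissible.

  Hyperconnectedness moves restriction idempotents between \<open>D\<close> and \<open>C\<close>: it
  lifts the domain on which a bisection follows a given section to an idempotent of
  \<open>D\<close>, and it makes joins of idempotents in \<open>D\<close> agree with those in
  \<open>C\<close>. Without it, distinct maps of \<open>D\<close> may be glued into the same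
  section.\<close>

context category
begin

lemma hom_iff: "f \<in> hom C a b \<longleftrightarrow> f \<in> Ar C \<and> src f = a \<and> tgt f = b"
  by (simp add: hom_def)

lemma src_Ob [simp]: "f \<in> Ar C \<Longrightarrow> src f \<in> Ob C"
  and tgt_Ob [simp]: "f \<in> Ar C \<Longrightarrow> tgt f \<in> Ob C"
  by (simp_all add: src_tgt_Ob)

lemma Idn_Ar [simp]: "a \<in> Ob C \<Longrightarrow> Idn C a \<in> Ar C"
  and src_Idn [simp]: "a \<in> Ob C \<Longrightarrow> src (Idn C a) = a"
  and tgt_Idn [simp]: "a \<in> Ob C \<Longrightarrow> tgt (Idn C a) = a"
  using Idn_hom[of a] by (simp_all add: hom_iff)

lemma Cmp_Ar [simp]: "\<lbrakk>f \<in> Ar C; g \<in> Ar C; tgt f = src g\<rbrakk> \<Longrightarrow> g \<odot> f \<in> Ar C"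
  and src_Cmp [simp]: "\<lbrakk>f \<in> Ar C; g \<in> Ar C; tgt f = src g\<rbrakk> \<Longrightarrow> src (g \<odot> f) = src f"
  and tgt_Cmp [simp]: "\<lbrakk>f \<in> Ar C; g \<in> Ar C; tgt f = src g\<rbrakk> \<Longrightarrow> tgt (g \<odot> f) = tgt g"
  using Cmp_hom[of f g] by (simp_all add: hom_iff)

lemma Cmp_Idn' [simp]: "\<lbrakk>f \<in> Ar C; src f = a\<rbrakk> \<Longrightarrow> f \<odot> Idn C a = f"
  using Cmp_Idn by auto

lemma Idn_Cmp' [simp]: "\<lbrakk>f \<in> Ar C; tgt f = a\<rbrakk> \<Longrightarrow> Idn C a \<odot> f = f"
  using Idn_Cmp by auto

lemma Cmp_assoc' [simp]:
  "\<lbrakk>f \<in> Ar C; g \<in> Ar C; h \<in> Ar C; tgt f = src g; tgt g = src h\<rbrakk> \<Longrightarrow> (h \<odot> g) \<odot> f = h \<odot> g \<odot> f"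
  by (rule Cmp_assoc)

text \<open>Simplification brackets composites to the right, so an equation
  \<open>g \<odot> f = k\<close> no longer matches inside a longer composite. This variant carries
  an arbitrary tail \<open>x\<close>.\<close>

lemma Cmp_reassoc:
  assumes "g \<odot> f = k" "x \<in> Ar C" "f \<in> Ar C" "g \<in> Ar C" "tgt x = src f" "tgt f = src g"
  shows "g \<odot> f \<odot> x = k \<odot> x"
  using assms by (metis Cmp_assoc)

lemma is_isoI:
  assumes "f \<in> hom C a b" "g \<in> hom C b a" "g \<odot> f = Idn C a" "f \<odot> g = Idn C b"
  shows "is_iso C f"
  using assms unfolding is_iso_def by (auto simp: hom_iff)

end

text \<open>Only the object part of the left adjoint and the unit are given. The remaining data are
  forced by initiality of the arrows \<open>\<eta> a\<close>, which is also how \<open>Psi\<close>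
  and \<open>counit_g\<close> are defined; \<open>lift\<close> and \<open>counit\<close> therefore
  repeat those descriptions.\<close>

locale universal_arrows = C: category C + D: category D
  for C :: "('o, 'u, 'y) cat_scheme" and D :: "('p, 'v, 'z) cat_scheme" +
  fixes R :: "('p, 'v, 'o, 'u) fctr" and L :: "'o \<Rightarrow> 'p" and \<eta> :: "'o \<Rightarrow> ('o, 'u) arr"
  assumes R_functor: "is_functor D C R"
    and L_Ob: "a \<in> Ob C \<Longrightarrow> L a \<in> Ob D"
    and \<eta>_hom: "a \<in> Ob C \<Longrightarrow> \<eta> a \<in> hom C a (FO R (L a))"
    and universal: "\<lbrakk>a \<in> Ob C; b \<in> Ob D; H \<in> hom C a (FO R b)\<rbrakk>
      \<Longrightarrow> \<exists>!K. K \<in> hom D (L a) b \<and> FA R K \<odot>\<^bsub>C\<^esub> \<eta> a = H"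
begin

definition lift :: "('o, 'u) arr \<Rightarrow> ('p, 'v) arr" where
  "lift H = (THE K. K \<in> hom D (L (src H)) (L (tgt H)) \<and>
    FA R K \<odot>\<^bsub>C\<^esub> \<eta> (src H) = \<eta> (tgt H) \<odot>\<^bsub>C\<^esub> H)"

definition counit :: "'p \<Rightarrow> ('p, 'v) arr" where
  "counit b = (THE E. E \<in> hom D (L (FO R b)) b \<and>
    FA R E \<odot>\<^bsub>C\<^esub> \<eta> (FO R b) = Idn C (FO R b))"

abbreviation left_adjoint :: "('o, 'u, 'p, 'v) fctr" where
  "left_adjoint \<equiv> \<lparr> FO = L, FA = lift \<rparr>"

lemma FO_R [simp]: "b \<in> Ob D \<Longrightarrow> FO R b \<in> Ob C"
  and FA_R [simp]: "K \<in> Ar D \<Longrightarrow> FA R K \<in> Ar C" "K \<in> Ar D \<Longrightarrow> src (FA R K) = FO R (src K)"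
    "K \<in> Ar D \<Longrightarrow> tgt (FA R K) = FO R (tgt K)"
  and R_Idn [simp]: "b \<in> Ob D \<Longrightarrow> FA R (Idn D b) = Idn C (FO R b)"
  and R_Cmp [simp]: "\<lbrakk>K \<in> Ar D; K' \<in> Ar D; tgt K = src K'\<rbrakk>
    \<Longrightarrow> FA R (K' \<odot>\<^bsub>D\<^esub> K) = FA R K' \<odot>\<^bsub>C\<^esub> FA R K"
  using R_functor by (auto simp: is_functor_def C.hom_iff)

lemma \<eta>_simps [simp]:
  "a \<in> Ob C \<Longrightarrow> \<eta> a \<in> Ar C" "a \<in> Ob C \<Longrightarrow> src (\<eta> a) = a" "a \<in> Ob C \<Longrightarrow> tgt (\<eta> a) = FO R (L a)"
  using \<eta>_hom by (auto simp: C.hom_iff)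

lemmas L_Ob' [simp] = L_Ob

lemma lift_hom: "H \<in> Ar C \<Longrightarrow> lift H \<in> hom D (L (src H)) (L (tgt H)) \<and>
    FA R (lift H) \<odot>\<^bsub>C\<^esub> \<eta> (src H) = \<eta> (tgt H) \<odot>\<^bsub>C\<^esub> H"
  unfolding lift_def by (rule theI', rule universal) (auto simp: C.hom_iff)

lemma counit_hom: "b \<in> Ob D \<Longrightarrow> counit b \<in> hom D (L (FO R b)) b \<and>
    FA R (counit b) \<odot>\<^bsub>C\<^esub> \<eta> (FO R b) = Idn C (FO R b)"
  unfolding counit_def by (rule theI', rule universal) (auto simp: C.hom_iff)

lemma lift_simps [simp]:
  assumes "H \<in> Ar C"
  shows "lift H \<in> Ar D" "src (lift H) = L (src H)" "tgt (lift H) = L (tgt H)"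
    "FA R (lift H) \<odot>\<^bsub>C\<^esub> \<eta> (src H) = \<eta> (tgt H) \<odot>\<^bsub>C\<^esub> H"
  using lift_hom[OF assms] by (auto simp: D.hom_iff)

lemma counit_simps [simp]:
  assumes "b \<in> Ob D"
  shows "counit b \<in> Ar D" "src (counit b) = L (FO R b)" "tgt (counit b) = b"
    "FA R (counit b) \<odot>\<^bsub>C\<^esub> \<eta> (FO R b) = Idn C (FO R b)"
  using counit_hom[OF assms] by (auto simp: D.hom_iff)

lemma lift_simps_comp [simp]:
  "\<lbrakk>H \<in> Ar C; x \<in> Ar C; tgt x = src H\<rbrakk> \<Longrightarrow>
    FA R (lift H) \<odot>\<^bsub>C\<^esub> \<eta> (src H) \<odot>\<^bsub>C\<^esub> x = \<eta> (tgt H) \<odot>\<^bsub>C\<^esub> H \<odot>\<^bsub>C\<^esub> x"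
  by (subst C.Cmp_reassoc[OF lift_simps(4)]) auto

lemma counit_simps_comp [simp]:
  "\<lbrakk>b \<in> Ob D; x \<in> Ar C; tgt x = FO R b\<rbrakk> \<Longrightarrow>
    FA R (counit b) \<odot>\<^bsub>C\<^esub> \<eta> (FO R b) \<odot>\<^bsub>C\<^esub> x = x"
  by (subst C.Cmp_reassoc[OF counit_simps(4)]) auto

text \<open>The uniqueness half of initiality, in the form used throughout: maps out of
  \<open>L a\<close> are compared after composing with the unit. Functor laws, naturality of the
  counit and the first triangle identity all reduce to it.\<close>

lemma universal_eq:
  assumes "K \<in> Ar D" "K' \<in> Ar D" "src K = L a" "src K' = L a" "tgt K = tgt K'" "a \<in> Ob C"
    and "FA R K \<odot>\<^bsub>C\<^esub> \<eta> a = FA R K' \<odot>\<^bsub>C\<^esub> \<eta> a"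
  shows "K = K'"
proof -
  have "\<exists>!J. J \<in> hom D (L a) (tgt K) \<and> FA R J \<odot>\<^bsub>C\<^esub> \<eta> a = FA R K \<odot>\<^bsub>C\<^esub> \<eta> a"
    using assms by (intro universal) (auto simp: C.hom_iff)
  then show ?thesis using assms by (auto simp: D.hom_iff)
qed

lemma left_adjoint_functor: "is_functor C D left_adjoint"
proof -
  have "lift (Idn C a) = Idn D (L a)" if "a \<in> Ob C" for a
  proof (rule universal_eq[of _ _ a])
    show "FA R (lift (Idn C a)) \<odot>\<^bsub>C\<^esub> \<eta> a = FA R (Idn D (L a)) \<odot>\<^bsub>C\<^esub> \<eta> a"
      using that lift_simps(4)[of "Idn C a"] by simp
  qed (use that in auto)
  moreover have "lift (G \<odot>\<^bsub>C\<^esub> F) = lift G \<odot>\<^bsub>D\<^esub> lift F"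
    if "F \<in> Ar C" "G \<in> Ar C" "tgt F = src G" for F G
  proof (rule universal_eq[of _ _ "src F"])
    show "FA R (lift (G \<odot>\<^bsub>C\<^esub> F)) \<odot>\<^bsub>C\<^esub> \<eta> (src F) = FA R (lift G \<odot>\<^bsub>D\<^esub> lift F) \<odot>\<^bsub>C\<^esub> \<eta> (src F)"
      using that lift_simps(4)[of "G \<odot>\<^bsub>C\<^esub> F"] lift_simps_comp[of G F] by simp
  qed (use that in auto)
  ultimately show ?thesis
    by (auto simp: is_functor_def C.category_axioms D.category_axioms D.hom_iff)
qed

lemma counit_natural:
  assumes "K \<in> Ar D"
  shows "K \<odot>\<^bsub>D\<^esub> counit (src K) = counit (tgt K) \<odot>\<^bsub>D\<^esub> lift (FA R K)"
proof (rule universal_eq[of _ _ "FO R (src K)"])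
  show "FA R (K \<odot>\<^bsub>D\<^esub> counit (src K)) \<odot>\<^bsub>C\<^esub> \<eta> (FO R (src K)) =
      FA R (counit (tgt K) \<odot>\<^bsub>D\<^esub> lift (FA R K)) \<odot>\<^bsub>C\<^esub> \<eta> (FO R (src K))"
    using assms lift_simps(4)[of "FA R K"] by simp
qed (use assms in auto)

lemma triangle_left:
  assumes "a \<in> Ob C"
  shows "counit (L a) \<odot>\<^bsub>D\<^esub> lift (\<eta> a) = Idn D (L a)"
proof (rule universal_eq[of _ _ a])
  show "FA R (counit (L a) \<odot>\<^bsub>D\<^esub> lift (\<eta> a)) \<odot>\<^bsub>C\<^esub> \<eta> a = FA R (Idn D (L a)) \<odot>\<^bsub>C\<^esub> \<eta> a"
    using assms lift_simps(4)[of "\<eta> a"] by simp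
qed (use assms in auto)

theorem adjunction: "is_adjunction C D left_adjoint R \<eta> counit"
  using left_adjoint_functor R_functor counit_natural triangle_left
  by (auto simp: is_adjunction_def is_nat_trans_def is_functor_def id_fctr_def comp_fctr_def
      C.hom_iff D.hom_iff)

text \<open>If \<open>R\<close> is full and faithful on the maps out of \<open>b\<close>, then \<open>(b, 1)\<close> is another universal arrow
  from \<open>R b\<close>, so that \<open>b\<close> is isomorphic to \<open>L (R b)\<close>.\<close>

lemma counit_iso:
  assumes b: "b \<in> Ob D"
    and ff: "\<And>d H. \<lbrakk>d \<in> Ob D; H \<in> hom C (FO R b) (FO R d)\<rbrakk> \<Longrightarrow> \<exists>!K. K \<in> hom D b d \<and> FA R K = H"
  shows "is_iso D (counit b)"
proof -
  let ?c = "L (FO R b)"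
  obtain K where K: "K \<in> hom D b ?c" "FA R K = \<eta> (FO R b)"
    using ff[of ?c "\<eta> (FO R b)"] b \<eta>_hom by auto
  have "K \<odot>\<^bsub>D\<^esub> counit b = Idn D ?c"
    by (rule universal_eq[of _ _ "FO R b"]) (use b K in \<open>auto simp: D.hom_iff\<close>)
  moreover have "counit b \<odot>\<^bsub>D\<^esub> K = Idn D b"
  proof -
    have "\<exists>!K. K \<in> hom D b b \<and> FA R K = Idn C (FO R b)"
      using b by (intro ff) (auto simp: C.hom_iff)
    moreover have "FA R (counit b \<odot>\<^bsub>D\<^esub> K) = Idn C (FO R b)"
      using b K by (auto simp: D.hom_iff)
    ultimately show ?thesis using b K by (auto simp: D.hom_iff)
  qed
  ultimately show ?thesis
    using b K by (intro D.is_isoI[of _ ?c b K]) (auto simp: D.hom_iff)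
qed

end

subsection \<open>Restriction to fixpoints\<close>

lemma category_full_subcat:
  assumes "category C"
  shows "category (full_subcat C p)"
proof -
  interpret category C by fact
  show ?thesis by unfold_locales (auto simp: full_subcat_def hom_def)
qed

lemma is_iso_full_subcat:
  "\<lbrakk>is_iso C f; p (src f); p (tgt f)\<rbrakk> \<Longrightarrow> is_iso (full_subcat C p) f"
  by (auto simp: is_iso_def full_subcat_def hom_def)

text \<open>A triangle identity exhibits a component of the counit as a one-sided inverse of
  something invertible. A left inverse of an invertible map coincides with its inverse, so it is
  invertible too.\<close>

lemma is_iso_left_inverse:
  assumes "category C" "is_iso C f" "g \<in> hom C (tgt f) (src f)" "g \<odot>\<^bsub>C\<^esub> f = Idn C (src f)"
  shows "is_iso C g"
proof -
  interpret category C by fact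
  obtain h where h: "h \<in> hom C (tgt f) (src f)" "h \<odot>\<^bsub>C\<^esub> f = Idn C (src f)" "f \<odot>\<^bsub>C\<^esub> h = Idn C (tgt f)"
    and f: "f \<in> Ar C"
    using assms(2) by (auto simp: is_iso_def)
  have "g = g \<odot>\<^bsub>C\<^esub> f \<odot>\<^bsub>C\<^esub> h" using h f assms(3) by (simp add: hom_iff)
  also have "\<dots> = h" using h f assms(3,4) Cmp_reassoc[OF assms(4), of h] by (simp add: hom_iff)
  finally show ?thesis using h f assms(3) by (intro is_isoI[of g _ _ f]) (auto simp: hom_iff)
qed

lemma is_iso_right_inverse:
  assumes "category C" "is_iso C f" "g \<in> hom C (tgt f) (src f)" "f \<odot>\<^bsub>C\<^esub> g = Idn C (tgt f)"
  shows "is_iso C g"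
proof -
  interpret category C by fact
  obtain h where h: "h \<in> hom C (tgt f) (src f)" "h \<odot>\<^bsub>C\<^esub> f = Idn C (src f)" "f \<odot>\<^bsub>C\<^esub> h = Idn C (tgt f)"
    and f: "f \<in> Ar C"
    using assms(2) by (auto simp: is_iso_def)
  have "g = h \<odot>\<^bsub>C\<^esub> f \<odot>\<^bsub>C\<^esub> g"
    using h f assms(3) Cmp_reassoc[OF h(2), of g] by (simp add: hom_iff)
  also have "\<dots> = h" using h f assms(3,4) by (simp add: hom_iff)
  finally show ?thesis using h f assms(3) by (intro is_isoI[of g _ _ f]) (auto simp: hom_iff)
qed

lemma functor_is_iso:
  assumes "is_functor C D F" "is_iso C f"
  shows "is_iso D (FA F f)"
proof -
  interpret C: category C using assms(1) by (simp add: is_functor_def)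
  interpret D: category D using assms(1) by (simp add: is_functor_def)
  obtain g where g: "g \<in> hom C (tgt f) (src f)" "g \<odot>\<^bsub>C\<^esub> f = Idn C (src f)" "f \<odot>\<^bsub>C\<^esub> g = Idn C (tgt f)"
    and f: "f \<in> Ar C"
    using assms(2) by (auto simp: is_iso_def)
  have F: "FA F x \<in> hom D (FO F (src x)) (FO F (tgt x))" if "x \<in> Ar C" for x
    using assms(1) that by (auto simp: is_functor_def)
  have "FA F g \<odot>\<^bsub>D\<^esub> FA F f = Idn D (FO F (src f))" "FA F f \<odot>\<^bsub>D\<^esub> FA F g = Idn D (FO F (tgt f))"
    using g f assms(1) by (auto simp: is_functor_def C.hom_iff)
      (metis C.hom_iff C.src_Ob C.tgt_Ob)+
  then show ?thesis using F[of f] F[of g] f g by (intro D.is_isoI) (auto simp: C.hom_iff)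
qed

lemma functor_full_subcat:
  assumes "is_functor C D F" "\<And>a. \<lbrakk>a \<in> Ob C; p a\<rbrakk> \<Longrightarrow> q (FO F a)"
  shows "is_functor (full_subcat C p) (full_subcat D q) F"
proof -
  interpret C: category C using assms(1) by (simp add: is_functor_def)
  have "category D" using assms(1) by (simp add: is_functor_def)
  then show ?thesis
    using assms by (auto simp: is_functor_def category_full_subcat C.category_axioms)
      (auto simp: full_subcat_def hom_def)
qed

text \<open>If \<open>\<eta> a\<close> is invertible then so is \<open>L (\<eta> a)\<close>, and the
  triangle identity makes \<open>\<epsilon> (L a)\<close> its left inverse; so \<open>L\<close>
  takes right fixpoints to left fixpoints. The other triangle identity treats \<open>R\<close>. Full
  subcategories inherit the rest.\<close>

theorem adjunction_fixpoints_equivalence: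
  assumes adj: "is_adjunction C D L R \<eta> \<epsilon>"
    and q: "left_fixpoints D \<epsilon> = {b \<in> Ob D. q b}" and p: "right_fixpoints C \<eta> = {a \<in> Ob C. p a}"
  shows "is_equivalence (full_subcat C p) (full_subcat D q) L R \<eta> \<epsilon>"
proof -
  note adj' = adj[unfolded is_adjunction_def is_nat_trans_def]
  have L: "is_functor C D L" and R: "is_functor D C R" using adj' by auto
  interpret C: category C using L by (simp add: is_functor_def)
  interpret D: category D using L by (simp add: is_functor_def)
  have LO: "FO L a \<in> Ob D" if "a \<in> Ob C" for a using L that by (auto simp: is_functor_def)
  have RO: "FO R b \<in> Ob C" if "b \<in> Ob D" for b using R that by (auto simp: is_functor_def)
  have LA: "FA L f \<in> hom D (FO L (src f)) (FO L (tgt f))" if "f \<in> Ar C" for f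
    using L that by (auto simp: is_functor_def)
  have RA: "FA R f \<in> hom C (FO R (src f)) (FO R (tgt f))" if "f \<in> Ar D" for f
    using R that by (auto simp: is_functor_def)
  have \<eta>: "\<eta> a \<in> hom C a (FO R (FO L a))" if "a \<in> Ob C" for a
    using adj' that by (auto simp: id_fctr_def comp_fctr_def)
  have \<epsilon>: "\<epsilon> b \<in> hom D (FO L (FO R b)) b" if "b \<in> Ob D" for b
    using adj' that by (auto simp: id_fctr_def comp_fctr_def)
  have p_iff: "p a \<longleftrightarrow> is_iso C (\<eta> a)" if "a \<in> Ob C" for a
    using p that by (auto simp: right_fixpoints_def)
  have q_iff: "q b \<longleftrightarrow> is_iso D (\<epsilon> b)" if "b \<in> Ob D" for b
    using q that by (auto simp: left_fixpoints_def)
  have Lq: "q (FO L a)" if "a \<in> Ob C" "p a" for a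
  proof -
    have iso: "is_iso D (FA L (\<eta> a))" using that p_iff functor_is_iso[OF L] by auto
    have "is_iso D (\<epsilon> (FO L a))"
      using adj' that LA[of "\<eta> a"] \<eta>[of a] \<epsilon>[of "FO L a"] LO[of a]
      by (intro is_iso_left_inverse[OF D.category_axioms iso]) (auto simp: D.hom_iff C.hom_iff)
    then show ?thesis using q_iff LO that by auto
  qed
  have Rp: "p (FO R b)" if "b \<in> Ob D" "q b" for b
  proof -
    have iso: "is_iso C (FA R (\<epsilon> b))" using that q_iff functor_is_iso[OF R] by auto
    have "is_iso C (\<eta> (FO R b))"
      using adj' that RA[of "\<epsilon> b"] \<epsilon>[of b] \<eta>[of "FO R b"] RO[of b]
      by (intro is_iso_right_inverse[OF C.category_axioms iso]) (auto simp: D.hom_iff C.hom_iff)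
    then show ?thesis using p_iff RO that by auto
  qed
  let ?C = "full_subcat C p" and ?D = "full_subcat D q"
  have FL: "is_functor ?C ?D L" and FR: "is_functor ?D ?C R"
    using functor_full_subcat[OF L, of p q] functor_full_subcat[OF R, of q p] Lq Rp by auto
  have "is_functor C C (comp_fctr R L)" "is_functor C C id_fctr"
    "is_functor D D (comp_fctr L R)" "is_functor D D id_fctr" using adj' by auto
  then have "is_functor ?C ?C (comp_fctr R L)" "is_functor ?C ?C id_fctr"
    "is_functor ?D ?D (comp_fctr L R)" "is_functor ?D ?D id_fctr"
    by (auto intro!: functor_full_subcat simp: comp_fctr_def id_fctr_def Lq Rp LO RO)
  moreover have "is_iso ?C (\<eta> a)" if "a \<in> Ob ?C" for a
    using that \<eta>[of a] p_iff Lq Rp LO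
    by (intro is_iso_full_subcat) (auto simp: full_subcat_def C.hom_iff)
  moreover have "is_iso ?D (\<epsilon> b)" if "b \<in> Ob ?D" for b
    using that \<epsilon>[of b] q_iff Lq Rp RO
    by (intro is_iso_full_subcat) (auto simp: full_subcat_def D.hom_iff)
  moreover have "\<eta> a \<in> hom ?C a (FO R (FO L a))" if "a \<in> Ob ?C" for a
    using that \<eta>[of a] Lq Rp LO by (auto simp: full_subcat_def hom_def)
  moreover have "\<epsilon> b \<in> hom ?D (FO L (FO R b)) b" if "b \<in> Ob ?D" for b
    using that \<epsilon>[of b] Lq Rp RO by (auto simp: full_subcat_def hom_def)
  ultimately show ?thesis
    using FL FR adj' unfolding is_equivalence_def is_nat_iso_def is_nat_trans_def
    by (auto simp: comp_fctr_def id_fctr_def) (auto simp: full_subcat_def)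
qed

section \<open>Restriction categories\<close>

context restriction_category
begin

lemma rst_Ar [simp]: "f \<in> Ar C \<Longrightarrow> rst C f \<in> Ar C"
  and src_rst [simp]: "f \<in> Ar C \<Longrightarrow> src (rst C f) = src f"
  and tgt_rst [simp]: "f \<in> Ar C \<Longrightarrow> tgt (rst C f) = src f"
  using rst_hom[of f] by (simp_all add: hom_iff)

lemma Cmp_rst' [simp]: "f \<in> Ar C \<Longrightarrow> f \<odot> rst C f = f"
  by (rule Cmp_rst)

lemma Cmp_rst_comp [simp]: "\<lbrakk>f \<in> Ar C; x \<in> Ar C; tgt x = src f\<rbrakk> \<Longrightarrow> f \<odot> rst C f \<odot> x = f \<odot> x"
  by (rule Cmp_reassoc) auto

lemma rst_Idn [simp]: "a \<in> Ob C \<Longrightarrow> rst C (Idn C a) = Idn C a"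
  using Cmp_rst[of "Idn C a"] Idn_Cmp[of "rst C (Idn C a)"] by simp

lemma rst_rst [simp]: "f \<in> Ar C \<Longrightarrow> rst C (rst C f) = rst C f"
  using rst_Cmp_rst[of f "Idn C (src f)"] by simp

lemma rst_rst_idem [simp]: "f \<in> Ar C \<Longrightarrow> rst C f \<odot> rst C f = rst C f"
  using Cmp_rst[of "rst C f"] by simp

lemma rst_le_src:
  assumes "f \<in> Ar C" "g \<in> Ar C" "tgt f = src g"
  shows "rst C (g \<odot> f) \<odot> rst C f = rst C (g \<odot> f)" "rst C f \<odot> rst C (g \<odot> f) = rst C (g \<odot> f)"
proof -
  show *: "rst C (g \<odot> f) \<odot> rst C f = rst C (g \<odot> f)"
    using rst_Cmp_rst[of f "g \<odot> f"] assms by simp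
  then show "rst C f \<odot> rst C (g \<odot> f) = rst C (g \<odot> f)"
    using rst_commute[of "g \<odot> f" f] assms by simp
qed

text \<open>Sliding \<open>rst C g\<close> past \<open>f\<close> gives
  \<open>f \<odot> rst C (g \<odot> f)\<close>, whose restriction is that of
  \<open>g \<odot> f\<close> because the latter lies below \<open>rst C f\<close>.\<close>

lemma rst_rst_Cmp:
  assumes "f \<in> Ar C" "g \<in> Ar C" "tgt f = src g"
  shows "rst C (rst C g \<odot> f) = rst C (g \<odot> f)"
proof -
  have "rst C (rst C g \<odot> f) = rst C (f \<odot> rst C (g \<odot> f))" using assms rst_Cmp[of f g] by simp
  also have "\<dots> = rst C (g \<odot> f)" using assms rst_Cmp_rst[of "g \<odot> f" f] by (simp add: rst_le_src)
  finally show ?thesis .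
qed

lemma rst_total_Cmp:
  assumes "f \<in> Ar C" "total_map C g" "tgt f = src g"
  shows "rst C (g \<odot> f) = rst C f"
  using assms rst_rst_Cmp[of f g] by (simp add: total_map_def)

lemma total_Ar [simp]: "total_map C f \<Longrightarrow> f \<in> Ar C"
  by (simp add: total_map_def)

lemma total_Cmp [simp]:
  "\<lbrakk>total_map C f; total_map C g; tgt f = src g\<rbrakk> \<Longrightarrow> total_map C (g \<odot> f)"
  by (simp add: total_map_def[of C "g \<odot> f"] rst_total_Cmp) (simp add: total_map_def)

lemma total_Idn [simp]: "a \<in> Ob C \<Longrightarrow> total_map C (Idn C a)"
  by (simp add: total_map_def)

lemma total_if_total_Cmp:
  assumes "f \<in> Ar C" "g \<in> Ar C" "tgt f = src g" "total_map C (g \<odot> f)"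
  shows "total_map C f"
  using rst_le_src(1)[of f g] assms by (simp add: total_map_def)

lemma idems_iff: "e \<in> idems C a \<longleftrightarrow> e \<in> Ar C \<and> src e = a \<and> tgt e = a \<and> rst C e = e"
  by (auto simp: idems_def hom_iff)

lemma rst_idems [simp]: "\<lbrakk>f \<in> Ar C; src f = a\<rbrakk> \<Longrightarrow> rst C f \<in> idems C a"
  by (simp add: idems_iff)

lemma idems_Cmp [simp]: "\<lbrakk>d \<in> idems C a; e \<in> idems C a\<rbrakk> \<Longrightarrow> d \<odot> e \<in> idems C a"
  using rst_Cmp_rst[of e d] by (auto simp: idems_iff)

lemma idems_commute: "\<lbrakk>d \<in> idems C a; e \<in> idems C a\<rbrakk> \<Longrightarrow> d \<odot> e = e \<odot> d"
  using rst_commute[of e d] by (auto simp: idems_iff)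

lemma idem_idem: "e \<in> idems C a \<Longrightarrow> e \<odot> e = e"
  using Cmp_rst[of e] by (auto simp: idems_iff)

lemma Idn_idems [simp]: "a \<in> Ob C \<Longrightarrow> Idn C a \<in> idems C a"
  by (simp add: idems_iff)

lemma rst_Cmp_idem: "\<lbrakk>e \<in> idems C a; f \<in> Ar C; src f = a\<rbrakk> \<Longrightarrow> rst C (f \<odot> e) = rst C f \<odot> e"
  using rst_Cmp_rst[of e f] by (auto simp: idems_iff)

lemma idem_Cmp: "\<lbrakk>e \<in> idems C a; f \<in> Ar C; tgt f = a\<rbrakk> \<Longrightarrow> e \<odot> f = f \<odot> rst C (e \<odot> f)"
  using rst_Cmp[of f e] by (auto simp: idems_iff)

subsection \<open>The natural order\<close>

lemma le_refl [simp]: "f \<in> Ar C \<Longrightarrow> restr_le C f f"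
  by (simp add: restr_le_def)

lemma le_src: "restr_le C f g \<Longrightarrow> src f = src g"
  and le_tgt: "restr_le C f g \<Longrightarrow> tgt f = tgt g"
  by (simp_all add: restr_le_def)

lemma le_rst: "\<lbrakk>restr_le C f g; f \<in> Ar C; g \<in> Ar C\<rbrakk> \<Longrightarrow> rst C f = rst C g \<odot> rst C f"
  using rst_Cmp_rst[of f g] unfolding restr_le_def by metis

lemma le_Cmp_rst: "\<lbrakk>restr_le C f g; f \<in> Ar C; g \<in> Ar C\<rbrakk> \<Longrightarrow> g \<odot> rst C f = f"
  by (simp add: restr_le_def)

text \<open>Any restriction idempotent may witness the inequality, not only \<open>rst C f\<close>:
  the restriction of \<open>g \<odot> e\<close> is \<open>rst C g \<odot> e\<close>, and
  \<open>g\<close> absorbs \<open>rst C g\<close>.\<close>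

lemma leI:
  assumes "g \<in> Ar C" "e \<in> idems C (src g)" "f = g \<odot> e"
  shows "restr_le C f g"
proof -
  have "g \<odot> rst C f = g \<odot> rst C g \<odot> e" using assms by (simp add: rst_Cmp_idem)
  also have "\<dots> = f" using assms by (auto simp: idems_iff)
  finally show ?thesis using assms by (auto simp: restr_le_def idems_iff)
qed

lemma le_antisym:
  assumes "restr_le C f g" "restr_le C g f" "f \<in> Ar C" "g \<in> Ar C"
  shows "f = g"
proof -
  have "rst C f = rst C g"
    using le_rst[OF assms(1,3,4)] le_rst[OF assms(2,4,3)] rst_commute[of f g] le_src[OF assms(1)] assms
    by simp
  then show ?thesis using le_Cmp_rst[OF assms(1)] assms by simp
qed

lemma le_postcomp:
  assumes "restr_le C f g" "f \<in> Ar C" "g \<in> Ar C" "h \<in> Ar C" "tgt g = src h"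
  shows "restr_le C (h \<odot> f) (h \<odot> g)"
  using assms by (intro leI[of _ "rst C f"]) (auto simp: restr_le_def)

lemma le_precomp:
  assumes "restr_le C f g" "f \<in> Ar C" "g \<in> Ar C" "h \<in> Ar C" "tgt h = src g"
  shows "restr_le C (f \<odot> h) (g \<odot> h)"
proof (rule leI)
  have "g \<odot> h \<odot> rst C (rst C f \<odot> h) = g \<odot> rst C f \<odot> h"
    using assms rst_Cmp[of h "rst C f"] by (simp add: restr_le_def)
  also have "\<dots> = f \<odot> h"
    using assms Cmp_reassoc[OF le_Cmp_rst[OF assms(1-3)], of h] by (simp add: restr_le_def)
  finally show "f \<odot> h = (g \<odot> h) \<odot> rst C (rst C f \<odot> h)" using assms by (simp add: restr_le_def)
qed (use assms in \<open>auto simp: restr_le_def\<close>)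

lemma idems_le_iff:
  "\<lbrakk>d \<in> idems C a; e \<in> idems C a\<rbrakk> \<Longrightarrow> restr_le C d e \<longleftrightarrow> e \<odot> d = d"
  by (auto simp: restr_le_def idems_iff)

lemma le_imp_rst_le:
  assumes "restr_le C f g" "f \<in> Ar C" "g \<in> Ar C"
  shows "restr_le C (rst C f) (rst C g)"
  using le_rst[OF assms] assms by (auto simp: restr_le_def)

lemma le_compat:
  assumes "restr_le C f p" "restr_le C g p" "f \<in> Ar C" "g \<in> Ar C" "p \<in> Ar C"
  shows "compat C f g"
proof -
  have st: "src f = src p" "tgt f = tgt p" "src g = src p" "tgt g = tgt p"
    using assms by (auto simp: restr_le_def)
  have "f \<odot> rst C g = p \<odot> rst C f \<odot> rst C g"
    using assms st le_Cmp_rst[of f p] Cmp_reassoc[of p "rst C f" f "rst C g"] by simp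
  also have "\<dots> = p \<odot> rst C g \<odot> rst C f"
    using assms st rst_commute[of f g] by simp
  also have "\<dots> = g \<odot> rst C f"
    using assms st le_Cmp_rst[of g p] Cmp_reassoc[of p "rst C g" g "rst C f"] by simp
  finally show ?thesis using st by (simp add: compat_def)
qed

lemma compat_idems: "\<lbrakk>d \<in> idems C a; e \<in> idems C a\<rbrakk> \<Longrightarrow> compat C d e"
  using idems_commute[of d a e] by (auto simp: compat_def idems_iff)

lemma is_join_unique:
  "\<lbrakk>is_join C a b S p; is_join C a b S p'\<rbrakk> \<Longrightarrow> p = p'"
  by (rule le_antisym) (auto simp: is_join_def hom_iff)

lemma join_eq: "is_join C a b S p \<Longrightarrow> join C a b S = p"
  unfolding join_def using is_join_unique by blast

subsection \<open>Partial inverses\<close>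

lemma partial_inverse_iff:
  "partial_inverse C s t \<longleftrightarrow> s \<in> Ar C \<and> t \<in> Ar C \<and> src t = tgt s \<and> tgt t = src s \<and>
    t \<odot> s = rst C s \<and> s \<odot> t = rst C t"
  by (auto simp: partial_inverse_def hom_iff)

lemma partial_inverse_sym: "partial_inverse C s t \<Longrightarrow> partial_inverse C t s"
  by (simp add: partial_inverse_iff)

text \<open>The chain is \<open>t' = t' s t' = (t s) t' = t (s t')\<close>. Exchanging
  \<open>t\<close> and \<open>t'\<close> gives the reverse inequality, and so uniqueness of partial
  inverses.\<close>

lemma partial_inverse_le:
  assumes "partial_inverse C s t" "partial_inverse C s t'"
  shows "restr_le C t' t"
proof (rule leI)
  have "t' = t' \<odot> s \<odot> t'" using assms by (simp add: partial_inverse_iff)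
  also have "\<dots> = rst C s \<odot> t'"
    using assms by (intro Cmp_reassoc) (auto simp: partial_inverse_iff)
  also have "\<dots> = t \<odot> s \<odot> t'"
    using assms by (intro Cmp_reassoc[symmetric]) (auto simp: partial_inverse_iff)
  also have "\<dots> = t \<odot> rst C t'" using assms by (auto simp: partial_inverse_iff)
  finally show "t' = t \<odot> rst C t'" .
qed (use assms in \<open>auto simp: partial_inverse_iff\<close>)

lemma partial_inverse_unique:
  assumes "partial_inverse C s t" "partial_inverse C s t'"
  shows "t = t'"
  by (rule le_antisym) (use assms partial_inverse_le in \<open>auto simp: partial_inverse_iff\<close>)

lemma partial_inverse_Cmp:
  assumes "partial_inverse C s t" "partial_inverse C u v" "tgt s = src u"
  shows "partial_inverse C (u \<odot> s) (t \<odot> v)"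
proof -
  \<comment> \<open>Generalised over all four maps: the second equation of a partial inverse is the
    same claim with \<open>s\<close>, \<open>u\<close> replaced by \<open>v\<close>,
    \<open>t\<close>.\<close>
  have *: "t \<odot> v \<odot> u \<odot> s = rst C (u \<odot> s)"
    if "partial_inverse C s t" "partial_inverse C u v" "tgt s = src u" for s t u v
  proof -
    have "t \<odot> v \<odot> u \<odot> s = t \<odot> rst C u \<odot> s"
      using that Cmp_reassoc[of v u "rst C u" s] by (auto simp: partial_inverse_iff)
    also have "\<dots> = t \<odot> s \<odot> rst C (u \<odot> s)"
      using that rst_Cmp[of s u] by (auto simp: partial_inverse_iff)
    also have "\<dots> = rst C s \<odot> rst C (u \<odot> s)"
      using that by (intro Cmp_reassoc) (auto simp: partial_inverse_iff)
    also have "\<dots> = rst C (u \<odot> s)"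
      using that by (auto simp: partial_inverse_iff rst_le_src)
    finally show ?thesis .
  qed
  have "(t \<odot> v) \<odot> (u \<odot> s) = rst C (u \<odot> s)" "(u \<odot> s) \<odot> (t \<odot> v) = rst C (t \<odot> v)"
    using *[OF assms] *[OF partial_inverse_sym[OF assms(2)] partial_inverse_sym[OF assms(1)]] assms
    by (auto simp: partial_inverse_iff)
  then show ?thesis using assms by (simp add: partial_inverse_iff)
qed

lemma partial_inverse_idem: "e \<in> idems C a \<Longrightarrow> partial_inverse C e e"
  using idem_idem[of e a] by (auto simp: partial_inverse_iff idems_iff)

lemma partial_iso_Cmp:
  "\<lbrakk>partial_iso C s; partial_iso C u; tgt s = src u\<rbrakk> \<Longrightarrow> partial_iso C (u \<odot> s)"
  using partial_inverse_Cmp unfolding partial_iso_def by blast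

lemma partial_iso_idem: "e \<in> idems C a \<Longrightarrow> partial_iso C e"
  using partial_inverse_idem unfolding partial_iso_def by blast

end

section \<open>Joins\<close>

context join_restriction_category
begin

lemma is_join_Ar:
  "is_join C a b S p \<Longrightarrow> p \<in> Ar C \<and> src p = a \<and> tgt p = b"
  by (simp add: is_join_def hom_iff)

lemma is_join_le: "\<lbrakk>is_join C a b S p; s \<in> S\<rbrakk> \<Longrightarrow> restr_le C s p"
  by (simp add: is_join_def)

lemma is_join_least:
  "\<lbrakk>is_join C a b S p; q \<in> hom C a b; \<And>s. s \<in> S \<Longrightarrow> restr_le C s q\<rbrakk> \<Longrightarrow> restr_le C p q"
  by (simp add: is_join_def)

lemma is_join_compat:
  assumes "is_join C a b S p" "S \<subseteq> hom C a b" "f \<in> S" "g \<in> S"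
  shows "compat C f g"
  using assms by (intro le_compat[of f p g]) (auto simp: hom_iff is_join_def)

lemma is_join_precomp:
  assumes "is_join C a b S p" "S \<subseteq> hom C a b" "h \<in> Ar C" "tgt h = a"
  shows "is_join C (src h) b ((\<lambda>s. s \<odot> h) ` S) (p \<odot> h)"
proof (rule join_precomp)
  show "a \<in> Ob C" "b \<in> Ob C" using is_join_Ar[OF assms(1)] by auto
qed (use assms is_join_compat in auto)

lemma idems_join:
  assumes "E \<subseteq> idems C a" "a \<in> Ob C"
  shows "\<exists>e. is_join C a a E e"
proof (rule join_exists)
  show "E \<subseteq> hom C a a" using assms(1) by (auto simp: idems_def)
  show "compat C f g" if "f \<in> E" "g \<in> E" for f g using that assms(1) compat_idems by blast
qed fact+

text \<open>Let \<open>e\<close> be the join of the restrictions. Every member of \<open>S\<close>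
  is also below \<open>p \<odot> e\<close>, so leastness puts \<open>p\<close> below
  \<open>p \<odot> e\<close>, whence \<open>rst C p\<close> is below \<open>e\<close>; the reverse
  inequality is clear.\<close>

lemma is_join_rst:
  assumes p: "is_join C a b S p" and S: "S \<subseteq> hom C a b"
  shows "is_join C a a (rst C ` S) (rst C p)"
proof -
  have pA: "p \<in> Ar C" "src p = a" "tgt p = b" using is_join_Ar[OF p] by auto
  have sA: "s \<in> Ar C" "src s = a" "tgt s = b" if "s \<in> S" for s using S that by (auto simp: hom_iff)
  have E: "rst C ` S \<subseteq> idems C a" using sA by auto
  obtain e where e: "is_join C a a (rst C ` S) e"
    using idems_join E src_Ob[OF pA(1)] pA(2) by metis
  have eA: "e \<in> Ar C" "src e = a" "tgt e = a" using is_join_Ar[OF e] by auto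
  have "restr_le C e (rst C p)"
    by (rule is_join_least[OF e]) (use sA pA is_join_le[OF p] le_imp_rst_le in \<open>auto simp: hom_iff\<close>)
  then have le: "rst C p \<odot> rst C e = e" using le_Cmp_rst pA eA by simp
  then have eI: "e \<in> idems C a"
    using idems_Cmp[of "rst C p" a "rst C e"] pA eA by simp
  have "restr_le C p (p \<odot> e)"
  proof (rule is_join_least[OF p])
    fix s assume s: "s \<in> S"
    have "e \<odot> rst C s = rst C s"
      using is_join_le[OF e, of "rst C s"] s sA[OF s] eA by (auto simp: restr_le_def)
    then have "s = (p \<odot> e) \<odot> rst C s"
      using is_join_le[OF p s] pA eA sA[OF s] by (auto simp: restr_le_def)
    then show "restr_le C s (p \<odot> e)" using pA eA sA[OF s] by (auto simp: restr_le_def)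
  qed (use pA eA in \<open>auto simp: hom_iff\<close>)
  then have "rst C p = rst C (p \<odot> e) \<odot> rst C p" using le_rst pA eA by auto
  also have "\<dots> = rst C p \<odot> e \<odot> rst C p" using pA eA eI by (simp add: rst_Cmp_idem)
  also have "\<dots> = rst C p \<odot> rst C p \<odot> e" using idems_commute[of "rst C p" a e] eI pA by simp
  also have "\<dots> = e" using le eI pA Cmp_reassoc[of "rst C p" "rst C p" "rst C p" e]
    by (auto simp: idems_iff)
  finally show ?thesis using e by simp
qed

text \<open>Under a common upper bound the family is compatible and has a join below
  \<open>p\<close>. The assumption on restrictions says that this join has the same domain as
  \<open>p\<close>, so the two coincide. Inequalities and domains are easier to check than
  leastness.\<close>

lemma is_joinI:
  assumes p: "p \<in> hom C a b" and S: "S \<subseteq> hom C a b"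
    and le: "\<And>s. s \<in> S \<Longrightarrow> restr_le C s p" and e: "is_join C a a (rst C ` S) (rst C p)"
  shows "is_join C a b S p"
proof -
  have "\<exists>p'. is_join C a b S p'"
    using le_compat[OF le le] S p by (intro join_exists) (auto simp: hom_iff subset_iff)
  then obtain p' where p': "is_join C a b S p'" by blast
  have "restr_le C p' p" using is_join_least[OF p' p le] .
  moreover have "rst C p = rst C p'" using is_join_unique[OF e is_join_rst[OF p' S]] .
  ultimately have "p' = p" using p is_join_Ar[OF p'] le_Cmp_rst[of p' p] by (metis Cmp_rst hom_iff)
  then show ?thesis using p' by simp
qed

lemma is_join_restrict:
  assumes "is_join C a b S p" "S \<subseteq> hom C a b" "e \<in> Ar C" "tgt e = a"
  shows "is_join C (src e) (src e) ((\<lambda>s. rst C (s \<odot> e)) ` S) (rst C (p \<odot> e))"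
proof -
  have "(\<lambda>s. s \<odot> e) ` S \<subseteq> hom C (src e) b" using assms by (auto simp: hom_iff subset_iff)
  from is_join_rst[OF is_join_precomp[OF assms] this] show ?thesis by (simp add: image_image)
qed

text \<open>Only precomposition is part of the axioms. \<open>h \<odot> p\<close> is an upper bound,
  and precomposing \<open>p\<close> with \<open>rst C (h \<odot> p)\<close> shows that its domain is
  the join of the domains of the \<open>h \<odot> s\<close>.\<close>

lemma is_join_postcomp:
  assumes p: "is_join C a b S p" and S: "S \<subseteq> hom C a b" and h: "h \<in> Ar C" "src h = b"
  shows "is_join C a (tgt h) ((\<odot>) h ` S) (h \<odot> p)"
proof (rule is_joinI)
  have pA: "p \<in> Ar C" "src p = a" "tgt p = b" using is_join_Ar[OF p] by auto
  have sA: "s \<in> Ar C" "src s = a" "tgt s = b" if "s \<in> S" for s using S that by (auto simp: hom_iff)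
  show "h \<odot> p \<in> hom C a (tgt h)" "(\<odot>) h ` S \<subseteq> hom C a (tgt h)"
    using pA sA h by (auto simp: hom_iff)
  show "restr_le C s (h \<odot> p)" if "s \<in> (\<odot>) h ` S" for s
    using that is_join_le[OF p] pA sA h by (auto intro!: le_postcomp)
  have "is_join C a a ((\<lambda>s. rst C (s \<odot> rst C (h \<odot> p))) ` S) (rst C (p \<odot> rst C (h \<odot> p)))"
    using is_join_restrict[OF p S, of "rst C (h \<odot> p)"] pA h by simp
  moreover have "rst C (p \<odot> rst C (h \<odot> p)) = rst C (h \<odot> p)"
    using pA h by (simp add: rst_Cmp_rst rst_le_src)
  moreover have "rst C (s \<odot> rst C (h \<odot> p)) = rst C (h \<odot> s)" if "s \<in> S" for s
  proof -
    have "rst C (s \<odot> rst C (h \<odot> p)) = rst C (h \<odot> p) \<odot> rst C s"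
      using pA sA[OF that] h rst_commute[of s "h \<odot> p"] by (simp add: rst_Cmp_rst)
    also have "\<dots> = rst C ((h \<odot> p) \<odot> rst C s)" using pA sA[OF that] h by (subst rst_Cmp_rst) auto
    also have "\<dots> = rst C (h \<odot> s)"
      using pA sA[OF that] h is_join_le[OF p that] by (simp add: restr_le_def)
    finally show ?thesis .
  qed
  ultimately show "is_join C a a (rst C ` (\<odot>) h ` S) (rst C (h \<odot> p))"
    by (simp add: image_image cong: image_cong)
qed

text \<open>Postcomposition preserves joins, so both sides are joins of one and the same family.
  This is how equations are tested on a cover.\<close>

lemma is_join_Cmp_eq:
  assumes "is_join C a a E e" "E \<subseteq> idems C a" "u \<in> hom C a b" "v \<in> hom C a b"
    and "\<And>d. d \<in> E \<Longrightarrow> u \<odot> d = v \<odot> d"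
  shows "u \<odot> e = v \<odot> e"
proof -
  have E: "E \<subseteq> hom C a a" using assms(2) by (auto simp: idems_def)
  have "(\<odot>) u ` E = (\<odot>) v ` E" using assms(5) by auto
  then show ?thesis
    using is_join_postcomp[OF assms(1) E, of u] is_join_postcomp[OF assms(1) E, of v] assms(3,4)
      is_join_unique by (auto simp: hom_iff)
qed

lemma is_join_rst_eq:
  assumes "is_join C a b (q ` I) p" "q ` I \<subseteq> hom C a b" "u \<in> hom C a c" "v \<in> hom C a c"
    and "\<And>i. i \<in> I \<Longrightarrow> u \<odot> rst C (q i) = v \<odot> rst C (q i)"
  shows "u \<odot> rst C p = v \<odot> rst C p"
  by (rule is_join_Cmp_eq[OF is_join_rst[OF assms(1,2)]]) (use assms(2-) in \<open>auto simp: hom_iff\<close>)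

lemma is_join_idem_le:
  assumes "is_join C a a E e" "E \<subseteq> idems C a" "d \<in> idems C a" "\<And>x. x \<in> E \<Longrightarrow> restr_le C x d"
  shows "restr_le C e d"
  by (rule is_join_least[OF assms(1)]) (use assms in \<open>auto simp: idems_def\<close>)

lemma is_join_idems:
  assumes "is_join C a a E e" "E \<subseteq> idems C a"
  shows "e \<in> idems C a"
proof -
  have "restr_le C e (Idn C a)"
  proof (rule is_join_idem_le[OF assms])
    show "restr_le C x (Idn C a)" if "x \<in> E" for x
      using that assms(2) is_join_Ar[OF assms(1)] by (auto simp: restr_le_def idems_iff subset_iff)
  qed (use is_join_Ar[OF assms(1)] in auto)
  from le_Cmp_rst[OF this] show ?thesis using is_join_Ar[OF assms(1)] by (auto simp: idems_iff)
qed

lemma idems_join_exists: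
  assumes "E \<subseteq> idems C a" "a \<in> Ob C"
  shows "is_join C a a E (join C a a E)" "join C a a E \<in> idems C a"
proof -
  obtain e where "is_join C a a E e"
    using idems_join[OF assms] by blast
  then show "is_join C a a E (join C a a E)" using join_eq by metis
  then show "join C a a E \<in> idems C a" using assms is_join_idems by blast
qed

text \<open>The inverses need a join of their own, which is where compatibility of the inverses,
  hence bicompatibility, enters. On the piece \<open>s i\<close> the map \<open>v\<close> acts as
  \<open>t i\<close>, because \<open>s i\<close> lands in the domain of \<open>t i\<close>.\<close>

lemma partial_iso_join:
  assumes u: "is_join C a b (s ` I) u" and v: "is_join C b a (t ` I) v"
    and inv: "\<And>i. i \<in> I \<Longrightarrow> partial_inverse C (s i) (t i)"
    and s: "s ` I \<subseteq> hom C a b" and t: "t ` I \<subseteq> hom C b a"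
  shows "partial_inverse C u v"
proof -
  have *: "v \<odot> u = rst C u"
    if u: "is_join C a b (s ` I) u" and v: "is_join C b a (t ` I) v"
    and inv: "\<And>i. i \<in> I \<Longrightarrow> partial_inverse C (s i) (t i)"
    and s: "s ` I \<subseteq> hom C a b" and t: "t ` I \<subseteq> hom C b a" for u v a b s t
  proof -
    have uA: "u \<in> Ar C" "src u = a" "tgt u = b" and vA: "v \<in> Ar C" "src v = b" "tgt v = a"
      using is_join_Ar[OF u] is_join_Ar[OF v] by auto
    have "(v \<odot> u) \<odot> rst C u = rst C u \<odot> rst C u"
    proof (rule is_join_rst_eq[OF u s])
      fix i assume i: "i \<in> I"
      have A: "s i \<in> Ar C" "src (s i) = a" "tgt (s i) = b" "t i \<in> Ar C" "src (t i) = b" "tgt (t i) = a"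
        and ts: "t i \<odot> s i = rst C (s i)" "s i \<odot> t i = rst C (t i)"
        using inv[OF i] s t i by (auto simp: partial_inverse_iff hom_iff)
      have us: "u \<odot> rst C (s i) = s i" and vt: "v \<odot> rst C (t i) = t i"
        using le_Cmp_rst[OF is_join_le[OF u]] le_Cmp_rst[OF is_join_le[OF v]] i A uA vA by auto
      have "v \<odot> s i = v \<odot> s i \<odot> t i \<odot> s i" using ts A by simp
      also have "\<dots> = v \<odot> rst C (t i) \<odot> s i" using A ts Cmp_reassoc[OF ts(2), of "s i"] by simp
      also have "\<dots> = t i \<odot> s i" using Cmp_reassoc[OF vt, of "s i"] A vA by simp
      finally have "(v \<odot> u) \<odot> rst C (s i) = rst C (s i)" using us ts A uA vA by simp
      also have "\<dots> = rst C u \<odot> rst C (s i)"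
        using le_rst[OF is_join_le[OF u]] i A uA by auto
      finally show "(v \<odot> u) \<odot> rst C (s i) = rst C u \<odot> rst C (s i)" .
    qed (use uA vA in \<open>auto simp: hom_iff\<close>)
    then show ?thesis using uA vA by simp
  qed
  have "u \<odot> v = rst C v"
    using *[OF v u _ t s] inv partial_inverse_sym by blast
  then show ?thesis
    using *[OF u v inv s t] is_join_Ar[OF u] is_join_Ar[OF v] by (auto simp: partial_inverse_iff)
qed

end

section \<open>Pullbacks\<close>

definition has_pb :: "('o, 'u, 'z) cat_scheme \<Rightarrow> ('o, 'u) arr \<Rightarrow> ('o, 'u) arr \<Rightarrow> bool" where
  "has_pb C f g \<longleftrightarrow> (\<exists>p q. is_pullback C f g p q)"

context category
begin

lemma is_pullback_pb: "has_pb C f g \<Longrightarrow> is_pullback C f g (pb1 C f g) (pb2 C f g)"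
  unfolding has_pb_def pb1_def pb2_def pb_def
  by (elim exE, rule someI2[of "\<lambda>(p, q). is_pullback C f g p q" "(_, _)"]) auto

lemma pb_simps:
  assumes "has_pb C f g"
  shows "f \<in> Ar C" "g \<in> Ar C" "tgt f = tgt g"
    "pb1 C f g \<in> Ar C" "pb2 C f g \<in> Ar C"
    "src (pb1 C f g) = pbo C f g" "src (pb2 C f g) = pbo C f g"
    "tgt (pb1 C f g) = src f" "tgt (pb2 C f g) = src g"
    "f \<odot> pb1 C f g = g \<odot> pb2 C f g" "pbo C f g \<in> Ob C"
  using is_pullback_pb[OF assms] by (auto simp: is_pullback_def pbo_def)

lemma pair_ex1:
  assumes "has_pb C f g" "u \<in> Ar C" "v \<in> Ar C" "src v = src u" "tgt u = src f" "tgt v = src g"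
    "f \<odot> u = g \<odot> v"
  shows "\<exists>!w. w \<in> hom C (src u) (pbo C f g) \<and> pb1 C f g \<odot> w = u \<and> pb2 C f g \<odot> w = v"
proof -
  have "src u \<in> Ob C" "u \<in> hom C (src u) (src f)" "v \<in> hom C (src u) (src g)"
    using assms by (auto simp: hom_iff)
  then show ?thesis
    using is_pullback_pb[OF assms(1)] assms(7) unfolding is_pullback_def pbo_def by blast
qed

lemma pair_simps:
  assumes "has_pb C f g" "u \<in> Ar C" "v \<in> Ar C" "src v = src u" "tgt u = src f" "tgt v = src g"
    "f \<odot> u = g \<odot> v"
  shows "pair C f g u v \<in> Ar C" "src (pair C f g u v) = src u" "tgt (pair C f g u v) = pbo C f g"
    "pb1 C f g \<odot> pair C f g u v = u" "pb2 C f g \<odot> pair C f g u v = v"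
  using theI'[OF pair_ex1[OF assms]] by (auto simp: pair_def hom_iff)

lemma pb_eqI:
  assumes "has_pb C f g" "w \<in> Ar C" "w' \<in> Ar C" "src w' = src w" "tgt w = pbo C f g" "tgt w' = pbo C f g"
    "pb1 C f g \<odot> w = pb1 C f g \<odot> w'" "pb2 C f g \<odot> w = pb2 C f g \<odot> w'"
  shows "w = w'"
proof -
  note pb_simps[OF assms(1), simp]
  have "f \<odot> pb1 C f g \<odot> w = g \<odot> pb2 C f g \<odot> w"
    using assms Cmp_reassoc[OF pb_simps(10)[OF assms(1)], of w] by simp
  then show ?thesis
    using pair_ex1[OF assms(1), of "pb1 C f g \<odot> w" "pb2 C f g \<odot> w"] assms by (auto simp: hom_iff)
qed

lemma pair_eqI:
  assumes "has_pb C f g" "w \<in> Ar C" "tgt w = pbo C f g"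
    "pb1 C f g \<odot> w = u" "pb2 C f g \<odot> w = v"
  shows "pair C f g u v = w"
proof (rule pb_eqI[OF assms(1)])
  note pb_simps[OF assms(1), simp]
  have uv: "u \<in> Ar C" "v \<in> Ar C" "src v = src u" "tgt u = src f" "tgt v = src g" "src u = src w"
    using assms by auto
  moreover have "f \<odot> u = g \<odot> v"
    using assms Cmp_reassoc[OF pb_simps(10)[OF assms(1)], of w] by auto
  ultimately show "pair C f g u v \<in> Ar C" "src w = src (pair C f g u v)" "tgt (pair C f g u v) = pbo C f g"
    "pb1 C f g \<odot> pair C f g u v = pb1 C f g \<odot> w" "pb2 C f g \<odot> pair C f g u v = pb2 C f g \<odot> w"
    using pair_simps[OF assms(1), of u v] assms(4,5) by auto
qed fact+

lemma pair_pb: "has_pb C f g \<Longrightarrow> pair C f g (pb1 C f g) (pb2 C f g) = Idn C (pbo C f g)"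
  by (rule pair_eqI) (auto simp: pb_simps)

lemma pair_Cmp:
  assumes "has_pb C f g" "u \<in> Ar C" "v \<in> Ar C" "src v = src u" "tgt u = src f" "tgt v = src g"
    "f \<odot> u = g \<odot> v" "h \<in> Ar C" "tgt h = src u"
  shows "pair C f g u v \<odot> h = pair C f g (u \<odot> h) (v \<odot> h)"
proof (rule pair_eqI[symmetric, OF assms(1)])
  note pair_simps[OF assms(1-7), simp] pb_simps[OF assms(1), simp]
  show "pb1 C f g \<odot> pair C f g u v \<odot> h = u \<odot> h" "pb2 C f g \<odot> pair C f g u v \<odot> h = v \<odot> h"
    using assms by (auto intro!: Cmp_reassoc)
qed (use assms in \<open>auto simp: pair_simps\<close>)

lemma pair_pb_Cmp:
  assumes "has_pb C f g" "h \<in> Ar C" "tgt h = pbo C f g"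
  shows "pair C f g (pb1 C f g \<odot> h) (pb2 C f g \<odot> h) = h"
  by (rule pair_eqI) (use assms in auto)

end

context restriction_category
begin

lemma total_rst_eq:
  assumes "total_map C f" "total_map C g" "u \<in> Ar C" "v \<in> Ar C" "tgt u = src f" "tgt v = src g"
    "f \<odot> u = g \<odot> v"
  shows "rst C u = rst C v"
  using assms rst_total_Cmp[of u f] rst_total_Cmp[of v g] by simp

text \<open>The projections of a pullback of total maps are total, since \<open>p (rst p) = p\<close> and
  \<open>q (rst p) = q\<close>, so that \<open>rst p = 1\<close>.\<close>

lemma pb_total:
  assumes "has_pb C f g" "total_map C f" "total_map C g"
  shows "total_map C (pb1 C f g)" "total_map C (pb2 C f g)"
proof -
  note pb_simps[OF assms(1), simp]
  have eq: "rst C (pb1 C f g) = rst C (pb2 C f g)"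
    by (rule total_rst_eq[OF assms(2,3)]) auto
  have "rst C (pb1 C f g) = Idn C (pbo C f g)"
    by (rule pb_eqI[OF assms(1)]) (simp_all add: eq, simp add: eq[symmetric])
  then show "total_map C (pb1 C f g)" "total_map C (pb2 C f g)"
    using eq by (auto simp: total_map_def)
qed

end

section \<open>Glueings\<close>

text \<open>A glueing whose atlas is left implicit: the entry at \<open>i\<close>, \<open>j\<close>
  is \<open>q j \<odot> s i\<close>. Its symmetry and cocycle conditions are consequences of the
  maps \<open>s i\<close> being sections of \<open>p\<close>.\<close>

locale glued = join_restriction_category C
  for C :: "('o, 'u, 'z) rcat_scheme" (structure) +
  fixes I :: "'i set" and p :: "('o, 'u) arr" and q s :: "'i \<Rightarrow> ('o, 'u) arr"
  assumes p_total: "total_map C p"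
    and q_hom: "i \<in> I \<Longrightarrow> q i \<in> hom C (src p) (tgt p)"
    and q_s_inverse: "i \<in> I \<Longrightarrow> partial_inverse C (q i) (s i)"
    and p_join: "is_join C (src p) (tgt p) (q ` I) p"
begin

lemma p_Ar [simp]: "p \<in> Ar C" using p_total by simp

lemma q_simps [simp]:
  assumes "i \<in> I"
  shows "q i \<in> Ar C" "src (q i) = src p" "tgt (q i) = tgt p"
  using q_hom[OF assms] by (auto simp: hom_iff)

lemma s_simps [simp]:
  assumes "i \<in> I"
  shows "s i \<in> Ar C" "src (s i) = tgt p" "tgt (s i) = src p"
    "s i \<odot> q i = rst C (q i)" "q i \<odot> s i = rst C (s i)"
  using q_s_inverse[OF assms] assms by (auto simp: partial_inverse_iff)

lemma p_rst_q [simp]: "i \<in> I \<Longrightarrow> p \<odot> rst C (q i) = q i"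
  by (rule le_Cmp_rst) (auto intro: is_join_le[OF p_join])

lemma q_subset: "q ` I \<subseteq> hom C (src p) (tgt p)"
  using q_hom by auto

lemma s_q_comp [simp]:
  "\<lbrakk>i \<in> I; x \<in> Ar C; tgt x = src p\<rbrakk> \<Longrightarrow> s i \<odot> q i \<odot> x = rst C (q i) \<odot> x"
  "\<lbrakk>i \<in> I; x \<in> Ar C; tgt x = tgt p\<rbrakk> \<Longrightarrow> q i \<odot> s i \<odot> x = rst C (s i) \<odot> x"
  "\<lbrakk>i \<in> I; x \<in> Ar C; tgt x = src p\<rbrakk> \<Longrightarrow> p \<odot> rst C (q i) \<odot> x = q i \<odot> x"
  by (auto intro!: Cmp_reassoc)

lemma rst_q_s [simp]: "i \<in> I \<Longrightarrow> rst C (q i) \<odot> s i = s i"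
  using s_q_comp(1)[of i "s i"] by simp

lemma p_s [simp]: "i \<in> I \<Longrightarrow> p \<odot> s i = rst C (s i)"
  using s_q_comp(3)[of i "s i"] by simp

lemma p_s_comp [simp]:
  "\<lbrakk>i \<in> I; x \<in> Ar C; tgt x = tgt p\<rbrakk> \<Longrightarrow> p \<odot> s i \<odot> x = rst C (s i) \<odot> x"
  "\<lbrakk>i \<in> I; x \<in> Ar C; tgt x = tgt p\<rbrakk> \<Longrightarrow> rst C (q i) \<odot> s i \<odot> x = s i \<odot> x"
  by (auto intro!: Cmp_reassoc)

lemma partial_section_s: "i \<in> I \<Longrightarrow> partial_section C p (s i)"
  by (simp add: partial_section_def hom_iff)

lemma rst_q_comp: "\<lbrakk>i \<in> I; x \<in> Ar C; tgt x = src p\<rbrakk> \<Longrightarrow> rst C (q i) \<odot> x = x \<odot> rst C (q i \<odot> x)"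
  by (rule rst_Cmp) auto

text \<open>Since \<open>q i = p rst (q i)\<close>, sliding the restriction past \<open>t\<close>
  leaves \<open>p t\<close>, an idempotent. So \<open>q i \<odot> t\<close> is the part of the base
  on which \<open>t\<close> runs inside piece \<open>i\<close>, and there \<open>t\<close> must be
  \<open>s i\<close>.\<close>

lemma q_section:
  assumes "partial_section C p t" "i \<in> I"
  shows "q i \<odot> t = rst C t \<odot> rst C (q i \<odot> t)" "q i \<odot> t \<in> idems C (tgt p)"
    "t \<odot> q i \<odot> t = s i \<odot> q i \<odot> t"
proof -
  have t: "t \<in> Ar C" "src t = tgt p" "tgt t = src p" "p \<odot> t = rst C t"
    using assms(1) by (auto simp: partial_section_def hom_iff)
  have "q i \<odot> t = p \<odot> rst C (q i) \<odot> t" using assms(2) t by simp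
  also have "\<dots> = p \<odot> t \<odot> rst C (q i \<odot> t)" using assms(2) t rst_q_comp by simp
  also have "\<dots> = rst C t \<odot> rst C (q i \<odot> t)" using assms(2) t by (intro Cmp_reassoc) auto
  finally show eq: "q i \<odot> t = rst C t \<odot> rst C (q i \<odot> t)" .
  then show "q i \<odot> t \<in> idems C (tgt p)"
    using assms(2) t idems_Cmp[of "rst C t" "tgt p" "rst C (q i \<odot> t)"] by simp
  have "rst C t \<odot> rst C (q i \<odot> t) = rst C (q i \<odot> t)"
    using rst_le_src(2)[of t "q i"] assms(2) t by simp
  then show "t \<odot> q i \<odot> t = s i \<odot> q i \<odot> t" using eq assms(2) t rst_q_comp by simp
qed

lemma phi_idem [simp]: "\<lbrakk>i \<in> I; j \<in> I\<rbrakk> \<Longrightarrow> q j \<odot> s i \<in> idems C (tgt p)"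
  using q_section(2)[OF partial_section_s] by auto

lemma phi_rst: "\<lbrakk>i \<in> I; j \<in> I\<rbrakk> \<Longrightarrow> rst C (q j \<odot> s i) = q j \<odot> s i"
  using phi_idem by (auto simp: idems_iff)

lemma s_phi: "\<lbrakk>i \<in> I; j \<in> I\<rbrakk> \<Longrightarrow> s i \<odot> q j \<odot> s i = s j \<odot> q j \<odot> s i"
  using q_section(3)[OF partial_section_s] by auto

lemma phi_le: "\<lbrakk>i \<in> I; j \<in> I\<rbrakk> \<Longrightarrow> rst C (s i) \<odot> q j \<odot> s i = q j \<odot> s i"
  using rst_le_src(2)[of "s i" "q j"] by (simp add: phi_rst)

text \<open>On \<open>q j \<odot> s i\<close> the sections \<open>s i\<close> and \<open>s j\<close>
  agree, so applying \<open>q i\<close> bounds this idempotent by \<open>q i \<odot> s j\<close>;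
  exchanging the indices gives equality.\<close>

lemma phi_sym:
  assumes "i \<in> I" "j \<in> I"
  shows "q j \<odot> s i = q i \<odot> s j"
proof (rule le_antisym)
  have *: "restr_le C (q j \<odot> s i) (q i \<odot> s j)" if "i \<in> I" "j \<in> I" for i j
  proof -
    have "q j \<odot> s i = q i \<odot> s i \<odot> q j \<odot> s i" using that phi_le by simp
    also have "\<dots> = q i \<odot> s j \<odot> q j \<odot> s i" using that s_phi by simp
    also have "\<dots> = (q i \<odot> s j) \<odot> q j \<odot> s i" using that by (intro Cmp_assoc[symmetric]) auto
    finally have "q j \<odot> s i = (q i \<odot> s j) \<odot> q j \<odot> s i" .
    then show ?thesis using idems_le_iff[OF phi_idem[OF that] phi_idem[OF that(2,1)]] by metis
  qed
  show "restr_le C (q j \<odot> s i) (q i \<odot> s j)" "restr_le C (q i \<odot> s j) (q j \<odot> s i)"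
    using * assms by auto
qed (use assms in auto)

text \<open>The idempotents \<open>rst C (q i \<odot> x)\<close> cover the domain of
  \<open>x\<close>: precomposing the join \<open>p\<close> with \<open>x\<close> keeps it a join,
  and \<open>p\<close> is total.\<close>

lemma local_eq:
  assumes "x \<in> Ar C" "tgt x = src p" "u \<in> hom C (src x) b" "v \<in> hom C (src x) b"
    and "\<And>i. i \<in> I \<Longrightarrow> u \<odot> rst C (q i \<odot> x) = v \<odot> rst C (q i \<odot> x)"
  shows "u \<odot> rst C x = v \<odot> rst C x"
proof -
  have "(\<lambda>i. q i \<odot> x) ` I = (\<lambda>t. t \<odot> x) ` (q ` I)" by auto
  then have "is_join C (src x) (tgt p) ((\<lambda>i. q i \<odot> x) ` I) (p \<odot> x)"
    using is_join_precomp[OF p_join q_subset assms(1,2)] by simp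
  then have "u \<odot> rst C (p \<odot> x) = v \<odot> rst C (p \<odot> x)"
    by (rule is_join_rst_eq) (use assms in \<open>auto simp: hom_iff\<close>)
  then show ?thesis using rst_total_Cmp[OF assms(1) p_total] assms by simp
qed

text \<open>Because \<open>s i \<odot> q i\<close> is an idempotent on the total space, an element
  lying in piece \<open>i\<close> is determined by its image in the base.\<close>

lemma local_rep:
  assumes "i \<in> I" "x \<in> Ar C" "tgt x = src p"
  shows "x \<odot> rst C (q i \<odot> x) = s i \<odot> p \<odot> x \<odot> rst C (q i \<odot> x)"
proof -
  have "x \<odot> rst C (q i \<odot> x) = s i \<odot> q i \<odot> x" using assms rst_q_comp by simp
  also have "\<dots> = s i \<odot> p \<odot> rst C (q i) \<odot> x" using assms by simp
  also have "\<dots> = s i \<odot> p \<odot> x \<odot> rst C (q i \<odot> x)" using assms rst_q_comp by simp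
  finally show ?thesis .
qed

text \<open>The idempotent \<open>e\<close> is the region already cut out by enclosing uses of the
  lemma, and \<open>r\<close> is a smaller region on which \<open>x\<close> follows the section
  \<open>s i\<close>. This makes the lemma nestable, one level for each arrow of a composable
  string. The premises on \<open>rst C x\<close> say that nothing of \<open>u\<close> or
  \<open>v\<close> lies outside the cover.\<close>

lemma piecewise_eq:
  assumes x: "x \<in> Ar C" "tgt x = src p" and uv: "u \<in> hom C (src x) b" "v \<in> hom C (src x) b"
    and ux: "u \<odot> rst C x = u" "v \<odot> rst C x = v" and e: "e \<in> idems C (src x)"
    and eq: "\<And>i r. \<lbrakk>i \<in> I; r \<in> idems C (src x); e \<odot> r = r; x \<odot> r = s i \<odot> p \<odot> x \<odot> r\<rbrakk> \<Longrightarrow> u \<odot> r = v \<odot> r"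
  shows "u \<odot> e = v \<odot> e"
proof -
  have eA: "e \<in> Ar C" "src e = src x" "tgt e = src x" using e by (auto simp: idems_iff)
  have "(u \<odot> e) \<odot> rst C x = (v \<odot> e) \<odot> rst C x"
  proof (rule local_eq[OF x])
    fix i assume i: "i \<in> I"
    let ?d = "rst C (q i \<odot> x)"
    have d: "?d \<in> idems C (src x)" "?d \<in> Ar C" "src ?d = src x" "tgt ?d = src x" using i x by auto
    have ee: "e \<odot> e \<odot> ?d = e \<odot> ?d" by (rule Cmp_reassoc[OF idem_idem[OF e]]) (use eA d in auto)
    have "x \<odot> e \<odot> ?d = (x \<odot> ?d) \<odot> e" using idems_commute[OF e d(1)] x eA d by simp
    also have "\<dots> = (s i \<odot> p \<odot> x \<odot> ?d) \<odot> e" using local_rep[OF i x] by simp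
    also have "\<dots> = s i \<odot> p \<odot> x \<odot> e \<odot> ?d" using idems_commute[OF e d(1)] i x eA d by simp
    finally show "(u \<odot> e) \<odot> ?d = (v \<odot> e) \<odot> ?d"
      using eq[OF i idems_Cmp[OF e d(1)] ee] uv eA d by (simp add: hom_iff)
  qed (use uv eA in \<open>auto simp: hom_iff\<close>)
  moreover have "(w \<odot> e) \<odot> rst C x = w \<odot> e" if "w \<in> hom C (src x) b" "w \<odot> rst C x = w" for w
    using that idems_commute[OF e, of "rst C x"] Cmp_reassoc[OF that(2), of e] x eA by (simp add: hom_iff)
  ultimately show ?thesis using uv ux by simp
qed

text \<open>The idempotents \<open>s i \<odot> q i\<close> cover \<open>src p\<close>, since
  \<open>p\<close> is total and the join of the \<open>q i\<close>.\<close>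

lemma joint_epi:
  assumes "u \<in> Ar C" "v \<in> Ar C" "src u = src p" "src v = src p" "tgt v = tgt u"
    and "\<And>i. i \<in> I \<Longrightarrow> u \<odot> s i = v \<odot> s i"
  shows "u = v"
proof -
  have "u \<odot> rst C p = v \<odot> rst C p"
  proof (rule is_join_rst_eq[OF p_join q_subset, of u "tgt u"])
    fix i assume i: "i \<in> I"
    have "u \<odot> s i \<odot> q i = v \<odot> s i \<odot> q i"
      using Cmp_reassoc[OF assms(6)[OF i], of "q i"] assms(1-5) i by simp
    then show "u \<odot> rst C (q i) = v \<odot> rst C (q i)" using i by simp
  qed (use assms in \<open>auto simp: hom_iff\<close>)
  then show ?thesis using p_total assms by (simp add: total_map_def)
qed

text \<open>Both \<open>rst C u\<close> and the identity are maps out of \<open>src p\<close>, so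
  they may be compared on the sections.\<close>

lemma total_if:
  assumes "u \<in> Ar C" "src u = src p" "\<And>i. i \<in> I \<Longrightarrow> rst C (u \<odot> s i) = rst C (s i)"
  shows "total_map C u"
proof -
  have "rst C u = Idn C (src p)"
    by (rule joint_epi) (use assms rst_Cmp[of "s _" u] in auto)
  then show ?thesis using assms by (simp add: total_map_def)
qed

text \<open>The map is the join of the \<open>u i \<odot> q i\<close>. Agreement of the
  \<open>u i\<close> on the overlaps \<open>q j \<odot> s i\<close> makes these pieces compatible,
  and \<open>dom\<close> ensures that the join composed with \<open>s i\<close> is all of
  \<open>u i\<close>.\<close>

lemma extension:
  assumes b: "b \<in> Ob C" and u: "\<And>i. i \<in> I \<Longrightarrow> u i \<in> hom C (tgt p) b"
    and dom: "\<And>i. i \<in> I \<Longrightarrow> u i \<odot> rst C (s i) = u i"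
    and agree: "\<And>i j. \<lbrakk>i \<in> I; j \<in> I\<rbrakk> \<Longrightarrow> u i \<odot> q j \<odot> s i = u j \<odot> q j \<odot> s i"
  shows "\<exists>w. w \<in> hom C (src p) b \<and> (\<forall>i\<in>I. w \<odot> s i = u i)"
proof -
  let ?S = "(\<lambda>i. u i \<odot> q i) ` I"
  have uA [simp]: "u i \<in> Ar C" "src (u i) = tgt p" "tgt (u i) = b" if "i \<in> I" for i
    using u[OF that] by (auto simp: hom_iff)
  have S: "?S \<subseteq> hom C (src p) b" by (auto simp: hom_iff)
  \<comment> \<open>Writing \<open>rst C (q j)\<close> as \<open>s j \<odot> q j\<close> carries the
    overlap down to the base, where \<open>agree\<close> speaks about it.\<close>
  have half: "u i \<odot> q i \<odot> rst C (q j) = u j \<odot> q i \<odot> rst C (q j)"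
    if "i \<in> I" "j \<in> I" for i j
  proof -
    have e: "q i \<odot> rst C (q j) = (q i \<odot> s j) \<odot> q j" using that by simp
    have "u i \<odot> (q i \<odot> s j) \<odot> q j = (u i \<odot> q j \<odot> s i) \<odot> q j"
      using that phi_sym[of i j] by simp
    also have "\<dots> = (u j \<odot> q i \<odot> s j) \<odot> q j" using that agree[of i j] phi_sym[of i j] by simp
    finally show ?thesis using that unfolding e by simp
  qed
  have qq: "q i \<odot> rst C (q j) = q j \<odot> rst C (q i)" if "i \<in> I" "j \<in> I" for i j
    using that rst_commute[of "q i" "q j"] s_q_comp(3)[of i "rst C (q j)"] s_q_comp(3)[of j "rst C (q i)"]
    by simp
  have compat: "compat C (u i \<odot> q i) (u j \<odot> q j)" if ij: "i \<in> I" "j \<in> I" for i j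
  proof -
    have *: "(u i \<odot> q i) \<odot> rst C (u j \<odot> q j) = u j \<odot> q j \<odot> rst C (q i)" if ij: "i \<in> I" "j \<in> I" for i j
    proof -
      have "(u i \<odot> q i) \<odot> rst C (u j \<odot> q j) = (u i \<odot> q i \<odot> rst C (q j)) \<odot> rst C (u j \<odot> q j)"
        using ij rst_le_src(2)[of "q j" "u j"] by simp
      also have "\<dots> = (u j \<odot> q j \<odot> rst C (q i)) \<odot> rst C (u j \<odot> q j)"
      proof -
        have "u i \<odot> q i \<odot> rst C (q j) = u j \<odot> q j \<odot> rst C (q i)"
          using half[OF ij] qq[OF ij] by simp
        from arg_cong[OF this, of "\<lambda>x. x \<odot> rst C (u j \<odot> q j)"] show ?thesis .
      qed
      also have "\<dots> = (u j \<odot> q j) \<odot> rst C (q i) \<odot> rst C (u j \<odot> q j)" using ij by simp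
      also have "\<dots> = (u j \<odot> q j) \<odot> rst C (u j \<odot> q j) \<odot> rst C (q i)"
        using ij rst_commute[of "q i" "u j \<odot> q j"] by simp
      also have "\<dots> = u j \<odot> q j \<odot> rst C (q i)" using ij by (subst Cmp_rst_comp) auto
      finally show ?thesis .
    qed
    have "u j \<odot> q j \<odot> rst C (q i) = u i \<odot> q i \<odot> rst C (q j)"
      using ij half[of i j] qq[of i j] by simp
    then show ?thesis using *[OF ij] *[OF ij(2,1)] ij by (simp add: compat_def)
  qed
  obtain w where w: "is_join C (src p) b ?S w"
    using join_exists[of "src p" b ?S] S compat b by fastforce
  have wA: "w \<in> Ar C" "src w = src p" "tgt w = b" using is_join_Ar[OF w] by auto
  have "w \<odot> s j = u j" if j: "j \<in> I" for j
  proof (rule le_antisym)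
    \<comment> \<open>After \<open>s j\<close>, every member of the family is a restriction of
      \<open>u j\<close>, and the member with index \<open>j\<close> is \<open>u j\<close>
      itself.\<close>
    have "is_join C (tgt p) b ((\<lambda>t. t \<odot> s j) ` ?S) (w \<odot> s j)"
      using is_join_precomp[OF w S, of "s j"] j by simp
    then show "restr_le C (w \<odot> s j) (u j)"
    proof (rule is_join_least)
      fix t assume "t \<in> (\<lambda>t. t \<odot> s j) ` ?S"
      then obtain i where i: "i \<in> I" "t = (u i \<odot> q i) \<odot> s j" by auto
      then have "t = u j \<odot> q i \<odot> s j" using j agree[of i j] phi_sym[of i j] by simp
      then show "restr_le C t (u j)" using i j by (intro leI[of _ "q i \<odot> s j"]) auto
    qed (use j in \<open>auto simp: hom_iff\<close>)
    have "restr_le C ((u j \<odot> q j) \<odot> s j) (w \<odot> s j)"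
      using j is_join_le[OF w] wA by (intro le_precomp) auto
    then show "restr_le C (u j) (w \<odot> s j)" using j dom by simp
  qed (use j wA in auto)
  then show ?thesis using wA by (auto simp: hom_iff)
qed

subsection \<open>Pulling back a glueing along a total map\<close>

text \<open>The pieces of the pulled back map are the preimages under \<open>g\<close> of the pieces
  of \<open>p\<close>, and the section over piece \<open>i\<close> is the pair
  \<open>(s i f, rst (s i f))\<close>, given here as \<open>t i\<close>. Coverage comes from
  precomposing the join \<open>p\<close> with \<open>g\<close>. The argument uses only the universal
  property, so it applies to any pullback square.\<close>

lemma glued_pullback:
  assumes pb: "is_pullback C p f g r" and f: "total_map C f"
    and t: "\<And>i. i \<in> I \<Longrightarrow> t i \<in> hom C (src f) (src g) \<and> g \<odot> t i = s i \<odot> f \<and> r \<odot> t i = rst C (s i \<odot> f)"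
  shows "glued C I r (\<lambda>i. r \<odot> rst C (q i \<odot> g)) t"
proof -
  have A [simp]: "f \<in> Ar C" "g \<in> Ar C" "r \<in> Ar C" "tgt f = tgt p" "src r = src g" "tgt g = src p"
    "tgt r = src f" and sq: "p \<odot> g = f \<odot> r"
    using pb by (auto simp: is_pullback_def)
  have univ: "\<exists>!w. w \<in> hom C z (src g) \<and> g \<odot> w = u \<and> r \<odot> w = v"
    if "u \<in> hom C z (src p)" "v \<in> hom C z (src f)" "p \<odot> u = f \<odot> v" for z u v
    using pb that unfolding is_pullback_def by (metis hom_iff src_Ob)
  have tA [simp]: "t i \<in> Ar C" "src (t i) = src f" "tgt (t i) = src g" "g \<odot> t i = s i \<odot> f"
    "r \<odot> t i = rst C (s i \<odot> f)" if "i \<in> I" for i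
    using t[OF that] by (auto simp: hom_iff)
  have mono: "w = w'" if "w \<in> hom C z (src g)" "w' \<in> hom C z (src g)" "g \<odot> w = g \<odot> w'" "r \<odot> w = r \<odot> w'" for w w' z
  proof -
    have "p \<odot> g \<odot> w = f \<odot> r \<odot> w"
      using that Cmp_reassoc[OF sq, of w] by (simp add: hom_iff)
    then show ?thesis using univ[of "g \<odot> w" z "r \<odot> w"] that by (auto simp: hom_iff)
  qed
  have r_total: "total_map C r"
  proof -
    have eq: "rst C g = rst C r" by (rule total_rst_eq[OF p_total f]) (use sq in auto)
    have "rst C r = Idn C (src r)"
    proof (rule mono[of _ "src r"])
      show "g \<odot> rst C r = g \<odot> Idn C (src r)" using eq Cmp_rst[of g] by simp
    qed (auto simp: hom_iff)
    then show ?thesis by (simp add: total_map_def)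
  qed
  let ?q = "\<lambda>i. r \<odot> rst C (q i \<odot> g)"
  have inv: "partial_inverse C (?q i) (t i)" if i: "i \<in> I" for i
  proof -
    have "?q i \<odot> t i = r \<odot> t i \<odot> rst C ((q i \<odot> g) \<odot> t i)"
      using i rst_Cmp[of "t i" "q i \<odot> g"] by simp
    also have "(q i \<odot> g) \<odot> t i = rst C (s i) \<odot> f" using i by simp
    also have "rst C (rst C (s i) \<odot> f) = rst C (s i \<odot> f)" using i by (simp add: rst_rst_Cmp)
    also have "r \<odot> t i \<odot> rst C (s i \<odot> f) = (r \<odot> t i) \<odot> rst C (s i \<odot> f)"
      using i by (subst Cmp_assoc) auto
    also have "\<dots> = rst C (t i)" using i rst_total_Cmp[of "t i" r] r_total by simp
    finally have 1: "?q i \<odot> t i = rst C (t i)" .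
    have rq: "rst C (?q i) = rst C (q i \<odot> g)"
      using i r_total rst_total_Cmp[of "rst C (q i \<odot> g)" r] by simp
    \<comment> \<open>The square turns \<open>f r\<close> into \<open>p g\<close>, and an element in
      piece \<open>i\<close> is recovered from its image under \<open>p\<close>.\<close>
    have sfq: "s i \<odot> f \<odot> ?q i = g \<odot> rst C (q i \<odot> g)"
    proof -
      have "s i \<odot> f \<odot> ?q i = s i \<odot> p \<odot> g \<odot> rst C (q i \<odot> g)"
        using i Cmp_reassoc[OF sq, of "rst C (q i \<odot> g)"] by simp
      also have "\<dots> = g \<odot> rst C (q i \<odot> g)" using i local_rep[of i g] by simp
      finally show ?thesis .
    qed
    have 2: "t i \<odot> ?q i = rst C (?q i)" unfolding rq
    proof (rule mono[of _ "src g"])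
      have "g \<odot> t i \<odot> ?q i = s i \<odot> f \<odot> ?q i"
        using i Cmp_reassoc[OF tA(4), of i "?q i"] by simp
      then show "g \<odot> t i \<odot> ?q i = g \<odot> rst C (q i \<odot> g)" using sfq by simp
      have "r \<odot> t i \<odot> ?q i = rst C (s i \<odot> f) \<odot> ?q i"
        using i by (intro Cmp_reassoc) auto
      also have "\<dots> = ?q i \<odot> rst C (s i \<odot> f \<odot> ?q i)"
        using i rst_Cmp[of "?q i" "s i \<odot> f"] by simp
      also have "rst C (s i \<odot> f \<odot> ?q i) = rst C (q i \<odot> g)"
        unfolding sfq using i rst_Cmp_rst[of "q i \<odot> g" g] rst_le_src(2)[of g "q i"] by simp
      finally show "r \<odot> t i \<odot> ?q i = r \<odot> rst C (q i \<odot> g)" using i by simp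
    qed (use i in \<open>auto simp: hom_iff\<close>)
    show ?thesis using i 1 2 by (simp add: partial_inverse_iff)
  qed
  \<comment> \<open>The cover is first turned into idempotents of \<open>src g\<close>, whose join
    is the identity; applying \<open>r\<close> then gives the pieces \<open>?q i\<close>.\<close>
  have j: "is_join C (src r) (tgt r) (?q ` I) r"
  proof -
    have S: "(\<lambda>t. t \<odot> g) ` q ` I \<subseteq> hom C (src g) (tgt p)" by (auto simp: hom_iff)
    have "is_join C (src g) (tgt p) ((\<lambda>t. t \<odot> g) ` q ` I) (p \<odot> g)"
      by (rule is_join_precomp[OF p_join q_subset]) auto
    from is_join_rst[OF this S]
    have "is_join C (src g) (src g) (rst C ` (\<lambda>t. t \<odot> g) ` q ` I) (rst C (p \<odot> g))" .
    moreover have "rst C (p \<odot> g) = Idn C (src g)"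
      using sq rst_total_Cmp[of r f] f r_total by (simp add: total_map_def)
    ultimately have "is_join C (src g) (src g) ((\<lambda>i. rst C (q i \<odot> g)) ` I) (Idn C (src g))"
      by (simp add: image_image)
    from is_join_postcomp[OF this, of r] show ?thesis
      by (auto simp: image_image hom_iff image_subset_iff)
  qed
  show "glued C I r ?q t"
    by unfold_locales (use r_total inv j in \<open>auto simp: hom_iff\<close>)
qed

text \<open>Sending an idempotent \<open>x\<close> of the base to \<open>rst C (x \<odot> f)\<close>
  is multiplicative, because an idempotent slides past \<open>f\<close> as its restriction. So the
  cocycle inequality in the base is carried to the source of \<open>f\<close>.\<close>

lemma glued_atlas:
  assumes "total_map C f" "tgt f = tgt p"
  shows "local_atlas C (src f) I (\<lambda>i j. rst C ((q j \<odot> s i) \<odot> f))"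
proof -
  have "restr_le C (rst C ((q k \<odot> s j) \<odot> f) \<odot> rst C ((q j \<odot> s i) \<odot> f)) (rst C ((q k \<odot> s i) \<odot> f))"
    if ijk: "i \<in> I" "j \<in> I" "k \<in> I" for i j k
  proof -
    let ?a = "q k \<odot> s j" and ?b = "q j \<odot> s i" and ?c = "q k \<odot> s i"
    have fA: "f \<in> Ar C" using assms by simp
    have "?a \<odot> ?b = q k \<odot> s j \<odot> q j \<odot> s i" using ijk by simp
    also have "\<dots> = ?c \<odot> ?b" using s_phi[of i j] ijk by simp
    finally have ab: "?a \<odot> ?b = ?c \<odot> ?b" .
    have *: "rst C (x \<odot> f) \<odot> rst C (?b \<odot> f) = rst C (x \<odot> ?b \<odot> f)" if "x \<in> idems C (tgt p)" for x
    proof -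
      have "?b \<odot> f = f \<odot> rst C (?b \<odot> f)"
        using ijk fA assms by (intro idem_Cmp[of _ "tgt p"]) auto
      from arg_cong[OF this, of "(\<odot>) x"] have "x \<odot> ?b \<odot> f = (x \<odot> f) \<odot> rst C (?b \<odot> f)"
        using that ijk fA assms by (simp add: idems_iff)
      then show ?thesis using that ijk fA assms rst_Cmp_rst[of "?b \<odot> f" "x \<odot> f"] by (auto simp: idems_iff)
    qed
    have "rst C (?a \<odot> f) \<odot> rst C (?b \<odot> f) = rst C (?a \<odot> ?b \<odot> f)" using * ijk by simp
    also have "?a \<odot> ?b \<odot> f = ?c \<odot> ?b \<odot> f" using Cmp_reassoc[OF ab, of f] ijk fA assms by simp
    also have "rst C (?c \<odot> ?b \<odot> f) = rst C (?c \<odot> f) \<odot> rst C (?b \<odot> f)" using * ijk by simp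
    finally show ?thesis using ijk fA assms
      by (intro leI[of _ "rst C (?b \<odot> f)"]) auto
  qed
  then show ?thesis using assms phi_sym unfolding local_atlas_def by (auto simp: idems_iff)
qed

end

text \<open>The existence half: once the pulled back atlas has a glueing, that glueing is a
  pullback. The projection \<open>g\<close> to \<open>src p\<close> extends the assignment
  \<open>t i \<mapsto> s i f\<close>. A cone \<open>(u, v)\<close> factors through the join of the
  maps \<open>t i \<odot> v \<odot> e i\<close>, where \<open>e i\<close> is the part of its domain
  on which \<open>u\<close> lies in piece \<open>i\<close>.\<close>

lemma glued_is_pullback:
  fixes C :: "('o, 'u, 'z) rcat_scheme" (structure)
  assumes "glued C I p q s" and f: "total_map C f" "tgt f = tgt p" and "glued C I r q' t"
    and r: "tgt r = src f" and phi: "\<And>i j. \<lbrakk>i \<in> I; j \<in> I\<rbrakk> \<Longrightarrow> q' j \<odot> t i = rst C ((q j \<odot> s i) \<odot> f)"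
  shows "has_pb C p f"
proof -
  interpret p: glued C I p q s by fact
  interpret r: glued C I r q' t by fact
  note [simp] = p.hom_iff
  have fA [simp]: "f \<in> Ar C" using f by simp
  note f(2) [simp] r [simp]
  have rt: "rst C (t i) = rst C (s i \<odot> f)" if i: "i \<in> I" for i
    using i phi[OF i i] p.rst_rst_Cmp[of f "s i"] by simp
  have "\<exists>w. w \<in> hom C (src r) (src p) \<and> (\<forall>i\<in>I. w \<odot> t i = s i \<odot> f)"
  proof (rule r.extension)
    show "(s i \<odot> f) \<odot> rst C (t i) = s i \<odot> f" if "i \<in> I" for i using that rt by simp
    show "(s i \<odot> f) \<odot> q' j \<odot> t i = (s j \<odot> f) \<odot> q' j \<odot> t i" if "i \<in> I" "j \<in> I" for i j
    proof -
      have *: "(s k \<odot> f) \<odot> q' j \<odot> t i = s k \<odot> (q j \<odot> s i) \<odot> f" if k: "k \<in> I" for k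
        using k \<open>i \<in> I\<close> \<open>j \<in> I\<close> p.idem_Cmp[of "q j \<odot> s i" "tgt p" f]
          by (simp add: phi)
      show ?thesis using *[OF that(1)] *[OF that(2)] that p.s_phi[of i j]
          p.Cmp_reassoc[of "s i" "q j \<odot> s i" _ f] by simp
    qed
  qed auto
  then obtain g where g [simp]: "g \<in> Ar C" "src g = src r" "tgt g = src p"
    and gt: "\<And>i. i \<in> I \<Longrightarrow> g \<odot> t i = s i \<odot> f" by auto
  have gt' [simp]: "g \<odot> t i \<odot> x = s i \<odot> f \<odot> x" if "i \<in> I" "x \<in> Ar C" "tgt x = src f" for i x
    using p.Cmp_reassoc[OF gt, of i x] that by simp
  note gt [simp]
  have sq: "p \<odot> g = f \<odot> r"
  proof (rule r.joint_epi)
    fix i assume i: "i \<in> I"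
    have "rst C (s i) \<odot> f = f \<odot> rst C (s i \<odot> f)" using i by (intro p.rst_Cmp) auto
    then show "(p \<odot> g) \<odot> t i = (f \<odot> r) \<odot> t i" using i rt[OF i] by simp
  qed auto
  \<comment> \<open>Used for uniqueness: it identifies the preimage under \<open>g\<close> of piece
    \<open>i\<close> with the domain of \<open>q' i\<close>.\<close>
  have qg: "q i \<odot> g = f \<odot> q' i" if i: "i \<in> I" for i
  proof (rule r.joint_epi)
    fix j assume j: "j \<in> I"
    show "(q i \<odot> g) \<odot> t j = (f \<odot> q' i) \<odot> t j"
      using i j phi[of j i] p.idem_Cmp[of "q i \<odot> s j" "tgt p" f] by simp
  qed (use i in auto)
  have "is_pullback C p f g r"
    unfolding is_pullback_def
  proof (intro conjI ballI impI)
    fix z u v assume z: "z \<in> Ob C" and "u \<in> hom C z (src p)" "v \<in> hom C z (src f)" and uv: "p \<odot> u = f \<odot> v"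
    then have u [simp]: "u \<in> Ar C" "src u = z" "tgt u = src p" and v [simp]: "v \<in> Ar C" "src v = z" "tgt v = src f"
      by auto
    define e where "e i = rst C (q i \<odot> u)" for i
    have e [simp]: "e i \<in> idems C z" "e i \<in> Ar C" "src (e i) = z" "tgt (e i) = z" "rst C (e i) = e i"
      if "i \<in> I" for i using that by (auto simp: e_def)
    have ru: "rst C u = rst C v" by (rule p.total_rst_eq[OF p.p_total f(1)]) (use uv in auto)
    have key: "s i \<odot> f \<odot> v \<odot> e i = u \<odot> e i" if i: "i \<in> I" for i
      using p.local_rep[of i u] i p.Cmp_reassoc[OF uv, of "e i"] unfolding e_def by simp
    have eu: "rst C (u \<odot> e i) = e i" if i: "i \<in> I" for i
      using i p.rst_le_src(2)[of u "q i"] p.rst_Cmp_rst[of "q i \<odot> u" u] unfolding e_def by simp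
    have rv: "rst C (t i) \<odot> v \<odot> e i = v \<odot> e i" if i: "i \<in> I" for i
    proof -
      have "rst C (t i) \<odot> v \<odot> e i = rst C (s i \<odot> f) \<odot> v \<odot> e i" using i rt by simp
      also have "\<dots> = (v \<odot> e i) \<odot> rst C (s i \<odot> f \<odot> v \<odot> e i)"
        using i p.rst_Cmp[of "v \<odot> e i" "s i \<odot> f"] by simp
      also have "\<dots> = v \<odot> e i \<odot> e i" using i key eu by simp
      also have "\<dots> = v \<odot> e i" using i p.idem_idem[of "e i" z] by simp
      finally show ?thesis .
    qed
    have gtw: "g \<odot> t i \<odot> v \<odot> e i = u \<odot> e i" and rtw: "r \<odot> t i \<odot> v \<odot> e i = v \<odot> e i" if i: "i \<in> I" for i
      using i key rv by simp_all
    have unique: "w \<odot> e i = t i \<odot> v \<odot> e i" if w: "w \<in> hom C z (src r)" "g \<odot> w = u" "r \<odot> w = v" and i: "i \<in> I" for w i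
    proof -
      have wA [simp]: "w \<in> Ar C" "src w = z" "tgt w = src r" using w(1) by auto
      have "rst C (q' i) = rst C (q i \<odot> g)"
        using qg i p.rst_total_Cmp[of "q' i" f] f by simp
      then have "rst C (q' i \<odot> w) = rst C ((q i \<odot> g) \<odot> w)"
        using i p.rst_rst_Cmp[of w "q' i"] p.rst_rst_Cmp[of w "q i \<odot> g"] by simp
      then have "rst C (q' i \<odot> w) = e i" using i w unfolding e_def by simp
      then show ?thesis using r.local_rep[of i w] i w p.Cmp_reassoc[OF w(3), of "e i"] by simp
    qed
    have compat: "compat C (t i \<odot> v \<odot> e i) (t j \<odot> v \<odot> e j)" if ij: "i \<in> I" "j \<in> I" for i j
    proof -
      \<comment> \<open>As \<open>r\<close> is total, the domain of
        \<open>t j \<odot> v \<odot> e j\<close> can be computed after applying \<open>r\<close>,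
        and is \<open>e j\<close>.\<close>
      have *: "(t i \<odot> v \<odot> e i) \<odot> rst C (t j \<odot> v \<odot> e j) = t i \<odot> v \<odot> e i \<odot> e j" if ij: "i \<in> I" "j \<in> I" for i j
      proof -
        have "rst C (t j \<odot> v \<odot> e j) = rst C (r \<odot> t j \<odot> v \<odot> e j)"
          using ij p.rst_total_Cmp[of "t j \<odot> v \<odot> e j" r] r.p_total by simp
        also have "\<dots> = rst C (v \<odot> e j)" using ij rtw by simp
        also have "\<dots> = rst C u \<odot> e j" using ij ru p.rst_Cmp_idem[of "e j" z v] by simp
        also have "\<dots> = e j" using ij p.rst_Cmp_idem[of "e j" z u] eu by simp
        finally show ?thesis using ij by simp
      qed
      \<comment> \<open>Over the overlap of \<open>e i\<close> and \<open>e j\<close>, the image of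
        \<open>v\<close> lies in the entry of the pulled back atlas at \<open>i\<close>,
        \<open>j\<close>; there the sections \<open>t i\<close> and \<open>t j\<close>
        coincide.\<close>
      have psi: "v \<odot> e i \<odot> e j = (q' j \<odot> t i) \<odot> v \<odot> e i \<odot> e j"
      proof -
        let ?w = "v \<odot> e i \<odot> e j"
        have a: "(q j \<odot> s i) \<odot> f \<odot> ?w = q j \<odot> u \<odot> e i \<odot> e j"
          using ij p.Cmp_reassoc[OF key[OF ij(1)], of "e j"] by simp
        have b: "rst C (q j \<odot> u \<odot> e i \<odot> e j) = e i \<odot> e j"
        proof -
          have "rst C ((q j \<odot> u) \<odot> (e i \<odot> e j)) = rst C (q j \<odot> u) \<odot> (e i \<odot> e j)"
            using ij by (intro p.rst_Cmp_idem) auto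
          also have "\<dots> = e j \<odot> e j \<odot> e i"
            using ij p.idems_commute[of "e i" z "e j"] by (simp add: e_def)
          also have "\<dots> = e i \<odot> e j" using ij p.idems_commute[of "e i" z "e j"] p.idem_idem[of "e j"]
              p.Cmp_reassoc[OF p.idem_idem[of "e j"], of z "e i"] by simp
          finally show ?thesis using ij by simp
        qed
        have "(q' j \<odot> t i) \<odot> ?w = rst C ((q j \<odot> s i) \<odot> f) \<odot> ?w" using ij phi by simp
        also have "\<dots> = ?w \<odot> rst C (((q j \<odot> s i) \<odot> f) \<odot> ?w)"
          using ij by (intro p.rst_Cmp) auto
        also have "((q j \<odot> s i) \<odot> f) \<odot> ?w = (q j \<odot> s i) \<odot> f \<odot> ?w" using ij by simp
        also have "?w \<odot> rst C ((q j \<odot> s i) \<odot> f \<odot> ?w) = ?w \<odot> (e i \<odot> e j)" unfolding a b ..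
        also have "\<dots> = v \<odot> (e i \<odot> e j) \<odot> (e i \<odot> e j)" using ij by simp
        also have "\<dots> = ?w" using ij p.idem_idem[of "e i \<odot> e j" z] by simp
        finally show ?thesis by simp
      qed
      have "t i \<odot> v \<odot> e i \<odot> e j = t i \<odot> (q' j \<odot> t i) \<odot> v \<odot> e i \<odot> e j"
        using psi by simp
      also have "\<dots> = (t i \<odot> q' j \<odot> t i) \<odot> v \<odot> e i \<odot> e j" using ij by simp
      also have "\<dots> = (t j \<odot> q' j \<odot> t i) \<odot> v \<odot> e i \<odot> e j" using ij r.s_phi by simp
      also have "\<dots> = t j \<odot> (q' j \<odot> t i) \<odot> v \<odot> e i \<odot> e j" using ij by simp
      also have "\<dots> = t j \<odot> v \<odot> e j \<odot> e i" using psi ij p.idems_commute[of "e i" z "e j"] by simp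
      finally have "t i \<odot> v \<odot> e i \<odot> e j = t j \<odot> v \<odot> e j \<odot> e i" .
      then show ?thesis using *[OF ij] *[OF ij(2,1)] ij by (simp add: compat_def)
    qed
    let ?S = "(\<lambda>i. t i \<odot> v \<odot> e i) ` I"
    have S: "?S \<subseteq> hom C z (src r)" by auto
    obtain w where w: "is_join C z (src r) ?S w"
      using p.join_exists[of z "src r" ?S] S z compat by fastforce
    have wA [simp]: "w \<in> Ar C" "src w = z" "tgt w = src r" using p.is_join_Ar[OF w] by auto
    \<comment> \<open>The idempotents \<open>e i\<close> cover the domain of \<open>u\<close>, so
      maps with no larger domain are compared on them.\<close>
    have cov: "x = y" if "x \<in> hom C z b" "y \<in> hom C z b" "x \<odot> rst C u = x" "y \<odot> rst C u = y"
      "\<And>i. i \<in> I \<Longrightarrow> x \<odot> e i = y \<odot> e i" for x y b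
      using p.local_eq[of u x b y] that by (auto simp: e_def)
    have we: "w \<odot> e i = t i \<odot> v \<odot> e i" if i: "i \<in> I" for i
    proof -
      have "rst C (t i \<odot> v \<odot> e i) = rst C (r \<odot> t i \<odot> v \<odot> e i)"
        using i p.rst_total_Cmp[of "t i \<odot> v \<odot> e i" r] r.p_total by simp
      also have "\<dots> = rst C u \<odot> e i" using i rtw ru p.rst_Cmp_idem[of "e i" z v] by simp
      also have "\<dots> = e i" using i p.rst_Cmp_idem[of "e i" z u] eu by simp
      finally show ?thesis using p.le_Cmp_rst[OF p.is_join_le[OF w], of "t i \<odot> v \<odot> e i"] i by simp
    qed
    \<comment> \<open>The members of the family have the domains \<open>e i\<close>, whose join is
      the domain of \<open>u\<close>; so \<open>w\<close> is defined exactly where \<open>u\<close>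
      is.\<close>
    have rw: "rst C w = rst C u"
    proof -
      have eq: "(\<lambda>t. rst C (t)) ` ?S = e ` I"
      proof -
        have "rst C (t i \<odot> v \<odot> e i) = e i" if i: "i \<in> I" for i
        proof -
          have "rst C (t i \<odot> v \<odot> e i) = rst C (r \<odot> t i \<odot> v \<odot> e i)"
            using i p.rst_total_Cmp[of "t i \<odot> v \<odot> e i" r] r.p_total by simp
          also have "\<dots> = rst C u \<odot> e i" using i rtw ru p.rst_Cmp_idem[of "e i" z v] by simp
          finally show ?thesis using i p.rst_Cmp_idem[of "e i" z u] eu by simp
        qed
        then show ?thesis by (auto simp: image_image)
      qed
      have "is_join C z z (rst C ` ?S) (rst C w)" by (rule p.is_join_rst[OF w S])
      moreover have "is_join C z z (e ` I) (rst C u)"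
      proof -
        have "is_join C z (tgt p) ((\<lambda>t. t \<odot> u) ` q ` I) (p \<odot> u)"
          using p.is_join_precomp[OF p.p_join p.q_subset, of u] by simp
        from p.is_join_rst[OF this] show ?thesis
          using p.rst_total_Cmp[of u p] p.p_total by (auto simp: image_image e_def image_subset_iff)
      qed
      ultimately show ?thesis using eq p.is_join_unique by simp
    qed
    have gw: "g \<odot> w = u"
      by (rule cov[of _ "src p"]) (use we gtw rw[symmetric] in \<open>auto\<close>, simp_all add: rw)
    have rww: "r \<odot> w = v"
      by (rule cov[of _ "src f"]) (use we rtw in auto, simp_all add: rw[symmetric], simp add: rw ru)
    show "\<exists>!w. w \<in> hom C z (src g) \<and> g \<odot> w = u \<and> r \<odot> w = v"
    proof (intro ex1I conjI)
      fix w' assume "w' \<in> hom C z (src g) \<and> g \<odot> w' = u \<and> r \<odot> w' = v"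
      then have w': "w' \<in> hom C z (src r)" "g \<odot> w' = u" "r \<odot> w' = v" by auto
      then have "rst C w' = rst C u" using p.rst_total_Cmp[of w' r] r.p_total ru by auto
      then have "w' \<odot> rst C u = w'" "w \<odot> rst C u = w"
        using p.Cmp_rst[of w] p.Cmp_rst[of w'] rw w'(1) by auto
      then show "w' = w"
        using unique[OF w'] we w'(1) by - (rule cov[of _ "src r"], auto)
    qed (use gw rww in auto)
  qed (use sq in auto)
  then show ?thesis by (auto simp: has_pb_def)
qed

section \<open>Glueings and pullbacks for arbitrary small index sets\<close>

lemma is_glueing_iff:
  fixes C :: "('o, 'u, 'z) rcat_scheme" (structure)
  assumes "join_restriction_category C"
  shows "is_glueing C x I \<phi> p q s \<longleftrightarrow>
    glued C I p q s \<and> tgt p = x \<and> (\<forall>i\<in>I. \<forall>j\<in>I. \<phi> i j = q j \<odot> s i)"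
proof -
  interpret join_restriction_category C by fact
  show ?thesis
  proof
    assume "is_glueing C x I \<phi> p q s"
    then show "glued C I p q s \<and> tgt p = x \<and> (\<forall>i\<in>I. \<forall>j\<in>I. \<phi> i j = q j \<odot> s i)"
      by (auto simp: is_glueing_def local_homeo_def glued_def glued_axioms_def assms)
  next
    assume R: "glued C I p q s \<and> tgt p = x \<and> (\<forall>i\<in>I. \<forall>j\<in>I. \<phi> i j = q j \<odot> s i)"
    then interpret glued C I p q s by simp
    have "\<exists>S\<subseteq>hom C (src p) (tgt p). (\<forall>s\<in>S. partial_iso C s) \<and> is_join C (src p) (tgt p) S p"
      by (rule exI[of _ "q ` I"]) (use q_subset p_join q_s_inverse in \<open>auto simp: partial_iso_def\<close>)
    then show "is_glueing C x I \<phi> p q s"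
      using R p_total p_join q_s_inverse
      by (auto simp: is_glueing_def local_homeo_def hom_iff)
  qed
qed

lemma lesspoll_inj_on:
  assumes "I \<prec> (UNIV :: 'u set)"
  obtains l :: "'i \<Rightarrow> 'u" where "inj_on l I" "l ` I \<prec> (UNIV :: 'u set)"
proof -
  obtain l :: "'i \<Rightarrow> 'u" where l: "inj_on l I"
    using lesspoll_imp_lepoll[OF assms] by (auto simp: lepoll_def)
  then have "l ` I \<approx> I" by (rule inj_on_image_eqpoll_self)
  then have "l ` I \<prec> (UNIV :: 'u set)"
    using assms by (meson eqpoll_imp_lepoll lesspoll_trans1)
  then show ?thesis using that l by blast
qed

text \<open>The hypothesis provides glueings for index sets of elements of \<open>'u\<close>,
  whereas the atlases to be glued are indexed by arrows. Smallness gives an injection into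
  \<open>'u\<close> along which the atlas is re-indexed.\<close>

lemma glueing_exists:
  fixes C :: "('o, 'u, 'z) rcat_scheme" (structure)
  assumes "join_restriction_category C" "has_local_glueings C" "x \<in> Ob C" "I \<prec> (UNIV :: 'u set)"
    and atlas: "local_atlas C x I \<phi>"
  shows "\<exists>p q s. is_glueing C x I \<phi> p q s"
proof -
  obtain l :: "_ \<Rightarrow> 'u" where l: "inj_on l I" "l ` I \<prec> (UNIV :: 'u set)"
    using lesspoll_inj_on[OF assms(4)] .
  define k where "k = the_inv_into I l"
  have k [simp]: "k (l i) = i" if "i \<in> I" for i
    using that l(1) by (simp add: k_def the_inv_into_f_f)
  have "local_atlas C x (l ` I) (\<lambda>i j. \<phi> (k i) (k j))"
    using atlas by (auto simp: local_atlas_def)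
  then obtain p q s where "is_glueing C x (l ` I) (\<lambda>i j. \<phi> (k i) (k j)) p q s"
    using assms(2,3) l(2) unfolding has_local_glueings_def by blast
  then have "is_glueing C x I \<phi> p (q \<circ> l) (s \<circ> l)"
    by (auto simp: is_glueing_def image_comp)
  then show ?thesis by blast
qed

lemma (in glued) has_pb_if_has_local_glueings:
  assumes "has_local_glueings C" "I \<prec> (UNIV :: 'u set)" "total_map C f" "tgt f = tgt p"
  shows "has_pb C p f"
proof -
  have "src f \<in> Ob C" using assms by simp
  then obtain r q' t where "is_glueing C (src f) I (\<lambda>i j. rst C ((q j \<odot> s i) \<odot> f)) r q' t"
    using glueing_exists[OF join_restriction_category_axioms assms(1) _ assms(2) glued_atlas[OF assms(3,4)]]
    by blast
  then show ?thesis
    using glued_is_pullback[OF glued_axioms assms(3,4), of r q' t]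
    by (auto simp: is_glueing_iff[OF join_restriction_category_axioms])
qed

section \<open>Partite categories and cofunctors through generalized elements\<close>

text \<open>Multiplication at a composable pair of generalised elements, that is, of maps
  \<open>y\<close>, \<open>x\<close> with a common source. In this form the pullbacks occurring in
  the axioms drop out of calculations; \<open>act\<close> plays the same role for
  cofunctors.\<close>

definition mul ::
  "('o, 'u) rcat \<Rightarrow> ('o, 'u) pcat \<Rightarrow> 'u \<Rightarrow> 'u \<Rightarrow> 'u \<Rightarrow> ('o, 'u) arr \<Rightarrow> ('o, 'u) arr \<Rightarrow> ('o, 'u) arr" where
  "mul C A i j k y x = mu A i j k \<odot>\<^bsub>C\<^esub> pair C (sgm A j k) (tau A i j) y x"

definition act ::
  "('o, 'u) rcat \<Rightarrow> ('o, 'u) pcat \<Rightarrow> ('o, 'u) cofun \<Rightarrow> 'u \<Rightarrow> 'u \<Rightarrow>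
   ('o, 'u) arr \<Rightarrow> ('o, 'u) arr \<Rightarrow> ('o, 'u) arr" where
  "act C A F i j x b = cf1 F i j \<odot>\<^bsub>C\<^esub> pair C (sgm A i j) (cf0 F i) x b"

context partite_category
begin

lemma P_Ob [simp]: "i \<in> Ix A \<Longrightarrow> P0 A i \<in> Ob C" "\<lbrakk>i \<in> Ix A; j \<in> Ix A\<rbrakk> \<Longrightarrow> P1 A i j \<in> Ob C"
  by (simp_all add: P0_Ob P1_Ob)

lemma sgm_simps [simp]:
  assumes "i \<in> Ix A" "j \<in> Ix A"
  shows "sgm A i j \<in> Ar C" "src (sgm A i j) = P1 A i j" "tgt (sgm A i j) = P0 A i"
    "total_map C (sgm A i j)"
  using sgm_hom[OF assms] sgm_total[OF assms] by (simp_all add: hom_iff)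

lemma tau_simps [simp]:
  assumes "i \<in> Ix A" "j \<in> Ix A"
  shows "tau A i j \<in> Ar C" "src (tau A i j) = P1 A i j" "tgt (tau A i j) = P0 A j"
    "total_map C (tau A i j)"
  using tau_hom[OF assms] tau_total[OF assms] by (simp_all add: hom_iff)

lemma eta_simps [simp]:
  assumes "i \<in> Ix A"
  shows "eta A i \<in> Ar C" "src (eta A i) = P0 A i" "tgt (eta A i) = P1 A i i"
    "sgm A i i \<odot> eta A i = Idn C (P0 A i)" "tau A i i \<odot> eta A i = Idn C (P0 A i)"
    "total_map C (eta A i)"
  using eta_hom[OF assms] sgm_eta[OF assms] tau_eta[OF assms]
    total_if_total_Cmp[of "eta A i" "sgm A i i"] assms by (simp_all add: hom_iff)

lemma eta_comp [simp]:
  assumes "i \<in> Ix A" "x \<in> Ar C" "tgt x = P0 A i"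
  shows "sgm A i i \<odot> eta A i \<odot> x = x" "tau A i i \<odot> eta A i \<odot> x = x"
  using assms Cmp_reassoc[OF sgm_eta, of i x] Cmp_reassoc[OF tau_eta, of i x] by simp_all

lemma has_pb_sgm [simp]:
  "\<lbrakk>i \<in> Ix A; j \<in> Ix A; total_map C f; tgt f = P0 A i\<rbrakk> \<Longrightarrow> has_pb C (sgm A i j) f"
  using sgm_pullbacks unfolding has_pb_def .

lemma rst_sgm [simp]: "\<lbrakk>i \<in> Ix A; j \<in> Ix A; x \<in> Ar C; tgt x = P1 A i j\<rbrakk> \<Longrightarrow> rst C (sgm A i j \<odot> x) = rst C x"
  and rst_tau [simp]: "\<lbrakk>i \<in> Ix A; j \<in> Ix A; x \<in> Ar C; tgt x = P1 A i j\<rbrakk> \<Longrightarrow> rst C (tau A i j \<odot> x) = rst C x"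
  and rst_eta [simp]: "\<lbrakk>i \<in> Ix A; x \<in> Ar C; tgt x = P0 A i\<rbrakk> \<Longrightarrow> rst C (eta A i \<odot> x) = rst C x"
  by (simp_all add: rst_total_Cmp)

lemma mu_simps [simp]:
  assumes "i \<in> Ix A" "j \<in> Ix A" "k \<in> Ix A"
  shows "mu A i j k \<in> Ar C" "src (mu A i j k) = pbo C (sgm A j k) (tau A i j)" "tgt (mu A i j k) = P1 A i k"
  using mu_hom[OF assms] by (simp_all add: hom_iff)

lemma mul_simps:
  assumes I: "i \<in> Ix A" "j \<in> Ix A" "k \<in> Ix A"
    and x: "x \<in> Ar C" "tgt x = P1 A i j" and y: "y \<in> Ar C" "src y = src x" "tgt y = P1 A j k"
    and yx: "sgm A j k \<odot> y = tau A i j \<odot> x"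
  shows "mul C A i j k y x \<in> Ar C" "src (mul C A i j k y x) = src x" "tgt (mul C A i j k y x) = P1 A i k"
    "sgm A i k \<odot> mul C A i j k y x = sgm A i j \<odot> x" "tau A i k \<odot> mul C A i j k y x = tau A j k \<odot> y"
    "rst C (mul C A i j k y x) = rst C x"
proof -
  have pb: "has_pb C (sgm A j k) (tau A i j)" using I by simp
  note pb_simps[OF pb, simp]
  have p: "pair C (sgm A j k) (tau A i j) y x \<in> Ar C" "src (pair C (sgm A j k) (tau A i j) y x) = src x"
    "tgt (pair C (sgm A j k) (tau A i j) y x) = pbo C (sgm A j k) (tau A i j)"
    "pb1 C (sgm A j k) (tau A i j) \<odot> pair C (sgm A j k) (tau A i j) y x = y"
    "pb2 C (sgm A j k) (tau A i j) \<odot> pair C (sgm A j k) (tau A i j) y x = x"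
    using pair_simps[OF pb, of y x] assms by simp_all
  show *: "mul C A i j k y x \<in> Ar C" "src (mul C A i j k y x) = src x" "tgt (mul C A i j k y x) = P1 A i k"
    using p I by (simp_all add: mul_def)
  show s: "sgm A i k \<odot> mul C A i j k y x = sgm A i j \<odot> x" "tau A i k \<odot> mul C A i j k y x = tau A j k \<odot> y"
    using Cmp_reassoc[OF sgm_mu[OF I], of "pair C (sgm A j k) (tau A i j) y x"]
      Cmp_reassoc[OF tau_mu[OF I], of "pair C (sgm A j k) (tau A i j) y x"] p I
    by (simp_all add: mul_def)
  show "rst C (mul C A i j k y x) = rst C x"
    using rst_sgm[of i k "mul C A i j k y x"] rst_sgm[of i j x] s * x I by (simp del: rst_sgm)
qed

lemma mul_Cmp:
  assumes I: "i \<in> Ix A" "j \<in> Ix A" "k \<in> Ix A"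
    and x: "x \<in> Ar C" "tgt x = P1 A i j" and y: "y \<in> Ar C" "src y = src x" "tgt y = P1 A j k"
    and yx: "sgm A j k \<odot> y = tau A i j \<odot> x" and h: "h \<in> Ar C" "tgt h = src x"
  shows "mul C A i j k y x \<odot> h = mul C A i j k (y \<odot> h) (x \<odot> h)"
proof -
  have pb: "has_pb C (sgm A j k) (tau A i j)" using I by simp
  note pair_simps[OF pb, of y x, simp]
  show ?thesis using assms pair_Cmp[OF pb, of y x h] by (simp add: mul_def)
qed

lemma mul_eta_right:
  assumes "i \<in> Ix A" "j \<in> Ix A" "x \<in> Ar C" "tgt x = P1 A i j"
  shows "mul C A i i j x (eta A i \<odot> sgm A i j \<odot> x) = x"
  using mul_Cmp[of i i j "eta A i \<odot> sgm A i j" "Idn C (P1 A i j)" x] mu_eta_right[of i j] assms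
  by (simp add: mul_def)

lemma mul_eta_left:
  assumes "i \<in> Ix A" "j \<in> Ix A" "x \<in> Ar C" "tgt x = P1 A i j"
  shows "mul C A i j j (eta A j \<odot> tau A i j \<odot> x) x = x"
  using mul_Cmp[of i j j "Idn C (P1 A i j)" "eta A j \<odot> tau A i j" x] mu_eta_left[of i j] assms
  by (simp add: mul_def)

text \<open>The axiom is the case of the universal composable triple formed by the pullback
  projections. Any other triple factors through it by the map \<open>w\<close>, and multiplication
  commutes with precomposition.\<close>

lemma mul_assoc:
  assumes I: "i \<in> Ix A" "j \<in> Ix A" "k \<in> Ix A" "l \<in> Ix A"
    and x: "x \<in> Ar C" "tgt x = P1 A i j" and y: "y \<in> Ar C" "src y = src x" "tgt y = P1 A j k"
    and z: "z \<in> Ar C" "src z = src x" "tgt z = P1 A k l"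
    and yx: "sgm A j k \<odot> y = tau A i j \<odot> x" and zy: "sgm A k l \<odot> z = tau A j k \<odot> y"
  shows "mul C A i k l z (mul C A i j k y x) = mul C A i j l (mul C A j k l z y) x"
proof -
  let ?s = "sgm A j k" and ?t = "tau A i j"
  have pb: "has_pb C ?s ?t" using I by simp
  note pbs = pb_simps[OF pb, simp]
  note pyx = pair_simps[OF pb, of y x]
  define f where "f = tau A j k \<odot> pb1 C ?s ?t"
  have f: "total_map C f" "f \<in> Ar C" "src f = pbo C ?s ?t" "tgt f = P0 A k"
    using I pb_total[OF pb] by (auto simp: f_def)
  have pb': "has_pb C (sgm A k l) f" using I f by simp
  note pbs' = pb_simps[OF pb', simp]
  define d where "d = pb2 C (sgm A k l) f"
  have d [simp]: "d \<in> Ar C" "src d = pbo C (sgm A k l) f" "tgt d = pbo C ?s ?t"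
    using f by (auto simp: d_def)
  let ?a = "pb1 C (sgm A k l) f" and ?b = "pb1 C ?s ?t \<odot> d" and ?c = "pb2 C ?s ?t \<odot> d"
  have eq: "mul C A i k l ?a (mu A i j k \<odot> d) = mul C A i j l (mul C A j k l ?a ?b) ?c"
    using mu_assoc[OF I] by (simp add: Let_def mul_def f_def[symmetric] d_def[symmetric])
  have bc: "mu A i j k \<odot> d = mul C A i j k ?b ?c"
    using pair_pb_Cmp[OF pb, of d] by (simp add: mul_def)
  have sb: "?s \<odot> ?b = ?t \<odot> ?c" using I Cmp_reassoc[OF pbs(10), of d] by simp
  have sa: "sgm A k l \<odot> ?a = tau A j k \<odot> ?b"
  proof -
    have "f \<odot> d = tau A j k \<odot> ?b" using I by (simp add: f_def)
    then show ?thesis using pbs'(10) by (simp add: d_def)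
  qed
  define w where "w = pair C (sgm A k l) f z (pair C ?s ?t y x)"
  have zw: "sgm A k l \<odot> z = f \<odot> pair C ?s ?t y x"
    using assms pyx by (simp add: f_def)
  have w: "w \<in> Ar C" "src w = src x" "tgt w = pbo C (sgm A k l) f" "?a \<odot> w = z" "d \<odot> w = pair C ?s ?t y x"
    using pair_simps[OF pb', of z "pair C ?s ?t y x"] assms pyx f zw by (auto simp: w_def d_def)
  have bw: "?b \<odot> w = y" "?c \<odot> w = x" using w pyx assms by auto
  note [simp] = I mul_simps
  have "mul C A i k l z (mul C A i j k y x) = mul C A i k l ?a (mul C A i j k ?b ?c) \<odot> w"
    using sb sa w(1-4) bw by (simp add: mul_Cmp)
  also have "\<dots> = mul C A i j l (mul C A j k l ?a ?b) ?c \<odot> w" using eq bc by simp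
  also have "\<dots> = mul C A i j l (mul C A j k l z y) x"
    using sb sa w(1-4) bw by (simp add: mul_Cmp)
  finally show ?thesis .
qed

end

locale cofunctor = A: partite_category C A + B: partite_category C B
  for C :: "('o, 'u) rcat" (structure) and A B :: "('o, 'u) pcat" +
  fixes F :: "('o, 'u) cofun"
  assumes is_cofunctor: "is_cofunctor C A B F"
begin

lemma cfI_Ix [simp]: "i \<in> Ix A \<Longrightarrow> cfI F i \<in> Ix B"
  using is_cofunctor by (auto simp: is_cofunctor_def)

lemma cf0_simps [simp]:
  assumes "i \<in> Ix A"
  shows "cf0 F i \<in> Ar C" "src (cf0 F i) = P0 B (cfI F i)" "tgt (cf0 F i) = P0 A i" "total_map C (cf0 F i)"
  using is_cofunctor assms by (auto simp: is_cofunctor_def A.hom_iff)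

lemma cf1_simps [simp]:
  assumes "i \<in> Ix A" "j \<in> Ix A"
  shows "cf1 F i j \<in> Ar C" "src (cf1 F i j) = pbo C (sgm A i j) (cf0 F i)"
    "tgt (cf1 F i j) = P1 B (cfI F i) (cfI F j)"
    "sgm B (cfI F i) (cfI F j) \<odot> cf1 F i j = pb2 C (sgm A i j) (cf0 F i)"
    "cf0 F j \<odot> tau B (cfI F i) (cfI F j) \<odot> cf1 F i j = tau A i j \<odot> pb1 C (sgm A i j) (cf0 F i)"
  using is_cofunctor assms by (auto simp: is_cofunctor_def A.hom_iff)

lemma has_pb_cf [simp]: "\<lbrakk>i \<in> Ix A; j \<in> Ix A\<rbrakk> \<Longrightarrow> has_pb C (sgm A i j) (cf0 F i)"
  by simp

lemma act_simps:
  assumes I: "i \<in> Ix A" "j \<in> Ix A"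
    and x: "x \<in> Ar C" "tgt x = P1 A i j" and b: "b \<in> Ar C" "src b = src x" "tgt b = P0 B (cfI F i)"
    and xb: "sgm A i j \<odot> x = cf0 F i \<odot> b"
  shows "act C A F i j x b \<in> Ar C" "src (act C A F i j x b) = src x"
    "tgt (act C A F i j x b) = P1 B (cfI F i) (cfI F j)"
    "sgm B (cfI F i) (cfI F j) \<odot> act C A F i j x b = b"
    "cf0 F j \<odot> tau B (cfI F i) (cfI F j) \<odot> act C A F i j x b = tau A i j \<odot> x"
    "rst C (act C A F i j x b) = rst C b"
proof -
  note pb = has_pb_cf[OF I]
  note A.pb_simps[OF pb, simp]
  have p: "pair C (sgm A i j) (cf0 F i) x b \<in> Ar C" "src (pair C (sgm A i j) (cf0 F i) x b) = src x"
    "tgt (pair C (sgm A i j) (cf0 F i) x b) = pbo C (sgm A i j) (cf0 F i)"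
    "pb1 C (sgm A i j) (cf0 F i) \<odot> pair C (sgm A i j) (cf0 F i) x b = x"
    "pb2 C (sgm A i j) (cf0 F i) \<odot> pair C (sgm A i j) (cf0 F i) x b = b"
    using A.pair_simps[OF pb, of x b] assms by simp_all
  show *: "act C A F i j x b \<in> Ar C" "src (act C A F i j x b) = src x"
    "tgt (act C A F i j x b) = P1 B (cfI F i) (cfI F j)"
    using p I by (simp_all add: act_def)
  show s: "sgm B (cfI F i) (cfI F j) \<odot> act C A F i j x b = b"
    using A.Cmp_reassoc[OF cf1_simps(4)[OF I], of "pair C (sgm A i j) (cf0 F i) x b"] p I
    by (simp add: act_def)
  have "cf0 F j \<odot> tau B (cfI F i) (cfI F j) \<odot> act C A F i j x b =
      (cf0 F j \<odot> tau B (cfI F i) (cfI F j) \<odot> cf1 F i j) \<odot> pair C (sgm A i j) (cf0 F i) x b"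
    using p I by (simp add: act_def del: cf1_simps(5))
  also have "\<dots> = tau A i j \<odot> x" using p I by simp
  finally show "cf0 F j \<odot> tau B (cfI F i) (cfI F j) \<odot> act C A F i j x b = tau A i j \<odot> x" .
  show "rst C (act C A F i j x b) = rst C b"
    using B.rst_sgm[of "cfI F i" "cfI F j" "act C A F i j x b"] s * b I by (simp del: B.rst_sgm)
qed

lemma act_Cmp:
  assumes I: "i \<in> Ix A" "j \<in> Ix A"
    and x: "x \<in> Ar C" "tgt x = P1 A i j" and b: "b \<in> Ar C" "src b = src x" "tgt b = P0 B (cfI F i)"
    and xb: "sgm A i j \<odot> x = cf0 F i \<odot> b" and h: "h \<in> Ar C" "tgt h = src x"
  shows "act C A F i j x b \<odot> h = act C A F i j (x \<odot> h) (b \<odot> h)"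
proof -
  note pb = has_pb_cf[OF I]
  note A.pair_simps[OF pb, of x b, simp]
  show ?thesis using assms A.pair_Cmp[OF pb, of x b h] by (simp add: act_def)
qed

lemma cf1_act: "\<lbrakk>i \<in> Ix A; j \<in> Ix A\<rbrakk> \<Longrightarrow> cf1 F i j = act C A F i j (pb1 C (sgm A i j) (cf0 F i)) (pb2 C (sgm A i j) (cf0 F i))"
  using A.pb_simps[OF has_pb_cf, of i j] by (simp add: act_def A.pair_pb)

lemma act_eta:
  assumes "i \<in> Ix A" "b \<in> Ar C" "tgt b = P0 B (cfI F i)"
  shows "act C A F i i (eta A i \<odot> cf0 F i \<odot> b) b = eta B (cfI F i) \<odot> b"
proof -
  have "act C A F i i (eta A i \<odot> cf0 F i) (Idn C (P0 B (cfI F i))) = eta B (cfI F i)"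
    using is_cofunctor assms(1) by (auto simp: is_cofunctor_def act_def)
  then show ?thesis
    using assms act_Cmp[of i i "eta A i \<odot> cf0 F i" "Idn C (P0 B (cfI F i))" b] by simp
qed

text \<open>As for associativity of \<open>mul\<close>: the axiom at the universal element
  \<open>(?a, ?b, ?c)\<close>, transported along the map \<open>w\<close> that classifies
  \<open>(y, x, b)\<close>.\<close>

lemma act_mul:
  assumes I: "i \<in> Ix A" "j \<in> Ix A" "k \<in> Ix A"
    and x: "x \<in> Ar C" "tgt x = P1 A i j" and y: "y \<in> Ar C" "src y = src x" "tgt y = P1 A j k"
    and b: "b \<in> Ar C" "src b = src x" "tgt b = P0 B (cfI F i)"
    and xb: "sgm A i j \<odot> x = cf0 F i \<odot> b" and yx: "sgm A j k \<odot> y = tau A i j \<odot> x"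
  shows "act C A F i k (mul C A i j k y x) b =
    mul C B (cfI F i) (cfI F j) (cfI F k)
      (act C A F j k y (tau B (cfI F i) (cfI F j) \<odot> act C A F i j x b)) (act C A F i j x b)"
proof -
  let ?s = "sgm A i j" and ?t = "cf0 F i" and ?T = "tau B (cfI F i) (cfI F j)"
  have pb: "has_pb C ?s ?t" using I by simp
  note pbs = A.pb_simps[OF pb, simp]
  note pxb = A.pair_simps[OF pb, of x b]
  define f where "f = tau A i j \<odot> pb1 C ?s ?t"
  have f: "total_map C f" "f \<in> Ar C" "src f = pbo C ?s ?t" "tgt f = P0 A j"
    using I A.pb_total[OF pb] by (auto simp: f_def)
  have pb': "has_pb C (sgm A j k) f" using I f by simp
  note pbs' = A.pb_simps[OF pb', simp]
  define d where "d = pb2 C (sgm A j k) f"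
  have d [simp]: "d \<in> Ar C" "src d = pbo C (sgm A j k) f" "tgt d = pbo C ?s ?t"
    using f by (auto simp: d_def)
  let ?a = "pb1 C (sgm A j k) f" and ?b = "pb1 C ?s ?t \<odot> d" and ?c = "pb2 C ?s ?t \<odot> d"
  have eq: "act C A F i k (mul C A i j k ?a ?b) ?c =
      mul C B (cfI F i) (cfI F j) (cfI F k) (act C A F j k ?a (?T \<odot> (cf1 F i j \<odot> d))) (cf1 F i j \<odot> d)"
    using is_cofunctor[unfolded is_cofunctor_def, THEN conjunct2, THEN conjunct2, THEN conjunct2,
        THEN conjunct2, THEN conjunct2, THEN conjunct2, THEN conjunct2, rule_format, OF I]
    unfolding mul_def act_def f_def d_def by (simp only: Let_def)
  have bc: "cf1 F i j \<odot> d = act C A F i j ?b ?c"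
    using A.pair_pb_Cmp[OF pb, of d] by (simp add: act_def)
  have sb: "?s \<odot> ?b = ?t \<odot> ?c" using I A.Cmp_reassoc[OF pbs(10), of d] by simp
  have sa: "sgm A j k \<odot> ?a = tau A i j \<odot> ?b"
  proof -
    have "f \<odot> d = tau A i j \<odot> ?b" using I by (simp add: f_def)
    then show ?thesis using pbs'(10) by (simp add: d_def)
  qed
  define w where "w = pair C (sgm A j k) f y (pair C ?s ?t x b)"
  have zw: "sgm A j k \<odot> y = f \<odot> pair C ?s ?t x b"
    using assms pxb by (simp add: f_def)
  have w: "w \<in> Ar C" "src w = src x" "tgt w = pbo C (sgm A j k) f" "?a \<odot> w = y" "d \<odot> w = pair C ?s ?t x b"
    using A.pair_simps[OF pb', of y "pair C ?s ?t x b"] assms pxb f zw by (auto simp: w_def d_def)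
  have bw: "?b \<odot> w = x" "?c \<odot> w = b" using w pxb assms by auto
  note [simp] = I A.mul_simps act_simps B.mul_simps
  have "act C A F i k (mul C A i j k y x) b = act C A F i k (mul C A i j k ?a ?b) ?c \<odot> w"
    using sb sa w(1-4) bw by (simp add: A.mul_Cmp act_Cmp)
  also have "\<dots> = mul C B (cfI F i) (cfI F j) (cfI F k) (act C A F j k ?a (?T \<odot> act C A F i j ?b ?c)) (act C A F i j ?b ?c) \<odot> w"
    using eq bc by simp
  also have "\<dots> = mul C B (cfI F i) (cfI F j) (cfI F k) (act C A F j k y (?T \<odot> act C A F i j x b)) (act C A F i j x b)"
    using sb sa w(1-4) bw by (simp add: B.mul_Cmp act_Cmp)
  finally show ?thesis .
qed

end

text \<open>The axioms are instances of laws for generalised elements, taken at the universal one.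
  Totality of \<open>cf1\<close> is derived: its composite with the source map is a projection of a
  pullback of total maps.\<close>

lemma is_cofunctorI:
  fixes C :: "('o, 'u) rcat" (structure)
  assumes "partite_category C A" "partite_category C B"
    and ext: "cfI F \<in> Ix A \<rightarrow>\<^sub>E Ix B" "cf0 F \<in> extensional (Ix A)" "cf1 F \<in> extensional (Ix A)"
      "\<And>i. i \<in> Ix A \<Longrightarrow> cf1 F i \<in> extensional (Ix A)"
    and cf0: "\<And>i. i \<in> Ix A \<Longrightarrow> cf0 F i \<in> hom C (P0 B (cfI F i)) (P0 A i) \<and> total_map C (cf0 F i)"
    and cf1: "\<And>i j. \<lbrakk>i \<in> Ix A; j \<in> Ix A\<rbrakk> \<Longrightarrow> cf1 F i j \<in> hom C (pbo C (sgm A i j) (cf0 F i)) (P1 B (cfI F i) (cfI F j))"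
    and sgm: "\<And>i j. \<lbrakk>i \<in> Ix A; j \<in> Ix A\<rbrakk> \<Longrightarrow>
      sgm B (cfI F i) (cfI F j) \<odot> cf1 F i j = pb2 C (sgm A i j) (cf0 F i)"
    and tau: "\<And>i j. \<lbrakk>i \<in> Ix A; j \<in> Ix A\<rbrakk> \<Longrightarrow>
      cf0 F j \<odot> tau B (cfI F i) (cfI F j) \<odot> cf1 F i j = tau A i j \<odot> pb1 C (sgm A i j) (cf0 F i)"
    and unit: "\<And>i. i \<in> Ix A \<Longrightarrow> act C A F i i (eta A i \<odot> cf0 F i) (Idn C (P0 B (cfI F i))) = eta B (cfI F i)"
    and mult: "\<And>i j k x y b. \<lbrakk>i \<in> Ix A; j \<in> Ix A; k \<in> Ix A; x \<in> Ar C; tgt x = P1 A i j;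
        y \<in> Ar C; src y = src x; tgt y = P1 A j k; b \<in> Ar C; src b = src x; tgt b = P0 B (cfI F i);
        sgm A i j \<odot> x = cf0 F i \<odot> b; sgm A j k \<odot> y = tau A i j \<odot> x\<rbrakk> \<Longrightarrow>
      act C A F i k (mul C A i j k y x) b = mul C B (cfI F i) (cfI F j) (cfI F k)
        (act C A F j k y (tau B (cfI F i) (cfI F j) \<odot> act C A F i j x b)) (act C A F i j x b)"
  shows "is_cofunctor C A B F"
proof -
  interpret A: partite_category C A by fact
  interpret B: partite_category C B by fact
  have FI [simp]: "cfI F i \<in> Ix B" if "i \<in> Ix A" for i using ext(1) that by auto
  have F0 [simp]: "cf0 F i \<in> Ar C" "src (cf0 F i) = P0 B (cfI F i)" "tgt (cf0 F i) = P0 A i" "total_map C (cf0 F i)"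
    if "i \<in> Ix A" for i using cf0[OF that] by (auto simp: A.hom_iff)
  have F1 [simp]: "cf1 F i j \<in> Ar C" "src (cf1 F i j) = pbo C (sgm A i j) (cf0 F i)"
    "tgt (cf1 F i j) = P1 B (cfI F i) (cfI F j)"
    if "i \<in> Ix A" "j \<in> Ix A" for i j using cf1[OF that] by (auto simp: A.hom_iff)
  have total: "total_map C (cf1 F i j)" if "i \<in> Ix A" "j \<in> Ix A" for i j
    using that A.pb_total(2)[of "sgm A i j" "cf0 F i"] sgm[OF that]
    by (intro A.total_if_total_Cmp[of "cf1 F i j" "sgm B (cfI F i) (cfI F j)"]) auto
  show ?thesis
    unfolding is_cofunctor_def
  proof (intro conjI ballI)
    fix i j k assume I: "i \<in> Ix A" "j \<in> Ix A" "k \<in> Ix A"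
    let ?s = "Defs.sgm A i j" and ?t = "cf0 F i"
    have pb: "has_pb C ?s ?t" using I by simp
    note pbs = A.pb_simps[OF pb, simp]
    define f where "f = Defs.tau A i j \<odot> pb1 C ?s ?t"
    have f: "total_map C f" "f \<in> Ar C" "src f = pbo C ?s ?t" "tgt f = P0 A j"
      using I A.pb_total[OF pb] by (auto simp: f_def)
    have pb': "has_pb C (Defs.sgm A j k) f" using I f by simp
    note pbs' = A.pb_simps[OF pb', simp]
    define d where "d = pb2 C (Defs.sgm A j k) f"
    have d [simp]: "d \<in> Ar C" "src d = pbo C (Defs.sgm A j k) f" "tgt d = pbo C ?s ?t"
      using f by (auto simp: d_def)
    let ?a = "pb1 C (Defs.sgm A j k) f" and ?b = "pb1 C ?s ?t \<odot> d" and ?c = "pb2 C ?s ?t \<odot> d"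
    have bc: "cf1 F i j \<odot> d = act C A F i j ?b ?c"
      using A.pair_pb_Cmp[OF pb, of d] by (simp add: act_def)
    have "act C A F i k (mul C A i j k ?a ?b) ?c = mul C B (cfI F i) (cfI F j) (cfI F k)
        (act C A F j k ?a (Defs.tau B (cfI F i) (cfI F j) \<odot> act C A F i j ?b ?c)) (act C A F i j ?b ?c)"
    proof (rule mult)
      show "?s \<odot> ?b = ?t \<odot> ?c" using I A.Cmp_reassoc[OF pbs(10), of d] by simp
      show "Defs.sgm A j k \<odot> ?a = Defs.tau A i j \<odot> ?b"
      proof -
        have "f \<odot> d = Defs.tau A i j \<odot> ?b" using I by (simp add: f_def)
        then show ?thesis using pbs'(10) by (simp add: d_def)
      qed
    qed (use I f in simp_all)
    then show "let f = Defs.tau A i j \<odot> pb1 C (Defs.sgm A i j) (cf0 F i);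
          a = pb1 C (Defs.sgm A j k) f;
          d = pb2 C (Defs.sgm A j k) f;
          b = pb1 C (Defs.sgm A i j) (cf0 F i) \<odot> d;
          c = pb2 C (Defs.sgm A i j) (cf0 F i) \<odot> d;
          w = cf1 F i j \<odot> d
      in cf1 F i k \<odot> pair C (Defs.sgm A i k) (cf0 F i)
           (mu A i j k \<odot> pair C (Defs.sgm A j k) (Defs.tau A i j) a b) c
         = mu B (cfI F i) (cfI F j) (cfI F k) \<odot>
           pair C (Defs.sgm B (cfI F j) (cfI F k)) (Defs.tau B (cfI F i) (cfI F j))
             (cf1 F j k \<odot>
               pair C (Defs.sgm A j k) (cf0 F j) a (Defs.tau B (cfI F i) (cfI F j) \<odot> w))
             w"
      unfolding bc[symmetric]
      by (simp add: Let_def mul_def act_def f_def[symmetric] d_def[symmetric])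
  qed (use ext cf0 cf1 sgm tau unit total in \<open>auto simp: act_def\<close>)
qed

lemma is_cofunctor_extensional:
  assumes "is_cofunctor C A B F"
  shows "cfI F \<in> extensional (Ix A)" "cf0 F \<in> extensional (Ix A)" "cf1 F \<in> extensional (Ix A)"
    "i \<in> Ix A \<Longrightarrow> cf1 F i \<in> extensional (Ix A)"
  using assms by (simp_all add: is_cofunctor_def PiE_def)

lemma cofun_eqI:
  assumes F: "is_cofunctor C A B F" and G: "is_cofunctor C A B' G"
    and I: "\<And>i. i \<in> Ix A \<Longrightarrow> cfI F i = cfI G i" and c0: "\<And>i. i \<in> Ix A \<Longrightarrow> cf0 F i = cf0 G i"
    and c1: "\<And>i j. \<lbrakk>i \<in> Ix A; j \<in> Ix A\<rbrakk> \<Longrightarrow> cf1 F i j = cf1 G i j"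
  shows "F = G"
proof -
  have "cfI F = cfI G"
    by (rule extensionalityI[of _ "Ix A"]) (use is_cofunctor_extensional[OF F] is_cofunctor_extensional[OF G] I in auto)
  moreover have "cf0 F = cf0 G"
    by (rule extensionalityI[of _ "Ix A"]) (use is_cofunctor_extensional[OF F] is_cofunctor_extensional[OF G] c0 in auto)
  moreover have "cf1 F = cf1 G"
  proof (rule extensionalityI[of _ "Ix A"])
    show "cf1 F i = cf1 G i" if i: "i \<in> Ix A" for i
      by (rule extensionalityI[of _ "Ix A"]) (use is_cofunctor_extensional[OF F] is_cofunctor_extensional[OF G] c1 i in auto)
  qed (use is_cofunctor_extensional[OF F] is_cofunctor_extensional[OF G] in auto)
  ultimately show ?thesis by simp
qed

subsection \<open>The category of partite groupoids\<close>

lemma (in partite_category) act_id: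
  assumes "i \<in> Ix A" "j \<in> Ix A" "x \<in> Ar C" "tgt x = P1 A i j"
  shows "act C A (id_cofun C A) i j x (sgm A i j \<odot> x) = x"
  using assms pair_simps[of "sgm A i j" "Idn C (P0 A i)" x "sgm A i j \<odot> x"]
  by (simp add: act_def id_cofun_def)

lemma (in partite_category) is_cofunctor_id: "is_cofunctor C A A (id_cofun C A)"
proof -
  let ?F = "id_cofun C A"
  have FI [simp]: "cfI ?F i = i" "cf0 ?F i = Idn C (P0 A i)" if "i \<in> Ix A" for i
    using that by (simp_all add: id_cofun_def)
  have F1 [simp]: "cf1 ?F i j = pb1 C (sgm A i j) (Idn C (P0 A i))" if "i \<in> Ix A" "j \<in> Ix A" for i j
    using that by (simp add: id_cofun_def)
  have aid: "act C A ?F i j x b = x"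
    if "i \<in> Ix A" "j \<in> Ix A" "x \<in> Ar C" "tgt x = P1 A i j" "sgm A i j \<odot> x = b" for i j x b
    using act_id that by blast
  note pbs = pb_simps[of "sgm A i j" "Idn C (P0 A i)" for i j, simp]
  show ?thesis
  proof (rule is_cofunctorI)
    fix i j k x y b
    assume *: "i \<in> Ix A" "j \<in> Ix A" "k \<in> Ix A" "x \<in> Ar C" "tgt x = P1 A i j"
        "y \<in> Ar C" "src y = src x" "tgt y = P1 A j k" "b \<in> Ar C" "src b = src x" "tgt b = P0 A (cfI ?F i)"
        "sgm A i j \<odot> x = cf0 ?F i \<odot> b" "sgm A j k \<odot> y = tau A i j \<odot> x"
    then show "act C A ?F i k (mul C A i j k y x) b = mul C A (cfI ?F i) (cfI ?F j) (cfI ?F k)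
        (act C A ?F j k y (tau A (cfI ?F i) (cfI ?F j) \<odot> act C A ?F i j x b)) (act C A ?F i j x b)"
      by (simp add: aid mul_simps)
  qed (use partite_category_axioms aid in \<open>auto simp: hom_iff id_cofun_def\<close>)
qed

locale composable_cofunctors = F: cofunctor C A B F + G: cofunctor C B D G
  for C :: "('o, 'u) rcat" (structure) and A B D F G
begin

abbreviation "GF \<equiv> comp_cofun C A B G F"

lemma comp_cofun_simps [simp]:
  "i \<in> Ix A \<Longrightarrow> cfI GF i = cfI G (cfI F i)"
  "i \<in> Ix A \<Longrightarrow> cf0 GF i = cf0 F i \<odot> cf0 G (cfI F i)"
  by (simp_all add: comp_cofun_def)

lemma cf1_comp:
  assumes "i \<in> Ix A" "j \<in> Ix A"
  defines "f \<equiv> cf0 F i \<odot> cf0 G (cfI F i)"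
  shows "cf1 GF i j = act C B G (cfI F i) (cfI F j)
    (act C A F i j (pb1 C (sgm A i j) f) (cf0 G (cfI F i) \<odot> pb2 C (sgm A i j) f)) (pb2 C (sgm A i j) f)"
  using assms by (simp add: comp_cofun_def act_def Let_def)

lemma has_pb_comp: "\<lbrakk>i \<in> Ix A; j \<in> Ix A\<rbrakk> \<Longrightarrow> has_pb C (sgm A i j) (cf0 F i \<odot> cf0 G (cfI F i))"
  by simp

text \<open>\<open>cf1_comp\<close> is this formula at the pullback projections; naturality of both
  actions extends it to every element.\<close>

lemma act_comp:
  assumes I: "i \<in> Ix A" "j \<in> Ix A"
    and x: "x \<in> Ar C" "tgt x = P1 A i j" and c: "c \<in> Ar C" "src c = src x" "tgt c = P0 D (cfI G (cfI F i))"
    and xc: "sgm A i j \<odot> x = cf0 F i \<odot> cf0 G (cfI F i) \<odot> c"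
  shows "act C A GF i j x c =
    act C B G (cfI F i) (cfI F j) (act C A F i j x (cf0 G (cfI F i) \<odot> c)) c"
proof -
  note pb = has_pb_comp[OF I]
  let ?f = "cf0 F i \<odot> cf0 G (cfI F i)"
  let ?p = "pair C (sgm A i j) ?f x c"
  note pbs = F.A.pb_simps[OF pb, simp]
  have p: "?p \<in> Ar C" "src ?p = src x" "tgt ?p = pbo C (sgm A i j) ?f"
    "pb1 C (sgm A i j) ?f \<odot> ?p = x" "pb2 C (sgm A i j) ?f \<odot> ?p = c"
    using F.A.pair_simps[OF pb, of x c] assms by simp_all
  note [simp] = F.act_simps G.act_simps I
  have sq: "sgm A i j \<odot> pb1 C (sgm A i j) ?f = cf0 F i \<odot> cf0 G (cfI F i) \<odot> pb2 C (sgm A i j) ?f"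
    using pbs(10) by simp
  have "act C A GF i j x c = cf1 GF i j \<odot> ?p" by (simp add: act_def)
  also have "\<dots> = act C B G (cfI F i) (cfI F j) (act C A F i j x (cf0 G (cfI F i) \<odot> c)) c"
    unfolding cf1_comp[OF I] using sq p by (simp add: G.act_Cmp F.act_Cmp)
  finally show ?thesis .
qed

lemma is_cofunctor_comp: "is_cofunctor C A D GF"
proof (rule is_cofunctorI)
  show "cfI GF \<in> Ix A \<rightarrow>\<^sub>E Ix D" "cf0 GF \<in> extensional (Ix A)" "cf1 GF \<in> extensional (Ix A)"
    by (auto simp: comp_cofun_def)
  show "cf1 GF i \<in> extensional (Ix A)" if "i \<in> Ix A" for i
    using that by (auto simp: comp_cofun_def)
  fix i j assume I: "i \<in> Ix A" "j \<in> Ix A"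
  note pbs = F.A.pb_simps[OF has_pb_comp[OF I], simp]
  have sq: "sgm A i j \<odot> pb1 C (sgm A i j) (cf0 F i \<odot> cf0 G (cfI F i))
      = cf0 F i \<odot> cf0 G (cfI F i) \<odot> pb2 C (sgm A i j) (cf0 F i \<odot> cf0 G (cfI F i))"
    using pbs(10) I by simp
  note [simp] = F.act_simps G.act_simps
  show "cf1 GF i j \<in> hom C (pbo C (sgm A i j) (cf0 GF i)) (P1 D (cfI GF i) (cfI GF j))"
    "sgm D (cfI GF i) (cfI GF j) \<odot> cf1 GF i j = pb2 C (sgm A i j) (cf0 GF i)"
    "cf0 GF j \<odot> tau D (cfI GF i) (cfI GF j) \<odot> cf1 GF i j = tau A i j \<odot> pb1 C (sgm A i j) (cf0 GF i)"
    using I sq by (simp_all add: cf1_comp F.A.hom_iff)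
next
  fix i assume I: "i \<in> Ix A"
  have "act C A GF i i (eta A i \<odot> cf0 F i \<odot> cf0 G (cfI F i)) (Idn C (P0 D (cfI G (cfI F i))))
    = act C B G (cfI F i) (cfI F i)
      (act C A F i i (eta A i \<odot> cf0 F i \<odot> cf0 G (cfI F i)) (cf0 G (cfI F i))) (Idn C (P0 D (cfI G (cfI F i))))"
    using I by (subst act_comp) auto
  also have "act C A F i i (eta A i \<odot> cf0 F i \<odot> cf0 G (cfI F i)) (cf0 G (cfI F i)) = eta B (cfI F i) \<odot> cf0 G (cfI F i)"
    using F.act_eta[of i "cf0 G (cfI F i)"] I by simp
  also have "act C B G (cfI F i) (cfI F i) (eta B (cfI F i) \<odot> cf0 G (cfI F i)) (Idn C (P0 D (cfI G (cfI F i))))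
      = eta D (cfI G (cfI F i))"
    using G.act_eta[of "cfI F i" "Idn C (P0 D (cfI G (cfI F i)))"] I by simp
  finally show "act C A GF i i (eta A i \<odot> cf0 GF i) (Idn C (P0 D (cfI GF i))) = eta D (cfI GF i)"
    using I by simp
next
  fix i j k x y b
  assume *: "i \<in> Ix A" "j \<in> Ix A" "k \<in> Ix A" "x \<in> Ar C" "tgt x = P1 A i j"
      "y \<in> Ar C" "src y = src x" "tgt y = P1 A j k" "b \<in> Ar C" "src b = src x" "tgt b = P0 D (cfI GF i)"
      "sgm A i j \<odot> x = cf0 GF i \<odot> b" "sgm A j k \<odot> y = tau A i j \<odot> x"
  then have **: "tgt b = P0 D (cfI G (cfI F i))" "sgm A i j \<odot> x = cf0 F i \<odot> cf0 G (cfI F i) \<odot> b"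
    by auto
  note [simp] = F.act_simps G.act_simps F.A.mul_simps F.B.mul_simps G.B.mul_simps *(1-10,13) **
  show "act C A GF i k (mul C A i j k y x) b = mul C D (cfI GF i) (cfI GF j) (cfI GF k)
      (act C A GF j k y (tau D (cfI GF i) (cfI GF j) \<odot> act C A GF i j x b)) (act C A GF i j x b)"
    by (simp add: act_comp F.act_mul G.act_mul)
qed (use F.A.partite_category_axioms G.B.partite_category_axioms in \<open>auto simp: F.A.hom_iff\<close>)

end

text \<open>Equality of the components \<open>cf1\<close> is checked at the projections of the
  pullback on which they are defined, where composition is given by the actions. Every object
  certifies that \<open>C\<close> is a restriction category, since that is part of being a partite
  groupoid.\<close>

lemma category_pGpd:
  fixes C :: "('o, 'u) rcat" (structure)
  shows "category (pGpd C)"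
proof
  have pc: "partite_category C A" if "partite_groupoid C A" for A
    using that by (simp add: partite_groupoid_def)
  have cf: "cofunctor C A B F" if "partite_groupoid C A" "partite_groupoid C B" "is_cofunctor C A B F" for A B F
    using that pc by (simp add: cofunctor_def cofunctor_axioms_def)
  have comp: "composable_cofunctors C A B D F G"
    if "partite_groupoid C A" "partite_groupoid C B" "partite_groupoid C D"
      "is_cofunctor C A B F" "is_cofunctor C B D G" for A B D F G
    using that cf by (simp add: composable_cofunctors_def)
  show "Idn (pGpd C) A \<in> hom (pGpd C) A A" if "A \<in> Ob (pGpd C)" for A
    using that pc partite_category.is_cofunctor_id by (auto simp: pGpd_def hom_def)
  show "G \<odot>\<^bsub>pGpd C\<^esub> F \<in> hom (pGpd C) (src F) (tgt G)"
    if "F \<in> Ar (pGpd C)" "G \<in> Ar (pGpd C)" "tgt F = src G" for F G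
    using that comp composable_cofunctors.is_cofunctor_comp by (fastforce simp: pGpd_def hom_def)
  show "F \<odot>\<^bsub>pGpd C\<^esub> Idn (pGpd C) (src F) = F" if F: "F \<in> Ar (pGpd C)" for F
  proof -
    obtain A K B where FE: "F = Arr A K B" by (cases F)
    have g: "partite_groupoid C A" "partite_groupoid C B" "is_cofunctor C A B K"
      using F by (auto simp: pGpd_def FE)
    interpret K: cofunctor C A B K using cf[OF g] .
    interpret KI: composable_cofunctors C A A B "id_cofun C A" K
      by (rule comp) (use g K.A.is_cofunctor_id in auto)
    have "comp_cofun C A A K (id_cofun C A) = K"
    proof (rule cofun_eqI[OF KI.is_cofunctor_comp g(3)])
      fix i j assume I: "i \<in> Ix A" "j \<in> Ix A"
      note [simp] = I
      have id: "cfI (id_cofun C A) l = l" "cf0 (id_cofun C A) l = Idn C (P0 A l)" if "l \<in> Ix A" for l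
        using that by (auto simp: id_cofun_def)
      show "cfI (comp_cofun C A A K (id_cofun C A)) i = cfI K i"
        "cf0 (comp_cofun C A A K (id_cofun C A)) i = cf0 K i" by (auto simp: id)
      let ?a = "pb1 C (sgm A i j) (cf0 K i)" and ?b = "pb2 C (sgm A i j) (cf0 K i)"
      note pbs = K.A.pb_simps[OF K.has_pb_cf[OF I], simp]
      have "cf1 (comp_cofun C A A K (id_cofun C A)) i j =
          act C A K i j (act C A (id_cofun C A) i j ?a (cf0 K i \<odot> ?b)) ?b"
        using KI.cf1_comp[OF I] by (simp add: id)
      also have "act C A (id_cofun C A) i j ?a (cf0 K i \<odot> ?b) = ?a"
        using K.A.act_id[of i j ?a] pbs(10) by simp
      finally show "cf1 (comp_cofun C A A K (id_cofun C A)) i j = cf1 K i j"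
        by (simp add: K.cf1_act)
    qed
    then show ?thesis by (simp add: FE pGpd_def)
  qed
  show "Idn (pGpd C) (tgt F) \<odot>\<^bsub>pGpd C\<^esub> F = F" if F: "F \<in> Ar (pGpd C)" for F
  proof -
    obtain A K B where FE: "F = Arr A K B" by (cases F)
    have g: "partite_groupoid C A" "partite_groupoid C B" "is_cofunctor C A B K"
      using F by (auto simp: pGpd_def FE)
    interpret K: cofunctor C A B K using cf[OF g] .
    interpret IK: composable_cofunctors C A B B K "id_cofun C B"
      by (rule comp) (use g K.B.is_cofunctor_id in auto)
    have "comp_cofun C A B (id_cofun C B) K = K"
    proof (rule cofun_eqI[OF IK.is_cofunctor_comp g(3)])
      fix i j assume I: "i \<in> Ix A" "j \<in> Ix A"
      note [simp] = I
      have id: "cfI (id_cofun C B) l = l" "cf0 (id_cofun C B) l = Idn C (P0 B l)" if "l \<in> Ix B" for l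
        using that by (auto simp: id_cofun_def)
      show "cfI (comp_cofun C A B (id_cofun C B) K) i = cfI K i"
        "cf0 (comp_cofun C A B (id_cofun C B) K) i = cf0 K i" by (auto simp: id)
      let ?a = "pb1 C (sgm A i j) (cf0 K i)" and ?b = "pb2 C (sgm A i j) (cf0 K i)"
      note pbs = K.A.pb_simps[OF K.has_pb_cf[OF I], simp]
      note [simp] = K.act_simps
      have "cf1 (comp_cofun C A B (id_cofun C B) K) i j =
          act C B (id_cofun C B) (cfI K i) (cfI K j) (act C A K i j ?a ?b) ?b"
        using IK.cf1_comp[OF I] by (simp add: id)
      also have "\<dots> = act C A K i j ?a ?b"
        using K.B.act_id[of "cfI K i" "cfI K j" "act C A K i j ?a ?b"] pbs(10) by simp
      finally show "cf1 (comp_cofun C A B (id_cofun C B) K) i j = cf1 K i j"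
        by (simp add: K.cf1_act)
    qed
    then show ?thesis by (simp add: FE pGpd_def)
  qed
  show "(H \<odot>\<^bsub>pGpd C\<^esub> G) \<odot>\<^bsub>pGpd C\<^esub> F = H \<odot>\<^bsub>pGpd C\<^esub> (G \<odot>\<^bsub>pGpd C\<^esub> F)"
    if FGH: "F \<in> Ar (pGpd C)" "G \<in> Ar (pGpd C)" "H \<in> Ar (pGpd C)" "tgt F = src G" "tgt G = src H" for F G H
  proof -
    obtain A K B where FE: "F = Arr A K B" by (cases F)
    obtain L D where GE: "G = Arr B L D" using FGH(4) FE by (cases G) auto
    obtain M E where HE: "H = Arr D M E" using FGH(5) GE by (cases H) auto
    have g: "partite_groupoid C A" "partite_groupoid C B" "partite_groupoid C D" "partite_groupoid C E"
      "is_cofunctor C A B K" "is_cofunctor C B D L" "is_cofunctor C D E M"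
      using FGH by (auto simp: pGpd_def FE GE HE)
    interpret FG: composable_cofunctors C A B D K L by (rule comp) (use g in auto)
    interpret GH: composable_cofunctors C B D E L M by (rule comp) (use g in auto)
    interpret FG_H: composable_cofunctors C A D E "comp_cofun C A B L K" M
      by (rule comp) (use g FG.is_cofunctor_comp in auto)
    interpret F_GH: composable_cofunctors C A B E K "comp_cofun C B D M L"
      by (rule comp) (use g GH.is_cofunctor_comp in auto)
    have "comp_cofun C A B (comp_cofun C B D M L) K = comp_cofun C A D M (comp_cofun C A B L K)"
    proof (rule cofun_eqI[OF F_GH.is_cofunctor_comp FG_H.is_cofunctor_comp])
      fix i j assume I: "i \<in> Ix A" "j \<in> Ix A"
      note [simp] = I
      show "cfI (comp_cofun C A B (comp_cofun C B D M L) K) i = cfI (comp_cofun C A D M (comp_cofun C A B L K)) i"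
        "cf0 (comp_cofun C A B (comp_cofun C B D M L) K) i = cf0 (comp_cofun C A D M (comp_cofun C A B L K)) i"
        by auto
      let ?f = "cf0 K i \<odot> cf0 L (cfI K i) \<odot> cf0 M (cfI L (cfI K i))"
      let ?a = "pb1 C (sgm A i j) ?f" and ?c = "pb2 C (sgm A i j) ?f"
      have pb: "has_pb C (sgm A i j) ?f" by simp
      note pbs = FG.F.A.pb_simps[OF pb, simp]
      have sq: "sgm A i j \<odot> ?a = cf0 K i \<odot> cf0 L (cfI K i) \<odot> cf0 M (cfI L (cfI K i)) \<odot> ?c"
        using pbs(10) by simp
      note [simp] = FG.F.act_simps FG.G.act_simps GH.G.act_simps
      show "cf1 (comp_cofun C A B (comp_cofun C B D M L) K) i j = cf1 (comp_cofun C A D M (comp_cofun C A B L K)) i j"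
        using sq by (simp add: F_GH.cf1_comp FG_H.cf1_comp FG.act_comp GH.act_comp)
    qed
    then show ?thesis by (simp add: FE GE HE pGpd_def)
  qed
qed (auto simp: pGpd_def)

section \<open>The category of inverse categories over a restriction category\<close>

lemma is_over_map_iff:
  "is_over_map C X Y h \<longleftrightarrow>
    FO (fst h) \<in> extensional (Ob (fst X)) \<and> FA (fst h) \<in> extensional (Ar (fst X)) \<and>
    snd h \<in> extensional (Ob (fst X)) \<and> is_functor (fst X) (fst Y) (fst h) \<and>
    is_nat_trans (fst X) C (comp_fctr (snd Y) (fst h)) (snd X) (snd h) \<and>
    (\<forall>i \<in> Ob (fst X). total_map C (snd h i))"
  by (simp add: is_over_map_def split_beta)

lemma is_over_obj_iff:
  "is_over_obj C X \<longleftrightarrow> inverse_category (fst X) \<and> Ob (fst X) \<prec> (UNIV :: 'u set) \<and>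
    small_hom_sets (fst X) \<and> is_restriction_functor (fst X) C (snd X)"
  for C :: "('o, 'u) rcat"
  by (simp add: is_over_obj_def split_beta)

lemma id_over_simps [simp]:
  "FO (fst (id_over C X)) = (\<lambda>i \<in> Ob (fst X). i)"
  "FA (fst (id_over C X)) = (\<lambda>f \<in> Ar (fst X). f)"
  "snd (id_over C X) = (\<lambda>i \<in> Ob (fst X). Idn C (FO (snd X) i))"
  by (simp_all add: id_over_def split_beta)

lemma comp_over_simps [simp]:
  "FO (fst (comp_over C X k h)) = (\<lambda>i \<in> Ob (fst X). FO (fst k) (FO (fst h) i))"
  "FA (fst (comp_over C X k h)) = (\<lambda>f \<in> Ar (fst X). FA (fst k) (FA (fst h) f))"
  "snd (comp_over C X k h) = (\<lambda>i \<in> Ob (fst X). snd h i \<odot>\<^bsub>C\<^esub> snd k (FO (fst h) i))"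
  by (simp_all add: comp_over_def split_beta)

lemma over_map_eqI:
  assumes "is_over_map C X Y h" "is_over_map C X Y' k"
    and "\<And>i. i \<in> Ob (fst X) \<Longrightarrow> FO (fst h) i = FO (fst k) i"
    and "\<And>f. f \<in> Ar (fst X) \<Longrightarrow> FA (fst h) f = FA (fst k) f"
    and "\<And>i. i \<in> Ob (fst X) \<Longrightarrow> snd h i = snd k i"
  shows "h = k"
proof -
  have ext: "FO (fst h) \<in> extensional (Ob (fst X))" "FO (fst k) \<in> extensional (Ob (fst X))"
    "FA (fst h) \<in> extensional (Ar (fst X))" "FA (fst k) \<in> extensional (Ar (fst X))"
    "snd h \<in> extensional (Ob (fst X))" "snd k \<in> extensional (Ob (fst X))"
    using assms(1,2) by (simp_all add: is_over_map_iff)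
  have "FO (fst h) = FO (fst k)" using ext(1,2) assms(3) by (rule extensionalityI)
  moreover have "FA (fst h) = FA (fst k)" using ext(3,4) assms(4) by (rule extensionalityI)
  moreover have "snd h = snd k" using ext(5,6) assms(5) by (rule extensionalityI)
  ultimately show ?thesis by (simp add: prod_eq_iff)
qed

lemma is_over_map_id:
  assumes "is_over_obj C X"
  shows "is_over_map C X X (id_over C X)"
proof -
  interpret D: category "fst X" using assms by (simp add: is_over_obj_iff inverse_category_def)
  have P: "is_functor (fst X) C (snd X)" using assms by (simp add: is_over_obj_iff is_restriction_functor_def)
  interpret C: category C using P by (simp add: is_functor_def)
  have PA: "FA (snd X) f \<in> hom C (FO (snd X) (src f)) (FO (snd X) (tgt f))" if "f \<in> Ar (fst X)" for f
    using P that by (auto simp: is_functor_def)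
  have PO: "FO (snd X) i \<in> Ob C" if "i \<in> Ob (fst X)" for i using P that by (auto simp: is_functor_def)
  have "restriction_category C" using assms by (simp add: is_over_obj_iff is_restriction_functor_def)
  then interpret C: restriction_category C .
  have "is_functor (fst X) (fst X) (fst (id_over C X))"
    by (auto simp: is_functor_def D.category_axioms D.hom_iff)
  moreover have "is_functor (fst X) C (comp_fctr (snd X) (fst (id_over C X)))"
    using P by (auto simp: is_functor_def comp_fctr_def)
  ultimately show ?thesis using PA PO P
    by (auto simp: is_over_map_iff is_nat_trans_def comp_fctr_def C.hom_iff)
qed

lemma is_over_map_comp:
  assumes "restriction_category C" "is_over_map C X Y h" "is_over_map C Y Z k"
  shows "is_over_map C X Z (comp_over C X k h)"
proof -
  interpret C: restriction_category C by fact
  have F: "is_functor (fst X) (fst Y) (fst h)" "is_functor (fst Y) (fst Z) (fst k)"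
    using assms by (auto simp: is_over_map_iff)
  interpret X: category "fst X" using F by (simp add: is_functor_def)
  interpret Y: category "fst Y" using F by (simp add: is_functor_def)
  interpret Z: category "fst Z" using F by (simp add: is_functor_def)
  have hO: "FO (fst h) i \<in> Ob (fst Y)" if "i \<in> Ob (fst X)" for i using F that by (auto simp: is_functor_def)
  have kO: "FO (fst k) i \<in> Ob (fst Z)" if "i \<in> Ob (fst Y)" for i using F that by (auto simp: is_functor_def)
  have hA: "FA (fst h) f \<in> Ar (fst Y)" "src (FA (fst h) f) = FO (fst h) (src f)" "tgt (FA (fst h) f) = FO (fst h) (tgt f)"
    if "f \<in> Ar (fst X)" for f using F that by (auto simp: is_functor_def Y.hom_iff)
  have kA: "FA (fst k) f \<in> Ar (fst Z)" "src (FA (fst k) f) = FO (fst k) (src f)" "tgt (FA (fst k) f) = FO (fst k) (tgt f)"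
    if "f \<in> Ar (fst Y)" for f using F that by (auto simp: is_functor_def Z.hom_iff)
  have hk: "is_functor (fst X) (fst Z) (fst (comp_over C X k h))"
    using F hO kO hA kA by (auto simp: is_functor_def Z.hom_iff)
  have nh: "is_nat_trans (fst X) C (comp_fctr (snd Y) (fst h)) (snd X) (snd h)"
    and nk: "is_nat_trans (fst Y) C (comp_fctr (snd Z) (fst k)) (snd Y) (snd k)"
    using assms by (auto simp: is_over_map_iff)
  have PX: "is_functor (fst X) C (snd X)" and PY: "is_functor (fst Y) C (snd Y)"
    and QZ: "is_functor (fst Y) C (comp_fctr (snd Z) (fst k))"
    using nh nk by (auto simp: is_nat_trans_def)
  have XA: "FA (snd X) f \<in> Ar C" "src (FA (snd X) f) = FO (snd X) (src f)" "tgt (FA (snd X) f) = FO (snd X) (tgt f)"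
    if "f \<in> Ar (fst X)" for f using PX that by (auto simp: is_functor_def C.hom_iff)
  have YA: "FA (snd Y) f \<in> Ar C" "src (FA (snd Y) f) = FO (snd Y) (src f)" "tgt (FA (snd Y) f) = FO (snd Y) (tgt f)"
    if "f \<in> Ar (fst Y)" for f using PY that by (auto simp: is_functor_def C.hom_iff)
  have ZA: "FA (snd Z) (FA (fst k) f) \<in> Ar C" "src (FA (snd Z) (FA (fst k) f)) = FO (snd Z) (FO (fst k) (src f))"
    "tgt (FA (snd Z) (FA (fst k) f)) = FO (snd Z) (FO (fst k) (tgt f))"
    if "f \<in> Ar (fst Y)" for f using QZ that by (auto simp: is_functor_def C.hom_iff comp_fctr_def)
  have ah: "snd h i \<in> Ar C" "src (snd h i) = FO (snd Y) (FO (fst h) i)" "tgt (snd h i) = FO (snd X) i" "total_map C (snd h i)"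
    if "i \<in> Ob (fst X)" for i using nh assms(2) that by (auto simp: is_nat_trans_def C.hom_iff comp_fctr_def is_over_map_iff)
  have ak: "snd k i \<in> Ar C" "src (snd k i) = FO (snd Z) (FO (fst k) i)" "tgt (snd k i) = FO (snd Y) i" "total_map C (snd k i)"
    if "i \<in> Ob (fst Y)" for i using nk assms(3) that by (auto simp: is_nat_trans_def C.hom_iff comp_fctr_def is_over_map_iff)
  have nath: "FA (snd X) f \<odot>\<^bsub>C\<^esub> snd h (src f) = snd h (tgt f) \<odot>\<^bsub>C\<^esub> FA (snd Y) (FA (fst h) f)"
    if "f \<in> Ar (fst X)" for f using nh that by (auto simp: is_nat_trans_def comp_fctr_def)
  have natk: "FA (snd Y) f \<odot>\<^bsub>C\<^esub> snd k (src f) = snd k (tgt f) \<odot>\<^bsub>C\<^esub> FA (snd Z) (FA (fst k) f)"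
    if "f \<in> Ar (fst Y)" for f using nk that by (auto simp: is_nat_trans_def comp_fctr_def)
  have "is_functor (fst X) C (comp_fctr (snd Z) (fst (comp_over C X k h)))"
    using F QZ hO kO hA kA C.category_axioms ZA
    by (auto simp: is_functor_def C.hom_iff comp_fctr_def)
  moreover have "FA (snd X) f \<odot>\<^bsub>C\<^esub> snd h (src f) \<odot>\<^bsub>C\<^esub> snd k (FO (fst h) (src f)) =
      (snd h (tgt f) \<odot>\<^bsub>C\<^esub> snd k (FO (fst h) (tgt f))) \<odot>\<^bsub>C\<^esub> FA (snd Z) (FA (fst k) (FA (fst h) f))"
    if f: "f \<in> Ar (fst X)" for f
  proof -
    have "FA (snd X) f \<odot>\<^bsub>C\<^esub> snd h (src f) \<odot>\<^bsub>C\<^esub> snd k (FO (fst h) (src f))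
      = (snd h (tgt f) \<odot>\<^bsub>C\<^esub> FA (snd Y) (FA (fst h) f)) \<odot>\<^bsub>C\<^esub> snd k (FO (fst h) (src f))"
      by (rule C.Cmp_reassoc[OF nath[OF f]]) (use f hO hA XA ah ak in auto)
    also have "\<dots> = snd h (tgt f) \<odot>\<^bsub>C\<^esub> FA (snd Y) (FA (fst h) f) \<odot>\<^bsub>C\<^esub> snd k (FO (fst h) (src f))"
      using f hO hA YA ah ak by simp
    also have "\<dots> = snd h (tgt f) \<odot>\<^bsub>C\<^esub> snd k (FO (fst h) (tgt f)) \<odot>\<^bsub>C\<^esub> FA (snd Z) (FA (fst k) (FA (fst h) f))"
      using natk[of "FA (fst h) f"] f hA by simp
    also have "\<dots> = (snd h (tgt f) \<odot>\<^bsub>C\<^esub> snd k (FO (fst h) (tgt f))) \<odot>\<^bsub>C\<^esub> FA (snd Z) (FA (fst k) (FA (fst h) f))"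
      using f hO hA ZA ah ak by simp
    finally show ?thesis .
  qed
  ultimately show ?thesis
    using hk PX ah ak hO by (auto simp: is_over_map_iff is_nat_trans_def C.hom_iff comp_fctr_def)
qed

lemma category_iCat_over:
  assumes "restriction_category C"
  shows "category (iCat_over C)"
proof
  interpret C: restriction_category C by fact
  show "Idn (iCat_over C) X \<in> hom (iCat_over C) X X" if "X \<in> Ob (iCat_over C)" for X
    using that is_over_map_id[of C X] by (simp add: iCat_over_def hom_def)
  show "G \<odot>\<^bsub>iCat_over C\<^esub> F \<in> hom (iCat_over C) (src F) (tgt G)"
    if "F \<in> Ar (iCat_over C)" "G \<in> Ar (iCat_over C)" "tgt F = src G" for F G
    using that is_over_map_comp[OF assms] by (fastforce simp: iCat_over_def hom_def)
  have facts: "FO (fst h) i \<in> Ob (fst Y)" "snd h i \<in> Ar C" "src (snd h i) = FO (snd Y) (FO (fst h) i)"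
    "tgt (snd h i) = FO (snd X) i"
    if "is_over_map C X Y h" "i \<in> Ob (fst X)" for h X Y i
    using that by (auto simp: is_over_map_iff is_functor_def is_nat_trans_def comp_fctr_def C.hom_iff)
  have facts': "FA (fst h) f \<in> Ar (fst Y)" if "is_over_map C X Y h" "f \<in> Ar (fst X)" for h X Y f
    using that by (auto simp: is_over_map_iff is_functor_def hom_def)
  show "F \<odot>\<^bsub>iCat_over C\<^esub> Idn (iCat_over C) (src F) = F" if F: "F \<in> Ar (iCat_over C)" for F
  proof -
    obtain X h Y where FE: "F = Arr X h Y" by (cases F)
    have h: "is_over_obj C X" "is_over_obj C Y" "is_over_map C X Y h"
      using F by (auto simp: iCat_over_def FE)
    have "comp_over C X h (id_over C X) = h"
      by (rule over_map_eqI[OF is_over_map_comp[OF assms is_over_map_id[OF h(1)] h(3)] h(3)])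
        (use facts[OF h(3)] in auto)
    then show ?thesis by (simp add: FE iCat_over_def)
  qed
  show "Idn (iCat_over C) (tgt F) \<odot>\<^bsub>iCat_over C\<^esub> F = F" if F: "F \<in> Ar (iCat_over C)" for F
  proof -
    obtain X h Y where FE: "F = Arr X h Y" by (cases F)
    have h: "is_over_obj C X" "is_over_obj C Y" "is_over_map C X Y h"
      using F by (auto simp: iCat_over_def FE)
    have "comp_over C X (id_over C Y) h = h"
      by (rule over_map_eqI[OF is_over_map_comp[OF assms h(3) is_over_map_id[OF h(2)]] h(3)])
        (use facts[OF h(3)] facts'[OF h(3)] in auto)
    then show ?thesis by (simp add: FE iCat_over_def)
  qed
  show "(H \<odot>\<^bsub>iCat_over C\<^esub> G) \<odot>\<^bsub>iCat_over C\<^esub> F = H \<odot>\<^bsub>iCat_over C\<^esub> (G \<odot>\<^bsub>iCat_over C\<^esub> F)"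
    if FGH: "F \<in> Ar (iCat_over C)" "G \<in> Ar (iCat_over C)" "H \<in> Ar (iCat_over C)" "tgt F = src G" "tgt G = src H" for F G H
  proof -
    obtain X h Y where FE: "F = Arr X h Y" by (cases F)
    obtain k Z where GE: "G = Arr Y k Z" using FGH(4) FE by (cases G) auto
    obtain l W where HE: "H = Arr Z l W" using FGH(5) GE by (cases H) auto
    have h: "is_over_map C X Y h" "is_over_map C Y Z k" "is_over_map C Z W l"
      using FGH by (auto simp: iCat_over_def FE GE HE)
    have "comp_over C X (comp_over C Y l k) h = comp_over C X l (comp_over C X k h)"
      by (rule over_map_eqI[OF is_over_map_comp[OF assms h(1) is_over_map_comp[OF assms h(2,3)]]
            is_over_map_comp[OF assms is_over_map_comp[OF assms h(1,2)] h(3)]])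
        (use facts[OF h(1)] facts[OF h(2)] facts[OF h(3)] facts'[OF h(1)] in auto)
    then show ?thesis by (simp add: FE GE HE iCat_over_def)
  qed
qed (auto simp: iCat_over_def)

section \<open>Inverse categories as restriction categories\<close>

text \<open>Since \<open>e\<close> is idempotent it absorbs its restriction on the left too:
  \<open>rst e e = e rst (e e) = e\<close>. Replacing this \<open>rst e\<close> by
  \<open>t e\<close> gives \<open>e = t e e = t e = rst e\<close>.\<close>

lemma (in restriction_category) idempotent_restriction:
  assumes "partial_inverse C e t" "src e = tgt e" "e \<odot> e = e"
  shows "rst C e = e"
proof -
  have e: "e \<in> Ar C" "t \<in> Ar C" "src t = src e" "tgt t = src e" "t \<odot> e = rst C e"
    using assms by (auto simp: partial_inverse_iff)
  have "e = rst C e \<odot> e"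
    using rst_Cmp[of e e] e(1) assms(2,3) Cmp_rst[of e] by metis
  also have "\<dots> = t \<odot> e \<odot> e"
    by (rule Cmp_reassoc[OF e(5), symmetric]) (use e assms(2) in auto)
  also have "\<dots> = rst C e" using e assms by simp
  finally show ?thesis by simp
qed

text \<open>The point is that \<open>t \<odot> s\<close> and \<open>s \<odot> t\<close> are
  idempotents which, like all maps here, have partial inverses, and so are restriction idempotents.
  Thus the algebraic inverse of an inverse category is the partial inverse of its restriction
  structure.\<close>

lemma (in restriction_category) is_star_iff_partial_inverse:
  assumes inv: "\<And>f. f \<in> Ar C \<Longrightarrow> partial_iso C f" and s: "s \<in> Ar C"
  shows "is_star C s t \<longleftrightarrow> partial_inverse C s t"
proof
  assume t: "is_star C s t"
  then have tA: "t \<in> Ar C" "src t = tgt s" "tgt t = src s" "s \<odot> t \<odot> s = s" "t \<odot> s \<odot> t = t"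
    by (auto simp: is_star_def hom_iff)
  have "rst C (t \<odot> s) = t \<odot> s" "rst C (s \<odot> t) = s \<odot> t"
  proof -
    have "partial_iso C (t \<odot> s)" "partial_iso C (s \<odot> t)" using inv s tA by auto
    then obtain u v where uv: "partial_inverse C (t \<odot> s) u" "partial_inverse C (s \<odot> t) v"
      by (auto simp: partial_iso_def)
    have "(t \<odot> s) \<odot> (t \<odot> s) = t \<odot> s" "(s \<odot> t) \<odot> (s \<odot> t) = s \<odot> t"
      using s tA by simp_all
    then show "rst C (t \<odot> s) = t \<odot> s" "rst C (s \<odot> t) = s \<odot> t"
      using idempotent_restriction[OF uv(1)] idempotent_restriction[OF uv(2)] s tA by simp_all
  qed
  moreover have "rst C (t \<odot> s) = rst C s"
  proof -
    have "rst C s \<odot> rst C (t \<odot> s) = rst C (t \<odot> s)" by (rule rst_le_src(2)) (use s tA in auto)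
    moreover have "rst C (t \<odot> s) \<odot> rst C s = rst C s"
      using rst_le_src(1)[of "t \<odot> s" s] rst_le_src(2)[of "t \<odot> s" s] tA s rst_commute[of s "t \<odot> s"] by simp
    ultimately show ?thesis using rst_commute[of s "t \<odot> s"] s tA by simp
  qed
  moreover have "rst C (s \<odot> t) = rst C t"
  proof -
    have "rst C t \<odot> rst C (s \<odot> t) = rst C (s \<odot> t)" by (rule rst_le_src(2)) (use s tA in auto)
    moreover have "rst C (s \<odot> t) \<odot> rst C t = rst C t"
      using rst_le_src(1)[of "s \<odot> t" t] rst_le_src(2)[of "s \<odot> t" t] tA s rst_commute[of t "s \<odot> t"] by simp
    ultimately show ?thesis using rst_commute[of t "s \<odot> t"] s tA by simp
  qed
  ultimately show "partial_inverse C s t" using s tA by (simp add: partial_inverse_iff)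
next
  assume "partial_inverse C s t"
  then show "is_star C s t" by (auto simp: partial_inverse_iff is_star_def hom_iff)
qed

lemma inverse_categoryI:
  assumes "restriction_category D" "\<And>f. f \<in> Ar D \<Longrightarrow> partial_iso D f"
  shows "inverse_category D"
proof -
  interpret restriction_category D by fact
  have ex: "\<exists>!t. is_star D s t" if s: "s \<in> Ar D" for s
  proof -
    obtain t where "partial_inverse D s t" using assms(2)[OF s] by (auto simp: partial_iso_def)
    then show ?thesis
      using partial_inverse_unique is_star_iff_partial_inverse[OF assms(2) s] by blast
  qed
  show ?thesis
  proof
    fix s assume s: "s \<in> Ar D"
    then have "is_star D s (star D s)" unfolding star_def by (rule theI'[OF ex])
    then show "rst D s = star D s \<odot>\<^bsub>D\<^esub> s"
      using is_star_iff_partial_inverse[OF assms(2) s] by (simp add: partial_inverse_iff)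
  qed (rule ex)
qed

text \<open>The restriction of an inverse category is \<open>star s \<odot> s\<close> by definition.
  As \<open>star\<close> is an involution, the second equation is the first one for
  \<open>star s\<close>.\<close>

lemma partial_inverse_star:
  assumes "restriction_category D" "inverse_category D" "s \<in> Ar D"
  shows "partial_inverse D s (star D s)"
proof -
  interpret inverse_category D by fact
  interpret restriction_category D by fact
  have star: "is_star D s (star D s)" if "s \<in> Ar D" for s
    unfolding star_def by (rule theI'[OF star_ex1[OF that]])
  have t: "star D s \<in> Ar D" "src (star D s) = tgt s" "tgt (star D s) = src s"
    using star[OF assms(3)] by (auto simp: is_star_def hom_iff)
  have "is_star D (star D s) s" using star[OF assms(3)] assms(3) t by (auto simp: is_star_def hom_iff)
  then have "star D (star D s) = s" using star[OF t(1)] star_ex1[OF t(1)] by blast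
  then show ?thesis
    using rst_star[OF assms(3)] rst_star[OF t(1)] t assms(3) by (simp add: partial_inverse_iff)
qed

lemma star_eq:
  assumes "restriction_category D" "inverse_category D" "partial_inverse D s t"
  shows "star D s = t"
proof -
  interpret restriction_category D by fact
  show ?thesis
    using partial_inverse_unique[OF partial_inverse_star[OF assms(1,2)] assms(3)] assms(3)
    by (simp add: partial_inverse_iff)
qed

lemma is_functor_comp:
  assumes "is_functor C D F" "is_functor D E G"
  shows "is_functor C E (comp_fctr G F)"
proof -
  interpret D: category D using assms by (simp add: is_functor_def)
  have F: "FA F f \<in> Ar D \<and> src (FA F f) = FO F (src f) \<and> tgt (FA F f) = FO F (tgt f)" if "f \<in> Ar C" for f
    using assms(1) that by (auto simp: is_functor_def D.hom_iff)
  have "FA G (FA F f) \<in> hom E (FO G (FO F (src f))) (FO G (FO F (tgt f)))" if "f \<in> Ar C" for f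
    using F[OF that] assms(2) unfolding is_functor_def by metis
  then show ?thesis using assms F by (auto simp: is_functor_def comp_fctr_def)
qed

lemma restriction_functor_simps:
  assumes "is_restriction_functor D C P"
  shows "f \<in> Ar D \<Longrightarrow> FA P f \<in> hom C (FO P (src f)) (FO P (tgt f))"
    "f \<in> Ar D \<Longrightarrow> FA P (rst D f) = rst C (FA P f)"
    "\<lbrakk>f \<in> Ar D; g \<in> Ar D; tgt f = src g\<rbrakk> \<Longrightarrow> FA P (g \<odot>\<^bsub>D\<^esub> f) = FA P g \<odot>\<^bsub>C\<^esub> FA P f"
    "restriction_category C" "restriction_category D"
  using assms by (auto simp: is_restriction_functor_def is_functor_def)

lemma functor_partial_inverse:
  assumes P: "is_restriction_functor D C P" and st: "partial_inverse D s t"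
  shows "partial_inverse C (FA P s) (FA P t)"
proof -
  note F = restriction_functor_simps[OF P]
  interpret D: restriction_category D by (rule F)
  interpret C: restriction_category C by (rule F)
  show ?thesis
    using st F(1,2)[of s] F(1,2)[of t] F(3)[of s t] F(3)[of t s]
    by (auto simp: D.partial_inverse_iff C.partial_inverse_iff C.hom_iff)
qed

lemma functor_compat:
  assumes P: "is_restriction_functor D C P" and c: "compat D f g" and fg: "f \<in> Ar D" "g \<in> Ar D"
  shows "compat C (FA P f) (FA P g)"
proof -
  note F = restriction_functor_simps[OF P]
  interpret D: restriction_category D by (rule F)
  interpret C: restriction_category C by (rule F)
  have c': "src f = src g" "tgt f = tgt g" "f \<odot>\<^bsub>D\<^esub> rst D g = g \<odot>\<^bsub>D\<^esub> rst D f"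
    using c by (auto simp: compat_def)
  have "FA P f \<odot>\<^bsub>C\<^esub> rst C (FA P g) = FA P g \<odot>\<^bsub>C\<^esub> rst C (FA P f)"
    using F(3)[of "rst D g" f] F(3)[of "rst D f" g] F(2)[OF fg(1)] F(2)[OF fg(2)] fg c' by simp
  then show ?thesis using F(1)[OF fg(1)] F(1)[OF fg(2)] c' by (simp add: compat_def C.hom_iff)
qed

section \<open>The functor of partial bisections\<close>

definition psec :: "('o, 'u) rcat \<Rightarrow> ('o, 'u) pcat \<Rightarrow> 'u \<Rightarrow> 'u \<Rightarrow> ('o, 'u) arr \<Rightarrow> bool" where
  "psec C A i j s \<longleftrightarrow> i \<in> Ix A \<and> j \<in> Ix A \<and> s \<in> Ar C \<and> src s = P0 A i \<and> tgt s = P1 A i j \<and>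
    sgm A i j \<odot>\<^bsub>C\<^esub> s = rst C s"

text \<open>The section \<open>s\<close> is cut down to the domain of \<open>w\<close> because only
  there do the two elements form a composable pair: \<open>sgm w = tau s rst w\<close>. By
  \<open>mu_tau_star\<close> this is the composition of \<open>Phi_cat\<close>.\<close>

definition scomp ::
  "('o, 'u) rcat \<Rightarrow> ('o, 'u) pcat \<Rightarrow> 'u \<Rightarrow> 'u \<Rightarrow> 'u \<Rightarrow> ('o, 'u) arr \<Rightarrow> ('o, 'u) arr \<Rightarrow> ('o, 'u) arr" where
  "scomp C A i j k t s =
    (let w = t \<odot>\<^bsub>C\<^esub> tau A i j \<odot>\<^bsub>C\<^esub> s in mul C A i j k w (s \<odot>\<^bsub>C\<^esub> rst C w))"

context partite_category
begin

lemma psec_simps: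
  assumes "psec C A i j s"
  shows "i \<in> Ix A" "j \<in> Ix A" "s \<in> Ar C" "src s = P0 A i" "tgt s = P1 A i j" "sgm A i j \<odot> s = rst C s"
  using assms by (auto simp: psec_def)

lemma psec_comp:
  assumes "psec C A i j s" "x \<in> Ar C" "tgt x = P0 A i"
  shows "sgm A i j \<odot> s \<odot> x = rst C s \<odot> x"
  by (rule Cmp_reassoc) (use psec_simps[OF assms(1)] assms in auto)

lemma psec_scomp_aux:
  assumes s: "psec C A i j s" and t: "psec C A j k t"
  defines "w \<equiv> t \<odot> tau A i j \<odot> s"
  shows "w \<in> Ar C" "src w = P0 A i" "tgt w = P1 A j k" "sgm A j k \<odot> w = tau A i j \<odot> s \<odot> rst C w"
    "rst C s \<odot> rst C w = rst C w"
proof -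
  note S = psec_simps[OF s] and T = psec_simps[OF t]
  show "w \<in> Ar C" "src w = P0 A i" "tgt w = P1 A j k" using S T by (auto simp: w_def)
  have "sgm A j k \<odot> w = rst C t \<odot> tau A i j \<odot> s"
    using S T psec_comp[OF t, of "tau A i j \<odot> s"] by (simp add: w_def)
  also have "\<dots> = tau A i j \<odot> s \<odot> rst C w"
    using S T rst_Cmp[of "tau A i j \<odot> s" t] by (simp add: w_def)
  finally show "sgm A j k \<odot> w = tau A i j \<odot> s \<odot> rst C w" .
  show "rst C s \<odot> rst C w = rst C w"
    using rst_le_src(2)[of s "t \<odot> tau A i j"] S T by (simp add: w_def)
qed

lemma scomp_simps:
  assumes s: "psec C A i j s" and t: "psec C A j k t"
  shows "psec C A i k (scomp C A i j k t s)" "rst C (scomp C A i j k t s) = rst C (t \<odot> tau A i j \<odot> s)"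
    "tau A i k \<odot> scomp C A i j k t s = tau A j k \<odot> t \<odot> tau A i j \<odot> s"
proof -
  note S = psec_simps[OF s] and T = psec_simps[OF t]
  define w where "w = t \<odot> tau A i j \<odot> s"
  note W = psec_scomp_aux[OF s t, folded w_def]
  note m = mul_simps[of i j k "s \<odot> rst C w" w]
  have rw: "rst C (s \<odot> rst C w) = rst C w"
    using rst_Cmp_rst[of w s] S W by simp
  show "rst C (scomp C A i j k t s) = rst C (t \<odot> tau A i j \<odot> s)"
    using m S T W rw by (simp add: scomp_def Let_def w_def[symmetric])
  show "tau A i k \<odot> scomp C A i j k t s = tau A j k \<odot> t \<odot> tau A i j \<odot> s"
    using m S T W by (simp add: scomp_def Let_def w_def[symmetric])
  show "psec C A i k (scomp C A i j k t s)"
    using m S T W rw psec_comp[OF s, of "rst C w"]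
    by (simp add: scomp_def Let_def w_def[symmetric] psec_def)
qed

text \<open>Inside the domain of the composite the restrictions disappear, which opens the way to
  calculating with \<open>mul\<close> alone.\<close>

lemma scomp_Cmp:
  assumes s: "psec C A i j s" and t: "psec C A j k t" and x: "x \<in> Ar C" "tgt x = P0 A i"
    and r: "rst C (t \<odot> tau A i j \<odot> s) \<odot> x = x"
  shows "scomp C A i j k t s \<odot> x = mul C A i j k (t \<odot> tau A i j \<odot> s \<odot> x) (s \<odot> x)"
proof -
  note S = psec_simps[OF s] and T = psec_simps[OF t]
  define w where "w = t \<odot> tau A i j \<odot> s"
  note W = psec_scomp_aux[OF s t, folded w_def]
  have "scomp C A i j k t s \<odot> x = mul C A i j k (w \<odot> x) (s \<odot> rst C w \<odot> x)"
    using mul_Cmp[of i j k "s \<odot> rst C w" w x] S T W x by (simp add: scomp_def Let_def w_def[symmetric])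
  also have "rst C w \<odot> x = x" using r by (simp add: w_def)
  finally show ?thesis using S T x by (simp add: w_def)
qed

text \<open>Both sides have the domain \<open>rst C ?w\<close> on which all three sections can be
  followed. Cut down to it, the three arrows become elements of equal domain and
  \<open>mul_assoc\<close> applies.\<close>

lemma scomp_assoc:
  assumes s: "psec C A i j s" and t: "psec C A j k t" and u: "psec C A k l u"
  shows "scomp C A i j l (scomp C A j k l u t) s = scomp C A i k l u (scomp C A i j k t s)"
proof -
  note S = psec_simps[OF s] and T = psec_simps[OF t] and U = psec_simps[OF u]
  let ?ts = "scomp C A i j k t s" and ?ut = "scomp C A j k l u t"
  note TS = psec_simps[OF scomp_simps(1)[OF s t]] and UT = psec_simps[OF scomp_simps(1)[OF t u]]
  let ?x = "tau A i j \<odot> s"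
  let ?w = "u \<odot> tau A j k \<odot> t \<odot> ?x"
  note [simp] = S T U TS UT
  have w1: "u \<odot> tau A i k \<odot> ?ts = ?w" using scomp_simps(3)[OF s t] by simp
  have rut: "rst C ?ut \<odot> ?x = ?x \<odot> rst C ?w"
    using scomp_simps(2)[OF t u] rst_Cmp[of ?x "u \<odot> tau A j k \<odot> t"] by simp
  have w2: "rst C (?ut \<odot> ?x) = rst C ?w"
    using rst_rst_Cmp[of ?x ?ut] rst_rst_Cmp[of ?x "u \<odot> tau A j k \<odot> t"] scomp_simps(2)[OF t u] by simp
  have rts: "rst C (t \<odot> ?x) \<odot> rst C ?w = rst C ?w"
    using rst_le_src(2)[of "t \<odot> ?x" "u \<odot> tau A j k"] by simp
  have z: "?ut \<odot> ?x = mul C A j k l ?w (t \<odot> ?x \<odot> rst C ?w)"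
  proof -
    have "?ut \<odot> ?x = ?ut \<odot> ?x \<odot> rst C ?w"
      using Cmp_rst[of "?ut \<odot> ?x"] w2 by simp
    also have "\<dots> = mul C A j k l (u \<odot> tau A j k \<odot> t \<odot> ?x \<odot> rst C ?w) (t \<odot> ?x \<odot> rst C ?w)"
    proof -
      have "rst C (u \<odot> tau A j k \<odot> t) \<odot> ?x \<odot> rst C ?w = (rst C ?ut \<odot> ?x) \<odot> rst C ?w"
        using scomp_simps(2)[OF t u] by simp
      also have "\<dots> = ?x \<odot> rst C ?w" unfolding rut by simp
      finally show ?thesis
        by (subst scomp_Cmp[OF t u, of "?x \<odot> rst C ?w", symmetric]) simp_all
    qed
    also have "u \<odot> tau A j k \<odot> t \<odot> ?x \<odot> rst C ?w = ?w \<odot> rst C ?w" by (simp del: Cmp_rst')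
    also have "\<dots> = ?w" by (rule Cmp_rst) simp
    finally show ?thesis .
  qed
  have y: "?ts \<odot> rst C ?w = mul C A i j k (t \<odot> ?x \<odot> rst C ?w) (s \<odot> rst C ?w)"
    using scomp_Cmp[OF s t, of "rst C ?w"] rts by simp
  have a1: "sgm A j k \<odot> t \<odot> ?x \<odot> rst C ?w = ?x \<odot> rst C ?w"
  proof -
    have "sgm A j k \<odot> t \<odot> ?x \<odot> rst C ?w = rst C t \<odot> ?x \<odot> rst C ?w"
      using psec_comp[OF t, of "?x \<odot> rst C ?w"] by simp
    also have "\<dots> = (rst C t \<odot> ?x) \<odot> rst C ?w" by simp
    also have "rst C t \<odot> ?x = ?x \<odot> rst C (t \<odot> ?x)" by (rule rst_Cmp) simp_all
    also have "(?x \<odot> rst C (t \<odot> ?x)) \<odot> rst C ?w = ?x \<odot> rst C (t \<odot> ?x) \<odot> rst C ?w"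
      by simp
    finally show ?thesis using rts by simp
  qed
  have a2: "sgm A k l \<odot> ?w = tau A j k \<odot> t \<odot> ?x \<odot> rst C ?w"
  proof -
    have "sgm A k l \<odot> ?w = rst C u \<odot> tau A j k \<odot> t \<odot> ?x"
      using psec_comp[OF u, of "tau A j k \<odot> t \<odot> ?x"] by simp
    also have "\<dots> = (tau A j k \<odot> t \<odot> ?x) \<odot> rst C ?w"
      using rst_Cmp[of "tau A j k \<odot> t \<odot> ?x" u] by simp
    finally show ?thesis by simp
  qed
  have "scomp C A i j l ?ut s = mul C A i j l (mul C A j k l ?w (t \<odot> ?x \<odot> rst C ?w)) (s \<odot> rst C ?w)"
    unfolding scomp_def[of C A i j l] Let_def w2 unfolding z ..
  also have "\<dots> = mul C A i k l ?w (mul C A i j k (t \<odot> ?x \<odot> rst C ?w) (s \<odot> rst C ?w))"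
    by (rule mul_assoc[symmetric]) (use a1 a2 in simp_all)
  also have "\<dots> = scomp C A i k l u ?ts"
    unfolding scomp_def[of C A i k l] Let_def w1 y ..
  finally show ?thesis .
qed

lemma psec_eta:
  assumes "i \<in> Ix A" "e \<in> idems C (P0 A i)"
  shows "psec C A i i (eta A i \<odot> e)" "rst C (eta A i \<odot> e) = e" "tau A i i \<odot> eta A i \<odot> e = e"
  using assms by (auto simp: psec_def idems_iff)

text \<open>The restriction idempotents of \<open>Phi_cat\<close> at \<open>i\<close> are the
  sections \<open>eta e\<close>. Composing with them on this side is restriction in
  \<open>C\<close>; on the other side, in \<open>scomp_eta_left\<close>, it is restriction to the
  preimage along \<open>tau s\<close>. The restriction axioms of \<open>Phi_cat\<close> reduce to
  these two rules.\<close>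

lemma scomp_eta_right:
  assumes s: "psec C A i j s" and e: "e \<in> idems C (P0 A i)"
  shows "scomp C A i i j s (eta A i \<odot> e) = s \<odot> e"
proof -
  note S = psec_simps[OF s]
  have [simp]: "e \<in> Ar C" "src e = P0 A i" "tgt e = P0 A i" using e by (auto simp: idems_iff)
  note [simp] = S
  have ee: "e \<odot> rst C (s \<odot> e) = rst C s \<odot> e"
    using rst_Cmp_idem[OF e, of s] idems_commute[OF e, of "rst C s"] idem_idem[OF e]
      Cmp_reassoc[OF idem_idem[OF e], of "rst C s"] by simp
  have "scomp C A i i j s (eta A i \<odot> e) = mul C A i i j (s \<odot> e) (eta A i \<odot> e \<odot> rst C (s \<odot> e))"
    by (simp add: scomp_def Let_def)
  also have "e \<odot> rst C (s \<odot> e) = sgm A i j \<odot> s \<odot> e" using ee psec_comp[OF s, of e] by simp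
  also have "mul C A i i j (s \<odot> e) (eta A i \<odot> sgm A i j \<odot> s \<odot> e) = s \<odot> e"
    by (rule mul_eta_right) simp_all
  finally show ?thesis .
qed

lemma scomp_eta_left:
  assumes s: "psec C A i j s" and e: "e \<in> idems C (P0 A j)"
  shows "scomp C A i j j (eta A j \<odot> e) s = s \<odot> rst C (e \<odot> tau A i j \<odot> s)"
proof -
  note S = psec_simps[OF s]
  have [simp]: "e \<in> Ar C" "src e = P0 A j" "tgt e = P0 A j" using e by (auto simp: idems_iff)
  note [simp] = S
  let ?w = "e \<odot> tau A i j \<odot> s"
  have w: "?w = tau A i j \<odot> s \<odot> rst C ?w"
    using idem_Cmp[OF e, of "tau A i j \<odot> s"] by simp
  have "scomp C A i j j (eta A j \<odot> e) s = mul C A i j j (eta A j \<odot> ?w) (s \<odot> rst C ?w)"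
    by (simp add: scomp_def Let_def)
  also have "\<dots> = mul C A i j j (eta A j \<odot> tau A i j \<odot> s \<odot> rst C ?w) (s \<odot> rst C ?w)"
    using w by simp
  also have "\<dots> = s \<odot> rst C ?w" by (rule mul_eta_left) simp_all
  finally show ?thesis .
qed

lemma mu_tau_star:
  assumes s: "psec C A i j s" and t: "psec C A j k t"
  shows "mu A i j k \<odot> tau_star C A i j k t \<odot> s = scomp C A i j k t s"
proof -
  note [simp] = psec_simps[OF s] psec_simps[OF t]
  have pb: "has_pb C (sgm A j k) (tau A i j)" by simp
  have sq: "sgm A j k \<odot> t \<odot> tau A i j = tau A i j \<odot> rst C (t \<odot> tau A i j)"
    using psec_comp[OF t, of "tau A i j"] rst_Cmp[of "tau A i j" t] by simp
  have "rst C (t \<odot> tau A i j) \<odot> s = s \<odot> rst C (t \<odot> tau A i j \<odot> s)"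
    using rst_Cmp[of s "t \<odot> tau A i j"] by simp
  then have "tau_star C A i j k t \<odot> s =
      pair C (sgm A j k) (tau A i j) (t \<odot> tau A i j \<odot> s) (s \<odot> rst C (t \<odot> tau A i j \<odot> s))"
    using pair_Cmp[OF pb, of "t \<odot> tau A i j" "rst C (t \<odot> tau A i j)" s] sq
    by (simp add: tau_star_def)
  then show ?thesis by (simp add: scomp_def mul_def Let_def)
qed

section \<open>The restriction category of partial bisections\<close>

lemma under_simps [simp]: "src (under A f) = P0 A (src f)" "tgt (under A f) = P1 A (src f) (tgt f)"
  "lab (under A f) = lab f"
  by (simp_all add: under_def)

lemma under_Arr: "src x = P0 A i \<Longrightarrow> tgt x = P1 A i j \<Longrightarrow> under A (Arr i (lab x) j) = x"
  by (cases x) (simp add: under_def)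

lemma under_eqI: "\<lbrakk>src f = src g; tgt f = tgt g; under A f = under A g\<rbrakk> \<Longrightarrow> f = g"
  by (cases f; cases g) (simp add: under_def)

lemma bisection_iff:
  "\<lbrakk>i \<in> Ix A; j \<in> Ix A\<rbrakk> \<Longrightarrow> bisection C A i j s \<longleftrightarrow> psec C A i j s \<and> partial_iso C (tau A i j \<odot> s)"
  by (auto simp: bisection_def partial_section_def psec_def hom_iff)

abbreviation "\<Phi> \<equiv> Phi_cat C A"

abbreviation Phi_Cmp_op (infixr "\<bullet>" 70) where "g \<bullet> f \<equiv> g \<odot>\<^bsub>\<Phi>\<^esub> f"

lemma Ar_Phi: "f \<in> Ar \<Phi> \<longleftrightarrow>
    psec C A (src f) (tgt f) (under A f) \<and> partial_iso C (tau A (src f) (tgt f) \<odot> under A f)"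
  by (auto simp: Phi_cat_def bisection_iff psec_def)

lemma Ar_Phi_Arr: "\<lbrakk>psec C A i j s; partial_iso C (tau A i j \<odot> s)\<rbrakk> \<Longrightarrow> Arr i (lab s) j \<in> Ar \<Phi>"
  by (simp add: Ar_Phi under_Arr psec_def)

lemma Ob_Phi [simp]: "Ob \<Phi> = Ix A"
  by (simp add: Phi_cat_def)

lemma Ar_PhiD:
  assumes "f \<in> Ar \<Phi>"
  shows "src f \<in> Ix A" "tgt f \<in> Ix A" "psec C A (src f) (tgt f) (under A f)"
    "partial_iso C (tau A (src f) (tgt f) \<odot> under A f)"
  using assms by (auto simp: Ar_Phi psec_def)

lemmas Phi_under = psec_simps[OF Ar_PhiD(3)]

lemma Phi_Cmp:
  assumes "f \<in> Ar \<Phi>" "g \<in> Ar \<Phi>" "tgt f = src g"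
  shows "g \<bullet> f = Arr (src f) (lab (scomp C A (src f) (tgt f) (tgt g) (under A g) (under A f))) (tgt g)"
    "src (g \<bullet> f) = src f" "tgt (g \<bullet> f) = tgt g"
    "under A (g \<bullet> f) = scomp C A (src f) (tgt f) (tgt g) (under A g) (under A f)"
    "g \<bullet> f \<in> Ar \<Phi>"
proof -
  note F = Ar_PhiD[OF assms(1)] and G = Ar_PhiD[OF assms(2)]
  have g: "psec C A (tgt f) (tgt g) (under A g)" using G assms(3) by simp
  note sc = scomp_simps[OF F(3) g]
  show eq: "g \<bullet> f = Arr (src f) (lab (scomp C A (src f) (tgt f) (tgt g) (under A g) (under A f))) (tgt g)"
    using mu_tau_star[OF F(3) g] by (simp add: Phi_cat_def)
  then show "src (g \<bullet> f) = src f" "tgt (g \<bullet> f) = tgt g" by simp_all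
  show "under A (g \<bullet> f) = scomp C A (src f) (tgt f) (tgt g) (under A g) (under A f)"
    using psec_simps[OF sc(1)] by (simp add: eq under_Arr)
  have "partial_iso C (tau A (src f) (tgt g) \<odot> scomp C A (src f) (tgt f) (tgt g) (under A g) (under A f))"
    using partial_iso_Cmp[OF F(4) G(4)] psec_simps[OF F(3)] psec_simps[OF g] sc(3) assms(3) by simp
  then show "g \<bullet> f \<in> Ar \<Phi>" unfolding eq by (rule Ar_Phi_Arr[OF sc(1)])
qed

lemma Phi_idem:
  assumes "i \<in> Ix A" "e \<in> idems C (P0 A i)"
  shows "Arr i (lab (eta A i \<odot> e)) i \<in> Ar \<Phi>" "under A (Arr i (lab (eta A i \<odot> e)) i) = eta A i \<odot> e"
proof -
  note e = psec_eta[OF assms]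
  show "Arr i (lab (eta A i \<odot> e)) i \<in> Ar \<Phi>"
    by (rule Ar_Phi_Arr[OF e(1)]) (use e(3) partial_iso_idem[OF assms(2)] in simp)
  show "under A (Arr i (lab (eta A i \<odot> e)) i) = eta A i \<odot> e"
    by (rule under_Arr) (use psec_simps[OF e(1)] in auto)
qed

lemma Phi_Idn:
  assumes "i \<in> Ix A"
  shows "Idn \<Phi> i \<in> Ar \<Phi>" "src (Idn \<Phi> i) = i" "tgt (Idn \<Phi> i) = i"
    "under A (Idn \<Phi> i) = eta A i"
  using Phi_idem[OF assms, of "Idn C (P0 A i)"] assms by (simp_all add: Phi_cat_def)

lemma Phi_rst:
  assumes "f \<in> Ar \<Phi>"
  shows "rst \<Phi> f \<in> Ar \<Phi>" "src (rst \<Phi> f) = src f"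
    "tgt (rst \<Phi> f) = src f" "under A (rst \<Phi> f) = eta A (src f) \<odot> rst C (under A f)"
  using Phi_idem[of "src f" "rst C (under A f)"] Ar_PhiD[OF assms] Phi_under[OF assms]
  by (simp_all add: Phi_cat_def)

lemma restriction_category_Phi: "restriction_category \<Phi>"
proof
  note simps = Phi_Cmp(2-) Phi_Idn Phi_rst
  fix f assume f: "f \<in> Ar \<Phi>"
  note F = Ar_PhiD[OF f] Phi_under[OF f]
  show "src f \<in> Ob \<Phi> \<and> tgt f \<in> Ob \<Phi>" using F by simp
  show "rst \<Phi> f \<in> hom \<Phi> (src f) (src f)" using simps f by (simp add: hom_def)
  show "f \<bullet> Idn \<Phi> (src f) = f"
    using simps f F scomp_eta_right[OF F(3), of "Idn C (P0 A (src f))"] by (intro under_eqI) simp_all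
  show "Idn \<Phi> (tgt f) \<bullet> f = f"
    using simps f F scomp_eta_left[OF F(3), of "Idn C (P0 A (tgt f))"] by (intro under_eqI) simp_all
  show "f \<bullet> rst \<Phi> f = f"
    using simps f F scomp_eta_right[OF F(3), of "rst C (under A f)"] by (intro under_eqI) simp_all
next
  fix f g assume f: "f \<in> Ar \<Phi>" and g: "g \<in> Ar \<Phi>" and fg: "tgt f = src g"
  note simps = Phi_Cmp(2-) Phi_Idn Phi_rst
  show "g \<bullet> f \<in> hom \<Phi> (src f) (tgt g)" using simps f g fg by (simp add: hom_def)
  note F = Ar_PhiD[OF f] Phi_under[OF f]
  note G = Ar_PhiD[OF g, folded fg] Phi_under[OF g, folded fg]
  let ?w = "under A g \<odot> tau A (src f) (tgt f) \<odot> under A f"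
  have "rst C (rst C (under A g) \<odot> tau A (src f) (tgt f) \<odot> under A f) = rst C ?w"
    by (rule rst_rst_Cmp) (use F G fg in auto)
  then show "rst \<Phi> g \<bullet> f = f \<bullet> rst \<Phi> (g \<bullet> f)"
    using simps f g fg F G scomp_eta_left[OF F(3), of "rst C (under A g)"]
      scomp_eta_right[OF F(3), of "rst C ?w"] scomp_simps[OF F(3) G(3)]
    by (intro under_eqI) simp_all
next
  fix f g assume f: "f \<in> Ar \<Phi>" and g: "g \<in> Ar \<Phi>" and fg: "src f = src g"
  note simps = Phi_Cmp(2-) Phi_Idn Phi_rst
  note F = Ar_PhiD[OF f, unfolded fg] Phi_under[OF f, unfolded fg]
  note G = Ar_PhiD[OF g] Phi_under[OF g]
  let ?e = "rst C (under A f)" and ?d = "rst C (under A g)"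
  have ed: "psec C A (src g) (src g) (eta A (src g) \<odot> ?e)" "psec C A (src g) (src g) (eta A (src g) \<odot> ?d)"
    by (rule psec_eta; use F G in simp)+
  have comm: "?e \<odot> ?d = ?d \<odot> ?e" by (rule rst_commute) (use F G in simp_all)
  show "rst \<Phi> f \<bullet> rst \<Phi> g = rst \<Phi> g \<bullet> rst \<Phi> f"
    using simps f g fg F G comm scomp_eta_right[OF ed(1), of ?d] scomp_eta_right[OF ed(2), of ?e]
    by (intro under_eqI) simp_all
  show "rst \<Phi> (g \<bullet> rst \<Phi> f) = rst \<Phi> g \<bullet> rst \<Phi> f"
    using simps f g fg F G comm scomp_eta_right[OF G(3), of ?e] scomp_eta_right[OF ed(2), of ?e]
      rst_Cmp_rst[of "under A f" "under A g"]
    by (intro under_eqI) simp_all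
next
  fix f g h assume f: "f \<in> Ar \<Phi>" and g: "g \<in> Ar \<Phi>" and h: "h \<in> Ar \<Phi>" and fg: "tgt f = src g" and gh: "tgt g = src h"
  note simps = Phi_Cmp(2-)
  show "(h \<bullet> g) \<bullet> f = h \<bullet> g \<bullet> f"
    using simps f g h fg gh scomp_assoc[OF Ar_PhiD(3)[OF f] Ar_PhiD(3)[OF g, folded fg] Ar_PhiD(3)[OF h, folded gh]]
    by (intro under_eqI) simp_all
qed (use Phi_Idn in \<open>auto simp: hom_def\<close>)

sublocale Phi: restriction_category "\<Phi>"
  by (rule restriction_category_Phi)

lemma Phi_proj_simps [simp]:
  "FO (Phi_proj C A) i = P0 A i" "FA (Phi_proj C A) f = tau A (src f) (tgt f) \<odot> under A f"
  by (simp_all add: Phi_proj_def)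

lemma is_restriction_functor_Phi_proj: "is_restriction_functor \<Phi> C (Phi_proj C A)"
proof -
  have 1: "tau A (src f) (tgt f) \<odot> under A f \<in> hom C (P0 A (src f)) (P0 A (tgt f))"
    if "f \<in> Ar \<Phi>" for f
    using that Ar_PhiD[OF that] Phi_under[OF that] by (auto simp: hom_iff)
  have 2: "tau A (src f) (tgt g) \<odot> under A (g \<bullet> f) =
      (tau A (src g) (tgt g) \<odot> under A g) \<odot> tau A (src f) (tgt f) \<odot> under A f"
    if f: "f \<in> Ar \<Phi>" and g: "g \<in> Ar \<Phi>" and fg: "tgt f = src g" for f g
    using scomp_simps[OF Ar_PhiD(3)[OF f] Ar_PhiD(3)[OF g, folded fg]] Phi_Cmp[OF f g fg]
      Phi_under[OF f] Phi_under[OF g] fg by simp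
  have 3: "tau A (src f) (src f) \<odot> under A (rst \<Phi> f) = rst C (tau A (src f) (tgt f) \<odot> under A f)"
    if f: "f \<in> Ar \<Phi>" for f
    using Phi_rst[OF f] Phi_under[OF f] by simp
  show ?thesis
    using 1 2 3 Phi_Idn Phi_rst Phi_Cmp
    by (simp add: is_restriction_functor_def is_functor_def restriction_category_axioms
        Phi.restriction_category_axioms Phi.category_axioms category_axioms)
qed

lemma small_hom_sets_Phi:
  assumes "small_hom_sets C"
  shows "small_hom_sets \<Phi>"
  unfolding small_hom_sets_def
proof (intro ballI)
  fix i j assume ij: "i \<in> Ob \<Phi>" "j \<in> Ob \<Phi>"
  have "inj_on (under A) (hom \<Phi> i j)"
    by (rule inj_onI) (auto simp: hom_def intro: under_eqI)
  moreover have "under A ` hom \<Phi> i j \<subseteq> hom C (P0 A i) (P1 A i j)"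
    using psec_simps[OF Ar_PhiD(3)] by (auto simp: hom_def)
  ultimately have "hom \<Phi> i j \<lesssim> hom C (P0 A i) (P1 A i j)"
    by (auto simp: lepoll_def)
  moreover have "hom C (P0 A i) (P1 A i j) \<prec> (UNIV :: 'u set)"
    using assms ij by (auto simp: small_hom_sets_def)
  ultimately show "hom \<Phi> i j \<prec> (UNIV :: 'u set)" by (rule lesspoll_trans1)
qed

end

context partite_groupoid
begin

lemma inversion_mul:
  "\<exists>\<iota>. \<forall>i \<in> Ix A. \<forall>j \<in> Ix A. (\<iota> i j \<in> hom C (P1 A i j) (P1 A j i) \<and> total_map C (\<iota> i j)) \<and>
    \<iota> i j \<odot> \<iota> j i = Idn C (P1 A j i) \<and> sgm A j i \<odot> \<iota> i j = tau A i j \<and>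
    mul C A i j i (\<iota> i j) (Idn C (P1 A i j)) = eta A i \<odot> sgm A i j"
  using inversion unfolding mul_def by blast

text \<open>With \<open>u\<close> the partial inverse of \<open>tau s\<close>, the inverse bisection
  is \<open>\<iota> s u\<close>: return along \<open>tau s\<close>, follow \<open>s\<close>, and
  invert the arrow reached.\<close>

lemma Phi_partial_iso:
  assumes f: "f \<in> Ar \<Phi>"
  shows "partial_iso \<Phi> f"
proof -
  obtain \<iota> where iota: "\<And>i j. \<lbrakk>i \<in> Ix A; j \<in> Ix A\<rbrakk> \<Longrightarrow> \<iota> i j \<in> hom C (P1 A i j) (P1 A j i) \<and> total_map C (\<iota> i j)"
    and iota_iota: "\<And>i j. \<lbrakk>i \<in> Ix A; j \<in> Ix A\<rbrakk> \<Longrightarrow> \<iota> i j \<odot> \<iota> j i = Idn C (P1 A j i)"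
    and sgm_iota: "\<And>i j. \<lbrakk>i \<in> Ix A; j \<in> Ix A\<rbrakk> \<Longrightarrow> sgm A j i \<odot> \<iota> i j = tau A i j"
    and mul_iota: "\<And>i j. \<lbrakk>i \<in> Ix A; j \<in> Ix A\<rbrakk> \<Longrightarrow> mul C A i j i (\<iota> i j) (Idn C (P1 A i j)) = eta A i \<odot> sgm A i j"
    using inversion_mul by blast
  define i j s where ijs: "i = src f" "j = tgt f" "s = under A f"
  note F = Ar_PhiD[OF f, folded ijs]
  note S = psec_simps[OF F(3)]
  note [simp] = S
  have \<iota>s [simp]: "\<iota> i j \<in> Ar C" "src (\<iota> i j) = P1 A i j" "tgt (\<iota> i j) = P1 A j i"
    "\<iota> j i \<in> Ar C" "src (\<iota> j i) = P1 A j i" "tgt (\<iota> j i) = P1 A i j" "total_map C (\<iota> i j)"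
    using iota[of i j] iota[of j i] by (auto simp: hom_iff)
  have \<iota>c [simp]: "sgm A j i \<odot> \<iota> i j \<odot> x = tau A i j \<odot> x" "\<iota> j i \<odot> \<iota> i j \<odot> x = x"
    if "x \<in> Ar C" "tgt x = P1 A i j" for x
    using that Cmp_reassoc[OF sgm_iota, of i j x] Cmp_reassoc[OF iota_iota, of j i x] by simp_all
  have tau_iota: "tau A j i \<odot> \<iota> i j \<odot> x = sgm A i j \<odot> x" if "x \<in> Ar C" "tgt x = P1 A i j" for x
    using that Cmp_reassoc[OF sgm_iota, of j i "\<iota> i j \<odot> x"] by simp
  have mul1: "mul C A i j i (\<iota> i j \<odot> x) x = eta A i \<odot> sgm A i j \<odot> x" if "x \<in> Ar C" "tgt x = P1 A i j" for x
    using that mul_Cmp[of i j i "Idn C (P1 A i j)" "\<iota> i j" x] mul_iota[of i j] sgm_iota[of i j] by simp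
  \<comment> \<open>The second inverse law is the given one at \<open>j\<close>, \<open>i\<close>,
    applied to \<open>\<iota> i j \<odot> x\<close>, because the two inversions are mutually
    inverse.\<close>
  have mul2: "mul C A j i j x (\<iota> i j \<odot> x) = eta A j \<odot> tau A i j \<odot> x" if "x \<in> Ar C" "tgt x = P1 A i j" for x
    using that mul_Cmp[of j i j "Idn C (P1 A j i)" "\<iota> j i" "\<iota> i j \<odot> x"] mul_iota[of j i] sgm_iota[of j i] by simp
  obtain u where u: "partial_inverse C (tau A i j \<odot> s) u" using F(4) by (auto simp: partial_iso_def)
  then have [simp]: "u \<in> Ar C" "src u = P0 A j" "tgt u = P0 A i"
    and us: "u \<odot> tau A i j \<odot> s = rst C s" and su: "tau A i j \<odot> s \<odot> u = rst C u"
    by (auto simp: partial_inverse_iff)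
  define t where "t = \<iota> i j \<odot> s \<odot> u"
  have tA [simp]: "t \<in> Ar C" "src t = P0 A j" "tgt t = P1 A j i" by (simp_all add: t_def)
  have rsu: "rst C (s \<odot> u) = rst C u"
    using rst_tau[of i j "s \<odot> u"] su by (simp del: rst_tau)
  have rt: "rst C t = rst C u" using rsu by (simp add: t_def rst_total_Cmp)
  have su_u: "rst C s \<odot> u = u"
    using us su Cmp_reassoc[OF us, of u] by simp
  have t: "psec C A j i t" using su rt by (simp add: psec_def) (simp add: t_def su)
  have taut: "tau A j i \<odot> t = u"
    using tau_iota[of "s \<odot> u"] psec_comp[OF F(3), of u] su_u by (simp add: t_def)
  have "partial_iso C u" using partial_inverse_sym[OF u] by (auto simp: partial_iso_def)
  then have g: "Arr j (lab t) i \<in> Ar \<Phi>" by (intro Ar_Phi_Arr[OF t]) (simp add: taut)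
  have ug: "under A (Arr j (lab t) i) = t" by (rule under_Arr) simp_all
  have "scomp C A i j i t s = mul C A i j i (\<iota> i j \<odot> s) s"
    using us rst_total_Cmp[of s "\<iota> i j"] Cmp_rst[of s] by (simp add: scomp_def Let_def t_def)
  then have ts: "scomp C A i j i t s = eta A i \<odot> rst C s" using mul1[of s] by simp
  have "scomp C A j i j s t = mul C A j i j (s \<odot> u) (\<iota> i j \<odot> s \<odot> u)"
    using rsu rt Cmp_rst[of t] by (simp add: scomp_def Let_def taut) (simp add: t_def)
  then have st: "scomp C A j i j s t = eta A j \<odot> rst C t" using mul2[of "s \<odot> u"] su rt by simp
  have "partial_inverse \<Phi> f (Arr j (lab t) i)"
    unfolding Phi.partial_inverse_iff
  proof (intro conjI)
    let ?g = "Arr j (lab t) i"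
    show "?g \<bullet> f = rst \<Phi> f" "f \<bullet> ?g = rst \<Phi> ?g"
      using f g ug ts st by (auto intro!: under_eqI simp: Phi_Cmp(2-) Phi_rst ijs[symmetric])
  qed (use f g ijs in auto)
  then show ?thesis by (auto simp: partial_iso_def)
qed

lemma inverse_category_Phi: "inverse_category \<Phi>"
  by (rule inverse_categoryI[OF restriction_category_Phi Phi_partial_iso])

lemma is_over_obj_Phi:
  assumes "small_hom_sets C"
  shows "is_over_obj C (Phi_obj C A)"
  using assms inverse_category_Phi is_restriction_functor_Phi_proj small_hom_sets_Phi Ix_small
  by (simp add: is_over_obj_iff Phi_obj_def)

text \<open>The inverse of the projection on idempotents is \<open>e \<mapsto> eta e\<close>, as
  \<open>tau eta = 1\<close> and every restriction idempotent of \<open>Phi_cat\<close> is of this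
  form.\<close>

lemma hyperconnected_Phi: "hyperconnected \<Phi> C (Phi_proj C A)"
  unfolding hyperconnected_def
proof (intro conjI ballI)
  show "is_restriction_functor \<Phi> C (Phi_proj C A)" by (rule is_restriction_functor_Phi_proj)
  fix i assume i: "i \<in> Ob \<Phi>"
  have *: "under A e = eta A i \<odot> tau A i i \<odot> under A e \<and> tau A i i \<odot> under A e = rst C (under A e)"
    if e: "e \<in> idems \<Phi> i" for e
  proof -
    have eA: "e \<in> Ar \<Phi>" "src e = i" "tgt e = i" "rst \<Phi> e = e"
      using e by (auto simp: Phi.idems_iff)
    have "under A e = eta A i \<odot> rst C (under A e)" using Phi_rst(4)[OF eA(1)] eA by simp
    then have "tau A i i \<odot> under A e = tau A i i \<odot> eta A i \<odot> rst C (under A e)" by simp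
    also have "\<dots> = rst C (under A e)" using Phi_under[OF eA(1)] eA by simp
    finally show ?thesis using \<open>under A e = eta A i \<odot> rst C (under A e)\<close> by simp
  qed
  show "bij_betw (FA (Phi_proj C A)) (idems \<Phi> i) (idems C (FO (Phi_proj C A) i))"
    unfolding bij_betw_def
  proof
    show "inj_on (FA (Phi_proj C A)) (idems \<Phi> i)"
    proof (rule inj_onI)
      fix d e assume de: "d \<in> idems \<Phi> i" "e \<in> idems \<Phi> i"
        "FA (Phi_proj C A) d = FA (Phi_proj C A) e"
      then have "tau A i i \<odot> under A d = tau A i i \<odot> under A e" by (auto simp: Phi.idems_iff)
      then have "under A d = under A e" using *[OF de(1)] *[OF de(2)] by metis
      then show "d = e" using de(1,2) by (intro under_eqI) (auto simp: Phi.idems_iff)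
    qed
    show "FA (Phi_proj C A) ` idems \<Phi> i = idems C (FO (Phi_proj C A) i)"
    proof
      show "FA (Phi_proj C A) ` idems \<Phi> i \<subseteq> idems C (FO (Phi_proj C A) i)"
      proof
        fix x assume "x \<in> FA (Phi_proj C A) ` idems \<Phi> i"
        then obtain e where e: "e \<in> idems \<Phi> i" "x = FA (Phi_proj C A) e" by auto
        then have eA: "e \<in> Ar \<Phi>" "src e = i" "tgt e = i" by (auto simp: Phi.idems_iff)
        then have "x = rst C (under A e)" using e * by simp
        then show "x \<in> idems C (FO (Phi_proj C A) i)" using Phi_under[OF eA(1)] eA by simp
      qed
      show "idems C (FO (Phi_proj C A) i) \<subseteq> FA (Phi_proj C A) ` idems \<Phi> i"
      proof
        fix e assume "e \<in> idems C (FO (Phi_proj C A) i)"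
        then have e: "i \<in> Ix A" "e \<in> idems C (P0 A i)" using i by auto
        note E = Phi_idem[OF e] psec_eta[OF e]
        let ?e = "Arr i (lab (eta A i \<odot> e)) i"
        have "rst \<Phi> ?e = ?e"
          using E Phi_rst[OF E(1)] by (intro under_eqI) simp_all
        then have "?e \<in> idems \<Phi> i" using E by (simp add: Phi.idems_iff)
        moreover have "FA (Phi_proj C A) ?e = e" using E by simp
        ultimately show "e \<in> FA (Phi_proj C A) ` idems \<Phi> i" by (metis imageI)
      qed
    qed
  qed
qed

end

section \<open>Order, compatibility and joins of partial bisections\<close>

lemma (in partite_category) Phi_le_iff:
  assumes "f \<in> Ar \<Phi>" "g \<in> Ar \<Phi>" "src f = src g" "tgt f = tgt g"
  shows "restr_le \<Phi> f g \<longleftrightarrow> restr_le C (under A f) (under A g)"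
proof -
  note F = Phi_rst[OF assms(1)] Phi_under[OF assms(1)]
  have gf: "under A (g \<bullet> rst \<Phi> f) = under A g \<odot> rst C (under A f)"
    using Phi_Cmp(4)[OF F(1) assms(2)] F scomp_eta_right[OF Ar_PhiD(3)[OF assms(2)], of "rst C (under A f)"] assms
    by simp
  have "f = g \<bullet> rst \<Phi> f \<longleftrightarrow> under A f = under A (g \<bullet> rst \<Phi> f)"
    using Phi_Cmp(2,3)[OF F(1) assms(2)] F assms under_eqI by metis
  then show ?thesis using assms gf by (simp add: restr_le_def)
qed

lemma (in partite_category) Phi_compat:
  assumes "f \<in> Ar \<Phi>" "g \<in> Ar \<Phi>" "compat \<Phi> f g"
  shows "compat C (under A f) (under A g)"
proof -
  have *: "under A (g \<bullet> rst \<Phi> f) = under A g \<odot> rst C (under A f)"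
    if "f \<in> Ar \<Phi>" "g \<in> Ar \<Phi>" "src f = src g" for f g
    using Phi_Cmp(4)[OF Phi_rst(1)[OF that(1)] that(2)] Phi_rst[OF that(1)] Phi_under[OF that(1)]
      scomp_eta_right[OF Ar_PhiD(3)[OF that(2)], of "rst C (under A f)"] that
    by simp
  show ?thesis using assms *[of f g] *[of g f] by (simp add: compat_def)
qed

locale join_partite_groupoid = partite_groupoid C A + join_restriction_category C
  for C :: "('o, 'u) rcat" (structure) and A :: "('o, 'u) pcat"
begin

lemma Phi_is_joinI:
  assumes S: "S \<subseteq> hom \<Phi> i j" and p: "p \<in> hom \<Phi> i j"
    and j: "is_join C (P0 A i) (P1 A i j) (under A ` S) (under A p)"
  shows "is_join \<Phi> i j S p"
  unfolding is_join_def
proof (intro conjI ballI impI)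
  fix s assume s: "s \<in> S"
  then have "s \<in> hom \<Phi> i j" using S by auto
  moreover have "restr_le C (under A s) (under A p)" using is_join_le[OF j] s by auto
  ultimately show "restr_le \<Phi> s p" using p by (subst Phi_le_iff) (auto simp: hom_def)
next
  fix q assume q: "q \<in> hom \<Phi> i j" "\<forall>s\<in>S. restr_le \<Phi> s q"
  have "restr_le C (under A p) (under A q)"
  proof (rule is_join_least[OF j])
    show "under A q \<in> hom C (P0 A i) (P1 A i j)"
      using q psec_simps[OF Ar_PhiD(3), of q] by (auto simp: hom_def)
    show "restr_le C s (under A q)" if "s \<in> under A ` S" for s
      using that q S Phi_le_iff by (fastforce simp: hom_def)
  qed
  then show "restr_le \<Phi> p q" using p q by (subst Phi_le_iff) (auto simp: hom_def)
qed (rule p)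

text \<open>The join of the underlying sections is taken in \<open>C\<close>; postcomposition with
  \<open>sgm\<close> shows that it is again a section. That its image under \<open>tau\<close> is a
  partial isomorphism requires a join of the inverses \<open>t s\<close>, which exists because the
  inverses are compatible as well.\<close>

lemma Phi_join_exists:
  assumes i: "i \<in> Ix A" "j \<in> Ix A" and S: "S \<subseteq> hom \<Phi> i j"
    and bc: "\<And>f g. \<lbrakk>f \<in> S; g \<in> S\<rbrakk> \<Longrightarrow> bicompat \<Phi> f g"
  shows "\<exists>p \<in> hom \<Phi> i j. is_join C (P0 A i) (P1 A i j) (under A ` S) (under A p)"
proof -
  have sA: "s \<in> Ar \<Phi>" "src s = i" "tgt s = j" if "s \<in> S" for s using S that by (auto simp: hom_def)
  have u: "under A s \<in> Ar C" "src (under A s) = P0 A i" "tgt (under A s) = P1 A i j"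
    "sgm A i j \<odot> under A s = rst C (under A s)" if "s \<in> S" for s
    using Phi_under[OF sA(1)[OF that]] sA[OF that] by auto
  have US: "under A ` S \<subseteq> hom C (P0 A i) (P1 A i j)" using u by (auto simp: hom_iff)
  have "\<exists>p. is_join C (P0 A i) (P1 A i j) (under A ` S) p"
  proof (rule join_exists[OF _ _ US])
    show "compat C f g" if "f \<in> under A ` S" "g \<in> under A ` S" for f g
      using that bc Phi_compat sA by (auto simp: bicompat_def)
  qed (use i in auto)
  then obtain p where p: "is_join C (P0 A i) (P1 A i j) (under A ` S) p" ..
  have pA: "p \<in> Ar C" "src p = P0 A i" "tgt p = P1 A i j" using is_join_Ar[OF p] by auto
  have "sgm A i j \<odot> p = rst C p"
  proof (rule is_join_unique)
    show "is_join C (P0 A i) (P0 A i) (rst C ` under A ` S) (rst C p)" by (rule is_join_rst[OF p US])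
    have "(\<odot>) (sgm A i j) ` under A ` S = rst C ` under A ` S" using u by (force simp: image_iff)
    then show "is_join C (P0 A i) (P0 A i) (rst C ` under A ` S) (sgm A i j \<odot> p)"
      using is_join_postcomp[OF p US, of "sgm A i j"] i by simp
  qed
  then have ps: "psec C A i j p" using i pA by (simp add: psec_def)
  define t where "t s = tau A j i \<odot> under A (star \<Phi> s)" for s
  have inv: "partial_inverse \<Phi> s (star \<Phi> s)" if "s \<in> S" for s
    by (rule partial_inverse_star[OF restriction_category_Phi inverse_category_Phi sA(1)[OF that]])
  have st: "star \<Phi> s \<in> Ar \<Phi>" "src (star \<Phi> s) = j" "tgt (star \<Phi> s) = i" if "s \<in> S" for s
    using inv[OF that] sA[OF that] by (auto simp: Phi.partial_inverse_iff)
  have inv': "partial_inverse C (tau A i j \<odot> under A s) (t s)" if "s \<in> S" for s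
    using functor_partial_inverse[OF is_restriction_functor_Phi_proj inv[OF that]] sA[OF that] st[OF that]
    by (simp add: t_def)
  have tA: "t s \<in> Ar C" "src (t s) = P0 A j" "tgt (t s) = P0 A i" if "s \<in> S" for s
    using inv'[OF that] u[OF that] i by (auto simp: partial_inverse_iff)
  have T: "t ` S \<subseteq> hom C (P0 A j) (P0 A i)" using tA by (auto simp: hom_iff)
  have "\<exists>v. is_join C (P0 A j) (P0 A i) (t ` S) v"
  proof (rule join_exists[OF _ _ T])
    fix f g assume "f \<in> t ` S" "g \<in> t ` S"
    then obtain x y where xy: "x \<in> S" "y \<in> S" "f = t x" "g = t y" by auto
    have "compat \<Phi> (star \<Phi> x) (star \<Phi> y)" using bc xy by (auto simp: bicompat_def)
    then have "compat C (FA (Phi_proj C A) (star \<Phi> x)) (FA (Phi_proj C A) (star \<Phi> y))"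
      by (intro functor_compat[OF is_restriction_functor_Phi_proj]) (use st xy in auto)
    then show "compat C f g" using xy st by (simp add: t_def)
  qed (use i in auto)
  then obtain v where v: "is_join C (P0 A j) (P0 A i) (t ` S) v" ..
  have "partial_inverse C (tau A i j \<odot> p) v"
  proof (rule partial_iso_join[OF _ v inv' _ T])
    have "(\<odot>) (tau A i j) ` under A ` S = (\<lambda>s. tau A i j \<odot> under A s) ` S" by auto
    then show "is_join C (P0 A i) (P0 A j) ((\<lambda>s. tau A i j \<odot> under A s) ` S) (tau A i j \<odot> p)"
      using is_join_postcomp[OF p US, of "tau A i j"] i by simp
    show "(\<lambda>s. tau A i j \<odot> under A s) ` S \<subseteq> hom C (P0 A i) (P0 A j)"
      using u i by (auto simp: hom_iff)
  qed
  then have "Arr i (lab p) j \<in> Ar \<Phi>" by (intro Ar_Phi_Arr[OF ps]) (auto simp: partial_iso_def)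
  then show ?thesis using p under_Arr[OF pA(2,3)] by (intro bexI[of _ "Arr i (lab p) j"]) (auto simp: hom_def)
qed

lemma join_inverse_category_Phi: "join_inverse_category \<Phi>"
proof -
  interpret inverse_category \<Phi> by (rule inverse_category_Phi)
  show ?thesis
  proof
    fix i j S
    assume i: "i \<in> Ob \<Phi>" "j \<in> Ob \<Phi>" and S: "S \<subseteq> hom \<Phi> i j"
      and bc: "\<And>f g. \<lbrakk>f \<in> S; g \<in> S\<rbrakk> \<Longrightarrow> bicompat \<Phi> f g"
    obtain p where p: "p \<in> hom \<Phi> i j" "is_join C (P0 A i) (P1 A i j) (under A ` S) (under A p)"
      using Phi_join_exists[of i j S] i S bc by auto
    have pj: "is_join \<Phi> i j S p" by (rule Phi_is_joinI[OF S p])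
    then show "\<exists>p. is_join \<Phi> i j S p" by blast
    fix p' h assume p': "is_join \<Phi> i j S p'" and h: "h \<in> Ar \<Phi>" "tgt h = i"
    then have p'p: "p' = p" using Phi.is_join_unique pj by blast
    note H = Ar_PhiD[OF h(1)] Phi_under[OF h(1)]
    have sA: "s \<in> Ar \<Phi>" "src s = i" "tgt s = j" if "s \<in> S" for s using S that by (auto simp: hom_def)
    have pA: "p \<in> Ar \<Phi>" "src p = i" "tgt p = j" using p by (auto simp: hom_def)
    have sh: "s \<bullet> h \<in> hom \<Phi> (src h) j" "psec C A (src h) j (under A (s \<bullet> h))"
      "rst C (under A (s \<bullet> h)) = rst C (under A s \<odot> tau A (src h) i \<odot> under A h)"
      if s: "s \<in> Ar \<Phi>" "src s = i" "tgt s = j" for s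
    proof -
      show "s \<bullet> h \<in> hom \<Phi> (src h) j" using Phi_Cmp[OF h(1) s(1)] s h by (auto simp: hom_def)
      show "psec C A (src h) j (under A (s \<bullet> h))"
        "rst C (under A (s \<bullet> h)) = rst C (under A s \<odot> tau A (src h) i \<odot> under A h)"
        using Phi_Cmp(4)[OF h(1) s(1)] scomp_simps[OF H(3)[unfolded h(2)] Ar_PhiD(3)[OF s(1), unfolded s(2,3)]]
          s h by simp_all
    qed
    show "is_join \<Phi> (src h) j ((\<lambda>s. s \<bullet> h) ` S) (p' \<bullet> h)"
      unfolding p'p
    proof (rule Phi_is_joinI)
      show "(\<lambda>s. s \<bullet> h) ` S \<subseteq> hom \<Phi> (src h) j" "p \<bullet> h \<in> hom \<Phi> (src h) j"
        using sh sA pA by blast+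
      have US: "under A ` S \<subseteq> hom C (P0 A i) (P1 A i j)"
        using sA psec_simps[OF Ar_PhiD(3)] by (auto simp: hom_def)
      let ?x = "tau A (src h) i \<odot> under A h"
      have x: "?x \<in> Ar C" "tgt ?x = P0 A i" "src ?x = P0 A (src h)" using H h by auto
      have le: "restr_le C (under A (s \<bullet> h)) (under A (p \<bullet> h))" if s: "s \<in> S" for s
      proof -
        have "restr_le \<Phi> s p" using pj s by (simp add: is_join_def)
        then have "restr_le \<Phi> (s \<bullet> h) (p \<bullet> h)"
          by (rule Phi.le_precomp) (use sA[OF s] pA h in auto)
        then show ?thesis using Phi_le_iff[of "s \<bullet> h" "p \<bullet> h"] sh(1)[OF sA[OF s]] sh(1)[OF pA]
          by (auto simp: hom_def)
      qed
      \<comment> \<open>Composition with \<open>h\<close> in \<open>Phi_cat\<close> is not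
        precomposition in \<open>C\<close>, so preservation of the join is not immediate. But it is
        monotone, and the domain of \<open>s \<bullet> h\<close> is that of \<open>s\<close>
        precomposed with \<open>tau h\<close>; such domains do have the right join.\<close>
      show "is_join C (P0 A (src h)) (P1 A (src h) j) (under A ` (\<lambda>s. s \<bullet> h) ` S) (under A (p \<bullet> h))"
      proof (rule is_joinI)
        show "under A (p \<bullet> h) \<in> hom C (P0 A (src h)) (P1 A (src h) j)"
          using psec_simps[OF sh(2)[OF pA]] by (auto simp: hom_def)
        show "under A ` (\<lambda>s. s \<bullet> h) ` S \<subseteq> hom C (P0 A (src h)) (P1 A (src h) j)"
          using psec_simps[OF sh(2)] sA by (auto simp: hom_def)
        show "restr_le C s (under A (p \<bullet> h))" if "s \<in> under A ` (\<lambda>s. s \<bullet> h) ` S" for s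
          using that le by auto
        have "rst C ` under A ` (\<lambda>s. s \<bullet> h) ` S = (\<lambda>s. rst C (s \<odot> ?x)) ` under A ` S"
          using sh(3) sA by (auto simp: image_iff)
        then show "is_join C (P0 A (src h)) (P0 A (src h)) (rst C ` under A ` (\<lambda>s. s \<bullet> h) ` S) (rst C (under A (p \<bullet> h)))"
          using is_join_restrict[OF p(2) US x(1,2)] x(3) sh(3)[OF pA] by simp
      qed
    qed
  qed
qed

end

subsection \<open>The action on cofunctors\<close>

context cofunctor
begin

text \<open>The action of \<open>Phi_map\<close> on maps, stated for the sections themselves instead
  of the labelled arrows; see \<open>FA_Phi_map\<close>.\<close>

definition smap :: "'u \<Rightarrow> 'u \<Rightarrow> ('o, 'u) arr \<Rightarrow> ('o, 'u) arr" where
  "smap i j s = act C A F i j (s \<odot> cf0 F i) (rst C (s \<odot> cf0 F i))"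

lemma smap_aux:
  assumes s: "psec C A i j s"
  shows "sgm A i j \<odot> s \<odot> cf0 F i = cf0 F i \<odot> rst C (s \<odot> cf0 F i)"
  using A.psec_simps[OF s] A.psec_comp[OF s, of "cf0 F i"] A.rst_Cmp[of "cf0 F i" s] by simp

lemma smap_simps:
  assumes s: "psec C A i j s"
  shows "psec C B (cfI F i) (cfI F j) (smap i j s)" "rst C (smap i j s) = rst C (s \<odot> cf0 F i)"
    "cf0 F j \<odot> tau B (cfI F i) (cfI F j) \<odot> smap i j s = tau A i j \<odot> s \<odot> cf0 F i"
  using A.psec_simps[OF s] smap_aux[OF s] act_simps[of i j "s \<odot> cf0 F i" "rst C (s \<odot> cf0 F i)"]
  by (simp_all add: smap_def psec_def)

lemma smap_Cmp:
  assumes s: "psec C A i j s" and b: "b \<in> Ar C" "tgt b = P0 B (cfI F i)" "rst C (s \<odot> cf0 F i) \<odot> b = b"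
  shows "smap i j s \<odot> b = act C A F i j (s \<odot> cf0 F i \<odot> b) b"
  using A.psec_simps[OF s] smap_aux[OF s] b act_Cmp[of i j "s \<odot> cf0 F i" "rst C (s \<odot> cf0 F i)" b]
  by (simp add: smap_def)

lemma smap_eta:
  assumes "i \<in> Ix A" "e \<in> idems C (P0 A i)"
  shows "smap i i (eta A i \<odot> e) = eta B (cfI F i) \<odot> rst C (e \<odot> cf0 F i)"
proof -
  have [simp]: "e \<in> Ar C" "src e = P0 A i" "tgt e = P0 A i" using assms by (auto simp: A.idems_iff)
  have "e \<odot> cf0 F i = cf0 F i \<odot> rst C (e \<odot> cf0 F i)"
    using A.idem_Cmp[OF assms(2), of "cf0 F i"] assms by simp
  then show ?thesis
    using act_eta[of i "rst C (e \<odot> cf0 F i)"] assms by (simp add: smap_def)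
qed

text \<open>Every term is cut down to \<open>w\<close>, the preimage along \<open>cf0 F i\<close> of
  the domain of the composite section. There the restrictions vanish and the identity becomes
  \<open>act_mul\<close> for the elements \<open>r \<odot> ?F\<close> and
  \<open>s \<odot> ?F \<odot> w\<close>.\<close>

lemma smap_scomp:
  assumes s: "psec C A i j s" and t: "psec C A j k t"
  shows "smap i k (scomp C A i j k t s) = scomp C B (cfI F i) (cfI F j) (cfI F k) (smap j k t) (smap i j s)"
proof -
  note [simp] = A.psec_simps[OF s] A.psec_simps[OF t] B.psec_simps[OF smap_simps(1)[OF s]]
    B.psec_simps[OF smap_simps(1)[OF t]]
  let ?F = "cf0 F i" and ?G = "cf0 F j"
  let ?ts = "scomp C A i j k t s"
  let ?T = "tau B (cfI F i) (cfI F j)"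
  note TS [simp] = A.psec_simps[OF A.scomp_simps(1)[OF s t]]
  define r where "r = t \<odot> tau A i j \<odot> s"
  define w where "w = rst C (r \<odot> ?F)"
  have r [simp]: "r \<in> Ar C" "src r = P0 A i" "tgt r = P1 A j k" by (simp_all add: r_def)
  have w [simp]: "w \<in> Ar C" "src w = P0 B (cfI F i)" "tgt w = P0 B (cfI F i)" "rst C w = w"
    by (simp_all add: w_def)
  have ww: "w \<odot> w = w" by (simp add: w_def)
  have rtsF: "rst C (?ts \<odot> ?F) = w"
    using A.scomp_simps(2)[OF s t] A.rst_rst_Cmp[of ?F ?ts] A.rst_rst_Cmp[of ?F r]
    by (simp add: r_def w_def)
  have rsw: "rst C (s \<odot> ?F) \<odot> w = w"
    using A.rst_le_src(2)[of "s \<odot> ?F" "t \<odot> tau A i j"] by (simp add: w_def r_def)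
  have nat: "?G \<odot> ?T \<odot> smap i j s = tau A i j \<odot> s \<odot> ?F" by (rule smap_simps(3)[OF s])
  have rt: "rst C (smap j k t \<odot> ?T \<odot> smap i j s) = w"
  proof -
    have "rst C (smap j k t \<odot> ?T \<odot> smap i j s) = rst C (rst C (smap j k t) \<odot> ?T \<odot> smap i j s)"
      by (rule A.rst_rst_Cmp[symmetric]) auto
    also have "\<dots> = rst C (rst C (t \<odot> ?G) \<odot> ?T \<odot> smap i j s)" using smap_simps(2)[OF t] by simp
    also have "\<dots> = rst C ((t \<odot> ?G) \<odot> ?T \<odot> smap i j s)" by (rule A.rst_rst_Cmp) auto
    also have "(t \<odot> ?G) \<odot> ?T \<odot> smap i j s = r \<odot> ?F" using nat by (simp add: r_def)
    finally show ?thesis by (simp add: w_def)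
  qed
  have sm: "smap i j s \<odot> w = act C A F i j (s \<odot> ?F \<odot> w) w"
    using smap_Cmp[OF s, of w] rsw by simp
  have xb: "sgm A i j \<odot> s \<odot> ?F \<odot> w = ?F \<odot> w"
  proof -
    have "sgm A i j \<odot> s \<odot> ?F \<odot> w = (sgm A i j \<odot> s \<odot> ?F) \<odot> w" by simp
    also have "\<dots> = ?F \<odot> rst C (s \<odot> ?F) \<odot> w" unfolding smap_aux[OF s] by simp
    finally show ?thesis using rsw by simp
  qed
  have Ftw: "rst C r \<odot> ?F = ?F \<odot> w" using A.rst_Cmp[of ?F r] by (simp add: w_def)
  have rF: "r \<odot> ?F = r \<odot> ?F \<odot> w"
    using A.Cmp_rst[of "r \<odot> ?F"] by (simp add: w_def del: A.Cmp_rst')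
  have yx: "sgm A j k \<odot> r \<odot> ?F = tau A i j \<odot> s \<odot> ?F \<odot> w"
  proof -
    have "sgm A j k \<odot> r \<odot> ?F = (sgm A j k \<odot> r) \<odot> ?F" by simp
    also have "sgm A j k \<odot> r = tau A i j \<odot> s \<odot> rst C r"
      using A.psec_scomp_aux(4)[OF s t] by (simp add: r_def)
    finally show ?thesis using Ftw by simp
  qed
  have tsF: "?ts \<odot> ?F = mul C A i j k (r \<odot> ?F) (s \<odot> ?F \<odot> w)"
  proof -
    have "?ts \<odot> ?F = ?ts \<odot> rst C ?ts \<odot> ?F" by simp
    also have "rst C ?ts \<odot> ?F = ?F \<odot> w"
      using A.scomp_simps(2)[OF s t] Ftw by (simp add: r_def)
    also have "?ts \<odot> ?F \<odot> w = mul C A i j k (t \<odot> tau A i j \<odot> s \<odot> ?F \<odot> w) (s \<odot> ?F \<odot> w)"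
    proof (rule A.scomp_Cmp[OF s t])
      have "rst C r \<odot> ?F \<odot> w = (?F \<odot> w) \<odot> w" using A.Cmp_reassoc[OF Ftw, of w] by simp
      then show "rst C (t \<odot> tau A i j \<odot> s) \<odot> ?F \<odot> w = ?F \<odot> w"
        using ww by (simp add: r_def[symmetric])
    qed simp_all
    also have "t \<odot> tau A i j \<odot> s \<odot> ?F \<odot> w = r \<odot> ?F" using rF by (simp add: r_def)
    finally show ?thesis .
  qed
  have taw: "?T \<odot> act C A F i j (s \<odot> ?F \<odot> w) w = ?T \<odot> smap i j s \<odot> w" using sm by simp
  \<comment> \<open>By \<open>nat\<close>, the point at which the second section is to be evaluated
    is the target of \<open>smap i j s\<close>; so the inner action is \<open>smap j k t\<close>
    evaluated there.\<close>
  have step: "act C A F j k (r \<odot> ?F) (?T \<odot> smap i j s \<odot> w) = smap j k t \<odot> ?T \<odot> smap i j s"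
  proof -
    let ?b = "?T \<odot> smap i j s \<odot> w"
    have "smap j k t \<odot> ?b = act C A F j k (t \<odot> ?G \<odot> ?b) ?b"
    proof (rule smap_Cmp[OF t])
      have "rst C (t \<odot> ?G) \<odot> ?b = ?b \<odot> rst C ((t \<odot> ?G) \<odot> ?b)" by (rule A.rst_Cmp) simp_all
      also have "(t \<odot> ?G) \<odot> ?b = t \<odot> (?G \<odot> ?T \<odot> smap i j s) \<odot> w" by simp
      also have "\<dots> = r \<odot> ?F" unfolding nat using rF by (simp add: r_def)
      also have "?b \<odot> rst C (r \<odot> ?F) = ?b" using ww by (simp add: w_def[symmetric])
      finally show "rst C (t \<odot> ?G) \<odot> ?b = ?b" .
    qed simp_all
    also have "t \<odot> ?G \<odot> ?b = r \<odot> ?F"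
    proof -
      have "t \<odot> ?G \<odot> ?b = t \<odot> (?G \<odot> ?T \<odot> smap i j s) \<odot> w" by simp
      also have "\<dots> = r \<odot> ?F" unfolding nat using rF by (simp add: r_def)
      finally show ?thesis .
    qed
    also have "smap j k t \<odot> ?b = smap j k t \<odot> ?T \<odot> smap i j s"
      using A.Cmp_rst[of "smap j k t \<odot> ?T \<odot> smap i j s"] rt by simp
    finally show ?thesis by simp
  qed
  have "smap i k ?ts = act C A F i k (mul C A i j k (r \<odot> ?F) (s \<odot> ?F \<odot> w)) w"
    unfolding smap_def rtsF unfolding tsF ..
  also have "\<dots> = mul C B (cfI F i) (cfI F j) (cfI F k)
      (act C A F j k (r \<odot> ?F) (?T \<odot> act C A F i j (s \<odot> ?F \<odot> w) w)) (act C A F i j (s \<odot> ?F \<odot> w) w)"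
    by (rule act_mul) (use xb yx in simp_all)
  also have "\<dots> = mul C B (cfI F i) (cfI F j) (cfI F k) (smap j k t \<odot> ?T \<odot> smap i j s) (smap i j s \<odot> w)"
    unfolding taw sm[symmetric] step ..
  also have "\<dots> = scomp C B (cfI F i) (cfI F j) (cfI F k) (smap j k t) (smap i j s)"
    unfolding scomp_def Let_def rt ..
  finally show ?thesis .
qed

lemma FA_Phi_map:
  "f \<in> Ar (Phi_cat C A) \<Longrightarrow> FA (fst (Phi_map C A F)) f =
    Arr (cfI F (src f)) (lab (smap (src f) (tgt f) (under A f))) (cfI F (tgt f))"
  by (simp add: Phi_map_def Let_def smap_def act_def)

end

locale groupoid_cofunctor = cofunctor C A B F + A: partite_groupoid C A + B: partite_groupoid C B
  for C :: "('o, 'u) rcat" (structure) and A B F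
begin

text \<open>The image of a bisection must again have a partially invertible target map. This does
  not follow from the property for \<open>f\<close> alone, since \<open>cf0 F\<close> need not be
  invertible. Instead the partial inverse \<open>g\<close> of \<open>f\<close> is transported:
  \<open>smap\<close> preserves composition and idempotents, and applying \<open>tau\<close> gives
  the two equations.\<close>

lemma FA_Phi_map_simps:
  assumes f: "f \<in> Ar (Phi_cat C A)"
  shows "FA (fst (Phi_map C A F)) f \<in> Ar (Phi_cat C B)"
    "src (FA (fst (Phi_map C A F)) f) = cfI F (src f)" "tgt (FA (fst (Phi_map C A F)) f) = cfI F (tgt f)"
    "under B (FA (fst (Phi_map C A F)) f) = smap (src f) (tgt f) (under A f)"
proof -
  note F = A.Ar_PhiD[OF f]
  note S = smap_simps[OF F(3)]
  show "src (FA (fst (Phi_map C A F)) f) = cfI F (src f)" "tgt (FA (fst (Phi_map C A F)) f) = cfI F (tgt f)"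
    "under B (FA (fst (Phi_map C A F)) f) = smap (src f) (tgt f) (under A f)"
    using FA_Phi_map[OF f] B.psec_simps[OF S(1)] by (simp_all add: B.under_Arr)
  obtain g where "partial_inverse (Phi_cat C A) f g" using A.Phi_partial_iso[OF f] by (auto simp: partial_iso_def)
  then have g: "g \<in> Ar (Phi_cat C A)" "src g = tgt f" "tgt g = src f"
    "g \<odot>\<^bsub>Phi_cat C A\<^esub> f = rst (Phi_cat C A) f" "f \<odot>\<^bsub>Phi_cat C A\<^esub> g = rst (Phi_cat C A) g"
    by (auto simp: A.Phi.partial_inverse_iff)
  note G = A.Ar_PhiD[OF g(1)]
  have *: "(tau B (cfI F (tgt f)) (cfI F (src f)) \<odot> smap (tgt f) (src f) (under A g)) \<odot>
      tau B (cfI F (src f)) (cfI F (tgt f)) \<odot> smap (src f) (tgt f) (under A f) =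
      rst C (smap (src f) (tgt f) (under A f))"
    if f: "f \<in> Ar (Phi_cat C A)" and g: "g \<in> Ar (Phi_cat C A)" "src g = tgt f" "tgt g = src f"
    "g \<odot>\<^bsub>Phi_cat C A\<^esub> f = rst (Phi_cat C A) f" for f g
  proof -
    note F = A.Ar_PhiD[OF f] A.psec_simps[OF A.Ar_PhiD(3)[OF f]]
    note G = A.Ar_PhiD[OF g(1), unfolded g(2,3)]
    note SF = B.psec_simps[OF smap_simps(1)[OF F(3)]] and SG = B.psec_simps[OF smap_simps(1)[OF G(3)]]
    let ?i = "src f" and ?j = "tgt f"
    have "scomp C A ?i ?j ?i (under A g) (under A f) = eta A ?i \<odot> rst C (under A f)"
      using A.Phi_Cmp(4)[OF f g(1) g(2)[symmetric]] g A.Phi_rst[OF f] by simp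
    then have "scomp C B (cfI F ?i) (cfI F ?j) (cfI F ?i) (smap ?j ?i (under A g)) (smap ?i ?j (under A f)) =
        eta B (cfI F ?i) \<odot> rst C (rst C (under A f) \<odot> cf0 F ?i)"
      using smap_scomp[OF F(3) G(3)] smap_eta[of ?i "rst C (under A f)"] F by simp
    also have "rst C (rst C (under A f) \<odot> cf0 F ?i) = rst C (smap ?i ?j (under A f))"
      using A.rst_rst_Cmp[of "cf0 F ?i" "under A f"] smap_simps(2)[OF F(3)] F by simp
    finally have "tau B (cfI F ?i) (cfI F ?i) \<odot> scomp C B (cfI F ?i) (cfI F ?j) (cfI F ?i) (smap ?j ?i (under A g)) (smap ?i ?j (under A f))
      = rst C (smap ?i ?j (under A f))" using SF by simp
    then show ?thesis
      using B.scomp_simps(3)[OF smap_simps(1)[OF F(3)] smap_simps(1)[OF G(3)]] SF SG by simp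
  qed
  have "partial_inverse C (tau B (cfI F (src f)) (cfI F (tgt f)) \<odot> smap (src f) (tgt f) (under A f))
    (tau B (cfI F (tgt f)) (cfI F (src f)) \<odot> smap (tgt f) (src f) (under A g))"
    using *[OF f g(1-4)] *[OF g(1) f g(3,2)[symmetric] g(5)] B.psec_simps[OF S(1)]
      B.psec_simps[OF smap_simps(1)[OF G(3)]] g(2,3)
    by (simp add: A.partial_inverse_iff)
  then show "FA (fst (Phi_map C A F)) f \<in> Ar (Phi_cat C B)"
    unfolding FA_Phi_map[OF f] by (intro B.Ar_Phi_Arr[OF S(1)]) (auto simp: partial_iso_def)
qed

lemma is_over_map_Phi: "is_over_map C (Phi_obj C A) (Phi_obj C B) (Phi_map C A F)"
proof -
  let ?F = "fst (Phi_map C A F)"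
  have FO: "FO ?F = cfI F" and snd: "snd (Phi_map C A F) = cf0 F" by (simp_all add: Phi_map_def)
  have ext: "FA ?F \<in> extensional (Ar (Phi_cat C A))" by (simp add: Phi_map_def)
  have idn: "FA ?F (Idn (Phi_cat C A) i) = Idn (Phi_cat C B) (cfI F i)" if i: "i \<in> Ix A" for i
    using i A.Phi_Idn[OF i] B.Phi_Idn[of "cfI F i"] FA_Phi_map_simps[OF A.Phi_Idn(1)[OF i]]
      smap_eta[of i "Idn C (P0 A i)"] cf0_simps(4)[OF i]
    by (intro B.under_eqI) (simp_all add: total_map_def)
  have cmp: "FA ?F (g \<odot>\<^bsub>Phi_cat C A\<^esub> f) = FA ?F g \<odot>\<^bsub>Phi_cat C B\<^esub> FA ?F f"
    if f: "f \<in> Ar (Phi_cat C A)" and g: "g \<in> Ar (Phi_cat C A)" and fg: "tgt f = src g" for f g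
    using A.Phi_Cmp(2-)[OF f g fg] FA_Phi_map_simps[OF f] FA_Phi_map_simps[OF g]
      FA_Phi_map_simps[OF A.Phi_Cmp(5)[OF f g fg]]
      B.Phi_Cmp(2-)[OF FA_Phi_map_simps(1)[OF f] FA_Phi_map_simps(1)[OF g]] fg
      smap_scomp[OF A.Ar_PhiD(3)[OF f] A.Ar_PhiD(3)[OF g, folded fg]]
    by (intro B.under_eqI) simp_all
  have fctr: "is_functor (Phi_cat C A) (Phi_cat C B) ?F"
    using idn cmp FA_Phi_map_simps
    by (auto simp: is_functor_def FO A.Phi.category_axioms B.Phi.category_axioms B.Phi.hom_iff)
  have PA: "is_functor (Phi_cat C A) C (Phi_proj C A)" and PB: "is_functor (Phi_cat C B) C (Phi_proj C B)"
    using A.is_restriction_functor_Phi_proj B.is_restriction_functor_Phi_proj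
    by (auto simp: is_restriction_functor_def)
  have PBF: "is_functor (Phi_cat C A) C (comp_fctr (Phi_proj C B) ?F)"
    using is_functor_comp[OF fctr PB] .
  have nat: "(tau A (src f) (tgt f) \<odot> under A f) \<odot> cf0 F (src f) =
      cf0 F (tgt f) \<odot> tau B (cfI F (src f)) (cfI F (tgt f)) \<odot> under B (FA ?F f)"
    if f: "f \<in> Ar (Phi_cat C A)" for f
    using smap_simps(3)[OF A.Ar_PhiD(3)[OF f]] FA_Phi_map_simps[OF f] A.psec_simps[OF A.Ar_PhiD(3)[OF f]]
    by simp
  show ?thesis
    using fctr ext PA PBF nat is_cofunctor_extensional[OF is_cofunctor] FA_Phi_map_simps
    by (auto simp: is_over_map_iff Phi_obj_def FO snd is_nat_trans_def comp_fctr_def A.hom_iff)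
qed

end

lemma groupoid_cofunctorI:
  "\<lbrakk>partite_groupoid C A; partite_groupoid C B; is_cofunctor C A B F\<rbrakk> \<Longrightarrow> groupoid_cofunctor C A B F"
  by (simp add: groupoid_cofunctor_def cofunctor_def cofunctor_axioms_def partite_groupoid_def)

lemma is_functor_Phi_g:
  fixes C :: "('o, 'u) rcat" (structure)
  assumes C: "restriction_category C" and small: "small_hom_sets C"
  shows "is_functor (pGpd C) (iCat_over C) (Phi_g C)"
proof -
  have obj: "is_over_obj C (Phi_obj C A)" if "partite_groupoid C A" for A
    using partite_groupoid.is_over_obj_Phi[OF that small] .
  have maps: "is_over_map C (Phi_obj C A) (Phi_obj C B) (Phi_map C A F)"
    if "partite_groupoid C A" "partite_groupoid C B" "is_cofunctor C A B F" for A B F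
    using groupoid_cofunctor.is_over_map_Phi[OF groupoid_cofunctorI[OF that]] .
  have idn: "Phi_map C A (id_cofun C A) = id_over C (Phi_obj C A)" if A: "partite_groupoid C A" for A
  proof -
    interpret A: partite_groupoid C A by fact
    interpret I: groupoid_cofunctor C A A "id_cofun C A"
      by (rule groupoid_cofunctorI[OF A A A.is_cofunctor_id])
    have id: "cfI (id_cofun C A) i = i" "cf0 (id_cofun C A) i = Idn C (P0 A i)" if "i \<in> Ix A" for i
      using that by (auto simp: id_cofun_def)
    show ?thesis
    proof (rule over_map_eqI[OF maps[OF A A A.is_cofunctor_id] is_over_map_id[OF obj[OF A]]])
      fix f assume f: "f \<in> Ar (fst (Phi_obj C A))"
      then have f': "f \<in> Ar (Phi_cat C A)" by (simp add: Phi_obj_def)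
      note S = A.Ar_PhiD[OF f'] A.psec_simps[OF A.Ar_PhiD(3)[OF f']]
      have "I.smap (src f) (tgt f) (under A f) = under A f"
        using A.act_id[of "src f" "tgt f" "under A f"] S by (simp add: I.smap_def id)
      then have "FA (fst (Phi_map C A (id_cofun C A))) f = f"
        using I.FA_Phi_map_simps[OF f'] S by (intro A.under_eqI) (simp_all add: id)
      then show "FA (fst (Phi_map C A (id_cofun C A))) f = FA (fst (id_over C (Phi_obj C A))) f"
        using f by simp
    qed (simp_all add: Phi_map_def Phi_obj_def id)
  qed
  have cmp: "Phi_map C A (comp_cofun C A B G F) = comp_over C (Phi_obj C A) (Phi_map C B G) (Phi_map C A F)"
    if A: "partite_groupoid C A" and B: "partite_groupoid C B" and D: "partite_groupoid C D"
      and F: "is_cofunctor C A B F" and G: "is_cofunctor C B D G" for A B D F G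
  proof -
    interpret F: groupoid_cofunctor C A B F by (rule groupoid_cofunctorI[OF A B F])
    interpret G: groupoid_cofunctor C B D G by (rule groupoid_cofunctorI[OF B D G])
    interpret GF: composable_cofunctors C A B D F G ..
    interpret H: groupoid_cofunctor C A D "comp_cofun C A B G F"
      by (rule groupoid_cofunctorI[OF A D GF.is_cofunctor_comp])
    show ?thesis
    proof (rule over_map_eqI[OF maps[OF A D GF.is_cofunctor_comp] is_over_map_comp[OF C maps[OF A B F] maps[OF B D G]]])
      fix f assume f: "f \<in> Ar (fst (Phi_obj C A))"
      then have f': "f \<in> Ar (Phi_cat C A)" by (simp add: Phi_obj_def)
      note S = F.A.Ar_PhiD[OF f'] F.A.psec_simps[OF F.A.Ar_PhiD(3)[OF f']]
      note Ff = F.FA_Phi_map_simps[OF f']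
      let ?i = "src f" and ?j = "tgt f" and ?s = "under A f"
      note [simp] = S
      let ?G0 = "cf0 G (cfI F ?i)"
      \<comment> \<open>\<open>r\<close> is the domain common to both ways of transporting the
        section; each becomes an action on the element
        \<open>?s \<odot> cf0 F ?i \<odot> ?G0\<close> over \<open>r\<close>.\<close>
      define r where "r = rst C (?s \<odot> cf0 F ?i \<odot> ?G0)"
      have [simp]: "r \<in> Ar C" "src r = P0 D (cfI G (cfI F ?i))" "tgt r = P0 D (cfI G (cfI F ?i))"
        by (simp_all add: r_def)
      have r1: "rst C (F.smap ?i ?j ?s \<odot> ?G0) = r"
        using F.smap_simps[OF S(3)] F.B.psec_simps[OF F.smap_simps(1)[OF S(3)]]
          F.A.rst_rst_Cmp[of ?G0 "F.smap ?i ?j ?s"] F.A.rst_rst_Cmp[of ?G0 "?s \<odot> cf0 F ?i"]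
        by (simp add: r_def)
      have r2: "rst C (?s \<odot> cf0 F ?i) \<odot> ?G0 = ?G0 \<odot> r"
        using F.A.rst_Cmp[of ?G0 "?s \<odot> cf0 F ?i"] by (simp add: r_def)
      have r3: "?s \<odot> cf0 F ?i \<odot> ?G0 \<odot> r = ?s \<odot> cf0 F ?i \<odot> ?G0"
        using F.A.Cmp_rst[of "?s \<odot> cf0 F ?i \<odot> ?G0"] by (simp add: r_def del: F.A.Cmp_rst')
      have sq: "sgm A ?i ?j \<odot> ?s \<odot> cf0 F ?i \<odot> ?G0 = cf0 F ?i \<odot> ?G0 \<odot> r"
        using F.A.Cmp_reassoc[OF F.smap_aux[OF S(3), simplified], of ?G0] r2
          F.A.psec_comp[OF S(3), of "cf0 F ?i \<odot> ?G0"] F.A.rst_Cmp[of "cf0 F ?i \<odot> ?G0" ?s]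
        by (simp add: r_def)
      have sm: "F.smap ?i ?j ?s \<odot> ?G0 = act C A F ?i ?j (?s \<odot> cf0 F ?i \<odot> ?G0) (?G0 \<odot> r)"
        unfolding F.smap_def using r2 F.smap_aux[OF S(3)] by (subst F.act_Cmp) simp_all
      have "H.smap ?i ?j ?s = act C A (comp_cofun C A B G F) ?i ?j (?s \<odot> cf0 F ?i \<odot> ?G0) r"
        by (simp add: H.smap_def r_def)
      also have "\<dots> = act C B G (cfI F ?i) (cfI F ?j) (act C A F ?i ?j (?s \<odot> cf0 F ?i \<odot> ?G0) (?G0 \<odot> r)) r"
        by (rule GF.act_comp) (use sq in simp_all)
      also have "\<dots> = G.smap (cfI F ?i) (cfI F ?j) (F.smap ?i ?j ?s)"
        unfolding G.smap_def r1 unfolding sm ..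
      finally have "FA (fst (Phi_map C A (comp_cofun C A B G F))) f = FA (fst (Phi_map C B G)) (FA (fst (Phi_map C A F)) f)"
        using H.FA_Phi_map_simps[OF f'] Ff G.FA_Phi_map_simps[OF Ff(1)]
        by (intro G.B.under_eqI) simp_all
      then show "FA (fst (Phi_map C A (comp_cofun C A B G F))) f =
          FA (fst (comp_over C (Phi_obj C A) (Phi_map C B G) (Phi_map C A F))) f" using f by simp
    qed (simp_all add: Phi_map_def Phi_obj_def)
  qed
  show ?thesis
    using obj maps idn cmp category_pGpd category_iCat_over[OF C]
    by (auto simp: is_functor_def Phi_g_def pGpd_def iCat_over_def hom_def)
qed

section \<open>The universal property of a presented groupoid\<close>

text \<open>A functor preserves the equations that characterise \<open>star\<close>, and in inverse
  categories the restriction is \<open>star f \<odot> f\<close>. This is why maps over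
  \<open>C\<close> are plain functors.\<close>

lemma functor_preserves_rst:
  assumes "restriction_category D" "inverse_category D" "restriction_category E" "inverse_category E"
    and F: "is_functor D E F" and f: "f \<in> Ar D"
  shows "FA F (rst D f) = rst E (FA F f)"
proof -
  interpret D: restriction_category D by fact
  interpret E: restriction_category E by fact
  have FA: "FA F x \<in> hom E (FO F (src x)) (FO F (tgt x))" if "x \<in> Ar D" for x
    using F that by (auto simp: is_functor_def)
  have FC: "FA F (y \<odot>\<^bsub>D\<^esub> x) = FA F y \<odot>\<^bsub>E\<^esub> FA F x" if "x \<in> Ar D" "y \<in> Ar D" "tgt x = src y" for x y
    using F that by (auto simp: is_functor_def)
  have s: "partial_inverse D f (star D f)" using partial_inverse_star assms(1,2) f by blast
  then have sA: "star D f \<in> Ar D" "src (star D f) = tgt f" "tgt (star D f) = src f"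
    "star D f \<odot>\<^bsub>D\<^esub> f = rst D f" "f \<odot>\<^bsub>D\<^esub> star D f = rst D (star D f)"
    by (auto simp: D.partial_inverse_iff)
  have pi: "partial_iso E x" if "x \<in> Ar E" for x
    using partial_inverse_star[OF assms(3,4) that] by (auto simp: partial_iso_def)
  have "FA F f \<odot>\<^bsub>E\<^esub> FA F (star D f) \<odot>\<^bsub>E\<^esub> FA F f = FA F (f \<odot>\<^bsub>D\<^esub> star D f \<odot>\<^bsub>D\<^esub> f)"
    "FA F (star D f) \<odot>\<^bsub>E\<^esub> FA F f \<odot>\<^bsub>E\<^esub> FA F (star D f) = FA F (star D f \<odot>\<^bsub>D\<^esub> f \<odot>\<^bsub>D\<^esub> star D f)"
    using sA(1-3) f by (simp_all add: FC)
  then have "is_star E (FA F f) (FA F (star D f))"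
    using FA[OF f] FA[OF sA(1)] sA f by (auto simp: is_star_def E.hom_iff)
  then have "partial_inverse E (FA F f) (FA F (star D f))"
    using E.is_star_iff_partial_inverse[OF pi, of "FA F f"] FA[OF f] by (auto simp: E.hom_iff)
  then show ?thesis using FC[of f "star D f"] sA f by (auto simp: E.partial_inverse_iff)
qed

section \<open>Maps over the base into partial bisections\<close>

locale over_object = join_restriction_category C
  for C :: "('o, 'u) rcat" (structure) +
  fixes D :: "('u, 'u) rcat" and P :: "('u, 'u, 'o, 'u) fctr"
  assumes over_obj: "is_over_obj C (D, P)"
begin

lemma inverse_category_D: "inverse_category D"
  and restriction_functor_P: "is_restriction_functor D C P"
  and restriction_category_D: "restriction_category D"
  using over_obj by (auto simp: is_over_obj_iff is_restriction_functor_def)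

sublocale D: restriction_category D by (rule restriction_category_D)

abbreviation D_Cmp (infixr "\<cdot>" 70) where "g \<cdot> f \<equiv> g \<odot>\<^bsub>D\<^esub> f"

lemma P_simps [simp]:
  "i \<in> Ob D \<Longrightarrow> FO P i \<in> Ob C"
  "f \<in> Ar D \<Longrightarrow> FA P f \<in> Ar C" "f \<in> Ar D \<Longrightarrow> src (FA P f) = FO P (src f)" "f \<in> Ar D \<Longrightarrow> tgt (FA P f) = FO P (tgt f)"
  "f \<in> Ar D \<Longrightarrow> FA P (rst D f) = rst C (FA P f)"
  "i \<in> Ob D \<Longrightarrow> FA P (Idn D i) = Idn C (FO P i)"
  "\<lbrakk>f \<in> Ar D; g \<in> Ar D; tgt f = src g\<rbrakk> \<Longrightarrow> FA P (g \<cdot> f) = FA P g \<odot> FA P f"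
  using restriction_functor_P by (auto simp: is_restriction_functor_def is_functor_def hom_iff)

lemma P_idems [simp]: "e \<in> idems D i \<Longrightarrow> FA P e \<in> idems C (FO P i)"
  using P_simps(5)[of e] by (auto simp: D.idems_iff idems_iff simp del: P_simps(5))

lemma agree_join:
  assumes "f \<in> Ar D" "g \<in> Ar D" "src g = src f" "tgt g = tgt f"
  defines "E \<equiv> FA P ` {e \<in> idems D (src f). restr_le D e (rst D f \<cdot> rst D g) \<and> f \<cdot> e = g \<cdot> e}"
  shows "is_join C (FO P (src f)) (FO P (src f)) E (agree C (D, P) f g)" "E \<subseteq> idems C (FO P (src f))"
    "agree C (D, P) f g \<in> idems C (FO P (src f))"
proof -
  show E: "E \<subseteq> idems C (FO P (src f))" by (auto simp: E_def)
  have O: "FO P (src f) \<in> Ob C" using assms by simp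
  show "is_join C (FO P (src f)) (FO P (src f)) E (agree C (D, P) f g)"
    "agree C (D, P) f g \<in> idems C (FO P (src f))"
    using idems_join_exists[OF E O] by (simp_all add: agree_def E_def)
qed

end

text \<open>A map over \<open>C\<close> from \<open>(D, P)\<close> to the bisections of
  \<open>B\<close> is studied through the sections \<open>u f\<close> of \<open>B\<close>. The
  component \<open>\<alpha> i\<close> leads from the object of \<open>B\<close> at
  \<open>FO F i\<close> to \<open>P i\<close>, so domains that come from \<open>D\<close> are pulled
  back along it.\<close>

locale Phi_over_map = join_partite_groupoid C B + over_object C D P
  for C :: "('o, 'u) rcat" (structure) and B :: "('o, 'u) pcat"
    and D :: "('u, 'u) rcat" and P :: "('u, 'u, 'o, 'u) fctr" +
  fixes F :: "('u, 'u, 'u, 'u) fctr" and \<alpha> :: "'u \<Rightarrow> ('o, 'u) arr"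
  assumes over_map: "is_over_map C (D, P) (Phi_obj C B) (F, \<alpha>)"
begin

definition u :: "('u, 'u) arr \<Rightarrow> ('o, 'u) arr" where
  "u f = under B (FA F f)"

lemma F_functor: "is_functor D (Phi_cat C B) F"
  using over_map by (auto simp: is_over_map_iff Phi_obj_def)

lemma F_simps [simp]:
  "i \<in> Ob D \<Longrightarrow> FO F i \<in> Ix B"
  "f \<in> Ar D \<Longrightarrow> FA F f \<in> Ar (Phi_cat C B)" "f \<in> Ar D \<Longrightarrow> src (FA F f) = FO F (src f)"
  "f \<in> Ar D \<Longrightarrow> tgt (FA F f) = FO F (tgt f)"
  "i \<in> Ob D \<Longrightarrow> FA F (Idn D i) = Idn (Phi_cat C B) (FO F i)"
  "\<lbrakk>f \<in> Ar D; g \<in> Ar D; tgt f = src g\<rbrakk> \<Longrightarrow> FA F (g \<cdot> f) = FA F g \<odot>\<^bsub>Phi_cat C B\<^esub> FA F f"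
  "f \<in> Ar D \<Longrightarrow> FA F (rst D f) = rst (Phi_cat C B) (FA F f)"
  using F_functor functor_preserves_rst[OF restriction_category_D inverse_category_D restriction_category_Phi
      inverse_category_Phi F_functor]
  by (auto simp: is_functor_def hom_def)

lemma \<alpha>_simps [simp]:
  assumes "i \<in> Ob D"
  shows "\<alpha> i \<in> Ar C" "src (\<alpha> i) = P0 B (FO F i)" "tgt (\<alpha> i) = FO P i" "total_map C (\<alpha> i)"
  using over_map assms by (auto simp: is_over_map_iff is_nat_trans_def hom_iff comp_fctr_def Phi_obj_def)

lemma u_psec: "f \<in> Ar D \<Longrightarrow> psec C B (FO F (src f)) (FO F (tgt f)) (u f)"
  using Ar_PhiD(3)[of "FA F f"] by (simp add: u_def)

lemma u_simps [simp]:
  assumes "f \<in> Ar D"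
  shows "u f \<in> Ar C" "src (u f) = P0 B (FO F (src f))" "tgt (u f) = P1 B (FO F (src f)) (FO F (tgt f))"
    "sgm B (FO F (src f)) (FO F (tgt f)) \<odot> u f = rst C (u f)"
  using psec_simps[OF u_psec[OF assms]] by auto

lemma u_natural: "f \<in> Ar D \<Longrightarrow>
    \<alpha> (tgt f) \<odot> tau B (FO F (src f)) (FO F (tgt f)) \<odot> u f = FA P f \<odot> \<alpha> (src f)"
  using over_map by (auto simp: is_over_map_iff is_nat_trans_def comp_fctr_def Phi_obj_def u_def)

lemma u_Idn: "i \<in> Ob D \<Longrightarrow> u (Idn D i) = eta B (FO F i)"
  using Phi_Idn(4)[of "FO F i"] by (simp add: u_def)

lemma u_Cmp: "\<lbrakk>f \<in> Ar D; g \<in> Ar D; tgt f = src g\<rbrakk> \<Longrightarrow>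
    u (g \<cdot> f) = scomp C B (FO F (src f)) (FO F (tgt f)) (FO F (tgt g)) (u g) (u f)"
  using Phi_Cmp(4)[of "FA F f" "FA F g"] by (simp add: u_def)

text \<open>Naturality of \<open>\<alpha>\<close> determines the domain of \<open>u f\<close>, as
  \<open>\<alpha>\<close> and \<open>tau\<close> are total.\<close>

lemma rst_u:
  assumes "f \<in> Ar D"
  shows "rst C (u f) = rst C (FA P f \<odot> \<alpha> (src f))"
proof -
  have "rst C (u f) = rst C (\<alpha> (tgt f) \<odot> tau B (FO F (src f)) (FO F (tgt f)) \<odot> u f)"
    using assms by (simp add: rst_total_Cmp)
  then show ?thesis using u_natural[OF assms] by simp
qed

lemma u_Cmp_idem:
  assumes f: "f \<in> Ar D" and e: "e \<in> idems D (src f)"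
  shows "u (f \<cdot> e) = u f \<odot> rst C (FA P e \<odot> \<alpha> (src f))"
proof -
  have eA: "e \<in> Ar D" "src e = src f" "tgt e = src f" "rst D e = e" using e by (auto simp: D.idems_iff)
  have "u e = under B (rst (Phi_cat C B) (FA F e))" using F_simps(7)[OF eA(1)] eA(4) by (simp add: u_def)
  also have "\<dots> = eta B (FO F (src f)) \<odot> rst C (FA P e \<odot> \<alpha> (src f))"
    using Phi_rst(4)[of "FA F e"] eA rst_u[OF eA(1)] by (simp add: u_def)
  finally have ue: "u e = eta B (FO F (src f)) \<odot> rst C (FA P e \<odot> \<alpha> (src f))" .
  have "u (f \<cdot> e) = scomp C B (FO F (src f)) (FO F (src f)) (FO F (tgt f)) (u f) (u e)"
    using u_Cmp[of e f] eA f by simp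
  also have "\<dots> = u f \<odot> rst C (FA P e \<odot> \<alpha> (src f))"
    unfolding ue by (rule scomp_eta_right[OF u_psec[OF f]]) (use f eA in simp)
  finally show ?thesis .
qed

text \<open>The agreement idempotent is the join of images \<open>P e\<close> with
  \<open>f e = g e\<close>, and pulling back along \<open>\<alpha>\<close> preserves this join. On
  each \<open>P e\<close> functoriality forces \<open>u f\<close> and \<open>u g\<close> to
  coincide.\<close>

lemma u_agree:
  assumes fg: "f \<in> Ar D" "g \<in> Ar D" "src g = src f" "tgt g = tgt f"
    and d: "d \<in> idems C (FO P (src f))" "restr_le C d (agree C (D, P) f g)"
  shows "u f \<odot> rst C (d \<odot> \<alpha> (src f)) = u g \<odot> rst C (d \<odot> \<alpha> (src f))"
proof -
  let ?a = "agree C (D, P) f g" and ?\<alpha> = "\<alpha> (src f)"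
  let ?E = "FA P ` {e \<in> idems D (src f). restr_le D e (rst D f \<cdot> rst D g) \<and> f \<cdot> e = g \<cdot> e}"
  note J = agree_join[OF fg]
  have i: "src f \<in> Ob D" using fg by simp
  have E: "?E \<subseteq> hom C (FO P (src f)) (FO P (src f))" using J(2) by (auto simp: idems_def)
  have aA: "?a \<in> Ar C" "src ?a = FO P (src f)" "tgt ?a = FO P (src f)" using J(3) by (auto simp: idems_iff)
  have dA: "d \<in> Ar C" "src d = FO P (src f)" "tgt d = FO P (src f)" "rst C d = d"
    using d(1) by (auto simp: idems_iff)
  have "u f \<odot> rst C (?a \<odot> ?\<alpha>) = u g \<odot> rst C (?a \<odot> ?\<alpha>)"
  proof (rule is_join_Cmp_eq)
    show "is_join C (src ?\<alpha>) (src ?\<alpha>) ((\<lambda>s. rst C (s \<odot> ?\<alpha>)) ` ?E) (rst C (?a \<odot> ?\<alpha>))"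
      by (rule is_join_restrict[OF J(1) E]) (use i in auto)
    show "(\<lambda>s. rst C (s \<odot> ?\<alpha>)) ` ?E \<subseteq> idems C (src ?\<alpha>)"
      using i by (auto simp: D.idems_iff)
    show "u f \<in> hom C (src ?\<alpha>) (tgt (u f))" "u g \<in> hom C (src ?\<alpha>) (tgt (u f))"
      using fg i by (auto simp: hom_iff)
    fix x assume "x \<in> (\<lambda>s. rst C (s \<odot> ?\<alpha>)) ` ?E"
    then obtain e where e: "e \<in> idems D (src f)" "f \<cdot> e = g \<cdot> e" "x = rst C (FA P e \<odot> ?\<alpha>)"
      by auto
    then show "u f \<odot> x = u g \<odot> x"
      using u_Cmp_idem[OF fg(1) e(1)] u_Cmp_idem[OF fg(2), of e] fg by simp
  qed
  moreover have "rst C (d \<odot> ?\<alpha>) = rst C (?a \<odot> ?\<alpha>) \<odot> rst C (d \<odot> ?\<alpha>)"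
  proof -
    have "restr_le C (d \<odot> ?\<alpha>) (?a \<odot> ?\<alpha>)" by (rule le_precomp[OF d(2)]) (use dA aA i in auto)
    from le_rst[OF this] show ?thesis using dA aA i by simp
  qed
  ultimately have "u f \<odot> rst C (d \<odot> ?\<alpha>) = (u g \<odot> rst C (?a \<odot> ?\<alpha>)) \<odot> rst C (d \<odot> ?\<alpha>)"
    using Cmp_assoc[of "rst C (d \<odot> ?\<alpha>)" "rst C (?a \<odot> ?\<alpha>)" "u f"] fg i aA dA by simp
  also have "\<dots> = u g \<odot> rst C (d \<odot> ?\<alpha>)"
    using \<open>rst C (d \<odot> ?\<alpha>) = rst C (?a \<odot> ?\<alpha>) \<odot> rst C (d \<odot> ?\<alpha>)\<close>
      Cmp_assoc[of "rst C (d \<odot> ?\<alpha>)" "rst C (?a \<odot> ?\<alpha>)" "u g"] fg i aA dA by simp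
  finally show ?thesis .
qed

end

text \<open>One shape for two units: with the sections of the chosen glueings it is the unit at
  \<open>(D, P)\<close>; with the bisections of an etale groupoid it is an identity.\<close>

definition unit_map ::
  "('o, 'u) rcat \<Rightarrow> ('u, 'u) rcat \<Rightarrow> ('u, 'u, 'o, 'u) fctr \<Rightarrow> (('u, 'u) arr \<Rightarrow> ('o, 'u) arr) \<Rightarrow> ('o, 'u) over_map" where
  "unit_map C D P sec = (\<lparr> FO = (\<lambda>i \<in> Ob D. i), FA = (\<lambda>f \<in> Ar D. Arr (src f) (lab (sec f)) (tgt f)) \<rparr>,
    \<lambda>i \<in> Ob D. Idn C (FO P i))"

text \<open>
  The sets \<open>T i j\<close> of pieces may be smaller than the hom-sets of \<open>D\<close>: in the presentation of an etale
  groupoid by all of its bisections, a bisection need not itself have a partial inverse, and only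
  those that do are pieces of the glueing.
\<close>

locale presentation = join_partite_groupoid C A
  for C :: "('o, 'u) rcat" (structure) and A :: "('o, 'u) pcat" +
  fixes D :: "('u, 'u) rcat" and P :: "('u, 'u, 'o, 'u) fctr"
    and sec :: "('u, 'u) arr \<Rightarrow> ('o, 'u) arr"
    and T :: "'u \<Rightarrow> 'u \<Rightarrow> ('u, 'u) arr set" and q :: "('u, 'u) arr \<Rightarrow> ('o, 'u) arr"
  assumes over_obj: "is_over_obj C (D, P)"
    and Ob_D: "Ob D = Ix A" and FO_P: "i \<in> Ix A \<Longrightarrow> FO P i = P0 A i"
    and unit_map: "is_over_map C (D, P) (Phi_obj C A) (unit_map C D P sec)"
    and sec_hom: "f \<in> Ar D \<Longrightarrow> sec f \<in> hom C (P0 A (src f)) (P1 A (src f) (tgt f))"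
    and T_hom: "T i j \<subseteq> hom D i j"
    and T_glued: "\<lbrakk>i \<in> Ix A; j \<in> Ix A\<rbrakk> \<Longrightarrow> glued C (T i j) (sgm A i j) q sec"
    and T_agree: "\<lbrakk>t \<in> T i j; f \<in> hom D i j\<rbrakk> \<Longrightarrow> restr_le C (q t \<odot> sec f) (agree C (D, P) t f)"
begin

text \<open>The unit is itself a map over \<open>C\<close> into bisections, with identity
  components. Its sections \<open>u f\<close> are the \<open>sec f\<close>, so the properties of
  \<open>sec\<close> come from the general lemmas about \<open>u\<close>.\<close>

sublocale U: Phi_over_map C A D P "fst (unit_map C D P sec)" "snd (unit_map C D P sec)"
  using over_obj unit_map by unfold_locales simp_all

lemmas Ob_D' [simp] = Ob_D and FO_P' [simp] = FO_P

lemma U_simps [simp]: "i \<in> Ix A \<Longrightarrow> FO (fst (unit_map C D P sec)) i = i"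
  "i \<in> Ix A \<Longrightarrow> snd (unit_map C D P sec) i = Idn C (P0 A i)"
  by (simp_all add: unit_map_def Ob_D FO_P)

lemma src_tgt_Ix [simp]: "f \<in> Ar D \<Longrightarrow> src f \<in> Ix A" "f \<in> Ar D \<Longrightarrow> tgt f \<in> Ix A"
  using U.D.src_Ob U.D.tgt_Ob Ob_D by auto

lemma u_eq_sec: "f \<in> Ar D \<Longrightarrow> U.u f = sec f"
  using sec_hom[of f] by (subst U.u_def) (simp add: unit_map_def hom_iff under_Arr)

lemma sec_simps [simp]:
  assumes "f \<in> Ar D"
  shows "sec f \<in> Ar C" "src (sec f) = P0 A (src f)" "tgt (sec f) = P1 A (src f) (tgt f)"
    "sgm A (src f) (tgt f) \<odot> sec f = rst C (sec f)"
    "psec C A (src f) (tgt f) (sec f)" "tau A (src f) (tgt f) \<odot> sec f = FA P f"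
  using U.u_simps[OF assms] U.u_psec[OF assms] U.u_natural[OF assms] u_eq_sec[OF assms] assms FO_P by simp_all

lemma rst_sec: "f \<in> Ar D \<Longrightarrow> rst C (sec f) = rst C (FA P f)"
  using U.rst_u[of f] u_eq_sec[of f] FO_P by simp

lemma sec_Idn: "i \<in> Ix A \<Longrightarrow> sec (Idn D i) = eta A i"
  using U.u_Idn[of i] u_eq_sec[of "Idn D i"] Ob_D by simp

lemma sec_Cmp: "\<lbrakk>f \<in> Ar D; g \<in> Ar D; tgt f = src g\<rbrakk> \<Longrightarrow>
    sec (g \<cdot> f) = scomp C A (src f) (tgt f) (tgt g) (sec g) (sec f)"
  using U.u_Cmp[of f g] u_eq_sec[of f] u_eq_sec[of g] u_eq_sec[of "g \<cdot> f"] by simp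

lemma T_Ar: "t \<in> T i j \<Longrightarrow> t \<in> Ar D \<and> src t = i \<and> tgt t = j"
  using T_hom by (auto simp: hom_def)

lemma etale: "etale C A"
proof -
  have "local_homeo C (sgm A i j)" if ij: "i \<in> Ix A" "j \<in> Ix A" for i j
  proof -
    interpret glued C "T i j" "sgm A i j" q sec using T_glued[OF ij] .
    show ?thesis unfolding local_homeo_def
      using p_total p_join q_subset q_s_inverse by (auto simp: partial_iso_def intro!: exI[of _ "q ` T i j"])
  qed
  then show ?thesis by (simp add: etale_def)
qed

end

section \<open>Extending a map over the base to a cofunctor\<close>

locale presentation_map = presentation C A D P sec T q + B: Phi_over_map C B D P F \<alpha>
  for C :: "('o, 'u) rcat" (structure) and A D P sec T q B F \<alpha>
begin

lemma \<alpha>_tgt [simp]: "i \<in> Ix A \<Longrightarrow> \<alpha> i \<in> Ar C" "i \<in> Ix A \<Longrightarrow> src (\<alpha> i) = P0 B (FO F i)"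
  "i \<in> Ix A \<Longrightarrow> tgt (\<alpha> i) = P0 A i" "i \<in> Ix A \<Longrightarrow> total_map C (\<alpha> i)" "i \<in> Ix A \<Longrightarrow> FO F i \<in> Ix B"
  using B.\<alpha>_simps[of i] B.F_simps(1)[of i] FO_P Ob_D by simp_all

text \<open>The pullback of the section \<open>sec f\<close> along \<open>\<alpha>\<close>. These
  are the pieces of the pullback on which the component \<open>cf1\<close> is to be
  prescribed.\<close>

definition tsec :: "('u, 'u) arr \<Rightarrow> ('o, 'u) arr" where
  "tsec f = pair C (sgm A (src f) (tgt f)) (\<alpha> (src f)) (sec f \<odot> \<alpha> (src f)) (rst C (sec f \<odot> \<alpha> (src f)))"

lemma rst_u_sec: "f \<in> Ar D \<Longrightarrow> rst C (B.u f) = rst C (sec f \<odot> \<alpha> (src f))"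
  using B.rst_u[of f] rst_sec[of f] rst_rst_Cmp[of "\<alpha> (src f)" "sec f"] rst_rst_Cmp[of "\<alpha> (src f)" "FA P f"]
  by simp

lemma tsec_square: "f \<in> Ar D \<Longrightarrow> sgm A (src f) (tgt f) \<odot> sec f \<odot> \<alpha> (src f) = \<alpha> (src f) \<odot> rst C (sec f \<odot> \<alpha> (src f))"
  using psec_comp[OF sec_simps(5), of f "\<alpha> (src f)"] rst_Cmp[of "\<alpha> (src f)" "sec f"] by simp

lemma has_pb_\<alpha> [simp]: "\<lbrakk>i \<in> Ix A; j \<in> Ix A\<rbrakk> \<Longrightarrow> has_pb C (sgm A i j) (\<alpha> i)"
  by simp

lemma tsec_simps [simp]:
  assumes f: "f \<in> Ar D"
  shows "tsec f \<in> Ar C" "src (tsec f) = P0 B (FO F (src f))" "tgt (tsec f) = pbo C (sgm A (src f) (tgt f)) (\<alpha> (src f))"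
    "pb1 C (sgm A (src f) (tgt f)) (\<alpha> (src f)) \<odot> tsec f = sec f \<odot> \<alpha> (src f)"
    "pb2 C (sgm A (src f) (tgt f)) (\<alpha> (src f)) \<odot> tsec f = rst C (sec f \<odot> \<alpha> (src f))"
  using pair_simps[OF has_pb_\<alpha>[of "src f" "tgt f"], of "sec f \<odot> \<alpha> (src f)" "rst C (sec f \<odot> \<alpha> (src f))"]
    tsec_square f by (simp_all add: tsec_def)

lemma glued_tsec:
  assumes ij: "i \<in> Ix A" "j \<in> Ix A"
  shows "glued C (T i j) (pb2 C (sgm A i j) (\<alpha> i)) (\<lambda>t. pb2 C (sgm A i j) (\<alpha> i) \<odot> rst C (q t \<odot> pb1 C (sgm A i j) (\<alpha> i))) tsec"
proof -
  interpret G: glued C "T i j" "sgm A i j" q sec using T_glued[OF ij] .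
  let ?g = "pb1 C (sgm A i j) (\<alpha> i)" and ?r = "pb2 C (sgm A i j) (\<alpha> i)"
  note pb = has_pb_\<alpha>[OF ij]
  show ?thesis
  proof (rule G.glued_pullback[OF is_pullback_pb[OF pb] \<alpha>_tgt(4)[OF ij(1)]])
    fix f assume f: "f \<in> T i j"
    have fA: "f \<in> Ar D" "src f = i" "tgt f = j" using T_Ar[OF f] by auto
    show "tsec f \<in> hom C (src (\<alpha> i)) (src ?g) \<and> ?g \<odot> tsec f = sec f \<odot> \<alpha> i \<and> ?r \<odot> tsec f = rst C (sec f \<odot> \<alpha> i)"
      using tsec_simps[OF fA(1)] fA ij pb_simps[OF pb] by (simp add: hom_iff)
  qed
qed

text \<open>The idempotent \<open>q t \<odot> sec f\<close> marks where \<open>sec f\<close> runs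
  inside piece \<open>t\<close>. By \<open>T_agree\<close> it is below the agreement of
  \<open>t\<close> and \<open>f\<close>, where \<open>u_agree\<close> applies. This is the
  consistency condition for glueing the \<open>u t\<close>.\<close>

lemma q_section_agree:
  assumes ij: "i \<in> Ix A" "j \<in> Ix A" and t: "t \<in> T i j" and f: "f \<in> hom D i j"
  shows "q t \<odot> sec f \<in> idems C (P0 A i)"
    "B.u t \<odot> rst C ((q t \<odot> sec f) \<odot> \<alpha> i) = B.u f \<odot> rst C ((q t \<odot> sec f) \<odot> \<alpha> i)"
proof -
  interpret G: glued C "T i j" "sgm A i j" q sec using T_glued[OF ij] .
  have fA: "f \<in> Ar D" "src f = i" "tgt f = j" and tA: "t \<in> Ar D" "src t = i" "tgt t = j"
    using f T_Ar[OF t] by (auto simp: hom_def)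
  have "partial_section C (sgm A i j) (sec f)"
    using sec_simps[OF fA(1)] fA ij by (auto simp: partial_section_def hom_iff)
  then show 1: "q t \<odot> sec f \<in> idems C (P0 A i)" using G.q_section(2)[OF _ t] ij by simp
  show "B.u t \<odot> rst C ((q t \<odot> sec f) \<odot> \<alpha> i) = B.u f \<odot> rst C ((q t \<odot> sec f) \<odot> \<alpha> i)"
    using B.u_agree[OF tA(1) fA(1), of "q t \<odot> sec f"] 1 T_agree[OF t f] fA tA FO_P ij by simp
qed

text \<open>The value \<open>u t\<close> is prescribed on the section \<open>tsec t\<close>. The
  overlap of two pulled back pieces is the preimage under \<open>\<alpha> i\<close> of the overlap
  below, so the prescription is consistent by \<open>q_section_agree\<close>.\<close>

lemma extension_exists:
  assumes ij: "i \<in> Ix A" "j \<in> Ix A"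
  shows "\<exists>w. w \<in> hom C (pbo C (sgm A i j) (\<alpha> i)) (P1 B (FO F i) (FO F j)) \<and> (\<forall>t \<in> T i j. w \<odot> tsec t = B.u t)"
proof -
  interpret G: glued C "T i j" "sgm A i j" q sec using T_glued[OF ij] .
  let ?g = "pb1 C (sgm A i j) (\<alpha> i)" and ?r = "pb2 C (sgm A i j) (\<alpha> i)"
  note pbs = pb_simps[OF has_pb_\<alpha>[OF ij], simp]
  interpret H: glued C "T i j" ?r "\<lambda>t. ?r \<odot> rst C (q t \<odot> ?g)" tsec using glued_tsec[OF ij] .
  note [simp] = ij
  have tA [simp]: "t \<in> Ar D" "src t = i" "tgt t = j" if "t \<in> T i j" for t using T_Ar[OF that] by auto
  have gts [simp]: "?g \<odot> tsec t = sec t \<odot> \<alpha> i" "?r \<odot> tsec t = rst C (sec t \<odot> \<alpha> i)"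
    "src (tsec t) = P0 B (FO F i)" "tgt (tsec t) = pbo C (sgm A i j) (\<alpha> i)" if "t \<in> T i j" for t
    using tsec_simps[of t] that by simp_all
have rts: "rst C (tsec t) = rst C (sec t \<odot> \<alpha> i)" if "t \<in> T i j" for t
    using H.p_s[OF that] gts(2)[OF that] by (rule trans[OF sym])
  have "\<exists>w. w \<in> hom C (src ?r) (P1 B (FO F i) (FO F j)) \<and> (\<forall>t \<in> T i j. w \<odot> tsec t = B.u t)"
  proof (rule H.extension)
    show "P1 B (FO F i) (FO F j) \<in> Ob C" by simp
    fix t assume t: "t \<in> T i j"
    show "B.u t \<in> hom C (tgt ?r) (P1 B (FO F i) (FO F j))"
      using t B.u_simps[of t] by (simp add: hom_iff)
    show "B.u t \<odot> rst C (tsec t) = B.u t"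
      using t rts[OF t] rst_u_sec[of t] Cmp_rst[of "B.u t"] by simp
    fix f assume f: "f \<in> T i j"
    have h: "t \<in> hom D i j" using t by (simp add: hom_def)
    have uA: "src (B.u t) = P0 B (FO F i)" "src (B.u f) = P0 B (FO F i)"
      using t f B.u_simps[of t] B.u_simps[of f] by simp_all
    have "(?r \<odot> rst C (q f \<odot> ?g)) \<odot> tsec t = ?r \<odot> tsec t \<odot> rst C ((q f \<odot> ?g) \<odot> tsec t)"
      using t f rst_Cmp[of "tsec t" "q f \<odot> ?g"] by simp
    also have "\<dots> = (?r \<odot> tsec t) \<odot> rst C ((q f \<odot> ?g) \<odot> tsec t)"
      using t f by (intro Cmp_assoc[symmetric]) auto
    also have "\<dots> = rst C (sec t \<odot> \<alpha> i) \<odot> rst C ((q f \<odot> sec t) \<odot> \<alpha> i)"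
      using t f rts[OF t] by simp
    also have "\<dots> = rst C ((q f \<odot> sec t) \<odot> \<alpha> i)"
      using rst_le_src(2)[of "sec t \<odot> \<alpha> i" "q f"] t f by simp
    finally have "(?r \<odot> rst C (q f \<odot> ?g)) \<odot> tsec t = rst C ((q f \<odot> sec t) \<odot> \<alpha> i)" .
    then show "B.u t \<odot> (?r \<odot> rst C (q f \<odot> ?g)) \<odot> tsec t = B.u f \<odot> (?r \<odot> rst C (q f \<odot> ?g)) \<odot> tsec t"
      using q_section_agree(2)[OF ij f h] by simp
  qed
  then show ?thesis by simp
qed

text \<open>The choice is harmless: the \<open>tsec t\<close> are jointly epic, so \<open>w\<close>
  is determined by its values on them.\<close>

definition K :: "('o, 'u) cofun" where
  "K = \<lparr> cfI = (\<lambda>i \<in> Ix A. FO F i), cf0 = (\<lambda>i \<in> Ix A. \<alpha> i),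
    cf1 = (\<lambda>i \<in> Ix A. \<lambda>j \<in> Ix A. SOME w. w \<in> hom C (pbo C (sgm A i j) (\<alpha> i)) (P1 B (FO F i) (FO F j)) \<and>
      (\<forall>t \<in> T i j. w \<odot> tsec t = B.u t)) \<rparr>"

lemma K_simps [simp]: "i \<in> Ix A \<Longrightarrow> cfI K i = FO F i" "i \<in> Ix A \<Longrightarrow> cf0 K i = \<alpha> i"
  by (simp_all add: K_def)

lemma cf1_K:
  assumes "i \<in> Ix A" "j \<in> Ix A"
  shows "cf1 K i j \<in> hom C (pbo C (sgm A i j) (\<alpha> i)) (P1 B (FO F i) (FO F j))"
    "t \<in> T i j \<Longrightarrow> cf1 K i j \<odot> tsec t = B.u t"
  using someI_ex[OF extension_exists[OF assms]] assms by (auto simp: K_def)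

lemma cf1_K_simps [simp]:
  assumes "i \<in> Ix A" "j \<in> Ix A"
  shows "cf1 K i j \<in> Ar C" "src (cf1 K i j) = pbo C (sgm A i j) (\<alpha> i)" "tgt (cf1 K i j) = P1 B (FO F i) (FO F j)"
  using cf1_K(1)[OF assms] by (auto simp: hom_iff)

text \<open>The facts of locale \<open>cofunctor\<close> are not yet available for \<open>K\<close>;
  these are the ones that do not depend on the cofunctor axioms.\<close>

lemma act_K_simps:
  assumes ij: "i \<in> Ix A" "j \<in> Ix A"
    and x: "x \<in> Ar C" "tgt x = P1 A i j" and b: "b \<in> Ar C" "src b = src x" "tgt b = P0 B (FO F i)"
    and xb: "sgm A i j \<odot> x = \<alpha> i \<odot> b"
  shows "act C A K i j x b \<in> Ar C" "src (act C A K i j x b) = src x" "tgt (act C A K i j x b) = P1 B (FO F i) (FO F j)"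
    "\<lbrakk>h \<in> Ar C; tgt h = src x\<rbrakk> \<Longrightarrow> act C A K i j x b \<odot> h = act C A K i j (x \<odot> h) (b \<odot> h)"
    "rst C x = rst C b"
proof -
  note pb = has_pb_\<alpha>[OF ij]
  note p = pair_simps[OF pb, of x b]
  show "act C A K i j x b \<in> Ar C" "src (act C A K i j x b) = src x" "tgt (act C A K i j x b) = P1 B (FO F i) (FO F j)"
    using p assms by (simp_all add: act_def)
  show "\<lbrakk>h \<in> Ar C; tgt h = src x\<rbrakk> \<Longrightarrow> act C A K i j x b \<odot> h = act C A K i j (x \<odot> h) (b \<odot> h)"
    using p assms pair_Cmp[OF pb, of x b h] by (simp add: act_def)
  show "rst C x = rst C b" using total_rst_eq[of "sgm A i j" "\<alpha> i" x b] assms by simp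
qed

lemma cf1_K_projections:
  assumes ij [simp]: "i \<in> Ix A" "j \<in> Ix A"
  shows "sgm B (FO F i) (FO F j) \<odot> cf1 K i j = pb2 C (sgm A i j) (\<alpha> i)"
    "\<alpha> j \<odot> tau B (FO F i) (FO F j) \<odot> cf1 K i j = tau A i j \<odot> pb1 C (sgm A i j) (\<alpha> i)"
proof -
  let ?g = "pb1 C (sgm A i j) (\<alpha> i)" and ?r = "pb2 C (sgm A i j) (\<alpha> i)"
  note pbs = pb_simps[OF has_pb_\<alpha>[OF ij], simp] and [simp] = cf1_K(1)[OF ij]
  interpret H: glued C "T i j" ?r "\<lambda>t. ?r \<odot> rst C (q t \<odot> ?g)" tsec using glued_tsec[OF ij] .
  have t: "t \<in> Ar D" "src t = i" "tgt t = j" if "t \<in> T i j" for t using T_Ar[OF that] by auto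
  show "sgm B (FO F i) (FO F j) \<odot> cf1 K i j = ?r"
  proof (rule H.joint_epi)
    fix f assume f: "f \<in> T i j"
    show "(sgm B (FO F i) (FO F j) \<odot> cf1 K i j) \<odot> tsec f = ?r \<odot> tsec f"
      using cf1_K(2)[OF ij f] tsec_simps[OF t(1)[OF f]] t[OF f] B.u_simps(4)[OF t(1)[OF f]] rst_u_sec[OF t(1)[OF f]]
      by simp
  qed auto
  show "\<alpha> j \<odot> tau B (FO F i) (FO F j) \<odot> cf1 K i j = tau A i j \<odot> ?g"
  proof (rule H.joint_epi)
    fix f assume f: "f \<in> T i j"
    note t = t[OF f]
    have "tau A i j \<odot> sec f \<odot> \<alpha> i = FA P f \<odot> \<alpha> i"
      using Cmp_reassoc[OF sec_simps(6)[OF t(1)], of "\<alpha> i"] sec_simps[OF t(1)] t by simp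
    then show "(\<alpha> j \<odot> tau B (FO F i) (FO F j) \<odot> cf1 K i j) \<odot> tsec f = (tau A i j \<odot> ?g) \<odot> tsec f"
      using cf1_K(2)[OF ij f] tsec_simps[OF t(1)] t B.u_natural[OF t(1)] by simp
  qed auto
qed

lemma act_K_projections:
  assumes ij: "i \<in> Ix A" "j \<in> Ix A"
    and x: "x \<in> Ar C" "tgt x = P1 A i j" and b: "b \<in> Ar C" "src b = src x" "tgt b = P0 B (FO F i)"
    and xb: "sgm A i j \<odot> x = \<alpha> i \<odot> b"
  shows "sgm B (FO F i) (FO F j) \<odot> act C A K i j x b = b"
    "\<alpha> j \<odot> tau B (FO F i) (FO F j) \<odot> act C A K i j x b = tau A i j \<odot> x"
proof -
  note pb = has_pb_\<alpha>[OF ij]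
  note p = pair_simps[OF pb, of x b] and pbs = pb_simps[OF pb] and k = cf1_K_projections[OF ij]
  show "sgm B (FO F i) (FO F j) \<odot> act C A K i j x b = b"
    "\<alpha> j \<odot> tau B (FO F i) (FO F j) \<odot> act C A K i j x b = tau A i j \<odot> x"
    using Cmp_reassoc[OF k(1), of "pair C (sgm A i j) (\<alpha> i) x b"] Cmp_reassoc[OF k(2), of "pair C (sgm A i j) (\<alpha> i) x b"]
      p pbs assms by (simp_all add: act_def)
qed

lemma act_K_T:
  assumes ij: "i \<in> Ix A" "j \<in> Ix A" and t: "t \<in> T i j"
    and b: "b \<in> Ar C" "tgt b = P0 B (FO F i)" "rst C (sec t \<odot> \<alpha> i \<odot> b) = rst C b"
  shows "act C A K i j (sec t \<odot> \<alpha> i \<odot> b) b = B.u t \<odot> b"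
proof -
  have tA: "t \<in> Ar D" "src t = i" "tgt t = j" using T_Ar[OF t] by auto
  note ts = tsec_simps[OF tA(1), unfolded tA(2,3)]
  have sA: "src (sec t) = P0 A i" "tgt (sec t) = P1 A i j" "sec t \<in> Ar C" using sec_simps[of t] tA by simp_all
  have r: "rst C (sec t \<odot> \<alpha> i) \<odot> b = b"
    using rst_Cmp[of b "sec t \<odot> \<alpha> i"] ij b sA by simp
  have "pair C (sgm A i j) (\<alpha> i) (sec t \<odot> \<alpha> i \<odot> b) b = tsec t \<odot> b"
  proof (rule pair_eqI[OF has_pb_\<alpha>[OF ij]])
    note pbs = pb_simps[OF has_pb_\<alpha>[OF ij]]
    show "pb1 C (sgm A i j) (\<alpha> i) \<odot> tsec t \<odot> b = sec t \<odot> \<alpha> i \<odot> b"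
      using Cmp_reassoc[OF ts(4), of b] b ts pbs ij sA by simp
    show "pb2 C (sgm A i j) (\<alpha> i) \<odot> tsec t \<odot> b = b"
      using Cmp_reassoc[OF ts(5), of b] b ts pbs ij r by simp
  qed (use ts b in auto)
  then have "act C A K i j (sec t \<odot> \<alpha> i \<odot> b) b = cf1 K i j \<odot> tsec t \<odot> b"
    using ij by (simp add: act_def)
  also have "\<dots> = B.u t \<odot> b" by (rule Cmp_reassoc[OF cf1_K(2)[OF ij t]]) (use ij b ts in auto)
  finally show ?thesis .
qed

text \<open>For pieces \<open>t\<close> the formula holds by construction. For a general
  \<open>f\<close> the element \<open>sec f \<odot> \<alpha> i \<odot> b\<close> is cut into parts
  lying in pieces \<open>t\<close>, and on each of these \<open>u t\<close> and \<open>u f\<close>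
  agree.\<close>

lemma act_K_sec:
  assumes f: "f \<in> Ar D" "src f = i" "tgt f = j"
    and b: "b \<in> Ar C" "tgt b = P0 B (FO F i)" "rst C (sec f \<odot> \<alpha> i \<odot> b) = rst C b"
  shows "act C A K i j (sec f \<odot> \<alpha> i \<odot> b) b = B.u f \<odot> b"
proof -
  have ij [simp]: "i \<in> Ix A" "j \<in> Ix A" using f src_tgt_Ix[of f] by auto
  interpret G: glued C "T i j" "sgm A i j" q sec using T_glued[OF ij] .
  have sA [simp]: "src (sec f) = P0 A i" "tgt (sec f) = P1 A i j" "sec f \<in> Ar C" using sec_simps[of f] f by simp_all
  have uA [simp]: "B.u f \<in> Ar C" "src (B.u f) = P0 B (FO F i)" "tgt (B.u f) = P1 B (FO F i) (FO F j)"
    using B.u_simps[of f] f by simp_all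
  note [simp] = b(1,2)
  let ?x = "sec f \<odot> \<alpha> i \<odot> b"
  have r: "rst C (sec f) \<odot> \<alpha> i \<odot> b = \<alpha> i \<odot> b"
    using rst_Cmp[of "\<alpha> i \<odot> b" "sec f"] b by simp
  have sx: "sgm A i j \<odot> ?x = \<alpha> i \<odot> b"
    using psec_comp[OF sec_simps(5)[OF f(1)], of "\<alpha> i \<odot> b"] f r by simp
  note ax = act_K_simps[OF ij, of ?x b]
  have "act C A K i j ?x b \<odot> rst C ?x = (B.u f \<odot> b) \<odot> rst C ?x"
  proof (rule G.local_eq)
    fix t assume t: "t \<in> T i j"
    have tA [simp]: "t \<in> Ar D" "src t = i" "tgt t = j" using T_Ar[OF t] by auto
have utA [simp]: "B.u t \<in> Ar C" "src (B.u t) = P0 B (FO F i)" "tgt (B.u t) = P1 B (FO F i) (FO F j)"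
      using B.u_simps[of t] by simp_all
    have qA [simp]: "q t \<in> Ar C" "src (q t) = P1 A i j" "tgt (q t) = P0 A i" using G.q_simps[OF t] by simp_all
    define r where "r = rst C (q t \<odot> ?x)"
    have rA [simp]: "r \<in> Ar C" "src r = src b" "tgt r = src b" "r \<in> idems C (src b)" by (simp_all add: r_def)
    have xr: "?x \<odot> r = sec t \<odot> \<alpha> i \<odot> b \<odot> r"
    proof -
      have "?x \<odot> r = sec t \<odot> sgm A i j \<odot> ?x \<odot> r"
        using G.local_rep[OF t, of ?x] by (simp add: r_def)
      also have "sgm A i j \<odot> ?x \<odot> r = \<alpha> i \<odot> b \<odot> r" using Cmp_reassoc[OF sx, of r] by simp
      finally show ?thesis .
    qed
    have rbr: "rst C (b \<odot> r) = rst C b \<odot> r" "rst C (?x \<odot> r) = rst C ?x \<odot> r"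
      using rst_Cmp_idem[of r "src b" b] rst_Cmp_idem[of r "src b" ?x] by simp_all
    have "act C A K i j ?x b \<odot> r = act C A K i j (sec t \<odot> \<alpha> i \<odot> b \<odot> r) (b \<odot> r)"
      using ax(4) sx xr by simp
    also have "\<dots> = B.u t \<odot> b \<odot> r"
      by (rule act_K_T[OF ij t]) (use xr rbr b(3) in simp_all)
    also have "b \<odot> r = rst C ((q t \<odot> sec f) \<odot> \<alpha> i) \<odot> b"
      using rst_Cmp[of b "(q t \<odot> sec f) \<odot> \<alpha> i"] by (simp add: r_def)
    also have "B.u t \<odot> rst C ((q t \<odot> sec f) \<odot> \<alpha> i) \<odot> b = B.u f \<odot> rst C ((q t \<odot> sec f) \<odot> \<alpha> i) \<odot> b"
      using arg_cong[OF q_section_agree(2)[OF ij t, of f], of "\<lambda>z. z \<odot> b"] f by (simp add: hom_def)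
    also have "rst C ((q t \<odot> sec f) \<odot> \<alpha> i) \<odot> b = b \<odot> r"
      using rst_Cmp[of b "(q t \<odot> sec f) \<odot> \<alpha> i"] by (simp add: r_def)
    finally show "act C A K i j ?x b \<odot> rst C (q t \<odot> ?x) = (B.u f \<odot> b) \<odot> rst C (q t \<odot> ?x)"
      by (simp add: r_def)
  qed (use ax sx in \<open>auto simp: hom_iff\<close>)
  moreover have "act C A K i j ?x b \<odot> rst C ?x = act C A K i j ?x b"
    using ax(4)[of "rst C ?x"] sx b(3) by simp
  moreover have "(B.u f \<odot> b) \<odot> rst C ?x = B.u f \<odot> b" using b(3) by simp
  ultimately show ?thesis by simp
qed

lemma mul_sec:
  assumes f: "f \<in> Ar D" "src f = i" "tgt f = j" and g: "g \<in> Ar D" "src g = j" "tgt g = k"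
    and v: "v \<in> Ar C" "tgt v = P0 A i" "rst C (sec g \<odot> FA P f \<odot> v) = rst C v"
  shows "mul C A i j k (sec g \<odot> FA P f \<odot> v) (sec f \<odot> v) = sec (g \<cdot> f) \<odot> v"
proof -
  have s: "psec C A i j (sec f)" and t: "psec C A j k (sec g)"
    using sec_simps(5)[OF f(1)] sec_simps(5)[OF g(1)] f g by simp_all
  note [simp] = psec_simps[OF s] psec_simps[OF t] v(1,2)
  have ft: "tau A i j \<odot> sec f = FA P f" using sec_simps(6)[OF f(1)] f by simp
  have ftv: "tau A i j \<odot> sec f \<odot> v = FA P f \<odot> v" using Cmp_reassoc[OF ft, of v] by simp
  have "scomp C A i j k (sec g) (sec f) \<odot> v = mul C A i j k (sec g \<odot> tau A i j \<odot> sec f \<odot> v) (sec f \<odot> v)"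
  proof (rule scomp_Cmp[OF s t v(1,2)])
    show "rst C (sec g \<odot> tau A i j \<odot> sec f) \<odot> v = v"
      using rst_Cmp[of v "sec g \<odot> tau A i j \<odot> sec f"] ftv v(3) by simp
  qed
  then show ?thesis using sec_Cmp[OF f(1) g(1)] f g ftv by simp
qed

text \<open>Multiplicativity is the substantial axiom. Cutting \<open>x\<close> into pieces
  \<open>sec f\<close> and then \<open>y\<close> into pieces \<open>sec g\<close> reduces both sides
  to \<open>u (g f)\<close>: on the left because \<open>sec\<close> respects composition, on the
  right because \<open>u\<close> does.\<close>

lemma is_cofunctor_K: "is_cofunctor C A B K"
proof (rule is_cofunctorI)
  show "partite_category C A" "partite_category C B"
    using partite_category_axioms B.partite_category_axioms by auto
  show "cfI K \<in> Ix A \<rightarrow>\<^sub>E Ix B" "cf0 K \<in> extensional (Ix A)" "cf1 K \<in> extensional (Ix A)"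
    by (auto simp: K_def)
  show "cf1 K i \<in> extensional (Ix A)" if "i \<in> Ix A" for i using that by (auto simp: K_def)
  show "cf0 K i \<in> hom C (P0 B (cfI K i)) (P0 A i) \<and> total_map C (cf0 K i)" if "i \<in> Ix A" for i
    using that by (simp add: hom_iff)
next
  fix i j assume ij [simp]: "i \<in> Ix A" "j \<in> Ix A"
  show "cf1 K i j \<in> hom C (pbo C (sgm A i j) (cf0 K i)) (P1 B (cfI K i) (cfI K j))"
    using cf1_K(1)[OF ij] by simp
  show "sgm B (cfI K i) (cfI K j) \<odot> cf1 K i j = pb2 C (sgm A i j) (cf0 K i)"
    "cf0 K j \<odot> tau B (cfI K i) (cfI K j) \<odot> cf1 K i j = tau A i j \<odot> pb1 C (sgm A i j) (cf0 K i)"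
    using cf1_K_projections[OF ij] by simp_all
next
  fix i assume i [simp]: "i \<in> Ix A"
  have iD: "i \<in> Ob D" by (simp add: Ob_D)
  \<comment> \<open>The unit of \<open>A\<close> at \<open>i\<close> is the section of an identity
    map, so the unit law is an instance of the formula for sections.\<close>
  have "act C A K i i (sec (Idn D i) \<odot> \<alpha> i \<odot> Idn C (P0 B (FO F i))) (Idn C (P0 B (FO F i))) = B.u (Idn D i) \<odot> Idn C (P0 B (FO F i))"
    by (rule act_K_sec) (use iD in \<open>simp_all add: sec_Idn rst_total_Cmp total_map_def[symmetric]\<close>,
      use \<alpha>_tgt(4)[OF i] in \<open>simp add: total_map_def\<close>)
  then show "act C A K i i (eta A i \<odot> cf0 K i) (Idn C (P0 B (cfI K i))) = eta B (cfI K i)"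
    using B.u_Idn[OF iD] by (simp add: sec_Idn)
next
  fix i j k x y b
  assume ij [simp]: "i \<in> Ix A" "j \<in> Ix A" "k \<in> Ix A" and x [simp]: "x \<in> Ar C" "tgt x = P1 A i j"
    and y [simp]: "y \<in> Ar C" "src y = src x" "tgt y = P1 A j k" and b [simp]: "b \<in> Ar C" "src b = src x"
    and b': "tgt b = P0 B (cfI K i)" and xb': "sgm A i j \<odot> x = cf0 K i \<odot> b" and yx: "sgm A j k \<odot> y = tau A i j \<odot> x"
  from b' have bt [simp]: "tgt b = P0 B (FO F i)" by simp
  from xb' have xb: "sgm A i j \<odot> x = \<alpha> i \<odot> b" by simp
  let ?T = "tau B (FO F i) (FO F j)"
  let ?L = "act C A K i k (mul C A i j k y x) b"
  let ?R = "mul C B (FO F i) (FO F j) (FO F k) (act C A K j k y (?T \<odot> act C A K i j x b)) (act C A K i j x b)"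
  interpret G: glued C "T i j" "sgm A i j" q sec using T_glued by simp
  interpret H: glued C "T j k" "sgm A j k" q sec using T_glued by simp
  note m = mul_simps[OF ij x y yx]
  note a1 = act_K_simps[OF ij(1,2) x b bt xb]
  have sm: "sgm A i k \<odot> mul C A i j k y x = \<alpha> i \<odot> b" using m xb by simp
  note aL = act_K_simps[OF ij(1,3) m(1,3), of b, OF b(1) _ bt sm]
  note nat = act_K_projections(2)[OF ij(1,2) x b bt xb] and sgm_act = act_K_projections(1)[OF ij(1,2) x b bt xb]
  have yx': "sgm A j k \<odot> y = \<alpha> j \<odot> ?T \<odot> act C A K i j x b" using yx nat by simp
  have tA: "?T \<odot> act C A K i j x b \<in> Ar C" "src (?T \<odot> act C A K i j x b) = src y"
    "tgt (?T \<odot> act C A K i j x b) = P0 B (FO F j)" using a1 by simp_all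
  note a2 = act_K_simps[OF ij(2,3) y(1,3) tA yx']
  note sgm2 = act_K_projections(1)[OF ij(2,3) y(1,3) tA yx']
  have FI: "FO F i \<in> Ix B" "FO F j \<in> Ix B" "FO F k \<in> Ix B" by simp_all
  note mB = B.mul_simps[OF FI a1(1,3) a2(1) a2(2)[unfolded y(2) a1(2)[symmetric]] a2(3) sgm2]
  have rx: "rst C x = rst C b" "rst C y = rst C b"
    using a1(5) total_rst_eq[of "sgm A j k" "tau A i j" y x] yx by simp_all
  \<comment> \<open>Neither side extends beyond the domain of \<open>b\<close>, which is also that
    of \<open>x\<close> and of \<open>y\<close>; so covers of these domains decide the
    equation.\<close>
  have L_r: "?L \<odot> rst C b = ?L" using aL(4)[of "rst C b"] m(2,6) rx mul_Cmp[OF ij x y yx, of "rst C b"]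
      Cmp_rst[of x] Cmp_rst[of y] b(2) by simp
  have R_r: "?R \<odot> rst C b = ?R"
    using mB a1 a2 sgm_act B.rst_sgm[of "FO F i" "FO F j" "act C A K i j x b"] Cmp_rst[OF mB(1)]
      by (simp del: B.rst_sgm)
  have xr: "x \<odot> rst C b = x" "y \<odot> rst C b = y" using Cmp_rst[of x] Cmp_rst[of y] rx by simp_all
  have hLR: "?L \<in> hom C (src x) (P1 B (FO F i) (FO F k))" "?R \<in> hom C (src x) (P1 B (FO F i) (FO F k))"
    using aL(1-3) mB(1-3) a1(1-3) m(1-3) by (auto simp: hom_iff)
  have "?L \<odot> rst C b = ?R \<odot> rst C b"
  proof (rule G.piecewise_eq[OF x(1) _ hLR])
    fix f r1 assume f: "f \<in> T i j" and r1: "r1 \<in> idems C (src x)" and xr1: "x \<odot> r1 = sec f \<odot> sgm A i j \<odot> x \<odot> r1"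
    have fA [simp]: "f \<in> Ar D" "src f = i" "tgt f = j" using T_Ar[OF f] by auto
    show "?L \<odot> r1 = ?R \<odot> r1"
    proof (rule H.piecewise_eq[OF y(1) _ hLR[folded y(2)]])
      fix g r assume g: "g \<in> T j k" and r': "r \<in> idems C (src y)" and r1r: "r1 \<odot> r = r" and yr1: "y \<odot> r = sec g \<odot> sgm A j k \<odot> y \<odot> r"
      have gA [simp]: "g \<in> Ar D" "src g = j" "tgt g = k" using T_Ar[OF g] by auto
have uA [simp]: "B.u f \<in> Ar C" "src (B.u f) = P0 B (FO F i)" "tgt (B.u f) = P1 B (FO F i) (FO F j)"
        "B.u g \<in> Ar C" "src (B.u g) = P0 B (FO F j)" "tgt (B.u g) = P1 B (FO F j) (FO F k)"
        using B.u_simps[of f] B.u_simps[of g] by simp_all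
      have r [simp]: "r \<in> Ar C" "src r = src x" "tgt r = src x" "r \<in> idems C (src x)" "r1 \<in> Ar C" "src r1 = src x" "tgt r1 = src x"
        using r' r1 by (auto simp: idems_iff)
      \<comment> \<open>\<open>c\<close> is \<open>b\<close> cut down to the current region, on
        which \<open>x\<close> and \<open>y\<close> follow the sections of \<open>f\<close> and
        \<open>g\<close> and are determined by \<open>c\<close>.\<close>
      define c where "c = b \<odot> r"
      have c [simp]: "c \<in> Ar C" "src c = src x" "tgt c = P0 B (FO F i)" by (simp_all add: c_def)
      have xr: "x \<odot> r = sec f \<odot> \<alpha> i \<odot> c"
        using arg_cong[OF xr1, of "\<lambda>z. z \<odot> r"] Cmp_reassoc[OF xb, of r] r1r by (simp add: c_def)
      have taux: "tau A i j \<odot> x \<odot> r = FA P f \<odot> \<alpha> i \<odot> c"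
        unfolding xr using Cmp_reassoc[OF sec_simps(6)[OF fA(1)], of "\<alpha> i \<odot> c"] by simp
      have yr: "y \<odot> r = sec g \<odot> FA P f \<odot> \<alpha> i \<odot> c"
      proof -
        note yr1
        also have "sgm A j k \<odot> y \<odot> r = tau A i j \<odot> x \<odot> r" using Cmp_reassoc[OF yx, of r] by simp
        finally show ?thesis using taux by simp
      qed
      have rc: "rst C (x \<odot> r) = rst C c" "rst C (y \<odot> r) = rst C c"
        using rst_Cmp_idem[of r "src x" b] rst_Cmp_idem[of r "src x" x] rst_Cmp_idem[of r "src x" y] rx
        by (simp_all add: c_def)
      have rac: "rst C (\<alpha> i \<odot> c) = rst C c" by (simp add: rst_total_Cmp)
      have mr: "mul C A i j k y x \<odot> r = sec (g \<cdot> f) \<odot> \<alpha> i \<odot> c"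
      proof -
        have "mul C A i j k y x \<odot> r = mul C A i j k (y \<odot> r) (x \<odot> r)"
          by (rule mul_Cmp[OF ij x y yx]) simp_all
        also have "\<dots> = mul C A i j k (sec g \<odot> FA P f \<odot> \<alpha> i \<odot> c) (sec f \<odot> \<alpha> i \<odot> c)"
          using xr yr by simp
        also have "\<dots> = sec (g \<cdot> f) \<odot> \<alpha> i \<odot> c"
          by (rule mul_sec) (use rc(2) yr rac in simp_all)
        finally show ?thesis .
      qed
      have gf: "g \<cdot> f \<in> Ar D" "src (g \<cdot> f) = i" "tgt (g \<cdot> f) = k" by simp_all
      have rmr: "rst C (sec (g \<cdot> f) \<odot> \<alpha> i \<odot> c) = rst C c"
      proof -
        have "rst C (mul C A i j k y x \<odot> r) = rst C (mul C A i j k y x) \<odot> r"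
          by (rule rst_Cmp_idem) (use m in simp_all)
        also have "\<dots> = rst C (x \<odot> r)" using m(6) rst_Cmp_idem[of r "src x" x] by simp
        finally show ?thesis using mr rc by simp
      qed
      have "?L \<odot> r = act C A K i k (mul C A i j k y x \<odot> r) c"
        using aL(4)[of r] m by (simp add: c_def)
      also have "\<dots> = B.u (g \<cdot> f) \<odot> c"
        unfolding mr by (rule act_K_sec[OF gf c(1,3) rmr])
      finally have Lr: "?L \<odot> r = B.u (g \<cdot> f) \<odot> c" .
      have ax: "act C A K i j x b \<odot> r = B.u f \<odot> c"
        using a1(4)[of r] act_K_sec[of f i j c] xr rc by (simp add: c_def)
      have ruc: "rst C (B.u f \<odot> c) = rst C c"
      proof -
        have "rst C (B.u f \<odot> c) = rst C (act C A K i j x b \<odot> r)" using ax by simp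
        also have "\<dots> = rst C (act C A K i j x b) \<odot> r" by (rule rst_Cmp_idem) (use a1 in simp_all)
        also have "rst C (act C A K i j x b) = rst C b"
          using sgm_act B.rst_sgm[of "FO F i" "FO F j" "act C A K i j x b"] a1 by (simp del: B.rst_sgm)
        also have "rst C b \<odot> r = rst C c" using rst_Cmp_idem[of r "src x" b] by (simp add: c_def)
        finally show ?thesis .
      qed
      have nf: "\<alpha> j \<odot> ?T \<odot> B.u f \<odot> c = FA P f \<odot> \<alpha> i \<odot> c"
        using arg_cong[OF B.u_natural[OF fA(1)], of "\<lambda>z. z \<odot> c"] by simp
      have ay: "act C A K j k y (?T \<odot> act C A K i j x b) \<odot> r = B.u g \<odot> ?T \<odot> B.u f \<odot> c"
      proof -
        have "act C A K j k y (?T \<odot> act C A K i j x b) \<odot> r = act C A K j k (y \<odot> r) (?T \<odot> act C A K i j x b \<odot> r)"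
          using a2(4)[of r] a1 by simp
        also have "\<dots> = act C A K j k (sec g \<odot> \<alpha> j \<odot> ?T \<odot> B.u f \<odot> c) (?T \<odot> B.u f \<odot> c)"
          using yr ax nf by simp
        also have "\<dots> = B.u g \<odot> ?T \<odot> B.u f \<odot> c"
          by (rule act_K_sec) (use nf yr rc ruc in simp_all)
        finally show ?thesis .
      qed
      have rug: "rst C (B.u g \<odot> ?T \<odot> B.u f \<odot> c) = rst C c"
      proof -
        let ?a = "act C A K j k y (?T \<odot> act C A K i j x b)"
        have "rst C (?a \<odot> r) = rst C ?a \<odot> r" by (rule rst_Cmp_idem) (use a2 in simp_all)
        also have "rst C ?a = rst C (?T \<odot> act C A K i j x b)"
          using sgm2 B.rst_sgm[of "FO F j" "FO F k" ?a] a2 by (simp del: B.rst_sgm)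
        also have "\<dots> = rst C b" using a2(5) rx by simp
        also have "rst C b \<odot> r = rst C c" using rst_Cmp_idem[of r "src x" b] by (simp add: c_def)
        finally show ?thesis using ay by simp
      qed
      have "?R \<odot> r = mul C B (FO F i) (FO F j) (FO F k) (B.u g \<odot> ?T \<odot> B.u f \<odot> c) (B.u f \<odot> c)"
        using B.mul_Cmp[OF FI a1(1,3) a2(1) a2(2)[unfolded y(2) a1(2)[symmetric]] a2(3) sgm2, of r] a1 ax ay by simp
      also have "\<dots> = scomp C B (FO F i) (FO F j) (FO F k) (B.u g) (B.u f) \<odot> c"
      proof (rule B.scomp_Cmp[symmetric])
        show "psec C B (FO F i) (FO F j) (B.u f)" "psec C B (FO F j) (FO F k) (B.u g)"
          using B.u_psec[OF fA(1)] B.u_psec[OF gA(1)] by simp_all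
        show "rst C (B.u g \<odot> ?T \<odot> B.u f) \<odot> c = c"
          using rst_Cmp[of c "B.u g \<odot> ?T \<odot> B.u f"] rug by simp
      qed simp_all
      also have "\<dots> = B.u (g \<cdot> f) \<odot> c" using B.u_Cmp[of f g] by simp
      finally show "?L \<odot> r = ?R \<odot> r" using Lr by simp
    qed (use L_r R_r rx r1 in simp_all)
  qed (use L_r R_r rx in simp_all)
  then show "act C A K i k (mul C A i j k y x) b = mul C B (cfI K i) (cfI K j) (cfI K k)
      (act C A K j k y (tau B (cfI K i) (cfI K j) \<odot> act C A K i j x b)) (act C A K i j x b)"
    using L_r R_r rx by simp
qed

text \<open>Composing with the unit takes \<open>f\<close> to the bisection
  \<open>smap (sec f)\<close>, which is the component \<open>cf1\<close> evaluated at
  \<open>tsec f\<close>. So commutation with the unit is a condition on the values at the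
  \<open>tsec f\<close>.\<close>

lemma Phi_map_K:
  assumes K': "is_cofunctor C A B K'"
  shows "comp_over C (D, P) (Phi_map C A K') (unit_map C D P sec) = (F, \<alpha>) \<longleftrightarrow>
    (\<forall>i \<in> Ix A. cfI K' i = FO F i \<and> cf0 K' i = \<alpha> i) \<and>
    (\<forall>i \<in> Ix A. \<forall>j \<in> Ix A. \<forall>f \<in> hom D i j. cf1 K' i j \<odot> tsec f = B.u f)"
proof -
  interpret K': groupoid_cofunctor C A B K'
    by (rule groupoid_cofunctorI[OF partite_groupoid_axioms B.partite_groupoid_axioms K'])
  have fA: "Arr (src f) (lab (sec f)) (tgt f) \<in> Ar (Phi_cat C A)"
    "under A (Arr (src f) (lab (sec f)) (tgt f)) = sec f" if "f \<in> Ar D" for f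
    using U.F_simps(2)[OF that] u_eq_sec[OF that, unfolded U.u_def] that by (simp_all add: unit_map_def)
  have "is_over_map C (D, P) (Phi_obj C B) (comp_over C (D, P) (Phi_map C A K') (unit_map C D P sec))"
    by (rule is_over_map_comp[OF restriction_category_axioms unit_map K'.is_over_map_Phi])
  then have "comp_over C (D, P) (Phi_map C A K') (unit_map C D P sec) = (F, \<alpha>) \<longleftrightarrow>
    (\<forall>i \<in> Ix A. cfI K' i = FO F i) \<and> (\<forall>i \<in> Ix A. Idn C (P0 A i) \<odot> cf0 K' i = \<alpha> i) \<and>
    (\<forall>f \<in> Ar D. FA (fst (Phi_map C A K')) (Arr (src f) (lab (sec f)) (tgt f)) = FA F f)"
    (is "?l = _ \<longleftrightarrow> ?R")
  proof -
    assume m: "is_over_map C (D, P) (Phi_obj C B) ?l"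
    have c1: "FO (fst ?l) i = cfI K' i" "snd ?l i = Idn C (P0 A i) \<odot> cf0 K' i" if "i \<in> Ix A" for i
      using that FO_P by (simp_all add: Ob_D unit_map_def Phi_map_def)
    have c2: "FA (fst ?l) f = FA (fst (Phi_map C A K')) (Arr (src f) (lab (sec f)) (tgt f))" if "f \<in> Ar D" for f
      using that by (simp add: unit_map_def)
    show "?l = (F, \<alpha>) \<longleftrightarrow> ?R"
    proof
      assume l: "?l = (F, \<alpha>)"
      show ?R using c1 c2 unfolding l by auto
    next
      assume ?R
      then show "?l = (F, \<alpha>)"
        by (intro over_map_eqI[OF m B.over_map]) (use c1 c2 Ob_D in auto)
    qed
  qed
  also have "\<dots> \<longleftrightarrow> (\<forall>i \<in> Ix A. cfI K' i = FO F i \<and> cf0 K' i = \<alpha> i) \<and>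
    (\<forall>f \<in> Ar D. FA (fst (Phi_map C A K')) (Arr (src f) (lab (sec f)) (tgt f)) = FA F f)" by auto
  also have "\<dots> \<longleftrightarrow> (\<forall>i \<in> Ix A. cfI K' i = FO F i \<and> cf0 K' i = \<alpha> i) \<and>
    (\<forall>f \<in> Ar D. cf1 K' (src f) (tgt f) \<odot> tsec f = B.u f)"
  proof (intro conj_cong refl ball_cong)
    fix f assume 0: "\<forall>i\<in>Ix A. cfI K' i = FO F i \<and> cf0 K' i = \<alpha> i" and f: "f \<in> Ar D"
    note S = K'.FA_Phi_map_simps[OF fA(1)[OF f]]
    have "K'.smap (src f) (tgt f) (sec f) = cf1 K' (src f) (tgt f) \<odot> tsec f"
      using 0 f by (simp add: K'.smap_def act_def tsec_def)
    then have "under B (FA (fst (Phi_map C A K')) (Arr (src f) (lab (sec f)) (tgt f))) = cf1 K' (src f) (tgt f) \<odot> tsec f"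
      using S fA[OF f] by simp
    moreover have "src (FA (fst (Phi_map C A K')) (Arr (src f) (lab (sec f)) (tgt f))) = src (FA F f)"
      "tgt (FA (fst (Phi_map C A K')) (Arr (src f) (lab (sec f)) (tgt f))) = tgt (FA F f)"
      using S 0 f by simp_all
    ultimately show "FA (fst (Phi_map C A K')) (Arr (src f) (lab (sec f)) (tgt f)) = FA F f \<longleftrightarrow>
        cf1 K' (src f) (tgt f) \<odot> tsec f = B.u f"
      unfolding B.u_def using B.under_eqI by metis
  qed
  also have "\<dots> \<longleftrightarrow> (\<forall>i \<in> Ix A. cfI K' i = FO F i \<and> cf0 K' i = \<alpha> i) \<and>
    (\<forall>i \<in> Ix A. \<forall>j \<in> Ix A. \<forall>f \<in> hom D i j. cf1 K' i j \<odot> tsec f = B.u f)"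
    by (auto simp: hom_def)
  finally show ?thesis .
qed

text \<open>Existence requires the values of \<open>K\<close> at all maps of \<open>D\<close>, which
  \<open>act_K_sec\<close> provides; uniqueness follows already from the pieces in \<open>T\<close>,
  whose \<open>tsec\<close> are jointly epic.\<close>

lemma ex1_cofunctor:
  "\<exists>!K. is_cofunctor C A B K \<and> comp_over C (D, P) (Phi_map C A K) (unit_map C D P sec) = (F, \<alpha>)"
proof (rule ex1I[of _ K])
  have "cf1 K i j \<odot> tsec f = B.u f" if ij: "i \<in> Ix A" "j \<in> Ix A" and f: "f \<in> hom D i j" for i j f
  proof -
    have fA: "f \<in> Ar D" "src f = i" "tgt f = j" using f by (auto simp: hom_def)
    have sA: "sec f \<in> Ar C" "src (sec f) = P0 A i" "tgt (sec f) = P1 A i j" using sec_simps[OF fA(1)] fA by simp_all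
    have "cf1 K i j \<odot> tsec f = act C A K i j (sec f \<odot> \<alpha> i \<odot> rst C (sec f \<odot> \<alpha> i)) (rst C (sec f \<odot> \<alpha> i))"
      using fA ij sA Cmp_rst[of "sec f \<odot> \<alpha> i"] by (simp add: act_def tsec_def del: Cmp_rst')
    also have "\<dots> = B.u f \<odot> rst C (sec f \<odot> \<alpha> i)"
      by (rule act_K_sec[OF fA]) (use ij sA Cmp_rst[of "sec f \<odot> \<alpha> i"] in \<open>simp_all del: Cmp_rst'\<close>)
    also have "\<dots> = B.u f" using rst_u_sec[OF fA(1)] Cmp_rst[of "B.u f"] fA by simp
    finally show ?thesis .
  qed
  then show "is_cofunctor C A B K \<and> comp_over C (D, P) (Phi_map C A K) (unit_map C D P sec) = (F, \<alpha>)"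
    using is_cofunctor_K Phi_map_K by simp
next
  fix K' assume K': "is_cofunctor C A B K' \<and> comp_over C (D, P) (Phi_map C A K') (unit_map C D P sec) = (F, \<alpha>)"
  interpret K': cofunctor C A B K'
    using K' partite_category_axioms B.partite_category_axioms by (simp add: cofunctor_def cofunctor_axioms_def)
  have eq: "cfI K' i = FO F i" "cf0 K' i = \<alpha> i" if "i \<in> Ix A" for i
    using K' Phi_map_K that by blast+
  have eq1: "cf1 K' i j \<odot> tsec f = B.u f" if "i \<in> Ix A" "j \<in> Ix A" "f \<in> hom D i j" for i j f
    using K' Phi_map_K that by blast
  show "K' = K"
  proof (rule cofun_eqI[of C A B _ B])
    fix i j assume ij: "i \<in> Ix A" "j \<in> Ix A"
    let ?g = "pb1 C (sgm A i j) (\<alpha> i)" and ?r = "pb2 C (sgm A i j) (\<alpha> i)"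
    note pbs = pb_simps[OF has_pb_\<alpha>[OF ij]]
    interpret H: glued C "T i j" ?r "\<lambda>t. ?r \<odot> rst C (q t \<odot> ?g)" tsec using glued_tsec[OF ij] .
    show "cf1 K' i j = cf1 K i j"
      by (rule H.joint_epi) (use ij eq eq1 cf1_K(2) K'.cf1_simps[OF ij] pbs T_hom in \<open>auto simp: subset_iff\<close>)
  qed (use K' is_cofunctor_K eq in auto)
qed

end

theorem (in presentation) universal:
  assumes "partite_groupoid C B" "is_over_map C (D, P) (Phi_obj C B) h"
  shows "\<exists>!K. is_cofunctor C A B K \<and> comp_over C (D, P) (Phi_map C A K) (unit_map C D P sec) = h"
proof -
  interpret B: partite_groupoid C B by fact
  obtain F \<alpha> where h: "h = (F, \<alpha>)" by (cases h)
  interpret presentation_map C A D P sec T q B F \<alpha>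
    using assms(2) over_obj by unfold_locales (simp_all add: h)
  show ?thesis using ex1_cofunctor by (simp add: h)
qed

section \<open>The groupoid glued from an inverse category\<close>

context over_object
begin

lemma P_src_tgt_hom: "f \<in> hom D i j \<Longrightarrow> f \<in> Ar D \<and> src f = i \<and> tgt f = j \<and> i \<in> Ob D \<and> j \<in> Ob D"
  by (auto simp: hom_def)

text \<open>Pulling back along \<open>x\<close> preserves the join that defines the agreement, so an
  equation over it is tested on single idempotents.\<close>

lemma agree_eqI:
  assumes fg: "f \<in> Ar D" "g \<in> Ar D" "src g = src f" "tgt g = tgt f"
    and x: "x \<in> Ar C" "tgt x = FO P (src f)" and uv: "u \<in> hom C (src x) b" "v \<in> hom C (src x) b"
    and eq: "\<And>e. \<lbrakk>e \<in> idems D (src f); f \<cdot> e = g \<cdot> e\<rbrakk> \<Longrightarrow> u \<odot> rst C (FA P e \<odot> x) = v \<odot> rst C (FA P e \<odot> x)"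
  shows "u \<odot> rst C (agree C (D, P) f g \<odot> x) = v \<odot> rst C (agree C (D, P) f g \<odot> x)"
proof (rule is_join_Cmp_eq[OF is_join_restrict[OF agree_join(1)[OF fg] _ x] _ uv])
  let ?E = "FA P ` {e \<in> idems D (src f). restr_le D e (rst D f \<cdot> rst D g) \<and> f \<cdot> e = g \<cdot> e}"
  show "?E \<subseteq> hom C (FO P (src f)) (FO P (src f))" using agree_join(2)[OF fg] by (auto simp: idems_def)
  show "(\<lambda>s. rst C (s \<odot> x)) ` ?E \<subseteq> idems C (src x)" using x fg by (auto simp: D.idems_iff)
  show "u \<odot> d = v \<odot> d" if "d \<in> (\<lambda>s. rst C (s \<odot> x)) ` ?E" for d
    using that eq by auto
qed

lemma agree_eqI':
  assumes fg: "f \<in> Ar D" "g \<in> Ar D" "src g = src f" "tgt g = tgt f"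
    and uv: "u \<in> hom C (FO P (src f)) b" "v \<in> hom C (FO P (src f)) b"
    and eq: "\<And>e. \<lbrakk>e \<in> idems D (src f); f \<cdot> e = g \<cdot> e\<rbrakk> \<Longrightarrow> u \<odot> FA P e = v \<odot> FA P e"
  shows "u \<odot> agree C (D, P) f g = v \<odot> agree C (D, P) f g"
  by (rule is_join_Cmp_eq[OF agree_join(1,2)[OF fg] uv]) (use eq in auto)

lemma agree_upper:
  assumes fg: "f \<in> Ar D" "g \<in> Ar D" "src g = src f" "tgt g = tgt f"
    and "e \<in> idems D (src f)" "restr_le D e (rst D f \<cdot> rst D g)" "f \<cdot> e = g \<cdot> e"
  shows "restr_le C (FA P e) (agree C (D, P) f g)"
  by (rule is_join_le[OF agree_join(1)[OF fg]]) (use assms in auto)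

lemma agree_sym:
  assumes "f \<in> Ar D" "g \<in> Ar D" "src g = src f" "tgt g = tgt f"
  shows "agree C (D, P) f g = agree C (D, P) g f"
  using D.rst_commute[of f g] assms by (simp add: agree_def eq_commute)

lemma agree_refl:
  assumes f: "f \<in> Ar D"
  shows "agree C (D, P) f f = FA P (rst D f)"
proof (rule le_antisym)
  note J = agree_join[OF f f refl refl]
  have rf: "rst D f \<in> idems D (src f)" using f by simp
  show "restr_le C (FA P (rst D f)) (agree C (D, P) f f)"
    by (rule agree_upper) (use f in simp_all)
  show "restr_le C (agree C (D, P) f f) (FA P (rst D f))"
  proof (rule is_join_idem_le[OF J(1,2)])
    show "FA P (rst D f) \<in> idems C (FO P (src f))" using rf by (rule P_idems)
    fix x assume "x \<in> FA P ` {e \<in> idems D (src f). restr_le D e (rst D f \<cdot> rst D f) \<and> f \<cdot> e = f \<cdot> e}"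
    then obtain e where e: "e \<in> idems D (src f)" "restr_le D e (rst D f)" "x = FA P e" using f by auto
    then have "rst D f \<cdot> e = e" using D.idems_le_iff[OF e(1) rf] by simp
    then have "FA P (rst D f) \<odot> FA P e = FA P e"
      using P_simps(7)[of e "rst D f"] e f by (simp add: D.idems_iff)
    then show "restr_le C x (FA P (rst D f))" using e rf by (simp add: idems_le_iff[of _ "FO P (src f)"])
  qed
qed (use f agree_join(3)[OF f f refl refl] in \<open>auto simp: idems_iff\<close>)

text \<open>Both factors are joins, and composition distributes over joins on either side, so
  generators suffice: \<open>P e\<close> with \<open>g e = h e\<close> and \<open>P d\<close> with
  \<open>f d = g d\<close>. Then \<open>e \<cdot> d\<close> equalises \<open>f\<close> and
  \<open>h\<close>.\<close>

lemma agree_trans: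
  assumes f: "f \<in> hom D i j" and g: "g \<in> hom D i j" and h: "h \<in> hom D i j"
  shows "restr_le C (agree C (D, P) g h \<odot> agree C (D, P) f g) (agree C (D, P) f h)"
proof -
  note F = P_src_tgt_hom[OF f] and G = P_src_tgt_hom[OF g] and H = P_src_tgt_hom[OF h]
  let ?X = "FO P i"
  let ?E = "\<lambda>f g. FA P ` {e \<in> idems D i. restr_le D e (rst D f \<cdot> rst D g) \<and> f \<cdot> e = g \<cdot> e}"
  have gh: "is_join C ?X ?X (?E g h) (agree C (D, P) g h)" "?E g h \<subseteq> idems C ?X" "agree C (D, P) g h \<in> idems C ?X"
    using agree_join[of g h] G H by simp_all
  have fg: "is_join C ?X ?X (?E f g) (agree C (D, P) f g)" "?E f g \<subseteq> idems C ?X" "agree C (D, P) f g \<in> idems C ?X"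
    using agree_join[of f g] F G by simp_all
  have fh: "agree C (D, P) f h \<in> idems C ?X" using agree_join(3)[of f h] F H by simp
  have idh: "x \<in> hom C ?X ?X" if "x \<in> idems C ?X" for x using that by (simp add: idems_def)
  have A: "x \<in> Ar C" "src x = ?X" "tgt x = ?X" if "x \<in> idems C ?X" for x using that by (auto simp: idems_iff)
  have "is_join C (src (agree C (D, P) f g)) ?X ((\<lambda>s. s \<odot> agree C (D, P) f g) ` ?E g h) (agree C (D, P) g h \<odot> agree C (D, P) f g)"
    by (rule is_join_precomp[OF gh(1)]) (use gh(2) idh A[OF fg(3)] in auto)
  then have J: "is_join C ?X ?X ((\<lambda>s. s \<odot> agree C (D, P) f g) ` ?E g h) (agree C (D, P) g h \<odot> agree C (D, P) f g)"
    using A[OF fg(3)] by simp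
  show ?thesis
  proof (rule is_join_least[OF J])
    show "agree C (D, P) f h \<in> hom C ?X ?X" using idh fh .
    fix x assume "x \<in> (\<lambda>s. s \<odot> agree C (D, P) f g) ` ?E g h"
    then obtain e where e: "e \<in> idems D i" "restr_le D e (rst D g \<cdot> rst D h)" "g \<cdot> e = h \<cdot> e"
      and x: "x = FA P e \<odot> agree C (D, P) f g" by auto
    have Pe: "FA P e \<in> idems C ?X" using e by simp
    have J': "is_join C ?X ?X ((\<odot>) (FA P e) ` ?E f g) x"
      unfolding x using is_join_postcomp[OF fg(1), of "FA P e"] fg(2) idh A[OF Pe] by auto
    show "restr_le C x (agree C (D, P) f h)"
    proof (rule is_join_least[OF J'])
      show "agree C (D, P) f h \<in> hom C ?X ?X" using idh fh .
      fix y assume "y \<in> (\<odot>) (FA P e) ` ?E f g"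
      then obtain d where d: "d \<in> idems D i" "restr_le D d (rst D f \<cdot> rst D g)" "f \<cdot> d = g \<cdot> d"
        and y: "y = FA P e \<odot> FA P d" by auto
      have eA: "e \<in> Ar D" "src e = i" "tgt e = i" and dA: "d \<in> Ar D" "src d = i" "tgt d = i"
        using d(1) e(1) by (auto simp: D.idems_iff)
      have ed: "e \<cdot> d \<in> idems D i" "e \<cdot> d = d \<cdot> e" using D.idems_commute e(1) d(1) by auto
      have rr: "rst D k \<in> idems D i" "rst D k \<in> Ar D" "src (rst D k) = i" "tgt (rst D k) = i" if "k \<in> hom D i j" for k
        using P_src_tgt_hom[OF that] by auto
      have re: "rst D h \<cdot> e = e"
      proof -
        have "(rst D g \<cdot> rst D h) \<cdot> e = e"
          using D.idems_le_iff[OF e(1), of "rst D g \<cdot> rst D h"] e(2) rr[OF g] rr[OF h] by simp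
        then have e': "rst D h \<cdot> rst D g \<cdot> e = e"
          using D.idems_commute[OF rr(1)[OF g] rr(1)[OF h]] eA rr[OF g] rr[OF h] by (metis D.Cmp_assoc)
        have "rst D h \<cdot> rst D h \<cdot> rst D g \<cdot> e = rst D h \<cdot> rst D g \<cdot> e"
          by (rule D.Cmp_reassoc[OF D.idem_idem[OF rr(1)[OF h]]]) (use eA rr[OF g] rr[OF h] in simp_all)
        then show ?thesis using e' by simp
      qed
      have rd: "rst D f \<cdot> d = d"
      proof -
        have d': "rst D f \<cdot> rst D g \<cdot> d = d"
          using D.idems_le_iff[OF d(1), of "rst D f \<cdot> rst D g"] d(2) rr[OF g] rr[OF f] dA by simp
        have "rst D f \<cdot> rst D f \<cdot> rst D g \<cdot> d = rst D f \<cdot> rst D g \<cdot> d"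
          by (rule D.Cmp_reassoc[OF D.idem_idem[OF rr(1)[OF f]]]) (use dA rr[OF g] rr[OF f] in simp_all)
        then show ?thesis using d' by simp
      qed
      have "restr_le C (FA P (e \<cdot> d)) (agree C (D, P) f h)"
      proof (rule agree_upper)
        show "e \<cdot> d \<in> idems D (src f)" using ed F by simp
        have "(rst D f \<cdot> rst D h) \<cdot> e \<cdot> d = rst D f \<cdot> e \<cdot> d"
          using D.Cmp_reassoc[OF re, of d] eA dA rr[OF f] rr[OF h] by simp
        also have "\<dots> = rst D f \<cdot> d \<cdot> e" using ed by simp
        also have "\<dots> = d \<cdot> e" using D.Cmp_reassoc[OF rd, of e] eA dA rr[OF f] by simp
        also have "\<dots> = e \<cdot> d" using ed by simp
        finally show "restr_le D (e \<cdot> d) (rst D f \<cdot> rst D h)"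
          using D.idems_le_iff[OF ed(1), of "rst D f \<cdot> rst D h"] rr[OF f] rr[OF h] by simp
        have "f \<cdot> e \<cdot> d = g \<cdot> d \<cdot> e"
          unfolding ed(2) using D.Cmp_reassoc[OF d(3), of e] F G eA dA by simp
        also have "\<dots> = g \<cdot> e \<cdot> d" using ed(2) by simp
        also have "\<dots> = h \<cdot> e \<cdot> d" using D.Cmp_reassoc[OF e(3), of d] G H eA dA by simp
        finally show "f \<cdot> e \<cdot> d = h \<cdot> e \<cdot> d" .
      qed (use F H in simp_all)
      then show "restr_le C y (agree C (D, P) f h)" using y eA dA by simp
    qed
  qed
qed

lemma agree_atlas:
  assumes "i \<in> Ob D" "j \<in> Ob D"
  shows "local_atlas C (FO P i) (hom D i j) (agree C (D, P))"
  unfolding local_atlas_def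
proof (intro conjI ballI)
  fix f g assume fg: "f \<in> hom D i j" "g \<in> hom D i j"
  show "agree C (D, P) f g \<in> idems C (FO P i)" "agree C (D, P) f g = agree C (D, P) g f"
    using agree_join(3)[of f g] agree_sym[of f g] P_src_tgt_hom[OF fg(1)] P_src_tgt_hom[OF fg(2)] by simp_all
  fix h assume "h \<in> hom D i j"
  then show "restr_le C (agree C (D, P) g h \<odot> agree C (D, P) f g) (agree C (D, P) f h)"
    using agree_trans fg by blast
qed

end

section \<open>Sections of the chosen glueings and maps defined on them\<close>

locale glueing_construction = over_object C D P
  for C :: "('o, 'u) rcat" (structure) and D P +
  assumes local_glueings: "has_local_glueings C"
begin

abbreviation "X \<equiv> (D, P)"
abbreviation "S \<equiv> Psi_sgm C X"
abbreviation "s \<equiv> Psi_sec C X"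
abbreviation "\<tau> \<equiv> Psi_tau C X"

definition q :: "('u, 'u) arr \<Rightarrow> ('o, 'u) arr" where
  "q f = fst (snd (Psi_glueing C X (src f) (tgt f))) f"

lemma small_hom: "\<lbrakk>i \<in> Ob D; j \<in> Ob D\<rbrakk> \<Longrightarrow> hom D i j \<prec> (UNIV :: 'u set)"
  using over_obj by (auto simp: is_over_obj_iff small_hom_sets_def)

lemma glued_S:
  assumes ij: "i \<in> Ob D" "j \<in> Ob D"
  shows "glued C (hom D i j) (S i j) q s" "tgt (S i j) = FO P i"
    "\<lbrakk>f \<in> hom D i j; g \<in> hom D i j\<rbrakk> \<Longrightarrow> q g \<odot> s f = agree C X f g"
proof -
  obtain p q' s' where e: "Psi_glueing C X i j = (p, q', s')" by (cases "Psi_glueing C X i j")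
  have "\<exists>p' q' s'. is_glueing C (FO P i) (hom D i j) (agree C X) p' q' s'"
    by (rule glueing_exists[OF join_restriction_category_axioms local_glueings _ small_hom[OF ij] agree_atlas[OF ij]])
      (use ij in simp)
  then have "\<exists>t. case t of (p', q', s') \<Rightarrow> is_glueing C (FO P i) (hom D i j) (agree C X) p' q' s'"
    by auto
  from someI_ex[OF this] have g: "is_glueing C (FO P i) (hom D i j) (agree C X) p q' s'"
    using e by (simp add: Psi_glueing_def)
  then have g': "glued C (hom D i j) p q' s'" "tgt p = FO P i"
    "\<And>f g. \<lbrakk>f \<in> hom D i j; g \<in> hom D i j\<rbrakk> \<Longrightarrow> agree C X f g = q' g \<odot> s' f"
    by (auto simp: is_glueing_iff[OF join_restriction_category_axioms])
  have p: "S i j = p" using e by (simp add: Psi_sgm_def)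
  \<comment> \<open>\<open>q\<close> and \<open>s\<close> select the glueing by source and target of
    their argument, so the comparison with the chosen maps is confined to this hom-set.\<close>
  have qs: "q f = q' f" "s f = s' f" if "f \<in> hom D i j" for f
    using that e by (auto simp: q_def Psi_sec_def hom_def)
  have "q ` hom D i j = q' ` hom D i j" using qs by (simp cong: image_cong)
  then show "glued C (hom D i j) (S i j) q s"
    using g'(1) qs unfolding glued_def glued_axioms_def p by simp
  show "tgt (S i j) = FO P i" using p g'(2) by simp
  show "\<lbrakk>f \<in> hom D i j; g \<in> hom D i j\<rbrakk> \<Longrightarrow> q g \<odot> s f = agree C X f g"
    using qs g'(3) by simp
qed

lemma S_simps [simp]:
  assumes "i \<in> Ob D" "j \<in> Ob D"
  shows "S i j \<in> Ar C" "tgt (S i j) = FO P i" "total_map C (S i j)" "src (S i j) \<in> Ob C"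
proof -
  interpret glued C "hom D i j" "S i j" q s by (rule glued_S[OF assms])
  show "S i j \<in> Ar C" "total_map C (S i j)" "src (S i j) \<in> Ob C" using p_total by auto
qed (rule glued_S[OF assms])

lemma Ar_hom: "f \<in> Ar D \<Longrightarrow> f \<in> hom D (src f) (tgt f)"
  by (simp add: hom_def)

lemma s_simps [simp]:
  assumes f: "f \<in> Ar D"
  shows "s f \<in> Ar C" "src (s f) = FO P (src f)" "tgt (s f) = src (S (src f) (tgt f))"
    "rst C (s f) = rst C (FA P f)" "S (src f) (tgt f) \<odot> s f = rst C (FA P f)"
proof -
  interpret glued C "hom D (src f) (tgt f)" "S (src f) (tgt f)" q s by (rule glued_S) (use f in auto)
  note F = Ar_hom[OF f]
  show "s f \<in> Ar C" "src (s f) = FO P (src f)" "tgt (s f) = src (S (src f) (tgt f))"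
    using s_simps(1-3)[OF F] f by simp_all
  have "rst C (s f) = agree C X f f"
    using s_simps(5)[OF F] glued_S(3)[OF _ _ F F] f by simp
  then show r: "rst C (s f) = rst C (FA P f)" using agree_refl[OF f] f by simp
  show "S (src f) (tgt f) \<odot> s f = rst C (FA P f)" using p_s[OF F] r by simp
qed

lemma S_s_comp: "\<lbrakk>f \<in> Ar D; x \<in> Ar C; tgt x = FO P (src f)\<rbrakk> \<Longrightarrow> S (src f) (tgt f) \<odot> s f \<odot> x = rst C (FA P f) \<odot> x"
  by (rule Cmp_reassoc) auto

lemma P_Cmp_idem: "\<lbrakk>f \<in> Ar D; e \<in> idems D (src f)\<rbrakk> \<Longrightarrow> FA P (f \<cdot> e) = FA P f \<odot> FA P e"
  by (simp add: D.idems_iff)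

text \<open>The maps \<open>f\<close> and \<open>f e\<close> agree on the domain of
  \<open>f e\<close>, so the glueing identifies their sections there; and that is the whole domain
  of \<open>s (f e)\<close>.\<close>

lemma s_Cmp_idem:
  assumes f: "f \<in> Ar D" and e: "e \<in> idems D (src f)"
  shows "s (f \<cdot> e) = s f \<odot> FA P e"
proof -
  have eA [simp]: "e \<in> Ar D" "src e = src f" "tgt e = src f" "rst D e = e" using e by (auto simp: D.idems_iff)
  note [simp] = f
  interpret glued C "hom D (src f) (tgt f)" "S (src f) (tgt f)" q s by (rule glued_S) auto
  let ?fe = "f \<cdot> e"
  have F: "f \<in> hom D (src f) (tgt f)" "?fe \<in> hom D (src f) (tgt f)" by (simp_all add: hom_def)
  let ?a = "agree C X f ?fe"
  have ag: "s f \<odot> ?a = s ?fe \<odot> ?a"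
    using s_phi[OF F] glued_S(3)[OF _ _ F] by simp
  let ?d = "rst D ?fe"
  have d: "?d = rst D f \<cdot> e" using D.rst_Cmp_idem[OF e f refl] .
  have a: "?a \<in> idems C (FO P (src f))" by (rule agree_join(3)) simp_all
  have le: "restr_le C (FA P ?d) ?a"
  proof (rule agree_upper)
    show "?d \<in> idems D (src f)" by simp
    have "(rst D f \<cdot> ?d) \<cdot> ?d = ?d" using D.rst_le_src(2)[of e f] d D.rst_rst_idem[of f]
        D.Cmp_reassoc[OF D.rst_rst_idem[of f], of e] by simp
    then show "restr_le D ?d (rst D f \<cdot> ?d)" by (subst D.idems_le_iff[of _ "src f"]) simp_all
    have "f \<cdot> ?d = ?fe" unfolding d by simp
    then show "f \<cdot> ?d = ?fe \<cdot> ?d" by simp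
  qed simp_all
  have Pd: "FA P ?d \<in> idems C (FO P (src f))" by (rule P_idems) simp
  have ad: "?a \<odot> FA P ?d = FA P ?d" using idems_le_iff[OF Pd a] le by simp
  have aA: "?a \<in> Ar C" "src ?a = FO P (src f)" "tgt ?a = FO P (src f)" using a by (auto simp: idems_iff)
  have "s ?fe = s ?fe \<odot> FA P ?d" using Cmp_rst[of "s ?fe"] by (simp del: P_simps(7))
  also have "\<dots> = (s ?fe \<odot> ?a) \<odot> FA P ?d" using ad aA by (simp del: P_simps(5,7))
  also have "\<dots> = s f \<odot> rst C (s f) \<odot> FA P e" using ag[symmetric] ad aA d by simp
  also have "\<dots> = s f \<odot> FA P e" by (rule Cmp_rst_comp) simp_all
  finally show ?thesis .
qed

lemma s_eq_on:
  assumes "f \<in> Ar D" "g \<in> Ar D" "src g = src f" "e \<in> idems D (src f)" "f \<cdot> e = g \<cdot> e"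
  shows "s f \<odot> FA P e = s g \<odot> FA P e"
  using s_Cmp_idem[of f e] s_Cmp_idem[of g e] assms by simp

text \<open>Entries of the atlas are joins of idempotents \<open>P e\<close> with
  \<open>f e = g e\<close>, so consistency of the prescribed values is checked only after composing
  with such \<open>P e\<close>. Target maps, multiplication and inversion all come from this
  lemma.\<close>

lemma extension_S:
  assumes ij: "i \<in> Ob D" "j \<in> Ob D" and b: "b \<in> Ob C"
    and v: "\<And>f. f \<in> hom D i j \<Longrightarrow> v f \<in> hom C (FO P i) b"
    and dom: "\<And>f. f \<in> hom D i j \<Longrightarrow> v f \<odot> rst C (FA P f) = v f"
    and eq: "\<And>f g e. \<lbrakk>f \<in> hom D i j; g \<in> hom D i j; e \<in> idems D i; f \<cdot> e = g \<cdot> e\<rbrakk>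
      \<Longrightarrow> v f \<odot> FA P e = v g \<odot> FA P e"
  shows "\<exists>!w. w \<in> hom C (src (S i j)) b \<and> (\<forall>f \<in> hom D i j. w \<odot> s f = v f)"
proof -
  interpret glued C "hom D i j" "S i j" q s by (rule glued_S[OF ij])
  have T: "tgt (S i j) = FO P i" using ij by simp
  have "\<exists>w. w \<in> hom C (src (S i j)) b \<and> (\<forall>f\<in>hom D i j. w \<odot> s f = v f)"
  proof (rule extension[OF b])
    fix f assume f: "f \<in> hom D i j"
    show "v f \<in> hom C (tgt (S i j)) b" using v f T by simp
    show "v f \<odot> rst C (s f) = v f" using dom[OF f] P_src_tgt_hom[OF f] by simp
    fix g assume g: "g \<in> hom D i j"
    show "v f \<odot> q g \<odot> s f = v g \<odot> q g \<odot> s f"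
      unfolding glued_S(3)[OF ij f g]
      by (rule agree_eqI') (use P_src_tgt_hom[OF f] P_src_tgt_hom[OF g] v[OF f] v[OF g] eq[OF f g] in auto)
  qed
  then obtain w where w: "w \<in> hom C (src (S i j)) b" "\<forall>f\<in>hom D i j. w \<odot> s f = v f" by auto
  show ?thesis
  proof (rule ex1I[of _ w])
    fix w' assume w': "w' \<in> hom C (src (S i j)) b \<and> (\<forall>f\<in>hom D i j. w' \<odot> s f = v f)"
    show "w' = w" by (rule joint_epi) (use w w' in \<open>auto simp: hom_iff\<close>)
  qed (use w in auto)
qed

lemma S_epi:
  assumes ij: "i \<in> Ob D" "j \<in> Ob D" and "w \<in> hom C (src (S i j)) b" "w' \<in> hom C (src (S i j)) b"
    and "\<And>f. \<lbrakk>f \<in> Ar D; src f = i; tgt f = j\<rbrakk> \<Longrightarrow> w \<odot> s f = w' \<odot> s f"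
  shows "w = w'"
proof -
  interpret glued C "hom D i j" "S i j" q s by (rule glued_S[OF ij])
  show ?thesis by (rule joint_epi) (use assms in \<open>auto simp: hom_iff D.hom_iff\<close>)
qed

lemma S_total:
  assumes ij: "i \<in> Ob D" "j \<in> Ob D" and w: "w \<in> Ar C" "src w = src (S i j)"
    and eq: "\<And>f. \<lbrakk>f \<in> Ar D; src f = i; tgt f = j\<rbrakk> \<Longrightarrow> rst C (w \<odot> s f) = rst C (FA P f)"
  shows "total_map C w"
proof -
  interpret glued C "hom D i j" "S i j" q s by (rule glued_S[OF ij])
  show ?thesis by (rule total_if) (use w eq in \<open>auto simp: D.hom_iff\<close>)
qed

lemma P_comp_idem:
  assumes f: "f \<in> Ar D" and g: "g \<in> Ar D" and "src g = src f" "e \<in> idems D (src f)" "f \<cdot> e = g \<cdot> e"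
  shows "FA P f \<odot> FA P e = FA P g \<odot> FA P e"
  using P_Cmp_idem[of f e] P_Cmp_idem[of g e] assms by simp

lemma \<tau>_simps:
  assumes ij: "i \<in> Ob D" "j \<in> Ob D"
  shows "\<tau> i j \<in> hom C (src (S i j)) (FO P j)" "\<And>f. f \<in> hom D i j \<Longrightarrow> \<tau> i j \<odot> s f = FA P f"
proof -
  have "\<exists>!t. t \<in> hom C (src (S i j)) (FO P j) \<and> (\<forall>f \<in> hom D i j. t \<odot> s f = FA P f)"
  proof (rule extension_S[OF ij])
    show "FA P f \<odot> FA P e = FA P g \<odot> FA P e"
      if "f \<in> hom D i j" "g \<in> hom D i j" "e \<in> idems D i" "f \<cdot> e = g \<cdot> e" for f g e
      using P_comp_idem[of f g e] P_src_tgt_hom that by simp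
  qed (use ij P_src_tgt_hom in \<open>auto simp: hom_iff\<close>)
  from theI'[OF this] show "\<tau> i j \<in> hom C (src (S i j)) (FO P j)" "\<And>f. f \<in> hom D i j \<Longrightarrow> \<tau> i j \<odot> s f = FA P f"
    by (simp_all add: Psi_tau_def)
qed

lemma \<tau>_Ar [simp]:
  assumes ij: "i \<in> Ob D" "j \<in> Ob D"
  shows "\<tau> i j \<in> Ar C" "src (\<tau> i j) = src (S i j)" "tgt (\<tau> i j) = FO P j"
  using \<tau>_simps(1)[OF ij] by (auto simp: hom_iff)

lemma \<tau>_s [simp]: "f \<in> Ar D \<Longrightarrow> \<tau> (src f) (tgt f) \<odot> s f = FA P f"
  using \<tau>_simps(2)[of "src f" "tgt f" f] by (simp add: hom_def)

text \<open>The simplification rules speak of \<open>src f\<close> and \<open>tgt f\<close>; once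
  these are named \<open>i\<close> and \<open>j\<close> they no longer match, so the typing facts
  are repeated with the equations as premises.\<close>

lemma s_at:
  assumes "f \<in> Ar D" "src f = i" "tgt f = j"
  shows "src (s f) = FO P i" "tgt (s f) = src (S i j)" "s f \<in> Ar C" "\<tau> i j \<odot> s f = FA P f"
    "S i j \<odot> s f = rst C (FA P f)" "src (FA P f) = FO P i" "tgt (FA P f) = FO P j" "FA P f \<in> Ar C"
  using assms by auto

lemma \<tau>_total [simp]: "\<lbrakk>i \<in> Ob D; j \<in> Ob D\<rbrakk> \<Longrightarrow> total_map C (\<tau> i j)"
  by (rule S_total) (auto)

text \<open>Smallness of the hom-sets of \<open>D\<close> enters: they index the atlas on the source
  of \<open>f\<close> whose glueing is the pullback.\<close>

lemma has_pb_S [simp]: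
  assumes ij: "i \<in> Ob D" "j \<in> Ob D" and f: "total_map C f" "tgt f = FO P i"
  shows "has_pb C (S i j) f"
proof -
  interpret glued C "hom D i j" "S i j" q s by (rule glued_S[OF ij])
  show ?thesis by (rule has_pb_if_has_local_glueings[OF local_glueings small_hom[OF ij] f(1)]) (use ij f in simp)
qed

text \<open>This is \<open>tau_star\<close> for the section \<open>s g\<close>, written out because
  the groupoid it belongs to is still under construction. These maps are the pieces of the pullback
  on which \<open>Psi_mu\<close> lives.\<close>

definition ts :: "'u \<Rightarrow> 'u \<Rightarrow> 'u \<Rightarrow> ('u, 'u) arr \<Rightarrow> ('o, 'u) arr" where
  "ts i j k g = pair C (S j k) (\<tau> i j) (s g \<odot> \<tau> i j) (rst C (s g \<odot> \<tau> i j))"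

abbreviation "po i j k \<equiv> pbo C (S j k) (\<tau> i j)"
abbreviation "pr1 i j k \<equiv> pb1 C (S j k) (\<tau> i j)"
abbreviation "pr2 i j k \<equiv> pb2 C (S j k) (\<tau> i j)"

lemma ts_simps:
  assumes I: "i \<in> Ob D" "j \<in> Ob D" "k \<in> Ob D" and g: "g \<in> Ar D" "src g = j" "tgt g = k"
  shows "ts i j k g \<in> Ar C" "src (ts i j k g) = src (S i j)" "tgt (ts i j k g) = po i j k"
    "pr1 i j k \<odot> ts i j k g = s g \<odot> \<tau> i j"
    "pr2 i j k \<odot> ts i j k g = rst C (s g \<odot> \<tau> i j)"
proof -
  have pb: "has_pb C (S j k) (\<tau> i j)" using I by simp
  have "S j k \<odot> s g \<odot> \<tau> i j = \<tau> i j \<odot> rst C (s g \<odot> \<tau> i j)"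
    using S_s_comp[of g "\<tau> i j"] s_simps(4)[OF g(1)] rst_Cmp[of "\<tau> i j" "s g"] I g by simp
  then show "ts i j k g \<in> Ar C" "src (ts i j k g) = src (S i j)" "tgt (ts i j k g) = po i j k"
    "pr1 i j k \<odot> ts i j k g = s g \<odot> \<tau> i j"
    "pr2 i j k \<odot> ts i j k g = rst C (s g \<odot> \<tau> i j)"
    using pair_simps[OF pb, of "s g \<odot> \<tau> i j" "rst C (s g \<odot> \<tau> i j)"] I g s_simps(1-3)[OF g(1)]
    by (simp_all add: ts_def del: s_simps(4))
qed

lemma glued_ts:
  assumes I: "i \<in> Ob D" "j \<in> Ob D" "k \<in> Ob D"
  shows "glued C (hom D j k) (pr2 i j k) (\<lambda>g. pr2 i j k \<odot> rst C (q g \<odot> pr1 i j k)) (ts i j k)"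
proof -
  interpret G: glued C "hom D j k" "S j k" q s by (rule glued_S) (use I in auto)
  have pb: "has_pb C (S j k) (\<tau> i j)" using I by simp
  show ?thesis
    by (rule G.glued_pullback[OF is_pullback_pb[OF pb]])
      (use ts_simps[OF I] I pb_simps[OF pb] in \<open>auto simp: hom_iff D.hom_iff\<close>)
qed

lemma rst_ts: "\<lbrakk>i \<in> Ob D; j \<in> Ob D; k \<in> Ob D; g \<in> Ar D; src g = j; tgt g = k\<rbrakk> \<Longrightarrow> rst C (ts i j k g) = rst C (s g \<odot> \<tau> i j)"
proof -
  assume I: "i \<in> Ob D" "j \<in> Ob D" "k \<in> Ob D" and g: "g \<in> Ar D" "src g = j" "tgt g = k"
  interpret H: glued C "hom D j k" "pr2 i j k" "\<lambda>g. pr2 i j k \<odot> rst C (q g \<odot> pr1 i j k)" "ts i j k"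
    by (rule glued_ts[OF I])
  show ?thesis using H.p_s[of g] ts_simps(5)[OF I g] g by (simp add: D.hom_iff)
qed

lemma rst_s_P:
  assumes f: "f \<in> Ar D" and g: "g \<in> Ar D" and fg: "tgt f = src g"
  shows "rst C (s g \<odot> FA P f) = rst C (FA P (g \<cdot> f))"
proof -
  have "rst C (s g \<odot> FA P f) = rst C (rst C (s g) \<odot> FA P f)"
    using f g fg by (intro rst_rst_Cmp[symmetric]) auto
  also have "\<dots> = rst C (FA P g \<odot> FA P f)" using f g fg rst_rst_Cmp[of "FA P f" "FA P g"] by simp
  finally show ?thesis using f g fg by simp
qed

text \<open>Two layers: the \<open>ts i j k g\<close> are jointly epic into the pullback, and the
  \<open>s f\<close> are jointly epic into their common source.\<close>

lemma pb_epi: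
  assumes I: "i \<in> Ob D" "j \<in> Ob D" "k \<in> Ob D"
    and w: "w \<in> hom C (po i j k) b" "w' \<in> hom C (po i j k) b"
    and eq: "\<And>f g. \<lbrakk>f \<in> Ar D; src f = i; tgt f = j; g \<in> Ar D; src g = j; tgt g = k\<rbrakk> \<Longrightarrow> w \<odot> ts i j k g \<odot> s f = w' \<odot> ts i j k g \<odot> s f"
  shows "w = w'"
proof -
  interpret H: glued C "hom D j k" "pr2 i j k" "\<lambda>g. pr2 i j k \<odot> rst C (q g \<odot> pr1 i j k)" "ts i j k"
    by (rule glued_ts[OF I])
  have pb: "has_pb C (S j k) (\<tau> i j)" using I by simp
  show ?thesis
  proof (rule H.joint_epi)
    fix g assume "g \<in> hom D j k"
    then have g: "g \<in> Ar D" "src g = j" "tgt g = k" by (auto simp: D.hom_iff)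
    note t = ts_simps[OF I g]
    show "w \<odot> ts i j k g = w' \<odot> ts i j k g"
    proof (rule S_epi[OF I(1,2)])
      fix f assume f: "f \<in> Ar D" "src f = i" "tgt f = j"
      have "s f \<in> Ar C" "tgt (s f) = src (S i j)" using s_simps(1,3)[OF f(1)] f by auto
      then show "(w \<odot> ts i j k g) \<odot> s f = (w' \<odot> ts i j k g) \<odot> s f"
        using eq[OF f g] w t by (simp add: hom_iff)
    qed (use w t in \<open>auto simp: hom_iff\<close>)
  qed (use w pb_simps[OF pb] in \<open>auto simp: hom_iff\<close>)
qed

text \<open>The map is built in two layers. For fixed \<open>g\<close> the assignment
  \<open>s f \<mapsto> s (g f)\<close> extends to a map \<open>m g\<close> on the object of arrows
  from \<open>i\<close> to \<open>j\<close>; then \<open>ts i j k g \<mapsto> m g\<close> extends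
  over the pullback.\<close>

lemma mu_exists:
  assumes I: "i \<in> Ob D" "j \<in> Ob D" "k \<in> Ob D"
  shows "\<exists>!m. m \<in> hom C (po i j k) (src (S i k)) \<and>
    (\<forall>f \<in> hom D i j. \<forall>g \<in> hom D j k. m \<odot> ts i j k g \<odot> s f = s (g \<cdot> f))"
proof -
  interpret H: glued C "hom D j k" "pr2 i j k" "\<lambda>g. pr2 i j k \<odot> rst C (q g \<odot> pr1 i j k)" "ts i j k"
    by (rule glued_ts[OF I])
  interpret G: glued C "hom D j k" "S j k" q s by (rule glued_S) (use I in auto)
  have pb: "has_pb C (S j k) (\<tau> i j)" using I by simp
  note pbs = pb_simps[OF pb]
  let ?g = "pr1 i j k" and ?r = "pr2 i j k"
  have hD: "f \<in> hom D a b \<Longrightarrow> f \<in> Ar D \<and> src f = a \<and> tgt f = b" for f a b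
    by (simp add: D.hom_iff)
  have "\<exists>!w. w \<in> hom C (src (S i j)) (src (S i k)) \<and> (\<forall>f \<in> hom D i j. w \<odot> s f = s (g \<cdot> f))" if g: "g \<in> hom D j k" for g
  proof (rule extension_S[OF I(1,2)])
    note g = hD[OF g]
    show "src (S i k) \<in> Ob C" using I by simp
    fix f assume f: "f \<in> hom D i j"
    then show "s (g \<cdot> f) \<in> hom C (FO P i) (src (S i k))"
      using s_simps(1-3)[of "g \<cdot> f"] hD[OF f] g by (simp add: hom_iff)
    show "s (g \<cdot> f) \<odot> rst C (FA P f) = s (g \<cdot> f)"
      using s_Cmp_idem[of "g \<cdot> f" "rst D f"] hD[OF f] g by simp
    fix f' e assume f': "f' \<in> hom D i j" and e: "e \<in> idems D i" and eq: "f \<cdot> e = f' \<cdot> e"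
    show "s (g \<cdot> f) \<odot> FA P e = s (g \<cdot> f') \<odot> FA P e"
    proof (rule s_eq_on)
      have "(g \<cdot> x) \<cdot> e = g \<cdot> (x \<cdot> e)" if "x \<in> hom D i j" for x
        using hD[OF that] g e by (intro D.Cmp_assoc) (auto simp: D.idems_iff)
      then show "(g \<cdot> f) \<cdot> e = (g \<cdot> f') \<cdot> e" using eq f f' by simp
    qed (use hD[OF f] hD[OF f'] g e in auto)
  qed
  then have "\<forall>g \<in> hom D j k. \<exists>w. w \<in> hom C (src (S i j)) (src (S i k)) \<and> (\<forall>f \<in> hom D i j. w \<odot> s f = s (g \<cdot> f))"
    by blast
  from bchoice[OF this] obtain m where
    m: "\<And>g. g \<in> hom D j k \<Longrightarrow> m g \<in> Ar C \<and> src (m g) = src (S i j) \<and> tgt (m g) = src (S i k)"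
    and ms: "\<And>g f. \<lbrakk>g \<in> hom D j k; f \<in> hom D i j\<rbrakk> \<Longrightarrow> m g \<odot> s f = s (g \<cdot> f)"
    by (auto simp: hom_iff)
  \<comment> \<open>Second layer. Consistency in \<open>g\<close> is an equation over the agreement
    of \<open>g\<close> and \<open>h\<close> pulled back along \<open>\<tau>\<close>; it is tested
    first on the sections \<open>s f\<close> and then on idempotents \<open>e\<close> with
    \<open>g e = h e\<close>.\<close>
  have "\<exists>w. w \<in> hom C (src ?r) (src (S i k)) \<and> (\<forall>g \<in> hom D j k. w \<odot> ts i j k g = m g)"
  proof (rule H.extension)
    show "src (S i k) \<in> Ob C" using I by simp
    fix g assume g: "g \<in> hom D j k"
    note gA = hD[OF g] and mg = m[OF g]
    have g3: "g \<in> Ar D" "src g = j" "tgt g = k" using gA by auto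
    note t = ts_simps[OF I g3]
    note sA = s_at(3,1,2)[OF g3]
    show "m g \<in> hom C (tgt ?r) (src (S i k))" using mg I pbs by (simp add: hom_iff)
    show "m g \<odot> rst C (ts i j k g) = m g"
    proof (rule S_epi[OF I(1,2)])
      fix f assume f: "f \<in> Ar D" "src f = i" "tgt f = j"
      note fA = s_at(3,1,2,4)[OF f]
      have "rst C (s g \<odot> \<tau> i j) \<odot> s f = s f \<odot> rst C (s g \<odot> \<tau> i j \<odot> s f)"
        using rst_Cmp[of "s f" "s g \<odot> \<tau> i j"] sA fA I by simp
      also have "\<dots> = s f \<odot> rst C (FA P (g \<cdot> f))" using fA(4) rst_s_P[of f g] gA f by simp
      finally have r: "rst C (s g \<odot> \<tau> i j) \<odot> s f = s f \<odot> rst C (FA P (g \<cdot> f))" .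
      have "(m g \<odot> rst C (ts i j k g)) \<odot> s f = (m g \<odot> s f) \<odot> rst C (FA P (g \<cdot> f))"
        using r mg fA sA t rst_ts[OF I g3] I gA f by (simp del: P_simps(7))
      also have "\<dots> = s (g \<cdot> f) \<odot> rst C (s (g \<cdot> f))"
        using ms[OF g, of f] f gA by (simp add: D.hom_iff)
      also have "\<dots> = m g \<odot> s f"
        using ms[OF g, of f] f gA Cmp_rst[of "s (g \<cdot> f)"] by (simp add: D.hom_iff del: s_simps(4))
      finally show "(m g \<odot> rst C (ts i j k g)) \<odot> s f = m g \<odot> s f" .
    qed (use mg t in \<open>auto simp: hom_iff\<close>)
    fix h assume h: "h \<in> hom D j k"
    note hA = hD[OF h] and mh = m[OF h]
    let ?a = "agree C X g h"
    have aA: "?a \<in> idems C (FO P j)" "?a \<in> Ar C" "src ?a = FO P j" "tgt ?a = FO P j"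
      using agree_join(3)[of g h] gA hA by (auto simp: idems_iff)
    have "(?r \<odot> rst C (q h \<odot> ?g)) \<odot> ts i j k g = ?r \<odot> ts i j k g \<odot> rst C ((q h \<odot> ?g) \<odot> ts i j k g)"
      using rst_Cmp[of "ts i j k g" "q h \<odot> ?g"] t pbs G.q_simps[OF h] I by simp
    also have "\<dots> = (?r \<odot> ts i j k g) \<odot> rst C ((q h \<odot> ?g) \<odot> ts i j k g)"
      using t pbs G.q_simps[OF h] sA I by (intro Cmp_assoc[symmetric]) auto
    also have "(q h \<odot> ?g) \<odot> ts i j k g = q h \<odot> s g \<odot> \<tau> i j"
      using t pbs G.q_simps[OF h] by simp
    also have "?r \<odot> ts i j k g = rst C (s g \<odot> \<tau> i j)" by (rule t(5))
    also have "rst C (s g \<odot> \<tau> i j) \<odot> rst C (q h \<odot> s g \<odot> \<tau> i j) = rst C (q h \<odot> s g \<odot> \<tau> i j)"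
      by (rule rst_le_src(2)) (use sA G.q_simps[OF h] I in auto)
    also have "q h \<odot> s g \<odot> \<tau> i j = ?a \<odot> \<tau> i j"
      by (rule Cmp_reassoc[OF glued_S(3)[OF I(2,3) g h]]) (use sA G.q_simps[OF h] I in auto)
    finally have qt: "(?r \<odot> rst C (q h \<odot> ?g)) \<odot> ts i j k g = rst C (?a \<odot> \<tau> i j)" .
    show "m g \<odot> (?r \<odot> rst C (q h \<odot> ?g)) \<odot> ts i j k g = m h \<odot> (?r \<odot> rst C (q h \<odot> ?g)) \<odot> ts i j k g"
      unfolding qt
    proof (rule S_epi[OF I(1,2)])
      fix f assume f: "f \<in> Ar D" "src f = i" "tgt f = j"
      note fA = s_at(3,1,2,4)[OF f]
      note PfA = s_at(6-8)[OF f]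
      have "rst C (?a \<odot> \<tau> i j) \<odot> s f = s f \<odot> rst C (?a \<odot> FA P f)"
        using rst_Cmp[of "s f" "?a \<odot> \<tau> i j"] aA fA I by simp
      then have *: "(m x \<odot> rst C (?a \<odot> \<tau> i j)) \<odot> s f = s (x \<cdot> f) \<odot> rst C (?a \<odot> FA P f)" if x: "x \<in> hom D j k" for x
        using m[OF x] fA aA I PfA ms[OF x, of f] f Cmp_reassoc[OF ms[OF x, of f], of "rst C (?a \<odot> FA P f)"]
        by (simp add: D.hom_iff)
      have sx: "s (x \<cdot> f) \<in> hom C (src (FA P f)) (src (S i k))" if x: "x \<in> hom D j k" for x
        using s_simps(1-3)[of "x \<cdot> f"] hD[OF x] f by (simp add: hom_iff)
      have "s (g \<cdot> f) \<odot> rst C (?a \<odot> FA P f) = s (h \<cdot> f) \<odot> rst C (?a \<odot> FA P f)"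
      proof (rule agree_eqI[OF _ _ _ _ _ _ sx[OF g] sx[OF h]])
        fix e assume e: "e \<in> idems D (src g)" "g \<cdot> e = h \<cdot> e"
        have eA: "e \<in> Ar D" "src e = j" "tgt e = j" using e gA by (auto simp: D.idems_iff)
        have ef: "rst D (e \<cdot> f) \<in> idems D i" using eA f by simp
        have P: "rst C (FA P e \<odot> FA P f) = FA P (rst D (e \<cdot> f))" using eA f by simp
        \<comment> \<open>The idempotent \<open>e\<close> at \<open>j\<close> is moved to
          \<open>i\<close> along \<open>f\<close>, which shows that \<open>g \<cdot> f\<close> and
          \<open>h \<cdot> f\<close> agree on \<open>rst D (e \<cdot> f)\<close>.\<close>
        have ex: "(x \<cdot> f) \<cdot> rst D (e \<cdot> f) = (x \<cdot> e) \<cdot> f" if x: "x \<in> hom D j k" for x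
          using D.idem_Cmp[of e j f] hD[OF x] e(1) gA eA f by simp
        show "s (g \<cdot> f) \<odot> rst C (FA P e \<odot> FA P f) = s (h \<cdot> f) \<odot> rst C (FA P e \<odot> FA P f)"
          unfolding P
          by (rule s_eq_on) (use ex[OF g] ex[OF h] e(2) ef gA hA f in simp_all)
      qed (use gA hA PfA in auto)
      then show "(m g \<odot> rst C (?a \<odot> \<tau> i j)) \<odot> s f = (m h \<odot> rst C (?a \<odot> \<tau> i j)) \<odot> s f"
        using *[OF g] *[OF h] by simp
    qed (use mg mh aA I in \<open>auto simp: hom_iff\<close>)
  qed
  then obtain w where w: "w \<in> hom C (src ?r) (src (S i k))" and wt: "\<And>g. g \<in> hom D j k \<Longrightarrow> w \<odot> ts i j k g = m g"
    by blast
  have wA: "w \<in> hom C (po i j k) (src (S i k))" using w pbs by simp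
  show ?thesis
  proof (rule ex1I[of _ w])
    have "w \<odot> ts i j k g \<odot> s f = s (g \<cdot> f)" if f: "f \<in> hom D i j" and g: "g \<in> hom D j k" for f g
    proof -
      have g3: "g \<in> Ar D" "src g = j" "tgt g = k" using hD[OF g] by auto
      have "w \<odot> ts i j k g \<odot> s f = m g \<odot> s f"
        by (rule Cmp_reassoc[OF wt[OF g]]) (use s_simps(1-3)[of f] hD[OF f] ts_simps[OF I g3] wA in \<open>auto simp: hom_iff\<close>)
      then show ?thesis using ms f g by simp
    qed
    then show "w \<in> hom C (po i j k) (src (S i k)) \<and>
      (\<forall>f \<in> hom D i j. \<forall>g \<in> hom D j k. w \<odot> ts i j k g \<odot> s f = s (g \<cdot> f))"
        using wA by blast
    fix w' assume w': "w' \<in> hom C (po i j k) (src (S i k)) \<and>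
      (\<forall>f \<in> hom D i j. \<forall>g \<in> hom D j k. w' \<odot> ts i j k g \<odot> s f = s (g \<cdot> f))"
    show "w' = w"
    proof (rule pb_epi[OF I])
      fix f g assume "f \<in> Ar D" "src f = i" "tgt f = j" "g \<in> Ar D" "src g = j" "tgt g = k"
      then have "f \<in> hom D i j" "g \<in> hom D j k" by (auto simp: D.hom_iff)
      then show "w' \<odot> ts i j k g \<odot> s f = w \<odot> ts i j k g \<odot> s f"
        using w' \<open>\<And>g f. \<lbrakk>f \<in> hom D i j; g \<in> hom D j k\<rbrakk> \<Longrightarrow> w \<odot> ts i j k g \<odot> s f = s (g \<cdot> f)\<close> by simp
    qed (use w' wA in auto)
  qed
qed

section \<open>Laws of the glued groupoid\<close>

abbreviation "\<Psi> \<equiv> Psi_obj C X"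
abbreviation "\<mu> \<equiv> Psi_mu C X"

lemma \<mu>_simps:
  assumes I: "i \<in> Ob D" "j \<in> Ob D" "k \<in> Ob D"
  shows "\<mu> i j k \<in> Ar C" "src (\<mu> i j k) = po i j k" "tgt (\<mu> i j k) = src (S i k)"
    "\<lbrakk>f \<in> Ar D; src f = i; tgt f = j; g \<in> Ar D; src g = j; tgt g = k\<rbrakk> \<Longrightarrow> \<mu> i j k \<odot> ts i j k g \<odot> s f = s (g \<cdot> f)"
proof -
  have *: "\<mu> i j k \<in> hom C (po i j k) (src (S i k)) \<and>
    (\<forall>f \<in> hom D i j. \<forall>g \<in> hom D j k. \<mu> i j k \<odot> ts i j k g \<odot> s f = s (g \<cdot> f))"
    unfolding Psi_mu_def Let_def fst_conv using theI'[OF mu_exists[OF I]] unfolding ts_def .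
  then show "\<mu> i j k \<in> Ar C" "src (\<mu> i j k) = po i j k" "tgt (\<mu> i j k) = src (S i k)"
    by (simp_all add: hom_iff)
  show "\<mu> i j k \<odot> ts i j k g \<odot> s f = s (g \<cdot> f)"
    if "f \<in> Ar D" "src f = i" "tgt f = j" "g \<in> Ar D" "src g = j" "tgt g = k"
    using * that by (auto simp: D.hom_iff)
qed

lemma \<Psi>_simps [simp]:
  "Ix \<Psi> = Ob D" "P0 \<Psi> = FO P" "P1 \<Psi> i j = src (S i j)" "sgm \<Psi> = S" "tau \<Psi> = \<tau>"
  "eta \<Psi> i = s (Idn D i)" "mu \<Psi> = \<mu>"
  by (simp_all add: Psi_obj_def)

text \<open>The element \<open>v\<close> cuts both sections down to a common domain, so that they
  form a composable pair. The laws of multiplication are derived from this formula.\<close>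

lemma mul_s:
  assumes f: "f \<in> Ar D" "src f = i" "tgt f = j" and g: "g \<in> Ar D" "src g = j" "tgt g = k"
    and v: "v \<in> Ar C" "tgt v = FO P i" "rst C (s g \<odot> FA P f \<odot> v) = rst C (s f \<odot> v)"
  shows "mul C \<Psi> i j k (s g \<odot> FA P f \<odot> v) (s f \<odot> v) = s (g \<cdot> f) \<odot> v"
proof -
  have I: "i \<in> Ob D" "j \<in> Ob D" "k \<in> Ob D" using f g by auto
  have pb: "has_pb C (S j k) (\<tau> i j)" using I by simp
  note t = ts_simps[OF I g] and pbs = pb_simps[OF pb]
  note sA = s_at(1-4)[OF f]
  note gA = s_at(1-3)[OF g]
  note PA = s_at(6-8)[OF f]
  have tv: "\<tau> i j \<odot> s f \<odot> v = FA P f \<odot> v" by (rule Cmp_reassoc[OF sA(4)]) (use sA v I in auto)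
  have "pair C (S j k) (\<tau> i j) (s g \<odot> FA P f \<odot> v) (s f \<odot> v) = ts i j k g \<odot> s f \<odot> v"
  proof (rule pair_eqI[OF pb])
    have "pr1 i j k \<odot> ts i j k g \<odot> s f \<odot> v = (s g \<odot> \<tau> i j) \<odot> s f \<odot> v"
      by (rule Cmp_reassoc[OF t(4)]) (use t pbs sA v in auto)
    then show "pr1 i j k \<odot> ts i j k g \<odot> s f \<odot> v = s g \<odot> FA P f \<odot> v"
      using tv sA gA v I by simp
    have "pr2 i j k \<odot> ts i j k g \<odot> s f \<odot> v = rst C (s g \<odot> \<tau> i j) \<odot> s f \<odot> v"
      by (rule Cmp_reassoc[OF t(5)]) (use t pbs sA v in auto)
    also have "\<dots> = (s f \<odot> v) \<odot> rst C ((s g \<odot> \<tau> i j) \<odot> s f \<odot> v)"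
      by (rule rst_Cmp) (use sA gA v I in auto)
    also have "(s g \<odot> \<tau> i j) \<odot> s f \<odot> v = s g \<odot> FA P f \<odot> v" using tv sA gA v I by simp
    also have "(s f \<odot> v) \<odot> rst C (s g \<odot> FA P f \<odot> v) = s f \<odot> v" unfolding v(3)
      by (rule Cmp_rst) (use sA v in auto)
    finally show "pr2 i j k \<odot> ts i j k g \<odot> s f \<odot> v = s f \<odot> v" .
  qed (use t sA v in auto)
  then have "mul C \<Psi> i j k (s g \<odot> FA P f \<odot> v) (s f \<odot> v) = \<mu> i j k \<odot> ts i j k g \<odot> s f \<odot> v"
    by (simp add: mul_def)
  also have "\<dots> = (\<mu> i j k \<odot> ts i j k g \<odot> s f) \<odot> v"
    using \<mu>_simps(1-3)[OF I] t sA v by simp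
  also have "\<dots> = s (g \<cdot> f) \<odot> v" using \<mu>_simps(4)[OF I f g] by simp
  finally show ?thesis .
qed

text \<open>These belong to locale \<open>partite_category\<close>, but serve to prove that the
  glued structure is an instance of it.\<close>

lemma mul_\<Psi>_Cmp:
  assumes I: "i \<in> Ob D" "j \<in> Ob D" "k \<in> Ob D"
    and "x \<in> Ar C" "tgt x = src (S i j)" "y \<in> Ar C" "src y = src x" "tgt y = src (S j k)" "S j k \<odot> y = \<tau> i j \<odot> x"
    "h \<in> Ar C" "tgt h = src x"
  shows "mul C \<Psi> i j k y x \<odot> h = mul C \<Psi> i j k (y \<odot> h) (x \<odot> h)"
    "mul C \<Psi> i j k y x \<in> Ar C" "src (mul C \<Psi> i j k y x) = src x" "tgt (mul C \<Psi> i j k y x) = src (S i k)"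
proof -
  have pb: "has_pb C (S j k) (\<tau> i j)" using I by simp
  note p = pair_simps[OF pb, of y x] and m = \<mu>_simps(1-3)[OF I]
  show "mul C \<Psi> i j k y x \<odot> h = mul C \<Psi> i j k (y \<odot> h) (x \<odot> h)"
    using p m assms pair_Cmp[OF pb, of y x h] by (simp add: mul_def)
  show "mul C \<Psi> i j k y x \<in> Ar C" "src (mul C \<Psi> i j k y x) = src x" "tgt (mul C \<Psi> i j k y x) = src (S i k)"
    using p m assms by (simp_all add: mul_def)
qed

lemma \<mu>_projections:
  assumes I: "i \<in> Ob D" "j \<in> Ob D" "k \<in> Ob D"
  shows "S i k \<odot> \<mu> i j k = S i j \<odot> pr2 i j k"
    "\<tau> i k \<odot> \<mu> i j k = \<tau> j k \<odot> pr1 i j k"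
proof -
  have pb: "has_pb C (S j k) (\<tau> i j)" using I by simp
  note pbs = pb_simps[OF pb] and m = \<mu>_simps[OF I]
  show "S i k \<odot> \<mu> i j k = S i j \<odot> pr2 i j k"
  proof (rule pb_epi[OF I, of _ "FO P i"])
    fix f g assume f: "f \<in> Ar D" "src f = i" "tgt f = j" and g: "g \<in> Ar D" "src g = j" "tgt g = k"
    note t = ts_simps[OF I g]
    note sA = s_at(1-5)[OF f]
    note gA = s_at(1-3)[OF g]
    note PA = s_at(6-8)[OF f]
    have r: "rst C (s g \<odot> \<tau> i j) \<odot> s f = s f \<odot> rst C (FA P (g \<cdot> f))"
      using rst_Cmp[of "s f" "s g \<odot> \<tau> i j"] sA(1-4) gA I rst_s_P[of f g] f g by simp
    have gfA: "FA P (g \<cdot> f) \<in> Ar C" "src (FA P (g \<cdot> f)) = FO P i" using f g by auto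
    have "pr2 i j k \<odot> ts i j k g \<odot> s f = rst C (s g \<odot> \<tau> i j) \<odot> s f"
      by (rule Cmp_reassoc[OF t(5)]) (use t pbs sA in auto)
    then have "(S i j \<odot> pr2 i j k) \<odot> ts i j k g \<odot> s f = S i j \<odot> s f \<odot> rst C (FA P (g \<cdot> f))"
      unfolding r using I pbs t(1-3) sA(1-3) by simp
    also have "\<dots> = rst C (FA P f) \<odot> rst C (FA P (g \<cdot> f))"
      by (rule Cmp_reassoc[OF sA(5)]) (use sA I gfA in auto)
    also have "\<dots> = (S i k \<odot> \<mu> i j k) \<odot> ts i j k g \<odot> s f"
      using rst_le_src(2)[of "FA P f" "FA P g"] f g s_simps(5)[of "g \<cdot> f"] f g m(1-3) m(4)[OF f g] t sA I by simp
    finally show "(S i k \<odot> \<mu> i j k) \<odot> ts i j k g \<odot> s f = (S i j \<odot> pr2 i j k) \<odot> ts i j k g \<odot> s f"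
      by simp
  qed (use I pbs m in \<open>auto simp: hom_iff\<close>)
  show "\<tau> i k \<odot> \<mu> i j k = \<tau> j k \<odot> pr1 i j k"
  proof (rule pb_epi[OF I, of _ "FO P k"])
    fix f g assume f: "f \<in> Ar D" "src f = i" "tgt f = j" and g: "g \<in> Ar D" "src g = j" "tgt g = k"
    note t = ts_simps[OF I g]
    note sA = s_at(1-4)[OF f]
    note gA = s_at(1-4)[OF g]
    note PA = s_at(6-8)[OF f]
    have "pr1 i j k \<odot> ts i j k g \<odot> s f = (s g \<odot> \<tau> i j) \<odot> s f"
      by (rule Cmp_reassoc[OF t(4)]) (use t pbs sA in auto)
    also have "\<dots> = s g \<odot> FA P f" using sA gA I by simp
    finally have "(\<tau> j k \<odot> pr1 i j k) \<odot> ts i j k g \<odot> s f = \<tau> j k \<odot> s g \<odot> FA P f"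
      using I pbs t(1-3) sA(1-3) by simp
    also have "\<dots> = FA P g \<odot> FA P f" by (rule Cmp_reassoc[OF gA(4)]) (use gA PA I in auto)
    also have "\<dots> = \<tau> i k \<odot> s (g \<cdot> f)" using \<tau>_s[of "g \<cdot> f"] f g by simp
    also have "\<dots> = (\<tau> i k \<odot> \<mu> i j k) \<odot> ts i j k g \<odot> s f"
      using m(1-3) m(4)[OF f g] t sA I by simp
    finally show "(\<tau> i k \<odot> \<mu> i j k) \<odot> ts i j k g \<odot> s f = (\<tau> j k \<odot> pr1 i j k) \<odot> ts i j k g \<odot> s f"
      by simp
  qed (use I pbs m in \<open>auto simp: hom_iff\<close>)
qed

lemma eta_\<Psi>:
  assumes i: "i \<in> Ob D"
  shows "s (Idn D i) \<in> hom C (FO P i) (src (S i i))" "S i i \<odot> s (Idn D i) = Idn C (FO P i)"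
    "\<tau> i i \<odot> s (Idn D i) = Idn C (FO P i)"
  using s_simps[of "Idn D i"] \<tau>_s[of "Idn D i"] i by (simp_all add: hom_iff)

text \<open>Three nested applications of \<open>piecewise_eq\<close> reduce to the case in which the
  elements are the sections of \<open>f\<close>, \<open>g\<close> and \<open>h\<close> followed from
  one base element \<open>v\<close>. There both sides are the section of
  \<open>h \<cdot> g \<cdot> f\<close>.\<close>

lemma mul_\<Psi>_assoc:
  assumes I: "i \<in> Ob D" "j \<in> Ob D" "k \<in> Ob D" "l \<in> Ob D"
    and x: "x \<in> Ar C" "tgt x = src (S i j)" and y: "y \<in> Ar C" "src y = src x" "tgt y = src (S j k)"
    and z: "z \<in> Ar C" "src z = src x" "tgt z = src (S k l)"
    and yx: "S j k \<odot> y = \<tau> i j \<odot> x" and zy: "S k l \<odot> z = \<tau> j k \<odot> y"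
  shows "mul C \<Psi> i k l z (mul C \<Psi> i j k y x) = mul C \<Psi> i j l (mul C \<Psi> j k l z y) x"
proof -
  have proj: "S i k \<odot> mul C \<Psi> i j k y x = S i j \<odot> x" "\<tau> i k \<odot> mul C \<Psi> i j k y x = \<tau> j k \<odot> y"
    if I: "i \<in> Ob D" "j \<in> Ob D" "k \<in> Ob D"
    and x: "x \<in> Ar C" "tgt x = src (S i j)" and y: "y \<in> Ar C" "src y = src x" "tgt y = src (S j k)"
    and yx: "S j k \<odot> y = \<tau> i j \<odot> x" for i j k x y
  proof -
    have pb: "has_pb C (S j k) (\<tau> i j)" using I by simp
    note p = pair_simps[OF pb, of y x] and m = \<mu>_simps(1-3)[OF I] and pbs = pb_simps[OF pb]
    have "S i k \<odot> \<mu> i j k \<odot> pair C (S j k) (\<tau> i j) y x = (S i j \<odot> pr2 i j k) \<odot> pair C (S j k) (\<tau> i j) y x"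
      by (rule Cmp_reassoc[OF \<mu>_projections(1)[OF I]]) (use p m I x y yx in auto)
    then show "S i k \<odot> mul C \<Psi> i j k y x = S i j \<odot> x" using p pbs I x y yx by (simp add: mul_def)
    have "\<tau> i k \<odot> \<mu> i j k \<odot> pair C (S j k) (\<tau> i j) y x = (\<tau> j k \<odot> pr1 i j k) \<odot> pair C (S j k) (\<tau> i j) y x"
      by (rule Cmp_reassoc[OF \<mu>_projections(2)[OF I]]) (use p m I x y yx in auto)
    then show "\<tau> i k \<odot> mul C \<Psi> i j k y x = \<tau> j k \<odot> y"
      using p pbs I x y yx by (simp add: mul_def)
  qed
  note m1 = mul_\<Psi>_Cmp[OF I(1-3) x y yx]
  have sx: "src x \<in> Ob C" using x by simp
  have m1A: "mul C \<Psi> i j k y x \<in> Ar C" "src (mul C \<Psi> i j k y x) = src x" "tgt (mul C \<Psi> i j k y x) = src (S i k)"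
    using m1[of "Idn C (src x)"] sx by simp_all
  have q1: "S k l \<odot> z = \<tau> i k \<odot> mul C \<Psi> i j k y x" using proj[OF I(1-3) x y yx] zy by simp
  have m2A: "mul C \<Psi> j k l z y \<in> Ar C" "src (mul C \<Psi> j k l z y) = src x" "tgt (mul C \<Psi> j k l z y) = src (S j l)"
    using mul_\<Psi>_Cmp[OF I(2-4) y(1,3) z(1) _ z(3) zy, of "Idn C (src x)"] sx y z by simp_all
  have q2: "S j l \<odot> mul C \<Psi> j k l z y = \<tau> i j \<odot> x"
    using proj[OF I(2-4) y(1,3) z(1) _ z(3) zy] y z yx by simp
  let ?L = "mul C \<Psi> i k l z (mul C \<Psi> i j k y x)" and ?R = "mul C \<Psi> i j l (mul C \<Psi> j k l z y) x"
  have zs: "src z = src (mul C \<Psi> i j k y x)" and zy': "src z = src y" and m2s: "src (mul C \<Psi> j k l z y) = src x"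
    using m1A m2A y z by simp_all
  note LL = mul_\<Psi>_Cmp[OF I(1,3,4) m1A(1,3) z(1) zs z(3) q1]
    and RR = mul_\<Psi>_Cmp[OF I(1,2,4) x m2A(1) m2s m2A(3) q2] and m2 = mul_\<Psi>_Cmp[OF I(2-4) y(1,3) z(1) zy' z(3) zy]
  have LA: "?L \<in> Ar C" "src ?L = src x" "tgt ?L = src (S i l)"
    and Lh: "\<And>h. \<lbrakk>h \<in> Ar C; tgt h = src x\<rbrakk> \<Longrightarrow> ?L \<odot> h = mul C \<Psi> i k l (z \<odot> h) (mul C \<Psi> i j k (y \<odot> h) (x \<odot> h))"
    using LL(2-4)[of "Idn C (src x)"] LL(1) m1(1) m1A sx by simp_all
  have RA: "?R \<in> Ar C" "src ?R = src x" "tgt ?R = src (S i l)"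
    and Rh: "\<And>h. \<lbrakk>h \<in> Ar C; tgt h = src x\<rbrakk> \<Longrightarrow> ?R \<odot> h = mul C \<Psi> i j l (mul C \<Psi> j k l (z \<odot> h) (y \<odot> h)) (x \<odot> h)"
    using RR(2-4)[of "Idn C (src x)"] RR(1) m2(1) m2A y sx by simp_all
  have rx: "rst C y = rst C x" "rst C z = rst C x"
    using total_rst_eq[of "S j k" "\<tau> i j" y x] total_rst_eq[of "S k l" "\<tau> j k" z y] I x y z yx zy by simp_all
  have xr: "x \<odot> rst C x = x" "y \<odot> rst C x = y" "z \<odot> rst C x = z"
    using Cmp_rst[OF x(1)] Cmp_rst[OF y(1)] Cmp_rst[OF z(1)] rx by simp_all
  have Lr: "?L \<odot> rst C x = ?L" "?R \<odot> rst C x = ?R" using Lh[of "rst C x"] Rh[of "rst C x"] x xr by simp_all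
  interpret G1: glued C "hom D i j" "S i j" q s by (rule glued_S[OF I(1,2)])
  interpret G2: glued C "hom D j k" "S j k" q s by (rule glued_S[OF I(2,3)])
  interpret G3: glued C "hom D k l" "S k l" q s by (rule glued_S[OF I(3,4)])
  have hLR: "?L \<in> hom C (src x) (src (S i l))" "?R \<in> hom C (src x) (src (S i l))"
    using LA RA by (auto simp: hom_iff)
  have "?L \<odot> rst C x = ?R \<odot> rst C x"
  proof (rule G1.piecewise_eq[OF x(1) _ hLR])
    fix f r1 assume f: "f \<in> hom D i j" and r1: "r1 \<in> idems C (src x)" and xr1: "x \<odot> r1 = s f \<odot> S i j \<odot> x \<odot> r1"
    show "?L \<odot> r1 = ?R \<odot> r1"
    proof (rule G2.piecewise_eq[OF y(1) _ hLR[folded y(2)]])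
      fix g r2 assume g: "g \<in> hom D j k" and r2: "r2 \<in> idems C (src y)" and r12: "r1 \<odot> r2 = r2"
        and yr2: "y \<odot> r2 = s g \<odot> S j k \<odot> y \<odot> r2"
      show "?L \<odot> r2 = ?R \<odot> r2"
      proof (rule G3.piecewise_eq[OF z(1) _ hLR[folded z(2)]])
        fix h r assume h: "h \<in> hom D k l" and r: "r \<in> idems C (src z)" and r23: "r2 \<odot> r = r"
          and zr: "z \<odot> r = s h \<odot> S k l \<odot> z \<odot> r"
        have rA [simp]: "r \<in> Ar C" "src r = src x" "tgt r = src x" "r1 \<in> Ar C" "src r1 = src x" "tgt r1 = src x"
          "r2 \<in> Ar C" "src r2 = src x" "tgt r2 = src x" using r1 r2 r y z by (auto simp: idems_iff)
        have r13: "r1 \<odot> r = r" using Cmp_reassoc[OF r12, of r] r23 by simp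
        have fA: "f \<in> Ar D" "src f = i" "tgt f = j" and gA: "g \<in> Ar D" "src g = j" "tgt g = k"
          and hA: "h \<in> Ar D" "src h = k" "tgt h = l" using f g h by (auto simp: D.hom_iff)
        note sA = s_at(1-4)[OF fA] s_at(1-4)[OF gA] s_at(1-3)[OF hA]
          and PA = s_at(6-8)[OF fA] s_at(6-8)[OF gA]
        define v where "v = S i j \<odot> x \<odot> r"
        have v: "v \<in> Ar C" "src v = src x" "tgt v = FO P i" using I x by (auto simp: v_def)
        have "x \<odot> r = s f \<odot> v"
          using arg_cong[OF xr1, of "\<lambda>w. w \<odot> r"] r13 x I sA by (simp add: v_def)
        note xv = this
        have txv: "\<tau> i j \<odot> x \<odot> r = FA P f \<odot> v"
          unfolding xv by (rule Cmp_reassoc[OF sA(4)]) (use sA v I in auto)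
        have "y \<odot> r = s g \<odot> S j k \<odot> y \<odot> r"
          using arg_cong[OF yr2, of "\<lambda>w. w \<odot> r"] r23 y I sA by simp
        also have "S j k \<odot> y \<odot> r = (\<tau> i j \<odot> x) \<odot> r"
          by (rule Cmp_reassoc[OF yx]) (use I y in auto)
        also have "\<dots> = FA P f \<odot> v" using txv I x by simp
        finally have yv: "y \<odot> r = s g \<odot> FA P f \<odot> v" .
        have tyv: "\<tau> j k \<odot> y \<odot> r = FA P g \<odot> FA P f \<odot> v"
          unfolding yv by (rule Cmp_reassoc[OF sA(8)]) (use sA v PA I in auto)
        note zr
        also have "S k l \<odot> z \<odot> r = (\<tau> j k \<odot> y) \<odot> r"
          by (rule Cmp_reassoc[OF zy]) (use I z in auto)
        also have "\<dots> = FA P g \<odot> FA P f \<odot> v" using tyv I y by simp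
        finally have zv: "z \<odot> r = s h \<odot> FA P g \<odot> FA P f \<odot> v" .
        have rst: "rst C (y \<odot> r) = rst C (x \<odot> r)" "rst C (z \<odot> r) = rst C (x \<odot> r)"
        proof -
          have rr: "rst C (w \<odot> r) = rst C (rst C w \<odot> r)" if "w \<in> Ar C" "src w = src x" for w
            by (rule rst_rst_Cmp[symmetric]) (use that in auto)
          show "rst C (y \<odot> r) = rst C (x \<odot> r)" "rst C (z \<odot> r) = rst C (x \<odot> r)"
            unfolding rr[OF x(1) refl] rr[OF y(1,2)] rr[OF z(1,2)] rx by (rule refl)+
        qed
        have gf: "g \<cdot> f \<in> Ar D" "src (g \<cdot> f) = i" "tgt (g \<cdot> f) = k"
          and hg: "h \<cdot> g \<in> Ar D" "src (h \<cdot> g) = j" "tgt (h \<cdot> g) = l" using fA gA hA by auto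
        have Pgf: "FA P (g \<cdot> f) \<odot> v = FA P g \<odot> FA P f \<odot> v" using fA gA v PA by simp
        have a: "mul C \<Psi> i j k (y \<odot> r) (x \<odot> r) = s (g \<cdot> f) \<odot> v"
          unfolding xv yv by (rule mul_s[OF fA gA v(1,3)]) (use rst xv yv in simp)
        have b: "mul C \<Psi> j k l (z \<odot> r) (y \<odot> r) = s (h \<cdot> g) \<odot> FA P f \<odot> v"
          unfolding zv yv by (rule mul_s[OF gA hA]) (use rst zv yv v PA in simp_all)
        \<comment> \<open>\<open>mul_s\<close> asks for elements of equal domain; the section of the
          composite along \<open>v\<close> has the domain of the current region.\<close>
        have tot: "rst C (s (g \<cdot> f) \<odot> v) = rst C (x \<odot> r)"
        proof -
          have "rst C (s (g \<cdot> f) \<odot> v) = rst C (rst C (s (g \<cdot> f)) \<odot> v)"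
            by (rule rst_rst_Cmp[symmetric]) (use s_simps(1-3)[OF gf(1)] gf v in auto)
          also have "rst C (s (g \<cdot> f)) = rst C (s g \<odot> FA P f)"
            using rst_s_P[of f g] s_simps(4)[OF gf(1)] fA gA by (simp del: P_simps(7))
          also have "rst C (rst C (s g \<odot> FA P f) \<odot> v) = rst C ((s g \<odot> FA P f) \<odot> v)"
            by (rule rst_rst_Cmp) (use sA PA v in auto)
          also have "(s g \<odot> FA P f) \<odot> v = y \<odot> r" using yv sA PA v by simp
          finally show ?thesis using rst by simp
        qed
        have tot2: "rst C (s (h \<cdot> g) \<odot> FA P f \<odot> v) = rst C (y \<odot> r)"
        proof -
          have "rst C (s (h \<cdot> g) \<odot> FA P f \<odot> v) = rst C (rst C (s (h \<cdot> g)) \<odot> FA P f \<odot> v)"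
            by (rule rst_rst_Cmp[symmetric]) (use s_simps(1-3)[OF hg(1)] hg PA v in auto)
          also have "rst C (s (h \<cdot> g)) = rst C (s h \<odot> FA P g)"
            using rst_s_P[of g h] s_simps(4)[OF hg(1)] hA gA by (simp del: P_simps(7))
          also have "rst C (rst C (s h \<odot> FA P g) \<odot> FA P f \<odot> v) = rst C ((s h \<odot> FA P g) \<odot> FA P f \<odot> v)"
            by (rule rst_rst_Cmp) (use sA PA v in auto)
          also have "(s h \<odot> FA P g) \<odot> FA P f \<odot> v = z \<odot> r" using zv sA PA v by simp
          finally show ?thesis using rst by simp
        qed
        have "?L \<odot> r = mul C \<Psi> i k l (s h \<odot> FA P (g \<cdot> f) \<odot> v) (s (g \<cdot> f) \<odot> v)"
          using Lh[of r] a zv Pgf by simp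
        also have "\<dots> = s (h \<cdot> g \<cdot> f) \<odot> v"
          by (rule mul_s[OF gf hA v(1,3)]) (use tot Pgf zv rst in simp)
        also have "\<dots> = ?R \<odot> r" using mul_s[OF fA hg v(1,3)] tot2 rst xv fA gA hA Rh[of r] b xv by simp
        finally show "?L \<odot> r = ?R \<odot> r" .
      qed (use Lr rx r2 y z in simp_all)
    qed (use Lr rx r1 y in simp_all)
  qed (use Lr x in simp_all)
  then show ?thesis using Lr by simp
qed

lemma s_Idn_P_rst: "f \<in> Ar D \<Longrightarrow> s (Idn D (src f)) \<odot> rst C (FA P f) = s (rst D f)"
  using s_Cmp_idem[of "Idn D (src f)" "rst D f"] by simp

lemma partite_category_\<Psi>: "partite_category C \<Psi>"
proof
  show "Ix \<Psi> \<prec> (UNIV :: 'u set)" using over_obj by (simp add: is_over_obj_iff)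
next
  fix i j f assume ij: "i \<in> Ix \<Psi>" "j \<in> Ix \<Psi>" "total_map C f" "tgt f = P0 \<Psi> i"
  then show "\<exists>p q. is_pullback C (sgm \<Psi> i j) f p q" using has_pb_S[of i j f] by (auto simp: has_pb_def)
next
  fix i j assume "i \<in> Ix \<Psi>" "j \<in> Ix \<Psi>"
  then have ij: "i \<in> Ob D" "j \<in> Ob D" by auto
  note eta = eta_\<Psi>[OF ij(1)] and etaj = eta_\<Psi>[OF ij(2)]
  have etaA: "s (Idn D i) \<in> Ar C" "src (s (Idn D i)) = FO P i" "tgt (s (Idn D i)) = src (S i i)"
    "s (Idn D j) \<in> Ar C" "src (s (Idn D j)) = FO P j" "tgt (s (Idn D j)) = src (S j j)"
    using eta(1) etaj(1) by (auto simp: hom_iff)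
  have Xo: "src (S i j) \<in> Ob C" using ij by simp
  have s1: "S i j \<odot> Idn C (src (S i j)) = \<tau> i i \<odot> s (Idn D i) \<odot> S i j"
    using Cmp_reassoc[OF eta(3), of "S i j"] ij etaA by simp
  have s2: "S j j \<odot> s (Idn D j) \<odot> \<tau> i j = \<tau> i j \<odot> Idn C (src (S i j))"
    using Cmp_reassoc[OF etaj(2), of "\<tau> i j"] ij etaA by simp
  \<comment> \<open>Tested on a section \<open>s f\<close>, the two unit laws become
    \<open>f 1 = f\<close> and \<open>1 f = f\<close> in \<open>D\<close>.\<close>
  have "mul C \<Psi> i i j (Idn C (src (S i j))) (s (Idn D i) \<odot> S i j) = Idn C (src (S i j))"
  proof (rule S_epi[OF ij, of _ "src (S i j)"])
    note m = mul_\<Psi>_Cmp[OF ij(1) ij(1) ij(2), of "s (Idn D i) \<odot> S i j" "Idn C (src (S i j))"]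
    show "mul C \<Psi> i i j (Idn C (src (S i j))) (s (Idn D i) \<odot> S i j) \<in> hom C (src (S i j)) (src (S i j))"
      using m(2-)[of "Idn C (src (S i j))"] ij etaA s1 Xo by (simp add: hom_iff)
    fix f assume f: "f \<in> Ar D" "src f = i" "tgt f = j"
    note sA = s_at(1-3,5)[OF f]
    have "mul C \<Psi> i i j (Idn C (src (S i j))) (s (Idn D i) \<odot> S i j) \<odot> s f = mul C \<Psi> i i j (s f \<odot> FA P (Idn D i) \<odot> rst C (FA P f)) (s (Idn D i) \<odot> rst C (FA P f))"
      using m(1)[of "s f"] sA ij etaA s1 Xo Cmp_rst[of "s f"] s_simps(4)[OF f(1)] ij f sA by simp
    also have "\<dots> = s (f \<cdot> Idn D i) \<odot> rst C (FA P f)"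
    proof (rule mul_s)
      have "rst C (s (Idn D i) \<odot> rst C (FA P f)) = rst C (FA P f)"
        using rst_Cmp_rst[of "FA P f" "s (Idn D i)"] s_simps(4)[of "Idn D i"] f ij etaA by simp
      moreover have "s f \<odot> rst C (FA P f) = s f" using Cmp_rst[of "s f"] s_simps(4)[OF f(1)] sA by simp
      ultimately show "rst C (s f \<odot> FA P (Idn D i) \<odot> rst C (FA P f)) = rst C (s (Idn D i) \<odot> rst C (FA P f))"
        using f ij sA s_simps(4)[OF f(1)] by simp
    qed (use f ij in simp_all)
    also have "\<dots> = Idn C (src (S i j)) \<odot> s f"
      using f sA Cmp_rst[of "s f"] s_simps(4)[OF f(1)] by simp
    finally show "mul C \<Psi> i i j (Idn C (src (S i j))) (s (Idn D i) \<odot> S i j) \<odot> s f = Idn C (src (S i j)) \<odot> s f" .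
  qed (use Xo in \<open>simp add: hom_iff\<close>)
  then show "mu \<Psi> i i j \<odot> pair C (sgm \<Psi> i j) (tau \<Psi> i i) (Idn C (P1 \<Psi> i j)) (eta \<Psi> i \<odot> sgm \<Psi> i j) = Idn C (P1 \<Psi> i j)"
    by (simp add: mul_def)
  have "mul C \<Psi> i j j (s (Idn D j) \<odot> \<tau> i j) (Idn C (src (S i j))) = Idn C (src (S i j))"
  proof (rule S_epi[OF ij, of _ "src (S i j)"])
    note m = mul_\<Psi>_Cmp[OF ij(1) ij(2) ij(2), of "Idn C (src (S i j))" "s (Idn D j) \<odot> \<tau> i j"]
    show "mul C \<Psi> i j j (s (Idn D j) \<odot> \<tau> i j) (Idn C (src (S i j))) \<in> hom C (src (S i j)) (src (S i j))"
      using m(2-)[of "Idn C (src (S i j))"] ij etaA s2 Xo by (simp add: hom_iff)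
    fix f assume f: "f \<in> Ar D" "src f = i" "tgt f = j"
    note sA = s_at(1-4)[OF f]
    note PA = s_at(6-8)[OF f]
    have O: "FO P i \<in> Ob C" using ij by simp
    have "mul C \<Psi> i j j (s (Idn D j) \<odot> \<tau> i j) (Idn C (src (S i j))) \<odot> s f = mul C \<Psi> i j j (s (Idn D j) \<odot> FA P f \<odot> Idn C (FO P i)) (s f \<odot> Idn C (FO P i))"
      using m(1)[of "s f"] sA ij etaA s2 Xo sA PA by simp
    also have "\<dots> = s (Idn D j \<cdot> f) \<odot> Idn C (FO P i)"
    proof (rule mul_s)
      have "rst C (s (Idn D j) \<odot> FA P f) = rst C (FA P f)" using rst_s_P[of f "Idn D j"] f ij by simp
      then show "rst C (s (Idn D j) \<odot> FA P f \<odot> Idn C (FO P i)) = rst C (s f \<odot> Idn C (FO P i))"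
        using sA PA s_simps(4)[OF f(1)] by simp
    qed (use f ij in simp_all)
    also have "\<dots> = Idn C (src (S i j)) \<odot> s f" using f sA by simp
    finally show "mul C \<Psi> i j j (s (Idn D j) \<odot> \<tau> i j) (Idn C (src (S i j))) \<odot> s f = Idn C (src (S i j)) \<odot> s f" .
  qed (use Xo in \<open>simp add: hom_iff\<close>)
  then show "mu \<Psi> i j j \<odot> pair C (sgm \<Psi> j j) (tau \<Psi> i j) (eta \<Psi> j \<odot> tau \<Psi> i j) (Idn C (P1 \<Psi> i j)) = Idn C (P1 \<Psi> i j)"
    by (simp add: mul_def)
next
  fix i j k l assume "i \<in> Ix \<Psi>" "j \<in> Ix \<Psi>" "k \<in> Ix \<Psi>" "l \<in> Ix \<Psi>"
  then have I: "i \<in> Ob D" "j \<in> Ob D" "k \<in> Ob D" "l \<in> Ob D" by auto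
  let ?s = "S j k" and ?t = "\<tau> i j"
  have pb: "has_pb C ?s ?t" using I by simp
  note pbs = pb_simps[OF pb]
  define f where "f = \<tau> j k \<odot> pb1 C ?s ?t"
  have f: "total_map C f" "f \<in> Ar C" "src f = pbo C ?s ?t" "tgt f = FO P k"
    using I pb_total[OF pb] pbs by (auto simp: f_def)
  have pb': "has_pb C (S k l) f" using I f by simp
  note pbs' = pb_simps[OF pb']
  define d where "d = pb2 C (S k l) f"
  have d: "d \<in> Ar C" "src d = pbo C (S k l) f" "tgt d = pbo C ?s ?t"
    using f pbs' by (auto simp: d_def)
  let ?a = "pb1 C (S k l) f" and ?b = "pb1 C ?s ?t \<odot> d" and ?c = "pb2 C ?s ?t \<odot> d"
  have bc: "\<mu> i j k \<odot> d = mul C \<Psi> i j k ?b ?c"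
    using pair_pb_Cmp[OF pb, of d] d by (simp add: mul_def)
  have sb: "?s \<odot> ?b = ?t \<odot> ?c" using I Cmp_reassoc[OF pbs(10), of d] d pbs by simp
  have "f \<odot> d = \<tau> j k \<odot> ?b" using I d pbs by (simp add: f_def)
  then have sa: "S k l \<odot> ?a = \<tau> j k \<odot> ?b" using pbs'(10)[folded d_def] by simp
  have "mul C \<Psi> i k l ?a (mul C \<Psi> i j k ?b ?c) = mul C \<Psi> i j l (mul C \<Psi> j k l ?a ?b) ?c"
    by (rule mul_\<Psi>_assoc[OF I]) (use I sb sa d pbs pbs' in simp_all)
  then show "let f = tau \<Psi> j k \<odot> pb1 C (sgm \<Psi> j k) (tau \<Psi> i j);
           a = pb1 C (sgm \<Psi> k l) f;
           d = pb2 C (sgm \<Psi> k l) f;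
           b = pb1 C (sgm \<Psi> j k) (tau \<Psi> i j) \<odot> d;
           c = pb2 C (sgm \<Psi> j k) (tau \<Psi> i j) \<odot> d
       in mu \<Psi> i k l \<odot> pair C (sgm \<Psi> k l) (tau \<Psi> i k) a (mu \<Psi> i j k \<odot> d)
          = mu \<Psi> i j l \<odot> pair C (sgm \<Psi> j l) (tau \<Psi> i j)
              (mu \<Psi> j k l \<odot> pair C (sgm \<Psi> k l) (tau \<Psi> j k) a b) c"
    unfolding Let_def \<Psi>_simps f_def[symmetric] d_def[symmetric] bc by (simp add: mul_def)
qed (use eta_\<Psi> \<mu>_projections \<mu>_simps(1-3) in \<open>auto simp: hom_iff\<close>)

lemma star_D:
  assumes f: "f \<in> Ar D"
  shows "star D f \<in> Ar D" "src (star D f) = tgt f" "tgt (star D f) = src f"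
    "star D f \<cdot> f = rst D f" "f \<cdot> star D f = rst D (star D f)" "star D (star D f) = f"
  using partial_inverse_star[OF restriction_category_D inverse_category_D f]
    star_eq[OF restriction_category_D inverse_category_D D.partial_inverse_sym[OF partial_inverse_star[OF restriction_category_D inverse_category_D f]]]
  by (auto simp: D.partial_inverse_iff)

lemma P_star:
  assumes f: "f \<in> Ar D"
  shows "FA P (star D f) \<odot> FA P f = rst C (FA P f)" "rst C (FA P (star D f)) \<odot> FA P f = FA P f"
proof -
  note st = star_D[OF f]
  show 1: "FA P (star D f) \<odot> FA P f = rst C (FA P f)" using P_simps(7)[of f "star D f"] st f by simp
  have "rst C (FA P (star D f)) = FA P f \<odot> FA P (star D f)" using P_simps(7)[of "star D f" f] st f by simp
  then have "rst C (FA P (star D f)) \<odot> FA P f = FA P f \<odot> FA P (star D f) \<odot> FA P f" using st f by simp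
  also have "\<dots> = FA P f" using 1 f by simp
  finally show "rst C (FA P (star D f)) \<odot> FA P f = FA P f" .
qed

text \<open>Inversion is prescribed by \<open>s f \<mapsto> s (star f) P f\<close>: go along
  \<open>f\<close> and take the section of its inverse. The laws then follow on sections from
  \<open>star f \<cdot> f = rst f\<close>.\<close>

lemma partite_groupoid_\<Psi>: "partite_groupoid C \<Psi>"
proof -
  interpret PC: partite_category C \<Psi> by (rule partite_category_\<Psi>)
  have ex: "\<exists>!w. w \<in> hom C (src (S i j)) (src (S j i)) \<and> (\<forall>f \<in> hom D i j. w \<odot> s f = s (star D f) \<odot> FA P f)"
    if ij: "i \<in> Ob D" "j \<in> Ob D" for i j
  proof (rule extension_S[OF ij])
    show "src (S j i) \<in> Ob C" using ij by simp
    fix f assume "f \<in> hom D i j"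
    then have f: "f \<in> Ar D" "src f = i" "tgt f = j" by (auto simp: D.hom_iff)
    note st = star_D[OF f(1)]
    have ss: "s (star D f) \<in> Ar C" "src (s (star D f)) = FO P j" "tgt (s (star D f)) = src (S j i)"
      using s_simps(1-3)[OF st(1)] st f by auto
    show "s (star D f) \<odot> FA P f \<in> hom C (FO P i) (src (S j i))" using ss f by (simp add: hom_iff)
    show "(s (star D f) \<odot> FA P f) \<odot> rst C (FA P f) = s (star D f) \<odot> FA P f" using ss f by simp
    fix g e assume "g \<in> hom D i j" and e: "e \<in> idems D i" and eq: "f \<cdot> e = g \<cdot> e"
    then have g: "g \<in> Ar D" "src g = i" "tgt g = j" by (auto simp: D.hom_iff)
    have eA: "e \<in> Ar D" "src e = i" "tgt e = i" using e by (auto simp: D.idems_iff)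
    \<comment> \<open>Consistency holds because the prescribed value restricted to
      \<open>P e\<close> depends on \<open>f\<close> only through \<open>f e\<close>: it is the
      value prescribed for \<open>f e\<close>.\<close>
    have *: "(s (star D f) \<odot> FA P f) \<odot> FA P e = s (star D (f \<cdot> e)) \<odot> FA P (f \<cdot> e)"
      if f: "f \<in> Ar D" "src f = i" "tgt f = j" for f
    proof -
      note st = star_D[OF f(1)]
      have ss: "s (star D f) \<in> Ar C" "src (s (star D f)) = FO P j" "tgt (s (star D f)) = src (S j i)"
        using s_simps(1-3)[OF st(1)] st f by auto
      let ?fe = "f \<cdot> e"
      have feA: "?fe \<in> Ar D" "src ?fe = i" "tgt ?fe = j" using f eA by auto
      note st' = star_D[OF feA(1)]
      have pi: "partial_inverse D ?fe (e \<cdot> star D f)"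
        by (rule D.partial_inverse_Cmp[OF D.partial_inverse_idem[OF e] partial_inverse_star[OF restriction_category_D inverse_category_D f(1)]])
          (use eA f in simp)
      have sfe: "star D ?fe = e \<cdot> star D f" by (rule star_eq[OF restriction_category_D inverse_category_D pi])
      have r: "rst D (star D ?fe) = f \<cdot> e \<cdot> star D f"
        using st'(5) sfe st f eA D.Cmp_reassoc[OF D.idem_idem[OF e], of "star D f"] by simp
      have "star D f \<cdot> rst D (star D ?fe) = rst D f \<cdot> e \<cdot> star D f"
        unfolding r by (rule D.Cmp_reassoc[OF st(4)]) (use st f eA in auto)
      also have "\<dots> = (rst D f \<cdot> e) \<cdot> star D f" using st f eA by simp
      also have "rst D f \<cdot> e = e \<cdot> rst D f" by (rule D.idems_commute[OF _ e]) (use f in simp)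
      also have "(e \<cdot> rst D f) \<cdot> star D f = e \<cdot> rst D f \<cdot> star D f" using st f eA by simp
      also have "rst D f \<cdot> star D f = star D f"
      proof -
        have "rst D f \<cdot> star D f = (star D f \<cdot> f) \<cdot> star D f" using st by simp
        also have "\<dots> = star D f \<cdot> f \<cdot> star D f" by (rule D.Cmp_assoc) (use st f in auto)
        also have "\<dots> = star D f" using st by simp
        finally show ?thesis .
      qed
      finally have sr: "star D f \<cdot> rst D (star D ?fe) = star D ?fe" using sfe by simp
      have "s (star D ?fe) = s (star D f) \<odot> FA P (rst D (star D ?fe))"
        using s_Cmp_idem[OF st(1), of "rst D (star D ?fe)"] sr st st' feA f by simp
      then have "s (star D ?fe) \<odot> FA P ?fe = s (star D f) \<odot> rst C (FA P (star D ?fe)) \<odot> FA P ?fe"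
        using ss st' feA by (simp del: P_simps(7))
      also have "\<dots> = (s (star D f) \<odot> FA P f) \<odot> FA P e" using P_star(2)[OF feA(1)] ss f eA by simp
      finally show ?thesis by simp
    qed
    show "(s (star D f) \<odot> FA P f) \<odot> FA P e = (s (star D g) \<odot> FA P g) \<odot> FA P e"
      using *[OF f] *[OF g] eq by simp
  qed
  define \<iota> where "\<iota> i j = (THE w. w \<in> hom C (src (S i j)) (src (S j i)) \<and> (\<forall>f \<in> hom D i j. w \<odot> s f = s (star D f) \<odot> FA P f))" for i j
  have \<iota>: "\<iota> i j \<in> hom C (src (S i j)) (src (S j i))" "\<And>f. \<lbrakk>f \<in> Ar D; src f = i; tgt f = j\<rbrakk> \<Longrightarrow> \<iota> i j \<odot> s f = s (star D f) \<odot> FA P f"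
    if ij: "i \<in> Ob D" "j \<in> Ob D" for i j
    using theI'[OF ex[OF ij]] by (auto simp: \<iota>_def D.hom_iff)
  have ss: "s (star D f) \<in> Ar C" "src (s (star D f)) = FO P (tgt f)" "tgt (s (star D f)) = src (S (tgt f) (src f))"
    if "f \<in> Ar D" for f using s_simps(1-3)[OF star_D(1)[OF that]] star_D[OF that] by auto
  have inv: "\<iota> i j \<in> hom C (P1 \<Psi> i j) (P1 \<Psi> j i) \<and> total_map C (\<iota> i j) \<and>
      \<iota> i j \<odot> \<iota> j i = Idn C (P1 \<Psi> j i) \<and>
      sgm \<Psi> j i \<odot> \<iota> i j = tau \<Psi> i j \<and>
      mu \<Psi> i j i \<odot> pair C (sgm \<Psi> j i) (tau \<Psi> i j) (\<iota> i j) (Idn C (P1 \<Psi> i j)) = eta \<Psi> i \<odot> sgm \<Psi> i j"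
    if ij: "i \<in> Ob D" "j \<in> Ob D" for i j
  proof -
    note 1 = \<iota>[OF ij] and 2 = \<iota>[OF ij(2,1)]
    have A: "\<iota> i j \<in> Ar C" "src (\<iota> i j) = src (S i j)" "tgt (\<iota> i j) = src (S j i)"
      "\<iota> j i \<in> Ar C" "src (\<iota> j i) = src (S j i)" "tgt (\<iota> j i) = src (S i j)"
      using 1(1) 2(1) by (auto simp: hom_iff)
    have O: "src (S i j) \<in> Ob C" "src (S j i) \<in> Ob C" using ij by auto
    have rr: "rst C (s (star D f) \<odot> FA P f) = rst C (FA P f)" if f: "f \<in> Ar D" for f
      using rst_s_P[OF f star_D(1)[OF f]] star_D[OF f] f by simp
    have total: "total_map C (\<iota> i j)"
      by (rule S_total[OF ij]) (use A 1(2) rr in auto)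
    have sg: "S j i \<odot> \<iota> i j = \<tau> i j"
    proof (rule S_epi[OF ij, of _ "FO P j"])
      fix f assume f: "f \<in> Ar D" "src f = i" "tgt f = j"
      note st = star_D[OF f(1)]
      note sA = s_at(1-3)[OF f]
      have "(S j i \<odot> \<iota> i j) \<odot> s f = rst C (FA P (star D f)) \<odot> FA P f"
        using 1(2)[OF f] A sA ij S_s_comp[OF st(1), of "FA P f"] st f by simp
      also have "\<dots> = \<tau> i j \<odot> s f" using P_star(2)[OF f(1)] \<tau>_s[OF f(1)] f by simp
      finally show "(S j i \<odot> \<iota> i j) \<odot> s f = \<tau> i j \<odot> s f" .
    qed (use A ij in \<open>auto simp: hom_iff\<close>)
    have ii: "\<iota> i j \<odot> \<iota> j i = Idn C (src (S j i))"
    proof (rule S_epi[OF ij(2,1), of _ "src (S j i)"])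
      fix f assume f: "f \<in> Ar D" "src f = j" "tgt f = i"
      note st = star_D[OF f(1)]
      note sA = s_at(1-3)[OF f]
      have "(\<iota> i j \<odot> \<iota> j i) \<odot> s f = \<iota> i j \<odot> s (star D f) \<odot> FA P f"
        using 2(2)[OF f] A sA by simp
      also have "\<dots> = (s (star D (star D f)) \<odot> FA P (star D f)) \<odot> FA P f"
        by (rule Cmp_reassoc[OF 1(2)]) (use st f A in auto)
      also have "\<dots> = s f \<odot> FA P (star D f) \<odot> FA P f" using st f sA by simp
      also have "\<dots> = s f" using P_star(1)[OF f(1)] Cmp_rst[OF sA(3)] s_simps(4)[OF f(1)] by simp
      finally show "(\<iota> i j \<odot> \<iota> j i) \<odot> s f = Idn C (src (S j i)) \<odot> s f" using sA by simp
    qed (use A O in \<open>auto simp: hom_iff\<close>)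
    have "mul C \<Psi> i j i (\<iota> i j) (Idn C (src (S i j))) = s (Idn D i) \<odot> S i j"
    proof (rule S_epi[OF ij, of _ "src (S i i)"])
      note m = mul_\<Psi>_Cmp[OF ij(1) ij(2) ij(1), of "Idn C (src (S i j))" "\<iota> i j"]
      have etaA: "s (Idn D i) \<in> Ar C" "src (s (Idn D i)) = FO P i" "tgt (s (Idn D i)) = src (S i i)"
        using eta_\<Psi>(1)[OF ij(1)] by (auto simp: hom_iff)
      show "mul C \<Psi> i j i (\<iota> i j) (Idn C (src (S i j))) \<in> hom C (src (S i j)) (src (S i i))"
        "s (Idn D i) \<odot> S i j \<in> hom C (src (S i j)) (src (S i i))"
        using m(2-)[of "Idn C (src (S i j))"] A ij sg O etaA by (auto simp: hom_iff)
      fix f assume f: "f \<in> Ar D" "src f = i" "tgt f = j"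
      note st = star_D[OF f(1)]
      note sA = s_at(1-3,5)[OF f]
      have Oi: "FO P i \<in> Ob C" using ij by simp
      have "mul C \<Psi> i j i (\<iota> i j) (Idn C (src (S i j))) \<odot> s f = mul C \<Psi> i j i (s (star D f) \<odot> FA P f) (s f)"
        using m(1)[of "s f"] A ij sg O sA 1(2)[OF f] by simp
      also have "\<dots> = mul C \<Psi> i j i (s (star D f) \<odot> FA P f \<odot> Idn C (FO P i)) (s f \<odot> Idn C (FO P i))"
        using sA f by simp
      also have "\<dots> = s (star D f \<cdot> f) \<odot> Idn C (FO P i)"
        by (rule mul_s[OF f]) (use st f ij sA rr[OF f(1)] s_simps(4)[OF f(1)] in simp_all)
      also have "\<dots> = s (rst D f)" using st f Oi s_simps(1-3)[of "rst D f"] by simp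
      also have "\<dots> = (s (Idn D i) \<odot> S i j) \<odot> s f" using s_Idn_P_rst[OF f(1)] f sA etaA ij by simp
      finally show "mul C \<Psi> i j i (\<iota> i j) (Idn C (src (S i j))) \<odot> s f = (s (Idn D i) \<odot> S i j) \<odot> s f" .
    qed
    then show ?thesis using 1(1) total sg ii by (simp add: mul_def)
  qed
  show ?thesis
    by unfold_locales (rule exI[of _ \<iota>], use inv in auto)
qed

sublocale \<Psi>: join_partite_groupoid C \<Psi>
  using partite_groupoid_\<Psi> join_restriction_category_axioms by (simp add: join_partite_groupoid_def)

lemma psec_s: "f \<in> Ar D \<Longrightarrow> psec C \<Psi> (src f) (tgt f) (s f)"
  by (simp add: psec_def)

lemma scomp_s:
  assumes f: "f \<in> Ar D" and g: "g \<in> Ar D" and fg: "tgt f = src g"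
  shows "scomp C \<Psi> (src f) (tgt f) (tgt g) (s g) (s f) = s (g \<cdot> f)"
proof -
  have sA: "src (s f) = FO P (src f)" "tgt (s f) = src (S (src f) (tgt f))" "s f \<in> Ar C"
    "src (s g) = FO P (tgt f)" "tgt (s g) = src (S (tgt f) (tgt g))" "s g \<in> Ar C"
    using s_simps(1-3)[OF f] s_simps(1-3)[OF g] fg by auto
  let ?gf = "g \<cdot> f"
  let ?v = "rst C (FA P ?gf)"
  have gf: "?gf \<in> Ar D" "src ?gf = src f" using f g fg by auto
  have PA: "FA P f \<in> Ar C" "src (FA P f) = FO P (src f)" "tgt (FA P f) = FO P (tgt f)" using f by auto
  have PgfA: "FA P ?gf \<in> Ar C" "src (FA P ?gf) = FO P (src f)" using gf P_simps(2,3)[OF gf(1)] by auto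
  have r: "rst C (s g \<odot> FA P f) = ?v" using rst_s_P[OF f g fg] .
  have "s g \<odot> FA P f = (s g \<odot> FA P f) \<odot> ?v" using r Cmp_rst[of "s g \<odot> FA P f"] sA PA by simp
  also have "\<dots> = s g \<odot> FA P f \<odot> ?v" by (rule Cmp_assoc) (use sA PA PgfA in auto)
  finally have sv: "s g \<odot> FA P f = s g \<odot> FA P f \<odot> ?v" .
  have "scomp C \<Psi> (src f) (tgt f) (tgt g) (s g) (s f) = mul C \<Psi> (src f) (tgt f) (tgt g) (s g \<odot> FA P f) (s f \<odot> ?v)"
    using \<tau>_s[OF f] r by (simp add: scomp_def Let_def)
  also have "\<dots> = mul C \<Psi> (src f) (tgt f) (tgt g) (s g \<odot> FA P f \<odot> ?v) (s f \<odot> ?v)"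
    using sv by simp
  also have "\<dots> = s ?gf \<odot> ?v"
  proof (rule mul_s)
    have "rst C (s f \<odot> ?v) = rst C (s f) \<odot> ?v" by (rule rst_Cmp_rst) (use sA PgfA in auto)
    also have "\<dots> = ?v" using s_simps(4)[OF f] rst_le_src(2)[of "FA P f" "FA P g"] f g fg by simp
    finally show "rst C (s g \<odot> FA P f \<odot> ?v) = rst C (s f \<odot> ?v)" using sv r by simp
  qed (use f g fg in auto)
  also have "\<dots> = s ?gf" using s_simps(1-4)[OF gf(1)] Cmp_rst[of "s ?gf"] by simp
  finally show ?thesis .
qed

lemma unit_is_over_map: "is_over_map C (D, P) (Phi_obj C \<Psi>) (unit_map C D P s)"
proof -
  let ?F = "fst (unit_map C D P s)"
  have F: "FA ?F f = Arr (src f) (lab (s f)) (tgt f)" if "f \<in> Ar D" for f using that by (simp add: unit_map_def)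
  have FO: "FO ?F i = i" if "i \<in> Ob D" for i using that by (simp add: unit_map_def)
  have arr: "FA ?F f \<in> Ar (Phi_cat C \<Psi>)" "src (FA ?F f) = src f" "tgt (FA ?F f) = tgt f" "under \<Psi> (FA ?F f) = s f"
    if f: "f \<in> Ar D" for f
  proof -
    have "partial_inverse C (FA P f) (FA P (star D f))"
      by (rule functor_partial_inverse[OF restriction_functor_P partial_inverse_star[OF restriction_category_D inverse_category_D f]])
    then have "partial_iso C (tau \<Psi> (src f) (tgt f) \<odot> s f)"
      using \<tau>_s[OF f] by (auto simp: partial_iso_def)
    then show "FA ?F f \<in> Ar (Phi_cat C \<Psi>)" unfolding F[OF f] by (rule \<Psi>.Ar_Phi_Arr[OF psec_s[OF f]])
    show "src (FA ?F f) = src f" "tgt (FA ?F f) = tgt f" using F f by auto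
    show "under \<Psi> (FA ?F f) = s f" unfolding F[OF f] by (rule \<Psi>.under_Arr) (use s_simps(1-3)[OF f] in auto)
  qed
  have idn: "FA ?F (Idn D i) = Idn (Phi_cat C \<Psi>) i" if i: "i \<in> Ob D" for i
    using arr[of "Idn D i"] \<Psi>.Phi_Idn[of i] i by (intro \<Psi>.under_eqI) auto
  have cmp: "FA ?F (g \<cdot> f) = FA ?F g \<odot>\<^bsub>Phi_cat C \<Psi>\<^esub> FA ?F f" if fg: "f \<in> Ar D" "g \<in> Ar D" "tgt f = src g" for f g
    using arr[of "g \<cdot> f"] arr[OF fg(1)] arr[OF fg(2)] fg \<Psi>.Phi_Cmp(2-)[OF arr(1)[OF fg(1)] arr(1)[OF fg(2)]] scomp_s[OF fg]
    by (intro \<Psi>.under_eqI) auto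
  have fctr: "is_functor D (Phi_cat C \<Psi>) ?F"
    using idn cmp arr FO by (auto simp: is_functor_def D.category_axioms \<Psi>.Phi.category_axioms hom_def)
  have P: "is_functor D C P" using restriction_functor_P by (simp add: is_restriction_functor_def)
  have PF: "is_functor D C (comp_fctr (Phi_proj C \<Psi>) ?F)"
    by (rule is_functor_comp[OF fctr])
      (use \<Psi>.is_restriction_functor_Phi_proj in \<open>simp add: is_restriction_functor_def\<close>)
  have "FA P f \<odot> Idn C (FO P (src f)) = Idn C (FO P (tgt f)) \<odot> tau \<Psi> (src f) (tgt f) \<odot> s f" if "f \<in> Ar D" for f
    using that \<tau>_s[OF that] by simp
  then show ?thesis
    using fctr P PF arr FO by (auto simp: is_over_map_iff is_nat_trans_def Phi_obj_def comp_fctr_def unit_map_def hom_iff)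
qed

text \<open>Here every map of \<open>D\<close> is a piece, and the overlaps of pieces are the
  agreement idempotents themselves.\<close>

lemma presentation_\<Psi>: "presentation C \<Psi> D P s (hom D) q"
proof (intro presentation.intro presentation_axioms.intro)
  show "join_partite_groupoid C \<Psi>" ..
  show "is_over_obj C (D, P)" by (rule over_obj)
  show "is_over_map C (D, P) (Phi_obj C \<Psi>) (unit_map C D P s)" by (rule unit_is_over_map)
  show "s f \<in> hom C (P0 \<Psi> (src f)) (P1 \<Psi> (src f) (tgt f))" if "f \<in> Ar D" for f
    using s_simps(1-3)[OF that] by (simp add: hom_iff)
  show "glued C (hom D i j) (sgm \<Psi> i j) q s" if "i \<in> Ix \<Psi>" "j \<in> Ix \<Psi>" for i j
    using glued_S(1)[of i j] that by simp
  show "restr_le C (q t \<odot> s f) (agree C (D, P) t f)" if tf: "t \<in> hom D i j" "f \<in> hom D i j" for t i j f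
  proof -
    note T = P_src_tgt_hom[OF tf(1)] and F = P_src_tgt_hom[OF tf(2)]
    have "q t \<odot> s f = agree C (D, P) t f" using glued_S(3)[of i j f t] agree_sym[of f t] T F tf by simp
    then show ?thesis using agree_join(3)[of t f] T F by (auto simp: idems_iff)
  qed
qed auto

end

section \<open>Etale groupoids are presented by their bisections\<close>

context join_partite_groupoid
begin

definition T_bis :: "'u \<Rightarrow> 'u \<Rightarrow> ('u, 'u) arr set" where
  "T_bis i j = {f \<in> hom \<Phi> i j. partial_iso C (under A f)}"

lemma etale_cover:
  assumes "etale C A" "i \<in> Ix A" "j \<in> Ix A"
  shows "\<exists>S \<subseteq> hom C (P1 A i j) (P0 A i). (\<forall>s \<in> S. partial_iso C s) \<and> is_join C (P1 A i j) (P0 A i) S (sgm A i j)"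
  using assms by (simp add: etale_def local_homeo_def)

definition q_bis :: "('u, 'u) arr \<Rightarrow> ('o, 'u) arr" where
  "q_bis f = (SOME u. partial_inverse C (under A f) u)"

text \<open>Inversion is an isomorphism carrying \<open>tau\<close> to a source map, so a cover of
  the latter is carried back by precomposition.\<close>

lemma tau_local_homeo:
  assumes ij: "i \<in> Ix A" "j \<in> Ix A" and et: "etale C A"
  obtains S where "S \<subseteq> hom C (P1 A i j) (P0 A j)" "\<And>s. s \<in> S \<Longrightarrow> partial_iso C s"
    "is_join C (P1 A i j) (P0 A j) S (tau A i j)"
proof -
  obtain \<iota> where \<iota>: "\<forall>i \<in> Ix A. \<forall>j \<in> Ix A. (\<iota> i j \<in> hom C (P1 A i j) (P1 A j i) \<and> total_map C (\<iota> i j)) \<and>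
      \<iota> i j \<odot> \<iota> j i = Idn C (P1 A j i) \<and> sgm A j i \<odot> \<iota> i j = tau A i j"
    using inversion_mul by blast
  let ?v = "\<iota> i j" and ?w = "\<iota> j i"
  have v: "?v \<in> Ar C" "src ?v = P1 A i j" "tgt ?v = P1 A j i" "total_map C ?v" "sgm A j i \<odot> ?v = tau A i j"
    and w: "?w \<in> Ar C" "src ?w = P1 A j i" "tgt ?w = P1 A i j" "total_map C ?w"
    and vw: "?v \<odot> ?w = Idn C (P1 A j i)" "?w \<odot> ?v = Idn C (P1 A i j)"
    using \<iota> ij by (auto simp: hom_iff)
  have pi: "partial_iso C ?v"
    unfolding partial_iso_def
    by (rule exI[of _ ?w]) (use v w vw in \<open>simp add: partial_inverse_iff total_map_def\<close>)
  obtain S where S: "S \<subseteq> hom C (P1 A j i) (P0 A j)" "\<And>s. s \<in> S \<Longrightarrow> partial_iso C s"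
    "is_join C (P1 A j i) (P0 A j) S (sgm A j i)"
    using etale_cover[OF et ij(2,1)] by blast
  show thesis
  proof (rule that[of "(\<lambda>s. s \<odot> ?v) ` S"])
    show "(\<lambda>s. s \<odot> ?v) ` S \<subseteq> hom C (P1 A i j) (P0 A j)" using S(1) v by (auto simp: hom_iff)
    show "partial_iso C t" if "t \<in> (\<lambda>s. s \<odot> ?v) ` S" for t
      using that S(1,2) v pi by (auto simp: hom_iff subset_iff intro!: partial_iso_Cmp)
    show "is_join C (P1 A i j) (P0 A j) ((\<lambda>s. s \<odot> ?v) ` S) (tau A i j)"
      using is_join_precomp[OF S(3,1), of ?v] v by simp
  qed
qed

lemma T_bis_D:
  assumes "f \<in> T_bis i j"
  shows "f \<in> Ar \<Phi>" "src f = i" "tgt f = j" "psec C A i j (under A f)" "partial_inverse C (q_bis f) (under A f)"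
proof -
  show f: "f \<in> Ar \<Phi>" "src f = i" "tgt f = j" using assms by (auto simp: T_bis_def hom_def)
  then show "psec C A i j (under A f)" using Ar_PhiD(3) by auto
  have "\<exists>u. partial_inverse C (under A f) u" using assms by (auto simp: T_bis_def partial_iso_def)
  then have "partial_inverse C (under A f) (q_bis f)" unfolding q_bis_def by (rule someI_ex)
  then show "partial_inverse C (q_bis f) (under A f)" by (rule partial_inverse_sym)
qed

text \<open>The section property \<open>sgm s = rst s\<close> forces the partial inverse of
  \<open>s\<close> to be a restriction of \<open>sgm\<close>.\<close>

lemma q_bis_eq:
  assumes "f \<in> T_bis i j"
  shows "q_bis f = sgm A i j \<odot> rst C (q_bis f)"
proof -
  note f = T_bis_D[OF assms] and s = psec_simps[OF T_bis_D(4)[OF assms]]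
  have q: "q_bis f \<in> Ar C" "src (q_bis f) = P1 A i j" "tgt (q_bis f) = P0 A i"
    "under A f \<odot> q_bis f = rst C (q_bis f)" "q_bis f \<odot> under A f = rst C (under A f)"
    using f(5) s by (auto simp: partial_inverse_iff)
  have "sgm A i j \<odot> rst C (q_bis f) = sgm A i j \<odot> under A f \<odot> q_bis f" using q by simp
  also have "\<dots> = rst C (under A f) \<odot> q_bis f" using psec_comp[OF f(4), of "q_bis f"] q(1,3) by simp
  also have "\<dots> = q_bis f \<odot> under A f \<odot> q_bis f" using Cmp_reassoc[OF q(5), of "q_bis f"] q s by simp
  also have "\<dots> = q_bis f" using q by simp
  finally show ?thesis by simp
qed

text \<open>The bisection is the partial inverse \<open>t\<close> of \<open>sgm e\<close>. It lands
  in \<open>e\<close>, so it is a section of \<open>sgm\<close>, and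
  \<open>tau t = (tau e) t\<close> is a composite of partial isomorphisms.\<close>

lemma bisection_of_partial_isos:
  assumes ij: "i \<in> Ix A" "j \<in> Ix A" and e: "e \<in> idems C (P1 A i j)"
    and pi: "partial_iso C (sgm A i j \<odot> e)" "partial_iso C (tau A i j \<odot> e)"
  shows "\<exists>f \<in> T_bis i j. q_bis f = sgm A i j \<odot> e"
proof -
  have eA: "e \<in> Ar C" "src e = P1 A i j" "tgt e = P1 A i j" "rst C e = e" using e by (auto simp: idems_iff)
  obtain t where t: "partial_inverse C (sgm A i j \<odot> e) t" using pi by (auto simp: partial_iso_def)
  then have tA: "t \<in> Ar C" "src t = P0 A i" "tgt t = P1 A i j" "t \<odot> sgm A i j \<odot> e = e" "sgm A i j \<odot> e \<odot> t = rst C t"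
    using ij eA by (auto simp: partial_inverse_iff)
  have "e \<odot> t = (t \<odot> sgm A i j \<odot> e) \<odot> t" by (simp only: tA(4))
  also have "\<dots> = t \<odot> sgm A i j \<odot> e \<odot> t" using tA(1-3) ij eA by simp
  also have "\<dots> = t" using tA by simp
  finally have et: "e \<odot> t = t" .
  have st: "sgm A i j \<odot> t = rst C t" using tA(5) et by simp
  have ps: "psec C A i j t" using ij tA st by (simp add: psec_def)
  have "partial_iso C t" using partial_inverse_sym[OF t] by (auto simp: partial_iso_def)
  then have "partial_iso C ((tau A i j \<odot> e) \<odot> t)"
    by (rule partial_iso_Cmp[OF _ pi(2)]) (use tA eA ij in simp)
  then have "partial_iso C (tau A i j \<odot> t)" using et tA eA ij by simp
  then have f: "Arr i (lab t) j \<in> Ar \<Phi>" by (rule Ar_Phi_Arr[OF ps])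
  have u: "under A (Arr i (lab t) j) = t" by (rule under_Arr[OF tA(2,3)])
  have T: "Arr i (lab t) j \<in> T_bis i j"
    using f u \<open>partial_iso C t\<close> by (simp add: T_bis_def hom_def)
  have "q_bis (Arr i (lab t) j) = sgm A i j \<odot> e"
    using partial_inverse_unique[OF partial_inverse_sym[OF T_bis_D(5)[OF T]], of "sgm A i j \<odot> e"]
      partial_inverse_sym[OF t] u by simp
  then show ?thesis using T by blast
qed

text \<open>A piece of the source map alone may not do, since the target map can fail to be
  injective on it. Intersecting the pieces of \<open>sgm\<close> with those of \<open>tau\<close>
  gives idempotents on which both are partial isomorphisms, and each of these comes from a
  bisection.\<close>

lemma glued_bisections:
  assumes ij: "i \<in> Ix A" "j \<in> Ix A" and et: "etale C A"
  shows "glued C (T_bis i j) (sgm A i j) q_bis (under A)"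
proof -
  have qh: "q_bis f \<in> hom C (P1 A i j) (P0 A i)" if "f \<in> T_bis i j" for f
    using T_bis_D(5)[OF that] psec_simps[OF T_bis_D(4)[OF that]] by (auto simp: partial_inverse_iff hom_iff)
  obtain S where S: "S \<subseteq> hom C (P1 A i j) (P0 A i)" "\<And>s. s \<in> S \<Longrightarrow> partial_iso C s"
    "is_join C (P1 A i j) (P0 A i) S (sgm A i j)"
    using etale_cover[OF et ij] by blast
  obtain S' where S': "S' \<subseteq> hom C (P1 A i j) (P0 A j)" "\<And>s. s \<in> S' \<Longrightarrow> partial_iso C s"
    "is_join C (P1 A i j) (P0 A j) S' (tau A i j)"
    using tau_local_homeo[OF ij et] by metis
  have "is_join C (P1 A i j) (P0 A i) (q_bis ` T_bis i j) (sgm A i j)"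
    unfolding is_join_def
  proof (intro conjI ballI impI)
    show "sgm A i j \<in> hom C (P1 A i j) (P0 A i)" using ij by (simp add: hom_iff)
    show "restr_le C t (sgm A i j)" if "t \<in> q_bis ` T_bis i j" for t
      using that q_bis_eq qh ij by (auto simp: restr_le_def hom_iff)
    fix x assume x: "x \<in> hom C (P1 A i j) (P0 A i)" and up: "\<forall>t \<in> q_bis ` T_bis i j. restr_le C t x"
    show "restr_le C (sgm A i j) x"
    proof (rule is_join_least[OF S(3) x])
      fix s assume s: "s \<in> S"
      have sA: "s \<in> Ar C" "src s = P1 A i j" "tgt s = P0 A i" using S(1) s by (auto simp: hom_iff)
      have ss: "sgm A i j \<odot> rst C s = s" using le_Cmp_rst[OF is_join_le[OF S(3) s]] sA ij by simp
      have xA: "x \<in> Ar C" "src x = P1 A i j" "tgt x = P0 A i" using x by (auto simp: hom_iff)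
      \<comment> \<open>As \<open>tau\<close> is total, \<open>rst C (tau A i j)\<close> is an
        identity; it is inserted so that the equation can be tested on the pieces \<open>t\<close>
        of \<open>tau\<close>.\<close>
      have "s \<odot> rst C (tau A i j) = (x \<odot> rst C s) \<odot> rst C (tau A i j)"
      proof (rule is_join_rst_eq[of "P1 A i j" "P0 A j" "\<lambda>t. t" S'])
        show "is_join C (P1 A i j) (P0 A j) ((\<lambda>t. t) ` S') (tau A i j)" "(\<lambda>t. t) ` S' \<subseteq> hom C (P1 A i j) (P0 A j)"
          using S' by simp_all
        show "s \<in> hom C (P1 A i j) (P0 A i)" "x \<odot> rst C s \<in> hom C (P1 A i j) (P0 A i)"
          using sA xA by (auto simp: hom_iff)
        fix t assume t: "t \<in> S'"
        have tA: "t \<in> Ar C" "src t = P1 A i j" "tgt t = P0 A j" using S'(1) t by (auto simp: hom_iff)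
        have tt: "tau A i j \<odot> rst C t = t" using le_Cmp_rst[OF is_join_le[OF S'(3) t]] tA ij by simp
        let ?e = "rst C s \<odot> rst C t"
        have e: "?e \<in> idems C (P1 A i j)" using sA tA by simp
        have eA: "?e \<in> Ar C" "src ?e = P1 A i j" "tgt ?e = P1 A i j" "rst C ?e = ?e"
          using e by (auto simp: idems_iff)
        have se: "sgm A i j \<odot> ?e = s \<odot> rst C t" using Cmp_reassoc[OF ss, of "rst C t"] sA tA ij by simp
        have te: "tau A i j \<odot> ?e = t \<odot> rst C s"
          using Cmp_reassoc[OF tt, of "rst C s"] rst_commute[of s t] sA tA ij by simp
        have "partial_iso C (s \<odot> rst C t)" "partial_iso C (t \<odot> rst C s)"
          using partial_iso_Cmp[OF partial_iso_idem[of "rst C t" "src s"] S(2)[OF s]]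
            partial_iso_Cmp[OF partial_iso_idem[of "rst C s" "src t"] S'(2)[OF t]] sA tA by auto
        then obtain f where f: "f \<in> T_bis i j" "q_bis f = sgm A i j \<odot> ?e"
          using bisection_of_partial_isos[OF ij e] unfolding se te by auto
        have "restr_le C (sgm A i j \<odot> ?e) x" using up f by auto
        then have "x \<odot> rst C (sgm A i j \<odot> ?e) = sgm A i j \<odot> ?e"
          by (rule le_Cmp_rst) (use xA eA ij in simp_all)
        moreover have "rst C (sgm A i j \<odot> ?e) = ?e" using rst_sgm[OF ij eA(1,3)] eA by simp
        ultimately show "s \<odot> rst C t = (x \<odot> rst C s) \<odot> rst C t" using se xA sA tA by simp
      qed
      then have "s = x \<odot> rst C s" using ij sA xA tau_total[OF ij] by (simp add: total_map_def)
      then show "restr_le C s x" using sA xA by (simp add: restr_le_def)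
    qed
  qed
  then show ?thesis
    by unfold_locales (use ij qh T_bis_D(5) sgm_total in auto)
qed

lemma unit_map_under: "unit_map C \<Phi> (Phi_proj C A) (under A) = id_over C (Phi_obj C A)"
  by (simp add: unit_map_def id_over_def Phi_obj_def)

text \<open>The condition to verify is that a piece \<open>t\<close> and a bisection
  \<open>f\<close> agree in \<open>Phi_cat\<close> wherever their sections overlap. The overlap
  \<open>d\<close> is an idempotent of \<open>C\<close>; it lifts to the bisection
  \<open>eta d\<close>, and composing \<open>t\<close> or \<open>f\<close> with this gives the same
  result.\<close>

lemma presentation_etale:
  assumes et: "etale C A" and small: "small_hom_sets C"
  shows "presentation C A \<Phi> (Phi_proj C A) (under A) T_bis q_bis"
proof (intro presentation.intro presentation_axioms.intro)
  show "join_partite_groupoid C A" ..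
  show obj: "is_over_obj C (\<Phi>, Phi_proj C A)"
    using is_over_obj_Phi[OF small] by (simp add: Phi_obj_def)
  show "is_over_map C (\<Phi>, Phi_proj C A) (Phi_obj C A) (unit_map C \<Phi> (Phi_proj C A) (under A))"
    using is_over_map_id[OF obj] by (simp add: unit_map_under Phi_obj_def)
  show "under A f \<in> hom C (P0 A (src f)) (P1 A (src f) (tgt f))" if "f \<in> Ar \<Phi>" for f
    using psec_simps[OF Ar_PhiD(3)[OF that]] by (simp add: hom_iff)
  show "T_bis i j \<subseteq> hom \<Phi> i j" for i j by (auto simp: T_bis_def)
  show "glued C (T_bis i j) (sgm A i j) q_bis (under A)" if "i \<in> Ix A" "j \<in> Ix A" for i j
    by (rule glued_bisections[OF that et])
  fix t f i j assume t: "t \<in> T_bis i j" and f: "f \<in> hom \<Phi> i j"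
  interpret X: over_object C "\<Phi>" "Phi_proj C A" by unfold_locales (rule obj)
  note T = T_bis_D[OF t]
  have fA: "f \<in> Ar \<Phi>" "src f = i" "tgt f = j" using f by (auto simp: hom_def)
  have I: "i \<in> Ix A" "j \<in> Ix A" using Ar_PhiD[OF fA(1)] fA by auto
  interpret G: glued C "T_bis i j" "sgm A i j" q_bis "under A" by (rule glued_bisections[OF I et])
  have ps: "psec C A i j (under A f)" using Ar_PhiD(3)[OF fA(1)] fA by simp
  note tsimp = psec_simps[OF T(4)] and fsimp = psec_simps[OF ps]
  have "partial_section C (sgm A i j) (under A f)" using ps I by (auto simp: psec_def partial_section_def hom_iff)
  note qs = G.q_section[OF this t]
  define d where "d = q_bis t \<odot> under A f"
  have d: "d \<in> idems C (P0 A i)" "under A f \<odot> d = under A t \<odot> d"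
    using qs(2,3) I by (simp_all add: d_def)
  have dA: "d \<in> Ar C" "src d = P0 A i" "tgt d = P0 A i" "rst C d = d" using d(1) by (auto simp: idems_iff)
  have rd: "rst C (under A f) \<odot> d = d"
  proof -
    have "rst C (under A f) \<odot> rst C (q_bis t \<odot> under A f) = rst C (q_bis t \<odot> under A f)"
      by (rule rst_le_src(2)) (use G.q_simps[OF t] fsimp in auto)
    then show ?thesis using dA by (simp add: d_def)
  qed
  define e where "e = Arr i (lab (eta A i \<odot> d)) i"
  note E = Phi_idem[OF I(1) d(1), folded e_def]
  have eA: "e \<in> Ar \<Phi>" "src e = i" "tgt e = i" "under A e = eta A i \<odot> d" using E by (simp_all add: e_def)
  have re: "rst \<Phi> e = e"
    using Phi_rst[OF eA(1)] eA dA I by (intro under_eqI) simp_all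
  have eI: "e \<in> idems \<Phi> i" using eA re by (simp add: Phi.idems_iff)
  have under_comp: "under A (g \<bullet> e) = under A g \<odot> d" if "g \<in> Ar \<Phi>" "src g = i" for g
    using Phi_Cmp(4)[OF eA(1) that(1)] eA that scomp_eta_right[OF Ar_PhiD(3)[OF that(1)], of d] d(1) by simp
  have te: "t \<bullet> e = f \<bullet> e"
    using under_comp[OF T(1,2)] under_comp[OF fA(1,2)] d(2) Phi_Cmp(2,3)[OF eA(1) T(1)] Phi_Cmp(2,3)[OF eA(1) fA(1)] eA T fA
    by (intro under_eqI) simp_all
  have rfe: "rst \<Phi> (f \<bullet> e) = e"
    using Phi_rst[of "f \<bullet> e"] Phi_Cmp(2,3,5)[OF eA(1) fA(1)] under_comp[OF fA(1,2)] eA fA rd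
      rst_Cmp_idem[OF d(1), of "under A f"] fsimp
    by (intro under_eqI) simp_all
  have f1: "rst \<Phi> f \<bullet> e = e" using Phi.rst_Cmp_idem[OF eI fA(1,2)] rfe by simp
  have t1: "rst \<Phi> t \<bullet> e = e" using Phi.rst_Cmp_idem[OF eI T(1,2)] rfe te by simp
  have "restr_le C (FA (Phi_proj C A) e) (agree C (\<Phi>, Phi_proj C A) t f)"
  proof (rule X.agree_upper)
    have "(rst \<Phi> t \<bullet> rst \<Phi> f) \<bullet> e = e"
      using f1 t1 T fA eA by simp
    then show "restr_le \<Phi> e (rst \<Phi> t \<bullet> rst \<Phi> f)"
      using Phi.idems_le_iff[OF eI, of "rst \<Phi> t \<bullet> rst \<Phi> f"] T fA by simp
  qed (use T fA eI te in auto)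
  moreover have "FA (Phi_proj C A) e = d" using eA dA I by simp
  ultimately show "restr_le C (q_bis t \<odot> under A f) (agree C (\<Phi>, Phi_proj C A) t f)" by (simp add: d_def)
qed (simp_all add: Phi_proj_def)

end

section \<open>Fixpoints\<close>

text \<open>With identities on objects and as components, only the bijection of arrows has to be
  inverted; that the inverse lies over \<open>C\<close> follows from the naturality squares of
  \<open>h\<close>, whose components are identities.\<close>

lemma over_iso:
  fixes C :: "('o, 'u) rcat" (structure)
  assumes C: "restriction_category C" and X: "is_over_obj C X" and Y: "is_over_obj C Y" and h: "is_over_map C X Y h"
    and O: "Ob (fst Y) = Ob (fst X)" "\<And>i. i \<in> Ob (fst X) \<Longrightarrow> FO (fst h) i = i"
    and P: "\<And>i. i \<in> Ob (fst X) \<Longrightarrow> snd h i = Idn C (FO (snd X) i)" "\<And>i. i \<in> Ob (fst X) \<Longrightarrow> FO (snd Y) i = FO (snd X) i"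
    and bij: "bij_betw (FA (fst h)) (Ar (fst X)) (Ar (fst Y))"
  shows "is_iso (iCat_over C) (Arr X h Y)"
proof -
  interpret restriction_category C by fact
  interpret I: category "iCat_over C" by (rule category_iCat_over[OF C])
  let ?D = "fst X" and ?E = "fst Y"
  define G where "G = inv_into (Ar ?D) (FA (fst h))"
  have hA: "FA (fst h) f \<in> Ar ?E" "src (FA (fst h) f) = src f" "tgt (FA (fst h) f) = tgt f" if "f \<in> Ar ?D" for f
  proof -
    interpret D: category ?D using h by (simp add: is_over_map_iff is_functor_def)
    show "FA (fst h) f \<in> Ar ?E" "src (FA (fst h) f) = src f" "tgt (FA (fst h) f) = tgt f"
      using h that O(2) by (auto simp: is_over_map_iff is_functor_def hom_def)
  qed
  interpret D: category ?D using h by (simp add: is_over_map_iff is_functor_def)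
  interpret E: category ?E using h by (simp add: is_over_map_iff is_functor_def)
  have GF: "G (FA (fst h) f) = f" if "f \<in> Ar ?D" for f
    using that bij by (simp add: G_def bij_betw_def inv_into_f_f)
  have FG: "FA (fst h) (G g) = g" "G g \<in> Ar ?D" if "g \<in> Ar ?E" for g
    using that bij by (auto simp: G_def bij_betw_def f_inv_into_f inv_into_into)
  have Gst: "src (G g) = src g" "tgt (G g) = tgt g" if "g \<in> Ar ?E" for g
    using hA[OF FG(2)[OF that]] FG[OF that] by simp_all
  have Gid: "G (Idn ?E i) = Idn ?D i" if "i \<in> Ob ?D" for i
    using GF[of "Idn ?D i"] h O that by (simp add: is_over_map_iff is_functor_def)
  have Gc: "G (b \<odot>\<^bsub>?E\<^esub> a) = G b \<odot>\<^bsub>?D\<^esub> G a" if "a \<in> Ar ?E" "b \<in> Ar ?E" "tgt a = src b" for a b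
  proof -
    have "FA (fst h) (G b \<odot>\<^bsub>?D\<^esub> G a) = b \<odot>\<^bsub>?E\<^esub> a"
      using h FG[OF that(1)] FG[OF that(2)] Gst that by (simp add: is_over_map_iff is_functor_def)
    then show ?thesis using GF[of "G b \<odot>\<^bsub>?D\<^esub> G a"] FG Gst that by simp
  qed
  have PX: "is_functor ?D C (snd X)" "is_functor ?E C (snd Y)"
    using X Y by (auto simp: is_over_obj_iff is_restriction_functor_def)
  have PA: "FA (snd X) f \<in> Ar C" "src (FA (snd X) f) = FO (snd X) (src f)" "tgt (FA (snd X) f) = FO (snd X) (tgt f)"
    "FO (snd X) (src f) \<in> Ob C"
    if "f \<in> Ar ?D" for f using PX that by (auto simp: is_functor_def hom_iff)
  have QA: "FA (snd Y) g \<in> Ar C" "src (FA (snd Y) g) = FO (snd X) (src g)" "tgt (FA (snd Y) g) = FO (snd X) (tgt g)"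
    if "g \<in> Ar ?E" for g
  proof -
    have "src g \<in> Ob ?D" "tgt g \<in> Ob ?D" using E.src_Ob[OF that] E.tgt_Ob[OF that] O by auto
    then show "FA (snd Y) g \<in> Ar C" "src (FA (snd Y) g) = FO (snd X) (src g)" "tgt (FA (snd Y) g) = FO (snd X) (tgt g)"
      using PX that P(2) by (auto simp: is_functor_def hom_iff)
  qed
  have PQ: "FA (snd Y) (FA (fst h) f) = FA (snd X) f" if "f \<in> Ar ?D" for f
  proof -
    have "FA (snd X) f \<odot> snd h (src f) = snd h (tgt f) \<odot> FA (snd Y) (FA (fst h) f)"
      using h that by (simp add: is_over_map_iff is_nat_trans_def comp_fctr_def)
    then show ?thesis using P(1) PA[OF that] QA[OF hA(1)[OF that]] hA[OF that] that by simp
  qed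
  define k where "k = (\<lparr> FO = (\<lambda>i \<in> Ob ?E. i), FA = (\<lambda>g \<in> Ar ?E. G g) \<rparr>, \<lambda>i \<in> Ob ?E. Idn C (FO (snd X) i))"
  have kf: "is_functor ?E ?D (fst k)"
    using FG Gst Gid Gc O by (auto simp: is_functor_def k_def D.category_axioms E.category_axioms hom_def)
  have kE: "is_functor ?E C (comp_fctr (snd X) (fst k))" by (rule is_functor_comp[OF kf PX(1)])
  have PO: "FO (snd X) i \<in> Ob C" if "i \<in> Ob ?D" for i using PX that by (auto simp: is_functor_def)
  have nat: "FA (snd Y) g \<odot> Idn C (FO (snd X) (src g)) = Idn C (FO (snd X) (tgt g)) \<odot> FA (snd X) (G g)" if "g \<in> Ar ?E" for g
    using PQ[OF FG(2)[OF that]] FG[OF that] QA[OF that] by simp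
  have k: "is_over_map C Y X k"
    using kf kE PX nat PO P O by (auto simp: is_over_map_iff is_nat_trans_def comp_fctr_def k_def hom_iff)
  have "comp_over C X k h = id_over C X"
    by (rule over_map_eqI[OF is_over_map_comp[OF C h k] is_over_map_id[OF X]])
      (use O P PO GF hA in \<open>auto simp: k_def\<close>)
  moreover have "comp_over C Y h k = id_over C Y"
    by (rule over_map_eqI[OF is_over_map_comp[OF C k h] is_over_map_id[OF Y]])
      (use O P PO FG in \<open>auto simp: k_def\<close>)
  ultimately show ?thesis
    using X Y h k by (intro I.is_isoI[of _ X Y "Arr Y k X"]) (auto simp: iCat_over_def hom_def)
qed

section \<open>Transfer along isomorphisms of restriction categories\<close>

locale category_iso =
  D: restriction_category D + E: restriction_category E
  for D E :: "('u, 'u) rcat" +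
  fixes F G :: "('u, 'u, 'u, 'u) fctr"
  assumes F: "is_restriction_functor D E F" and G: "is_restriction_functor E D G"
    and F_O: "i \<in> Ob D \<Longrightarrow> FO F i = i" and G_O: "i \<in> Ob E \<Longrightarrow> FO G i = i"
    and GF: "f \<in> Ar D \<Longrightarrow> FA G (FA F f) = f" and FG: "g \<in> Ar E \<Longrightarrow> FA F (FA G g) = g"
begin

lemma F_simps:
  "f \<in> Ar D \<Longrightarrow> FA F f \<in> Ar E" "f \<in> Ar D \<Longrightarrow> src (FA F f) = src f" "f \<in> Ar D \<Longrightarrow> tgt (FA F f) = tgt f"
  "f \<in> Ar D \<Longrightarrow> FA F (rst D f) = rst E (FA F f)"
  "\<lbrakk>f \<in> Ar D; g \<in> Ar D; tgt f = src g\<rbrakk> \<Longrightarrow> FA F (g \<odot>\<^bsub>D\<^esub> f) = FA F g \<odot>\<^bsub>E\<^esub> FA F f"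
  using F F_O by (auto simp: is_restriction_functor_def is_functor_def E.hom_iff)

lemma F_hom: "f \<in> hom D i j \<Longrightarrow> FA F f \<in> hom E i j"
  using F_simps by (auto simp: hom_def)

lemma F_le:
  assumes "f \<in> Ar D" "g \<in> Ar D" "restr_le D f g"
  shows "restr_le E (FA F f) (FA F g)"
proof -
  have fg: "src f = src g" "tgt f = tgt g" using assms D.le_src D.le_tgt by auto
  have "FA F (g \<odot>\<^bsub>D\<^esub> rst D f) = FA F g \<odot>\<^bsub>E\<^esub> rst E (FA F f)"
    using F_simps assms fg by simp
  then show ?thesis using D.le_Cmp_rst[OF assms(3,1,2)] F_simps assms fg by (simp add: restr_le_def)
qed

lemma swap: "category_iso E D G F"
  using F G F_O G_O GF FG D.restriction_category_axioms E.restriction_category_axioms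
  by (simp add: category_iso_def category_iso_axioms_def)

end

lemma (in category_iso) is_join_transfer:
  assumes S: "S \<subseteq> hom D i j" and p: "is_join D i j S p"
  shows "is_join E i j (FA F ` S) (FA F p)"
proof -
  interpret sw: category_iso E D G F by (rule swap)
  have pA: "p \<in> hom D i j" using p by (simp add: is_join_def)
  show ?thesis
    unfolding is_join_def
  proof (intro conjI ballI impI)
    show "FA F p \<in> hom E i j" using F_hom[OF pA] .
    show "restr_le E s (FA F p)" if "s \<in> FA F ` S" for s
      using that p S pA F_le by (auto simp: is_join_def hom_def)
    fix x assume x: "x \<in> hom E i j" and up: "\<forall>s \<in> FA F ` S. restr_le E s x"
    have "restr_le D p (FA G x)"
    proof -
      have "restr_le D s (FA G x)" if s: "s \<in> S" for s
      proof -
        have "restr_le D (FA G (FA F s)) (FA G x)"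
          using sw.F_le[of "FA F s" x] up s S x F_simps(1) by (auto simp: hom_def)
        then show ?thesis using GF s S by (auto simp: hom_def)
      qed
      then show ?thesis using p sw.F_hom[OF x] by (simp add: is_join_def)
    qed
    then have "restr_le E (FA F p) (FA F (FA G x))" using F_le pA sw.F_hom[OF x] by (auto simp: hom_def)
    then show "restr_le E (FA F p) x" using FG x by (auto simp: hom_def)
  qed
qed

lemma (in category_iso) join_inverse_transfer:
  assumes D: "inverse_category D" and E: "join_inverse_category E" and O: "Ob E = Ob D"
  shows "join_inverse_category D"
proof -
  interpret sw: category_iso E D G F by (rule swap)
  interpret DI: inverse_category D by fact
  interpret EJ: join_inverse_category E by fact
  have star: "star E (FA F f) = FA F (star D f)" "star D f \<in> Ar D" if f: "f \<in> Ar D" for f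
  proof -
    note pi = partial_inverse_star[OF D.restriction_category_axioms D f]
    show "star E (FA F f) = FA F (star D f)"
      by (rule star_eq[OF E.restriction_category_axioms EJ.inverse_category_axioms functor_partial_inverse[OF F pi]])
    show "star D f \<in> Ar D" using pi by (simp add: D.partial_inverse_iff)
  qed
  have bc: "bicompat E f g" if S: "S \<subseteq> hom D i j" and b: "\<And>f g. \<lbrakk>f \<in> S; g \<in> S\<rbrakk> \<Longrightarrow> bicompat D f g" and fg: "f \<in> FA F ` S" "g \<in> FA F ` S"
    for S i j f g
  proof -
    obtain f' g' where f': "f' \<in> S" "g' \<in> S" "f = FA F f'" "g = FA F g'" using fg by auto
    then have A: "f' \<in> Ar D" "g' \<in> Ar D" using S by (auto simp: hom_def)
    show ?thesis
      using b[OF f'(1,2)] functor_compat[OF F _ A] functor_compat[OF F _ star(2)[OF A(1)] star(2)[OF A(2)]] star(1)[OF A(1)] star(1)[OF A(2)] f'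
      by (simp add: bicompat_def)
  qed
  have GFim: "FA G ` FA F ` S = S" if "S \<subseteq> Ar D" for S
    unfolding image_image using that GF by (subst image_cong[OF refl, of _ _ "\<lambda>x. x"]) auto
  show ?thesis
  proof
    fix i j S assume ij: "i \<in> Ob D" "j \<in> Ob D" and S: "S \<subseteq> hom D i j" and b: "\<And>f g. \<lbrakk>f \<in> S; g \<in> S\<rbrakk> \<Longrightarrow> bicompat D f g"
    have SA: "S \<subseteq> Ar D" using S by (auto simp: hom_def)
    have FS: "FA F ` S \<subseteq> hom E i j" using S F_hom by auto
    obtain p where p: "is_join E i j (FA F ` S) p"
      using EJ.join_exists[of i j "FA F ` S"] FS bc[OF S b] ij O by auto
    show "\<exists>p. is_join D i j S p" using sw.is_join_transfer[OF FS p] GFim[OF SA] by auto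
    fix p h assume p: "is_join D i j S p" and h: "h \<in> Ar D" "tgt h = i"
    have pA: "p \<in> Ar D" "src p = i" "tgt p = j" using p by (auto simp: is_join_def hom_def)
    have "is_join E (src (FA F h)) j ((\<lambda>s. s \<odot>\<^bsub>E\<^esub> FA F h) ` FA F ` S) (FA F p \<odot>\<^bsub>E\<^esub> FA F h)"
      by (rule EJ.join_precomp[OF _ _ FS bc[OF S b] is_join_transfer[OF S p]]) (use ij O h F_simps in auto)
    moreover have "(\<lambda>s. s \<odot>\<^bsub>E\<^esub> FA F h) ` FA F ` S = FA F ` (\<lambda>s. s \<odot>\<^bsub>D\<^esub> h) ` S"
    proof -
      have "FA F s \<odot>\<^bsub>E\<^esub> FA F h = FA F (s \<odot>\<^bsub>D\<^esub> h)" if "s \<in> S" for s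
        using F_simps(5)[of h s] that S h by (auto simp: hom_def)
      then show ?thesis by (auto simp: image_iff)
    qed
    ultimately have "is_join E (src h) j (FA F ` (\<lambda>s. s \<odot>\<^bsub>D\<^esub> h) ` S) (FA F (p \<odot>\<^bsub>D\<^esub> h))"
      using F_simps h pA by simp
    moreover have Sh: "(\<lambda>s. s \<odot>\<^bsub>D\<^esub> h) ` S \<subseteq> hom D (src h) j"
      using S h by (auto simp: hom_def)
    ultimately have "is_join D (src h) j (FA G ` FA F ` (\<lambda>s. s \<odot>\<^bsub>D\<^esub> h) ` S) (FA G (FA F (p \<odot>\<^bsub>D\<^esub> h)))"
      by (intro sw.is_join_transfer) (use F_hom in auto)
    moreover have "(\<lambda>s. s \<odot>\<^bsub>D\<^esub> h) ` S \<subseteq> Ar D" using Sh by (auto simp: hom_def)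
    ultimately show "is_join D (src h) j ((\<lambda>s. s \<odot>\<^bsub>D\<^esub> h) ` S) (p \<odot>\<^bsub>D\<^esub> h)"
      using GFim GF[of "p \<odot>\<^bsub>D\<^esub> h"] pA h by simp
  qed
qed

lemma (in category_iso) bij_betw_idems: "bij_betw (FA F) (idems D i) (idems E i)"
proof -
  interpret sw: category_iso E D G F by (rule swap)
  show ?thesis
  proof (rule bij_betwI[of _ _ _ "FA G"])
    show "FA F \<in> idems D i \<rightarrow> idems E i"
      using F_simps by (auto simp: D.idems_iff E.idems_iff) (metis F_simps(4))
    show "FA G \<in> idems E i \<rightarrow> idems D i"
      using sw.F_simps by (auto simp: D.idems_iff E.idems_iff) (metis sw.F_simps(4))
  qed (use GF FG in \<open>auto simp: D.idems_iff E.idems_iff\<close>)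
qed

section \<open>Objects at which the unit is invertible\<close>

context glueing_construction
begin

definition U :: "('u, 'u, 'u, 'u) fctr" where
  "U = fst (unit_map C D P s)"

lemma U_simps [simp]: "i \<in> Ob D \<Longrightarrow> FO U i = i" "f \<in> Ar D \<Longrightarrow> FA U f = Arr (src f) (lab (s f)) (tgt f)"
  by (simp_all add: U_def unit_map_def)

lemma U_functor: "is_functor D (Phi_cat C \<Psi>) U"
  using unit_is_over_map by (simp add: is_over_map_iff U_def Phi_obj_def)

lemma U_arr:
  assumes "f \<in> Ar D"
  shows "FA U f \<in> Ar (Phi_cat C \<Psi>)" "under \<Psi> (FA U f) = s f"
proof -
  show "FA U f \<in> Ar (Phi_cat C \<Psi>)" using U_functor assms unfolding is_functor_def hom_def by blast
  show "under \<Psi> (FA U f) = s f" using assms s_simps(1-3)[OF assms] by (simp add: \<Psi>.under_Arr)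
qed

lemma U_restriction_functor: "is_restriction_functor D (Phi_cat C \<Psi>) U"
  using U_functor functor_preserves_rst[OF restriction_category_D inverse_category_D
      \<Psi>.restriction_category_Phi \<Psi>.inverse_category_Phi U_functor]
  by (simp add: is_restriction_functor_def restriction_category_D \<Psi>.restriction_category_Phi del: U_simps)

text \<open>The projection from bisections composed with \<open>U\<close> is \<open>P\<close>, so
  the bijection on idempotents for \<open>P\<close> is the composite of those for \<open>U\<close>
  and for the projection.\<close>

lemma fixpoint_if_unit_iso:
  assumes iso: "is_iso (iCat_over C) (Arr X (unit_map C D P s) (Phi_obj C \<Psi>))"
  shows "join_inverse_category D" "hyperconnected D C P"
proof -
  obtain k where k: "is_over_map C (Phi_obj C \<Psi>) X k"
    "comp_over C X k (unit_map C D P s) = id_over C X"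
    "comp_over C (Phi_obj C \<Psi>) (unit_map C D P s) k = id_over C (Phi_obj C \<Psi>)"
  proof -
    obtain K where K: "K \<in> hom (iCat_over C) (Phi_obj C \<Psi>) X"
      "K \<odot>\<^bsub>iCat_over C\<^esub> Arr X (unit_map C D P s) (Phi_obj C \<Psi>) = Idn (iCat_over C) X"
      "Arr X (unit_map C D P s) (Phi_obj C \<Psi>) \<odot>\<^bsub>iCat_over C\<^esub> K = Idn (iCat_over C) (Phi_obj C \<Psi>)"
      using iso by (auto simp: is_iso_def)
    show thesis by (rule that[of "lab K"]) (use K in \<open>auto simp: iCat_over_def hom_def\<close>)
  qed
  let ?E = "Phi_cat C \<Psi>"
  have G: "is_functor ?E D (fst k)" using k(1) by (simp add: is_over_map_iff Phi_obj_def)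
  have GF: "FA (fst k) (FA U f) = f" if "f \<in> Ar D" for f
  proof -
    have "FA (fst (comp_over C X k (unit_map C D P s))) f = FA (fst (id_over C X)) f" using k(2) by simp
    then show ?thesis using that by (simp add: U_def del: U_simps)
  qed
  have GO: "FO (fst k) i = i" if "i \<in> Ob D" for i
  proof -
    have "FO (fst (comp_over C X k (unit_map C D P s))) i = FO (fst (id_over C X)) i" using k(2) by simp
    then show ?thesis using that by (simp add: unit_map_def)
  qed
  have FG: "FA U (FA (fst k) g) = g" if "g \<in> Ar ?E" for g
  proof -
    have "FA (fst (comp_over C (Phi_obj C \<Psi>) (unit_map C D P s) k)) g = FA (fst (id_over C (Phi_obj C \<Psi>))) g"
      using k(3) by simp
    then show ?thesis using that by (simp add: U_def Phi_obj_def del: U_simps)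
  qed
  have Gr: "is_restriction_functor ?E D (fst k)"
    using G functor_preserves_rst[OF \<Psi>.restriction_category_Phi \<Psi>.inverse_category_Phi restriction_category_D inverse_category_D G]
    by (simp add: is_restriction_functor_def restriction_category_D \<Psi>.restriction_category_Phi)
  interpret iso: category_iso D ?E U "fst k"
    using U_restriction_functor Gr GF GO FG D.restriction_category_axioms \<Psi>.restriction_category_Phi
    by (simp add: category_iso_def category_iso_axioms_def)
  show "join_inverse_category D"
    by (rule iso.join_inverse_transfer[OF inverse_category_D \<Psi>.join_inverse_category_Phi]) simp
  show "hyperconnected D C P"
    unfolding hyperconnected_def
  proof (intro conjI ballI)
    show "is_restriction_functor D C P" by (rule restriction_functor_P)
    fix i assume i: "i \<in> Ob D"
    have "bij_betw (FA (Phi_proj C \<Psi>)) (idems ?E i) (idems C (FO P i))"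
      using \<Psi>.hyperconnected_Phi i by (simp add: hyperconnected_def)
    then have "bij_betw (FA (Phi_proj C \<Psi>) \<circ> FA U) (idems D i) (idems C (FO P i))"
      by (rule bij_betw_trans[OF iso.bij_betw_idems])
    moreover have "(FA (Phi_proj C \<Psi>) \<circ> FA U) e = FA P e" if "e \<in> idems D i" for e
    proof -
      have e: "e \<in> Ar D" using that by (simp add: D.idems_iff)
      then show ?thesis using U_arr[OF e] \<tau>_s[OF e] by simp
    qed
    ultimately show "bij_betw (FA P) (idems D i) (idems C (FO P i))"
      using bij_betw_cong[of "idems D i" "FA (Phi_proj C \<Psi>) \<circ> FA U" "FA P"] by blast
  qed
qed

end

section \<open>The unit over a hyperconnected join inverse category\<close>

locale hyperconnected_glueing = glueing_construction C D P
  for C :: "('o, 'u) rcat" (structure) and D P +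
  assumes join_inverse: "join_inverse_category D" and hyper: "hyperconnected D C P"
begin

interpretation J: join_inverse_category D by (rule join_inverse)

lemma P_inj: "\<lbrakk>d \<in> idems D i; e \<in> idems D i; FA P d = FA P e\<rbrakk> \<Longrightarrow> d = e"
proof -
  assume d: "d \<in> idems D i" "e \<in> idems D i" "FA P d = FA P e"
  then have "i \<in> Ob D" by (auto simp: D.idems_iff)
  then show "d = e" using hyper d by (auto simp: hyperconnected_def bij_betw_def dest: inj_onD)
qed

lemma P_surj: "\<lbrakk>i \<in> Ob D; x \<in> idems C (FO P i)\<rbrakk> \<Longrightarrow> \<exists>e \<in> idems D i. FA P e = x"
  using hyper unfolding hyperconnected_def bij_betw_def by (metis imageE)

lemma P_reflects_le:
  assumes d: "d \<in> idems D i" and e: "e \<in> idems D i" and le: "restr_le C (FA P d) (FA P e)"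
  shows "restr_le D d e"
proof -
  have A: "d \<in> Ar D" "src d = i" "tgt d = i" "e \<in> Ar D" "src e = i" "tgt e = i"
    using d e by (auto simp: D.idems_iff)
  have "FA P e \<odot> FA P d = FA P d" using idems_le_iff[OF P_idems[OF d] P_idems[OF e]] le by simp
  then have "FA P (e \<cdot> d) = FA P d" using A by simp
  then have "e \<cdot> d = d" by (rule P_inj[OF D.idems_Cmp[OF e d] d])
  then show ?thesis using D.idems_le_iff[OF d e] by simp
qed

lemma star_idem: "e \<in> idems D i \<Longrightarrow> star D e = e"
  by (rule star_eq[OF restriction_category_D inverse_category_D D.partial_inverse_idem])

text \<open>In \<open>D\<close> the join exists because idempotents are their own inverses, hence
  bicompatible. That \<open>P\<close> preserves it is due to hyperconnectedness: the join in
  \<open>C\<close> is \<open>P d\<close> for some idempotent \<open>d\<close>, which is an upper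
  bound because \<open>P\<close> reflects the order.\<close>

lemma idems_D_join:
  assumes i: "i \<in> Ob D" and E: "E \<subseteq> idems D i"
  obtains e where "is_join D i i E e" "e \<in> idems D i" "is_join C (FO P i) (FO P i) (FA P ` E) (FA P e)"
proof -
  have EA: "x \<in> Ar D" "src x = i" "tgt x = i" if "x \<in> E" for x using E that by (auto simp: D.idems_iff)
  have Eh: "E \<subseteq> hom D i i" using EA by (auto simp: hom_def)
  have "\<exists>e. is_join D i i E e"
  proof (rule J.join_exists[OF i i Eh])
    show "bicompat D f g" if "f \<in> E" "g \<in> E" for f g
    proof -
      have "f \<in> idems D i" "g \<in> idems D i" using that E by auto
      then show ?thesis using D.compat_idems[of f i g] star_idem by (simp add: bicompat_def)
    qed
  qed
  then obtain e where e: "is_join D i i E e" ..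
  have eA: "e \<in> Ar D" "src e = i" "tgt e = i" using e by (auto simp: is_join_def hom_def)
  have "restr_le D e (Idn D i)"
  proof -
    have "restr_le D x (Idn D i)" if "x \<in> E" for x
      using that EA[OF that] E i by (auto simp: restr_le_def D.idems_iff subset_iff)
    then show ?thesis using e D.Idn_hom[OF i] by (simp add: is_join_def)
  qed
  from D.le_Cmp_rst[OF this] have eI: "e \<in> idems D i" using eA i by (simp add: D.idems_iff)
  have PE: "FA P ` E \<subseteq> idems C (FO P i)" using E by auto
  note j = idems_join_exists[OF PE P_simps(1)[OF i]]
  obtain d where d: "d \<in> idems D i" "FA P d = join C (FO P i) (FO P i) (FA P ` E)"
    using P_surj[OF i j(2)] by blast
  have Pe: "FA P e \<in> idems C (FO P i)" using eI by simp
  have "restr_le D e d"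
  proof -
    have "restr_le D x d" if x: "x \<in> E" for x
      using P_reflects_le[of x i d] is_join_le[OF j(1), of "FA P x"] d x E by auto
    then show ?thesis using e d(1) by (simp add: is_join_def idems_def)
  qed
  then have "d \<cdot> e = e" using D.idems_le_iff[OF eI d(1)] by simp
  moreover have "restr_le C (FA P d) (FA P e)"
    unfolding d(2)
  proof (rule is_join_idem_le[OF j(1) PE Pe])
    fix y assume "y \<in> FA P ` E"
    then obtain x where x: "x \<in> E" "y = FA P x" by auto
    have xI: "x \<in> idems D i" using x E by auto
    have "restr_le D x e" using e x by (simp add: is_join_def)
    then have "e \<cdot> x = x" using D.idems_le_iff[OF xI eI] by simp
    then have "FA P e \<odot> FA P x = FA P x" using P_simps(7)[of x e] EA[OF x(1)] eA by simp
    then show "restr_le C y (FA P e)" using idems_le_iff[OF P_idems[OF xI] Pe] x by simp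
  qed
  then have "restr_le D d e" by (rule P_reflects_le[OF d(1) eI])
  then have "e \<cdot> d = d" using D.idems_le_iff[OF d(1) eI] by simp
  ultimately have "d = e" using D.idems_commute[OF d(1) eI] by simp
  then show thesis using that[OF e eI] j(1) d(2) by simp
qed

text \<open>The inverse of \<open>g \<cdot> rst f\<close> is \<open>rst f \<cdot> star g\<close>,
  and an idempotent on the left slides to a restriction on the right.\<close>

lemma star_le:
  assumes "f \<in> Ar D" "g \<in> Ar D" "restr_le D f g"
  shows "restr_le D (star D f) (star D g)"
proof -
  have st: "src f = src g" "tgt f = tgt g" "g \<cdot> rst D f = f"
    using assms D.le_src D.le_tgt D.le_Cmp_rst by auto
  have r: "rst D f \<in> idems D (src g)" using assms st by simp
  have "partial_inverse D (g \<cdot> rst D f) (rst D f \<cdot> star D g)"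
    by (rule D.partial_inverse_Cmp[OF D.partial_inverse_idem[OF r] partial_inverse_star[OF restriction_category_D inverse_category_D assms(2)]])
      (use assms st in simp)
  then have "star D f = rst D f \<cdot> star D g"
    using star_eq[OF restriction_category_D inverse_category_D] st by simp
  also have "\<dots> = star D g \<cdot> rst D (rst D f \<cdot> star D g)"
    using D.idem_Cmp[OF r, of "star D g"] star_D[OF assms(2)] by simp
  finally show ?thesis using star_D[OF assms(2)] assms st by (intro D.leI) auto
qed

lemma le_bicompat:
  assumes "f \<in> Ar D" "g \<in> Ar D" "h \<in> Ar D" "restr_le D f h" "restr_le D g h"
  shows "bicompat D f g"
  using D.le_compat[OF assms(4,5,1,2,3)]
    D.le_compat[OF star_le[OF assms(1,3,4)] star_le[OF assms(2,3,5)]] star_D assms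
  by (simp add: bicompat_def)

text \<open>Equal sections have equal domains and agree on all of them, so the agreement of
  \<open>f\<close> and \<open>g\<close> is \<open>P (rst f)\<close>. Since \<open>P\<close>
  preserves the join of the idempotents equalising \<open>f\<close> and \<open>g\<close>, that join
  is \<open>rst f\<close> already in \<open>D\<close>. The join \<open>h\<close> of the
  corresponding restrictions then lies below both maps and has their full domain.\<close>

lemma s_inj:
  assumes f: "f \<in> hom D i j" and g: "g \<in> hom D i j" and eq: "s f = s g"
  shows "f = g"
proof -
  note F = P_src_tgt_hom[OF f] and G = P_src_tgt_hom[OF g]
  have i: "i \<in> Ob D" "j \<in> Ob D" using F by auto
  have "FA P (rst D f) = FA P (rst D g)" using s_simps(4)[of f] s_simps(4)[of g] eq F G by simp
  then have r: "rst D f = rst D g" by (intro P_inj[of _ i]) (use F G in auto)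
  have ag: "agree C X f g = FA P (rst D f)"
    using glued_S(3)[OF i f g] glued_S(3)[OF i g g] agree_refl[of g] eq r G by simp
  let ?E = "{e \<in> idems D i. restr_le D e (rst D f \<cdot> rst D g) \<and> f \<cdot> e = g \<cdot> e}"
  obtain e0 where e0: "is_join D i i ?E e0" "e0 \<in> idems D i" "is_join C (FO P i) (FO P i) (FA P ` ?E) (FA P e0)"
    using idems_D_join[OF i(1), of ?E] by blast
  have "is_join C (FO P i) (FO P i) (FA P ` ?E) (agree C X f g)" using agree_join(1)[of f g] F G by simp
  then have "FA P e0 = FA P (rst D f)" using is_join_unique[OF e0(3)] ag by simp
  then have e0r: "e0 = rst D f" by (intro P_inj[OF e0(2)]) (use F in auto)
  let ?S = "(\<lambda>e. f \<cdot> e) ` ?E"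
  have eA: "e \<in> Ar D" "src e = i" "tgt e = i" "rst D f \<cdot> e = e" if "e \<in> ?E" for e
  proof -
    show A: "e \<in> Ar D" "src e = i" "tgt e = i" using that by (auto simp: D.idems_iff)
    have "restr_le D e (rst D f)" using that r F G by simp
    then show "rst D f \<cdot> e = e" using D.idems_le_iff[of e i "rst D f"] that F by auto
  qed
  have Sle: "restr_le D x f" "restr_le D x g" "x \<in> hom D i j" if x: "x \<in> ?S" for x
  proof -
    obtain e where e: "e \<in> ?E" "x = f \<cdot> e" using x by auto
    then have e': "e \<in> idems D i" "x = g \<cdot> e" by auto
    show "restr_le D x f" by (rule D.leI[of _ e]) (use e e' F in auto)
    show "restr_le D x g" by (rule D.leI[of _ e]) (use e' G in auto)
    show "x \<in> hom D i j" using e(2) eA[OF e(1)] F by (simp add: hom_def)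
  qed
  have "\<exists>h. is_join D i j ?S h"
  proof (rule J.join_exists[OF i])
    show "?S \<subseteq> hom D i j" using Sle by blast
    show "bicompat D x y" if "x \<in> ?S" "y \<in> ?S" for x y
      using le_bicompat[of x y f] Sle[OF that(1)] Sle[OF that(2)] F by (auto simp: hom_def)
  qed
  then obtain h where h: "is_join D i j ?S h" ..
  have hA: "h \<in> Ar D" "src h = i" "tgt h = j" using h by (auto simp: is_join_def hom_def)
  have hf: "restr_le D h f" "restr_le D h g" using h Sle f g by (auto simp: is_join_def)
  have "restr_le D e0 (rst D h)"
  proof -
    have "restr_le D e (rst D h)" if e: "e \<in> ?E" for e
    proof -
      have "restr_le D (f \<cdot> e) h" using h e by (simp add: is_join_def)
      then have "restr_le D (rst D (f \<cdot> e)) (rst D h)" by (rule D.le_imp_rst_le) (use eA[OF e] F hA in auto)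
      moreover have "rst D (f \<cdot> e) = e" using D.rst_Cmp_idem[of e i f] e eA[OF e] F by simp
      ultimately show ?thesis by simp
    qed
    then show ?thesis using e0(1) hA by (simp add: is_join_def hom_def)
  qed
  then have rh: "rst D h \<cdot> rst D f = rst D f"
    unfolding e0r using D.idems_le_iff[of "rst D f" i "rst D h"] F hA by simp
  have fh: "f \<cdot> rst D h = h" and gh: "g \<cdot> rst D h = h" using D.le_Cmp_rst hf hA F G by auto
  have "f = f \<cdot> rst D h \<cdot> rst D f" using rh F by simp
  also have "\<dots> = h \<cdot> rst D f" by (rule D.Cmp_reassoc[OF fh]) (use hA F in auto)
  also have "\<dots> = g \<cdot> rst D h \<cdot> rst D f" by (rule D.Cmp_reassoc[OF gh, symmetric]) (use hA F G in auto)
  also have "\<dots> = g \<cdot> rst D g" using rh r by simp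
  also have "\<dots> = g" using G by simp
  finally show ?thesis .
qed

text \<open>Compatibility is an equation between maps of \<open>D\<close>, and \<open>s\<close> is
  injective on each hom-set.\<close>

lemma U_compat_reflect:
  assumes ab: "a \<in> Ar D" "b \<in> Ar D" and c: "compat (Phi_cat C \<Psi>) (FA U a) (FA U b)"
  shows "compat D a b"
proof -
  have st: "src a = src b" "tgt a = tgt b" using c ab by (auto simp: compat_def)
  have U: "FA U (rst D f) = rst (Phi_cat C \<Psi>) (FA U f)" if "f \<in> Ar D" for f
    using U_restriction_functor that unfolding is_restriction_functor_def by blast
  have Uc: "FA U (f \<cdot> g) = FA U f \<odot>\<^bsub>Phi_cat C \<Psi>\<^esub> FA U g" if "f \<in> Ar D" "g \<in> Ar D" "tgt g = src f" for f g
    using U_functor that unfolding is_functor_def by blast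
  have "FA U (a \<cdot> rst D b) = FA U (b \<cdot> rst D a)"
    using c Uc[of a "rst D b"] Uc[of b "rst D a"] U[OF ab(1)] U[OF ab(2)] ab st by (simp add: compat_def del: U_simps)
  then have "s (a \<cdot> rst D b) = s (b \<cdot> rst D a)"
    using U_arr(2)[of "a \<cdot> rst D b"] U_arr(2)[of "b \<cdot> rst D a"] ab st by (simp del: U_simps)
  then have "a \<cdot> rst D b = b \<cdot> rst D a"
    by (rule s_inj[rotated 2, of _ _ "src a" "tgt a"]) (use ab st in \<open>auto simp: hom_def\<close>)
  then show ?thesis using st by (simp add: compat_def)
qed

lemma le_star_compat:
  assumes E: "restriction_category E" "inverse_category E" and "f \<in> Ar E" "g \<in> Ar E" "h \<in> Ar E" "restr_le E f h" "restr_le E g h"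
  shows "compat E f g \<and> compat E (star E f) (star E g)"
proof -
  interpret E: restriction_category E by fact
  have pi: "partial_inverse E x (star E x)" if "x \<in> Ar E" for x using partial_inverse_star[OF E that] .
  have le: "restr_le E (star E f) (star E h)" if f: "f \<in> Ar E" "restr_le E f h" for f
  proof -
    have st: "src f = src h" "tgt f = tgt h" "h \<odot>\<^bsub>E\<^esub> rst E f = f"
      using assms f E.le_src E.le_tgt E.le_Cmp_rst by auto
    have r: "rst E f \<in> idems E (src h)" using f st by simp
    have hA: "star E h \<in> Ar E" "src (star E h) = tgt h" "tgt (star E h) = src h"
      using pi[OF assms(5)] by (auto simp: E.partial_inverse_iff)
    have "partial_inverse E (h \<odot>\<^bsub>E\<^esub> rst E f) (rst E f \<odot>\<^bsub>E\<^esub> star E h)"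
      by (rule E.partial_inverse_Cmp[OF E.partial_inverse_idem[OF r] pi[OF assms(5)]]) (use f st in simp)
    then have "star E f = rst E f \<odot>\<^bsub>E\<^esub> star E h" using star_eq[OF E] st by simp
    also have "\<dots> = star E h \<odot>\<^bsub>E\<^esub> rst E (rst E f \<odot>\<^bsub>E\<^esub> star E h)"
      using E.idem_Cmp[OF r, of "star E h"] hA by simp
    finally show ?thesis using hA f st by (intro E.leI) auto
  qed
  have A: "star E x \<in> Ar E" if "x \<in> Ar E" for x using pi[OF that] by (simp add: E.partial_inverse_iff)
  show ?thesis
    using E.le_compat[OF assms(6,7,3,4,5)] E.le_compat[OF le[OF assms(3,6)] le[OF assms(4,7)]] A assms by simp
qed

lemma s_surj:
  assumes w: "w \<in> Ar (Phi_cat C \<Psi>)"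
  shows "\<exists>g \<in> hom D (src w) (tgt w). FA U g = w"
proof -
  define i j u where iju: "i = src w" "j = tgt w" "u = under \<Psi> w"
  note W = \<Psi>.Ar_PhiD[OF w, folded iju]
  have ij: "i \<in> Ob D" "j \<in> Ob D" using W by auto
  have u: "u \<in> Ar C" "src u = FO P i" "tgt u = src (S i j)" "S i j \<odot> u = rst C u"
    using \<Psi>.psec_simps[OF W(3)] by auto
  interpret Gl: glued C "hom D i j" "S i j" q s by (rule glued_S[OF ij])
  have sec: "partial_section C (S i j) u" using u ij by (simp add: partial_section_def hom_iff)
  \<comment> \<open>\<open>d f\<close> is where the bisection follows the section
    \<open>s f\<close>. By hyperconnectedness it is \<open>P (e f)\<close>, and \<open>g f\<close>
    is the map of \<open>D\<close> whose section is that part of the bisection.\<close>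
  define d where "d f = q f \<odot> u" for f
  have d: "d f \<in> idems C (FO P i)" "u \<odot> d f = s f \<odot> d f" if "f \<in> hom D i j" for f
    using Gl.q_section(2,3)[OF sec that] ij by (simp_all add: d_def)
  have "\<forall>f \<in> hom D i j. \<exists>e. e \<in> idems D i \<and> FA P e = d f"
    using P_surj[OF ij(1)] d(1) by blast
  from bchoice[OF this] obtain e where e: "\<And>f. f \<in> hom D i j \<Longrightarrow> e f \<in> idems D i \<and> FA P (e f) = d f"
    by blast
  define g where "g f = f \<cdot> e f" for f
  have gA: "g f \<in> Ar D" "src (g f) = i" "tgt (g f) = j" and sg: "s (g f) = u \<odot> d f" if f: "f \<in> hom D i j" for f
  proof -
    have ef: "e f \<in> Ar D" "src (e f) = i" "tgt (e f) = i" using e[OF f] by (auto simp: D.idems_iff)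
    note F = P_src_tgt_hom[OF f]
    show "g f \<in> Ar D" "src (g f) = i" "tgt (g f) = j" using ef F by (auto simp: g_def)
    show "s (g f) = u \<odot> d f" using s_Cmp_idem[of f "e f"] e[OF f] F d(2)[OF f] by (simp add: g_def)
  qed
  have rg: "FA P (rst D (g f)) = d f" if f: "f \<in> hom D i j" for f
  proof -
    have dA: "d f \<in> Ar C" "src (d f) = FO P i" "tgt (d f) = FO P i" "rst C (d f) = d f"
      using d(1)[OF f] by (auto simp: idems_iff)
    have qA: "q f \<in> Ar C" "src (q f) = src (S i j)" using Gl.q_simps[OF f] by auto
    have "rst C (s (g f)) = rst C (u \<odot> d f)" using sg[OF f] by simp
    also have "\<dots> = rst C u \<odot> d f" by (rule rst_Cmp_idem[OF d(1)[OF f]]) (use u in auto)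
    also have "\<dots> = rst C u \<odot> rst C (q f \<odot> u)" using dA(4) by (simp add: d_def)
    also have "\<dots> = rst C (q f \<odot> u)" by (rule rst_le_src(2)) (use u qA in auto)
    also have "\<dots> = d f" using dA(4) by (simp add: d_def)
    finally show ?thesis using s_simps(4)[OF gA(1)[OF f]] gA[OF f] by simp
  qed
  have le: "restr_le (Phi_cat C \<Psi>) (FA U (g f)) w" if f: "f \<in> hom D i j" for f
  proof -
    have "restr_le C (s (g f)) u" by (rule leI[of _ "d f"]) (use u d[OF f] sg[OF f] in auto)
    then show ?thesis
      using \<Psi>.Phi_le_iff[OF U_arr(1)[OF gA(1)[OF f]] w] U_arr(2)[OF gA(1)[OF f]] gA[OF f] iju by simp
  qed
  have starU: "star (Phi_cat C \<Psi>) (FA U a) = FA U (star D a)" if "a \<in> Ar D" for a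
    by (rule star_eq[OF \<Psi>.restriction_category_Phi \<Psi>.inverse_category_Phi
          functor_partial_inverse[OF U_restriction_functor partial_inverse_star[OF restriction_category_D inverse_category_D that]]])
  \<comment> \<open>Bicompatibility is not visible in \<open>D\<close> directly. All
    \<open>U (g f)\<close> lie below \<open>w\<close> in the category of bisections, where a common
    upper bound gives it, and \<open>U\<close> reflects compatibility.\<close>
  have bc: "bicompat D (g f) (g f')" if f: "f \<in> hom D i j" "f' \<in> hom D i j" for f f'
  proof -
    note G = gA(1)[OF f(1)] gA(1)[OF f(2)]
    have "compat (Phi_cat C \<Psi>) (FA U (g f)) (FA U (g f')) \<and>
        compat (Phi_cat C \<Psi>) (star (Phi_cat C \<Psi>) (FA U (g f))) (star (Phi_cat C \<Psi>) (FA U (g f')))"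
      by (rule le_star_compat[OF \<Psi>.restriction_category_Phi \<Psi>.inverse_category_Phi U_arr(1)[OF G(1)] U_arr(1)[OF G(2)] w le[OF f(1)] le[OF f(2)]])
    then show ?thesis
      using U_compat_reflect[OF G] U_compat_reflect[OF star_D(1)[OF G(1)] star_D(1)[OF G(2)]] starU[OF G(1)] starU[OF G(2)]
      by (simp add: bicompat_def del: U_simps)
  qed
  have gS: "g ` hom D i j \<subseteq> hom D i j" using gA by (auto simp: hom_def)
  have "\<exists>h. is_join D i j (g ` hom D i j) h"
    by (rule J.join_exists[OF ij gS]) (use bc in auto)
  then obtain h where h: "is_join D i j (g ` hom D i j) h" ..
  have hA: "h \<in> Ar D" "src h = i" "tgt h = j" using h by (auto simp: is_join_def hom_def)
  have gh: "h \<cdot> rst D (g f) = g f" if f: "f \<in> hom D i j" for f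
    using h D.le_Cmp_rst[of "g f" h] gA[OF f] hA f by (simp add: is_join_def)
  \<comment> \<open>The join \<open>h\<close> is known only by its order property. Its domain is
    computed as the join \<open>r\<close> of the domains of the \<open>g f\<close>; as
    \<open>P\<close> preserves that join, \<open>P r\<close> is the domain of the bisection.\<close>
  let ?R = "(\<lambda>f. rst D (g f)) ` hom D i j"
  obtain r where r: "is_join D i i ?R r" "r \<in> idems D i" "is_join C (FO P i) (FO P i) (FA P ` ?R) (FA P r)"
  proof (rule idems_D_join[OF ij(1), of ?R])
    show "?R \<subseteq> idems D i" using gA by auto
  qed
  have rA: "r \<in> Ar D" "src r = i" "tgt r = i" using r(2) by (auto simp: D.idems_iff)
  have "restr_le D h (h \<cdot> r)"
  proof -
    have "restr_le D (g f) (h \<cdot> r)" if f: "f \<in> hom D i j" for f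
    proof (rule D.leI[of _ "rst D (g f)"])
      have "restr_le D (rst D (g f)) r" using r(1) f by (auto simp: is_join_def)
      then have "r \<cdot> rst D (g f) = rst D (g f)"
        using D.idems_le_iff[of "rst D (g f)" i r] r(2) gA[OF f] by simp
      then show "g f = (h \<cdot> r) \<cdot> rst D (g f)" using gh[OF f] hA rA gA[OF f] by simp
    qed (use hA rA gA[OF f] in auto)
    moreover have "h \<cdot> r \<in> hom D i j" using hA rA by (simp add: hom_def)
    ultimately show ?thesis using h by (auto simp: is_join_def)
  qed
  then have "rst D h = rst D (h \<cdot> r) \<cdot> rst D h" by (rule D.le_rst) (use hA rA in auto)
  also have "\<dots> = (rst D h \<cdot> r) \<cdot> rst D h" using D.rst_Cmp_idem[OF r(2), of h] hA by simp
  also have "\<dots> = rst D h \<cdot> rst D h \<cdot> r"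
    using D.idems_commute[OF r(2), of "rst D h"] hA rA by simp
  also have "\<dots> = rst D h \<cdot> r" using hA rA D.Cmp_reassoc[OF D.rst_rst_idem[OF hA(1)], of r] by simp
  finally have hr: "rst D h \<cdot> r = rst D h" by simp
  have "restr_le D r (rst D h)"
  proof -
    have "restr_le D (rst D (g f)) (rst D h)" if f: "f \<in> hom D i j" for f
      by (rule D.le_imp_rst_le) (use h f gA[OF f] hA in \<open>auto simp: is_join_def\<close>)
    then show ?thesis using r(1) hA by (auto simp: is_join_def hom_def)
  qed
  then have "rst D h \<cdot> r = r" using D.idems_le_iff[OF r(2), of "rst D h"] hA by simp
  then have rh: "rst D h = r" using hr by simp
  have FR: "FA P ` ?R = d ` hom D i j" using rg by (force simp: image_iff)
  have "is_join C (FO P i) (FO P i) ((\<lambda>t. t \<odot> u) ` q ` hom D i j) (S i j \<odot> u)"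
    using is_join_precomp[OF Gl.p_join Gl.q_subset, of u] u ij by simp
  then have ju: "is_join C (FO P i) (FO P i) (d ` hom D i j) (rst C u)" using u by (simp add: image_image d_def)
  then have Pr: "FA P r = rst C u" using is_join_unique[OF r(3)] FR by simp
  have sh: "s h \<in> Ar C" "src (s h) = FO P i" "tgt (s h) = src (S i j)" "rst C (s h) = rst C u"
    using s_simps(1-4)[OF hA(1)] hA Pr rh P_simps(5)[OF hA(1)] by simp_all
  have "s h \<odot> rst C u = u \<odot> rst C u"
  proof (rule is_join_Cmp_eq[OF ju])
    show "d ` hom D i j \<subseteq> idems C (FO P i)" using d by auto
    fix x assume "x \<in> d ` hom D i j"
    then obtain f where f: "f \<in> hom D i j" "x = d f" by auto
    have "s h \<odot> FA P (rst D (g f)) = s (g f)"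
      using s_Cmp_idem[OF hA(1), of "rst D (g f)"] gh[OF f(1)] gA[OF f(1)] hA by simp
    then show "s h \<odot> x = u \<odot> x" using rg[OF f(1)] sg[OF f(1)] f(2) by simp
  qed (use sh u in \<open>auto simp: hom_iff\<close>)
  then have "s h = u" by (metis Cmp_rst sh(1,4) u(1))
  then have "FA U h = w" using U_arr(2)[OF hA(1)] hA iju by (intro \<Psi>.under_eqI) auto
  then show ?thesis using hA iju by (auto simp: hom_def)
qed

lemma unit_iso_if_fixpoint:
  assumes "small_hom_sets C"
  shows "is_iso (iCat_over C) (Arr X (unit_map C D P s) (Phi_obj C \<Psi>))"
proof (rule over_iso[OF restriction_category_axioms over_obj \<Psi>.is_over_obj_Phi[OF assms] unit_is_over_map])
  show "bij_betw (FA (fst (unit_map C D P s))) (Ar (fst X)) (Ar (fst (Phi_obj C \<Psi>)))"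
    unfolding bij_betw_def U_def[symmetric]
  proof
    show "inj_on (FA U) (Ar (fst X))"
    proof (rule inj_onI)
      fix f g assume fg: "f \<in> Ar (fst X)" "g \<in> Ar (fst X)" and eq: "FA U f = FA U g"
      then have A: "f \<in> Ar D" "g \<in> Ar D" by auto
      have st: "src f = src g" "tgt f = tgt g" using eq A by simp_all
      have "s f = s g" using U_arr(2)[OF A(1)] U_arr(2)[OF A(2)] eq by (simp del: U_simps)
      then show "f = g" using s_inj[of f "src f" "tgt f" g] A st by (simp add: hom_def)
    qed
    show "FA U ` Ar (fst X) = Ar (fst (Phi_obj C \<Psi>))"
      using U_arr(1) s_surj by (force simp: Phi_obj_def hom_def image_iff simp del: U_simps)
  qed
qed (auto simp: unit_map_def Phi_obj_def)

end

section \<open>The equivalence\<close>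

locale glueing_setting = join_restriction_category C
  for C :: "('o, 'u) rcat" (structure) +
  assumes small: "small_hom_sets C" and local_glueings: "has_local_glueings C"
begin

lemma glueing_construction: "is_over_obj C X \<Longrightarrow> glueing_construction C (fst X) (snd X)"
  using join_restriction_category_axioms local_glueings
  by (simp add: glueing_construction_def glueing_construction_axioms_def over_object_def over_object_axioms_def)

lemma join_partite_groupoid: "partite_groupoid C A \<Longrightarrow> join_partite_groupoid C A"
  using join_restriction_category_axioms by (simp add: join_partite_groupoid_def)

lemma Ob_pGpd [simp]: "A \<in> Ob (pGpd C) \<longleftrightarrow> partite_groupoid C A"
  and Ob_iCat_over [simp]: "X \<in> Ob (iCat_over C) \<longleftrightarrow> is_over_obj C X"
  by (simp_all add: pGpd_def iCat_over_def)

lemma unit_g_eq: "unit_g C X = Arr X (unit_map C (fst X) (snd X) (Psi_sec C X)) (Phi_obj C (Psi_obj C X))"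
  by (simp add: unit_g_def unit_map_def)

lemma hom_pGpd: "K \<in> hom (pGpd C) A B \<longleftrightarrow>
    (\<exists>k. K = Arr A k B \<and> partite_groupoid C A \<and> partite_groupoid C B \<and> is_cofunctor C A B k)"
  by (cases K) (auto simp: pGpd_def hom_def)

lemma hom_iCat_over: "H \<in> hom (iCat_over C) X Y \<longleftrightarrow>
    (\<exists>h. H = Arr X h Y \<and> is_over_obj C X \<and> is_over_obj C Y \<and> is_over_map C X Y h)"
  by (cases H) (auto simp: iCat_over_def hom_def)

lemma universal_arrows: "universal_arrows (iCat_over C) (pGpd C) (Phi_g C) (Psi_obj C) (unit_g C)"
proof (intro universal_arrows.intro universal_arrows_axioms.intro)
  show "category (iCat_over C)" by (rule category_iCat_over[OF restriction_category_axioms])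
  show "category (pGpd C)" by (rule category_pGpd)
  show "is_functor (pGpd C) (iCat_over C) (Phi_g C)" by (rule is_functor_Phi_g[OF restriction_category_axioms small])
next
  fix X assume "X \<in> Ob (iCat_over C)"
  then have X: "is_over_obj C X" by simp
  interpret G: glueing_construction C "fst X" "snd X" by (rule glueing_construction[OF X])
  show "Psi_obj C X \<in> Ob (pGpd C)" using G.partite_groupoid_\<Psi> by simp
  show "unit_g C X \<in> hom (iCat_over C) X (FO (Phi_g C) (Psi_obj C X))"
    using X G.unit_is_over_map G.\<Psi>.is_over_obj_Phi[OF small] by (simp add: unit_g_eq Phi_g_def hom_iCat_over)
  fix B H assume "B \<in> Ob (pGpd C)" and H: "H \<in> hom (iCat_over C) X (FO (Phi_g C) B)"
  then have B: "partite_groupoid C B" by simp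
  obtain h where h: "H = Arr X h (Phi_obj C B)" "is_over_map C X (Phi_obj C B) h"
    using H by (auto simp: hom_iCat_over Phi_g_def)
  interpret Pr: presentation C "Psi_obj C X" "fst X" "snd X" "Psi_sec C X" "hom (fst X)" G.q
    using G.presentation_\<Psi> by simp
  have ex1: "\<exists>!k. is_cofunctor C (Psi_obj C X) B k \<and>
      comp_over C X (Phi_map C (Psi_obj C X) k) (unit_map C (fst X) (snd X) (Psi_sec C X)) = h"
    using Pr.universal[OF B, of h] h(2) by simp
  have eq: "FA (Phi_g C) (Arr (Psi_obj C X) k B) \<odot>\<^bsub>iCat_over C\<^esub> unit_g C X =
      Arr X (comp_over C X (Phi_map C (Psi_obj C X) k) (unit_map C (fst X) (snd X) (Psi_sec C X))) (Phi_obj C B)" for k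
    by (simp add: iCat_over_def Phi_g_def unit_g_eq)
  show "\<exists>!K. K \<in> hom (pGpd C) (Psi_obj C X) B \<and> FA (Phi_g C) K \<odot>\<^bsub>iCat_over C\<^esub> unit_g C X = H"
  proof -
    obtain k where k: "is_cofunctor C (Psi_obj C X) B k"
      "comp_over C X (Phi_map C (Psi_obj C X) k) (unit_map C (fst X) (snd X) (Psi_sec C X)) = h"
      using ex1 by blast
    show ?thesis
    proof (rule ex1I[of _ "Arr (Psi_obj C X) k B"])
      show "Arr (Psi_obj C X) k B \<in> hom (pGpd C) (Psi_obj C X) B \<and>
          FA (Phi_g C) (Arr (Psi_obj C X) k B) \<odot>\<^bsub>iCat_over C\<^esub> unit_g C X = H"
        unfolding eq using k h B G.partite_groupoid_\<Psi> by (simp add: hom_pGpd)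
      fix K assume K: "K \<in> hom (pGpd C) (Psi_obj C X) B \<and> FA (Phi_g C) K \<odot>\<^bsub>iCat_over C\<^esub> unit_g C X = H"
      then obtain k' where k': "K = Arr (Psi_obj C X) k' B" "is_cofunctor C (Psi_obj C X) B k'" by (auto simp: hom_pGpd)
      then have "comp_over C X (Phi_map C (Psi_obj C X) k') (unit_map C (fst X) (snd X) (Psi_sec C X)) = h"
        using K h(1) unfolding k'(1) eq by simp
      then show "K = Arr (Psi_obj C X) k B" using ex1 k k' by blast
    qed
  qed
qed

sublocale ua: universal_arrows "iCat_over C" "pGpd C" "Phi_g C" "Psi_obj C" "unit_g C"
  by (rule universal_arrows)

lemma Psi_eq: "Psi C = ua.left_adjoint"
  by (simp add: Psi_def ua.lift_def fun_eq_iff)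

lemma counit_eq: "counit_g C = ua.counit"
  by (simp add: counit_g_def ua.counit_def fun_eq_iff) (simp add: Phi_g_def)

text \<open>Presented by its own bisections, \<open>A\<close> has an identity as its unit map, and
  the universal property then says that \<open>Phi_g\<close> is bijective on cofunctors out of
  \<open>A\<close>.\<close>

lemma counit_iso_if_etale:
  assumes A: "partite_groupoid C A" and et: "etale C A"
  shows "is_iso (pGpd C) (ua.counit A)"
proof (rule ua.counit_iso)
  interpret A: join_partite_groupoid C A by (rule join_partite_groupoid[OF A])
  interpret Pr: presentation C A "Phi_cat C A" "Phi_proj C A" "under A" A.T_bis A.q_bis
    by (rule A.presentation_etale[OF et small])
  show "A \<in> Ob (pGpd C)" using A by simp
  fix B H assume "B \<in> Ob (pGpd C)" and H: "H \<in> hom (iCat_over C) (FO (Phi_g C) A) (FO (Phi_g C) B)"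
  then have B: "partite_groupoid C B" by simp
  obtain h where h: "H = Arr (Phi_obj C A) h (Phi_obj C B)" "is_over_map C (Phi_obj C A) (Phi_obj C B) h"
    using H by (auto simp: hom_iCat_over Phi_g_def)
  have unit: "comp_over C (Phi_obj C A) (Phi_map C A k) (id_over C (Phi_obj C A)) = Phi_map C A k"
    if k: "is_cofunctor C A B k" for k
  proof -
    interpret k: groupoid_cofunctor C A B k by (rule groupoid_cofunctorI[OF A B k])
    have "Arr (Phi_obj C A) (Phi_map C A k) (Phi_obj C B) \<in> Ar (iCat_over C)"
      using k.is_over_map_Phi A.is_over_obj_Phi[OF small] partite_groupoid.is_over_obj_Phi[OF B small]
        by (simp add: iCat_over_def)
    from ua.C.Cmp_Idn[OF this] show ?thesis by (simp add: iCat_over_def)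
  qed
  have ex1: "\<exists>!k. is_cofunctor C A B k \<and> Phi_map C A k = h"
    using Pr.universal[OF B, of h] h(2) unit unfolding A.unit_map_under Phi_obj_def[symmetric] by metis
  show "\<exists>!K. K \<in> hom (pGpd C) A B \<and> FA (Phi_g C) K = H"
  proof -
    obtain k where k: "is_cofunctor C A B k" "Phi_map C A k = h" using ex1 by blast
    show ?thesis
    proof (rule ex1I[of _ "Arr A k B"])
      show "Arr A k B \<in> hom (pGpd C) A B \<and> FA (Phi_g C) (Arr A k B) = H"
        using k h A B by (simp add: hom_pGpd Phi_g_def)
      fix K assume K: "K \<in> hom (pGpd C) A B \<and> FA (Phi_g C) K = H"
      then obtain k' where k': "K = Arr A k' B" "is_cofunctor C A B k'" by (auto simp: hom_pGpd)
      then have "Phi_map C A k' = h" using K h(1) by (simp add: Phi_g_def)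
      then show "K = Arr A k B" using ex1 k k' by blast
    qed
  qed
qed

text \<open>The counit \<open>e\<close> and its inverse \<open>l\<close> are identities on indices
  and objects. Their actions are then mutually inverse maps between arrow objects over the source
  maps, and precomposition with one of them carries the cover of the glued source map to
  \<open>A\<close>.\<close>

lemma etale_if_counit_iso:
  assumes A: "partite_groupoid C A" and iso: "is_iso (pGpd C) (ua.counit A)"
  shows "etale C A"
proof -
  interpret A: join_partite_groupoid C A by (rule join_partite_groupoid[OF A])
  have X: "is_over_obj C (Phi_obj C A)" by (rule A.is_over_obj_Phi[OF small])
  let ?X = "Phi_obj C A" and ?B = "Psi_obj C (Phi_obj C A)"
  interpret G: glueing_construction C "Phi_cat C A" "Phi_proj C A"
    using glueing_construction[OF X] by (simp add: Phi_obj_def)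
  have Xe: "?X = (Phi_cat C A, Phi_proj C A)" by (simp add: Phi_obj_def)
  have B: "partite_groupoid C ?B" using G.partite_groupoid_\<Psi> by (simp add: Xe)
  interpret B: join_partite_groupoid C ?B by (rule join_partite_groupoid[OF B])
  have etB: "etale C ?B" using presentation.etale[OF G.presentation_\<Psi>] by (simp add: Xe)
  have IxB: "Ix ?B = Ix A" "P0 ?B i = P0 A i" for i by (simp_all add: Psi_obj_def Phi_obj_def)
  obtain e where e: "ua.counit A = Arr ?B e A" "is_cofunctor C ?B A e"
    using ua.counit_hom[of A] A by (auto simp: hom_pGpd Phi_g_def)
  obtain l where l: "is_cofunctor C A ?B l" "comp_cofun C ?B A l e = id_cofun C ?B" "comp_cofun C A ?B e l = id_cofun C A"
    using iso e(1) by (auto simp: is_iso_def hom_pGpd) (auto simp: pGpd_def)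
  have "comp_over C ?X (Phi_map C ?B e) (unit_map C (Phi_cat C A) (Phi_proj C A) (Psi_sec C ?X)) = id_over C ?X"
    using ua.counit_hom[of A] A e(1) by (simp add: Phi_g_def iCat_over_def unit_g_eq) (simp add: Phi_obj_def)
  then have ce: "FO (fst (comp_over C ?X (Phi_map C ?B e) (unit_map C (Phi_cat C A) (Phi_proj C A) (Psi_sec C ?X)))) i = FO (fst (id_over C ?X)) i"
    "snd (comp_over C ?X (Phi_map C ?B e) (unit_map C (Phi_cat C A) (Phi_proj C A) (Psi_sec C ?X))) i = snd (id_over C ?X) i" for i
    by simp_all
  interpret el: composable_cofunctors C A ?B A l e
    using l(1) e(2) A.partite_category_axioms B.partite_category_axioms
    by (simp add: composable_cofunctors_def cofunctor_def cofunctor_axioms_def)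
  interpret le: composable_cofunctors C ?B A ?B e l
    using l(1) e(2) A.partite_category_axioms B.partite_category_axioms
    by (simp add: composable_cofunctors_def cofunctor_def cofunctor_axioms_def)
  \<comment> \<open>Read off from the triangle identity, since the unit is the identity on objects
    and in its components.\<close>
  have eI: "cfI e i = i" if "i \<in> Ix A" for i
    using ce(1)[of i] that by (simp add: Phi_obj_def unit_map_def Phi_map_def)
  have e0: "cf0 e i = Idn C (P0 A i)" if i: "i \<in> Ix A" for i
  proof -
    have "Idn C (P0 A i) \<odot> cf0 e i = Idn C (P0 A i)"
      using ce(2)[of i] i by (simp add: Phi_obj_def unit_map_def Phi_map_def)
    then show ?thesis using el.G.cf0_simps[of i] i IxB by simp
  qed
  have lI: "cfI l i = i" if i: "i \<in> Ix A" for i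
  proof -
    have "cfI (comp_cofun C ?B A l e) i = cfI (id_cofun C ?B) i" using l(2) by simp
    then show ?thesis using i eI IxB by (simp add: id_cofun_def comp_cofun_def)
  qed
  have l0: "cf0 l i = Idn C (P0 A i)" if i: "i \<in> Ix A" for i
  proof -
    have "cf0 (comp_cofun C ?B A l e) i = cf0 (id_cofun C ?B) i" using l(2) by simp
    then have "cf0 e i \<odot> cf0 l i = Idn C (P0 A i)" using i eI IxB by (simp add: id_cofun_def comp_cofun_def)
    then show ?thesis using e0[OF i] el.F.cf0_simps[of i] i lI[OF i] by simp
  qed
  have "local_homeo C (sgm A i j)" if ij: "i \<in> Ix A" "j \<in> Ix A" for i j
  proof -
    note ijB = ij[folded IxB(1)]
    \<comment> \<open>With identities as object components, the pullbacks carrying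
      \<open>cf1\<close> are copies of the arrow objects; evaluating at the identity element turns
      the components into maps between the arrow objects themselves.\<close>
    let ?e = "act C ?B e i j (Idn C (P1 ?B i j)) (sgm ?B i j)" and ?l = "act C A l i j (Idn C (P1 A i j)) (sgm A i j)"
    have OA: "P1 A i j \<in> Ob C" "P1 ?B i j \<in> Ob C" using ij ijB by simp_all
    note le = el.G.act_simps[of i j "Idn C (P1 ?B i j)" "sgm ?B i j", OF ijB]
    note ll = el.F.act_simps[of i j "Idn C (P1 A i j)" "sgm A i j", OF ij]
    have eA: "?e \<in> Ar C" "src ?e = P1 ?B i j" "tgt ?e = P1 A i j" "sgm A i j \<odot> ?e = sgm ?B i j"
      using le ij ijB e0 eI IxB OA B.sgm_simps[OF ijB] by simp_all
    have lA: "?l \<in> Ar C" "src ?l = P1 A i j" "tgt ?l = P1 ?B i j" "sgm ?B i j \<odot> ?l = sgm A i j"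
      using ll ij ijB l0 lI IxB OA by simp_all
    have "?e \<odot> ?l = act C ?B e i j ?l (sgm A i j)"
      using el.G.act_Cmp[of i j "Idn C (P1 ?B i j)" "sgm ?B i j" ?l] ij ijB e0 eI IxB OA B.sgm_simps[OF ijB] lA by simp
    also have "\<dots> = act C A (comp_cofun C A ?B e l) i j (Idn C (P1 A i j)) (sgm A i j)"
      using el.act_comp[of i j "Idn C (P1 A i j)" "sgm A i j"] ij e0 l0 eI lI IxB OA by simp
    also have "\<dots> = Idn C (P1 A i j)"
      using A.act_id[of i j "Idn C (P1 A i j)"] ij l(3) OA by simp
    finally have el1: "?e \<odot> ?l = Idn C (P1 A i j)" .
    have "?l \<odot> ?e = act C A l i j ?e (sgm ?B i j)"
      using el.F.act_Cmp[of i j "Idn C (P1 A i j)" "sgm A i j" ?e] ij l0 lI IxB OA eA by simp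
    also have "\<dots> = act C ?B (comp_cofun C ?B A l e) i j (Idn C (P1 ?B i j)) (sgm ?B i j)"
      using le.act_comp[of i j "Idn C (P1 ?B i j)" "sgm ?B i j"] ij ijB e0 l0 eI lI IxB OA B.sgm_simps[OF ijB] by simp
    also have "\<dots> = Idn C (P1 ?B i j)"
      using B.act_id[of i j "Idn C (P1 ?B i j)"] ijB l(2) OA B.sgm_simps[OF ijB] by simp
    finally have le1: "?l \<odot> ?e = Idn C (P1 ?B i j)" .
    have lt: "total_map C ?l" by (rule total_if_total_Cmp[of ?l ?e]) (use eA lA el1 OA in auto)
    have et: "total_map C ?e" by (rule total_if_total_Cmp[of ?e ?l]) (use eA lA le1 OA in auto)
    have pl: "partial_iso C ?l"
      unfolding partial_iso_def by (rule exI[of _ ?e]) (use eA lA el1 le1 lt et in \<open>simp add: partial_inverse_iff total_map_def\<close>)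
    obtain S where S: "S \<subseteq> hom C (P1 ?B i j) (P0 A i)" "\<And>s. s \<in> S \<Longrightarrow> partial_iso C s"
      "is_join C (P1 ?B i j) (P0 A i) S (sgm ?B i j)"
      using B.etale_cover[OF etB ijB] unfolding IxB(2) by blast
    have "(\<lambda>s. s \<odot> ?l) ` S \<subseteq> hom C (P1 A i j) (P0 A i)" using S(1) lA by (auto simp: hom_iff)
    moreover have "partial_iso C t" if "t \<in> (\<lambda>s. s \<odot> ?l) ` S" for t
      using that S(1,2) lA pl by (auto simp: hom_iff subset_iff intro!: partial_iso_Cmp)
    moreover have "is_join C (P1 A i j) (P0 A i) ((\<lambda>s. s \<odot> ?l) ` S) (sgm A i j)"
      using is_join_precomp[OF S(3,1), of ?l] lA by simp
    ultimately show ?thesis using ij by (auto simp: local_homeo_def)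
  qed
  then show ?thesis by (simp add: etale_def)
qed

lemma left_fixpoints: "left_fixpoints (pGpd C) (counit_g C) = {A \<in> Ob (pGpd C). etale C A}"
  using counit_iso_if_etale etale_if_counit_iso by (auto simp: left_fixpoints_def counit_eq)

lemma right_fixpoints: "right_fixpoints (iCat_over C) (unit_g C) =
    {X \<in> Ob (iCat_over C). join_inverse_category (fst X) \<and> hyperconnected (fst X) C (snd X)}"
proof -
  have "is_iso (iCat_over C) (unit_g C X) \<longleftrightarrow> join_inverse_category (fst X) \<and> hyperconnected (fst X) C (snd X)"
    if X: "is_over_obj C X" for X
  proof
    interpret G: glueing_construction C "fst X" "snd X" by (rule glueing_construction[OF X])
    show "join_inverse_category (fst X) \<and> hyperconnected (fst X) C (snd X)" if "is_iso (iCat_over C) (unit_g C X)"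
      using G.fixpoint_if_unit_iso that by (simp add: unit_g_eq)
    assume jh: "join_inverse_category (fst X) \<and> hyperconnected (fst X) C (snd X)"
    interpret H: hyperconnected_glueing C "fst X" "snd X" using G.glueing_construction_axioms jh
      by (simp add: hyperconnected_glueing_def hyperconnected_glueing_axioms_def)
    show "is_iso (iCat_over C) (unit_g C X)" using H.unit_iso_if_fixpoint[OF small] by (simp add: unit_g_eq)
  qed
  then show ?thesis by (auto simp: right_fixpoints_def)
qed

end

theorem theorem6p9:
  fixes C :: "('o, 'u) rcat"
  assumes "join_restriction_category C"
    and "small_hom_sets C"
    and "has_local_glueings C"
  shows "is_adjunction (iCat_over C) (pGpd C) (Psi C) (Phi_g C) (unit_g C) (counit_g C) \<and>
    left_fixpoints (pGpd C) (counit_g C) = Ob (peGpd C) \<and>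
    right_fixpoints (iCat_over C) (unit_g C) = Ob (jiCat_over_h C) \<and>
    is_equivalence (jiCat_over_h C) (peGpd C) (Psi C) (Phi_g C) (unit_g C) (counit_g C)"
proof -
  interpret glueing_setting C
    using assms by (simp add: glueing_setting_def glueing_setting_axioms_def)
  let ?p = "\<lambda>(D, P). join_inverse_category D \<and> hyperconnected D C P"
  have adj: "is_adjunction (iCat_over C) (pGpd C) (Psi C) (Phi_g C) (unit_g C) (counit_g C)"
    using ua.adjunction by (simp add: Psi_eq counit_eq)
  have right: "right_fixpoints (iCat_over C) (unit_g C) = {X \<in> Ob (iCat_over C). ?p X}"
    unfolding right_fixpoints by (simp add: split_beta)
  have "Ob (peGpd C) = {A \<in> Ob (pGpd C). etale C A}" "Ob (jiCat_over_h C) = {X \<in> Ob (iCat_over C). ?p X}"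
    by (simp_all add: peGpd_def jiCat_over_h_def full_subcat_def)
  moreover have "is_equivalence (jiCat_over_h C) (peGpd C) (Psi C) (Phi_g C) (unit_g C) (counit_g C)"
    unfolding jiCat_over_h_def peGpd_def
    by (rule adjunction_fixpoints_equivalence[OF adj left_fixpoints right])
  ultimately show ?thesis using adj left_fixpoints right by simp
qed

end
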